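(* Let $\wp(\cdot)=\wp(\cdot\,;a,b)$ satisfy $\wp'^2=4\wp^3-a\wp-b=4(\wp-e)(\wp-e')(\wp-e'')$, and consider the equations $$\text{(T)}\quad \psi_{\mathfrak u\mathfrak u}=-\frac14\{\wp(\mathfrak u;a,b)+A\}\psi,$$ $$\text{(L)}\quad \psi_{ss}=-\frac{3}{16}\left\{\frac1{(s-e)^2}+\frac1{(s-e')^2}+\frac1{(s-e'')^2}-\frac13\frac{5s-A}{(s-e)(s-e')(s-e'')}\right\}\psi,$$ $$\text{(P)}\quad \psi_{xx}=-\frac14\left\{\frac1{(x-e)^2}+\frac1{(x-e')^2}+\frac1{(x-e'')^2}-\frac{2x-A}{(x-e)(x-e')(x-e'')}\right\}\psi .$$ Halphen's transformation is a transcendental version of birational transformations between representations of the elliptic curve $\wp'^2=4\wp^3-a\wp-b$ in the form of covers $G(s,\wp(\mathfrak u),\wp'(\mathfrak u))=0$. This entails an equivalence of the $A$-parameter problems for the equations (L), (P) and (T), and the computability of their $A$-parameters one through another. The quantities $x$, $s$ and $\mathfrak u$, as functions of the ratio $\tau=\psi_2/\psi_1$ of solutions, are single-valued and computable if one of these functions has been known.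
   Context: Covers: a cover representing the curve is a relation $\Phi(s,\mathfrak u):=G\big(s,\wp(\mathfrak u),\wp'(\mathfrak u)\big)=0$, polynomial in $s,\wp,\wp'$ (hence polynomial in $s$ and transcendental in $\mathfrak u$). Halphen's transformation: the chain $s=\wp(\mathfrak u)$, $\mathfrak u=2u$, $x=\wp(u)$, which passes from $s$ to $x$. It relates the two covers $\Phi_1:\ x=\wp(\tfrac12\mathfrak u)$ and $\Phi_2:\ s=\wp(2u)$ of the one elliptic curve. "Transcendental version of a birational transformation" means that it is given by transformations between the pairs $(x,\mathfrak u)$ and $(s,u)$ which are single-valued in both directions, although they involve the transcendental function $\wp$. Equations are transformed by a change of independent variable accompanied by the linear change $\tilde\psi=\sqrt{dz/dx}\,\psi$ of the dependent variable. $A$-parameter problem: for given $(a,b)$, determine the parameter $A$ for which the monodromy group of the equation is a Fuchsian group of finite genus, i.e. for which the independent variable ($x$, $s$ or $\mathfrak u$), obtained by inverting the ratio $\tau=\psi_2/\psi_1$ of two linearly independent solutions, is a single-valued analytic function of $\tau$ everywhere in its domain of existence. *)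

theory Defs
  imports "HOL-Complex_Analysis.Complex_Analysis"
begin

section \<open>The Weierstrass function\<close>

text \<open>
  The function \<open>\<wp>(\<cdot>; a, b)\<close> is the meromorphic function on the plane with a pole at the origin that
  satisfies \<open>\<wp>'\<^sup>2 = 4\<wp>\<^sup>3 - a\<wp> - b\<close>.  The differential equation forces the leading term
  \<open>1/z\<^sup>2\<close> at the origin, so that for given \<open>a, b\<close> there is at most one such function.
  As usual for total functions, \<open>nicely_meromorphic_on\<close> assigns the dummy value 0 at the poles.
\<close>

definition weierstrass_p :: "complex \<Rightarrow> complex \<Rightarrow> (complex \<Rightarrow> complex) \<Rightarrow> bool" where
  "weierstrass_p a b P \<longleftrightarrow>
     P nicely_meromorphic_on UNIV \<and> is_pole P 0 \<and>
     (\<forall>z. \<not> is_pole P z \<longrightarrow> (deriv P z)\<^sup>2 = 4 * P z ^ 3 - a * P z - b)"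

definition is_period :: "(complex \<Rightarrow> complex) \<Rightarrow> complex \<Rightarrow> bool" where
  "is_period P l \<longleftrightarrow> (\<forall>z. P (z + l) = P z)"

text \<open>The duplication formula: \<open>\<wp>(2u) = dup a b (\<wp>(u))\<close>.\<close>

definition dup :: "complex \<Rightarrow> complex \<Rightarrow> complex \<Rightarrow> complex" where
  "dup a b x = ((x\<^sup>2 + a / 4)\<^sup>2 + 2 * b * x) / (4 * x ^ 3 - a * x - b)"


section \<open>Covers and birational maps\<close>

text \<open>
  Polynomials \<open>G(s, p, q)\<close> in three variables are nested univariate ones, the first variable
  being the outermost.
\<close>

definition eval3 :: "complex poly poly poly \<Rightarrow> complex \<times> complex \<times> complex \<Rightarrow> complex" where
  "eval3 G = (\<lambda>(s, p, q). poly (poly (poly G [:[:s:]:]) [:p:]) q)"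

text \<open>
  The relation \<open>G(s, \<wp>(v), \<wp>'(v)) = 0\<close> between the points \<open>s\<close> and \<open>v\<close>, and the algebraic space
  curve which it defines over the elliptic curve \<open>q\<^sup>2 = 4p\<^sup>3 - ap - b\<close>.
\<close>

definition cover :: "(complex \<Rightarrow> complex) \<Rightarrow> complex poly poly poly \<Rightarrow> (complex \<times> complex) set" where
  "cover P G = {(s, v). \<not> is_pole P v \<and> eval3 G (s, P v, deriv P v) = 0}"

definition cover_curve ::
  "complex \<Rightarrow> complex \<Rightarrow> complex poly poly poly \<Rightarrow> (complex \<times> complex \<times> complex) set" where
  "cover_curve a b G = {(s, p, q). q\<^sup>2 = 4 * p ^ 3 - a * p - b \<and> eval3 G (s, p, q) = 0}"

definition rational_on ::
  "(complex \<times> complex \<times> complex \<Rightarrow> complex \<times> complex \<times> complex)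
     \<Rightarrow> (complex \<times> complex \<times> complex) set \<Rightarrow> bool" where
  "rational_on f X \<longleftrightarrow> (\<exists>N1 D1 N2 D2 N3 D3. \<forall>x\<in>X.
     eval3 D1 x \<noteq> 0 \<and> eval3 D2 x \<noteq> 0 \<and> eval3 D3 x \<noteq> 0 \<and>
     f x = (eval3 N1 x / eval3 D1 x, eval3 N2 x / eval3 D2 x, eval3 N3 x / eval3 D3 x))"

text \<open>
  \<open>f\<close> and \<open>g\<close> are mutually inverse birational maps of the curves \<open>X\<close> and \<open>Y\<close>, with the finite
  exceptional sets \<open>E\<close> and \<open>F\<close>.
\<close>

definition birational_pair where
  "birational_pair X E f Y F g \<longleftrightarrow>
     finite E \<and> finite F \<and> rational_on f (X - E) \<and> rational_on g (Y - F) \<and>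
     f ` (X - E) = Y - F \<and> g ` (Y - F) = X - E \<and>
     (\<forall>x\<in>X - E. g (f x) = x) \<and> (\<forall>y\<in>Y - F. f (g y) = y)"


section \<open>Halphen's transformation\<close>

text \<open>
  The covers \<open>x = \<wp>(v/2)\<close> and \<open>s = \<wp>(2u)\<close>, as sets of pairs \<open>(x, v)\<close> and \<open>(s, u)\<close>, at the points
  where both \<open>x\<close> and \<open>s\<close> are finite.
\<close>

definition halphen_cover1 :: "(complex \<Rightarrow> complex) \<Rightarrow> (complex \<times> complex) set" where
  "halphen_cover1 P = {(x, v). \<not> is_pole P v \<and> x = P (v / 2)}"

definition halphen_cover2 :: "(complex \<Rightarrow> complex) \<Rightarrow> (complex \<times> complex) set" where
  "halphen_cover2 P = {(s, u). \<not> is_pole P (2 * u) \<and> s = P (2 * u)}"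

text \<open>The chain \<open>s = \<wp>(v)\<close>, \<open>v = 2u\<close>, \<open>x = \<wp>(u)\<close>, read in the two directions.\<close>

definition halphen :: "(complex \<Rightarrow> complex) \<Rightarrow> complex \<times> complex \<Rightarrow> complex \<times> complex" where
  "halphen P = (\<lambda>(x, v). (P v, v / 2))"

definition halphen_inv :: "(complex \<Rightarrow> complex) \<Rightarrow> complex \<times> complex \<Rightarrow> complex \<times> complex" where
  "halphen_inv P = (\<lambda>(s, u). (P u, 2 * u))"


section \<open>The equations and their transformation\<close>

text \<open>An equation \<open>\<psi>'' = Q \<psi>\<close> is given by its potential \<open>Q\<close>.\<close>

definition potential_T :: "(complex \<Rightarrow> complex) \<Rightarrow> complex \<Rightarrow> complex \<Rightarrow> complex" where
  "potential_T P A v = - (1 / 4) * (P v + A)"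

definition potential_L ::
  "complex \<Rightarrow> complex \<Rightarrow> complex \<Rightarrow> complex \<Rightarrow> complex \<Rightarrow> complex" where
  "potential_L e e' e'' A s =
     - (3 / 16) * (1 / (s - e)\<^sup>2 + 1 / (s - e')\<^sup>2 + 1 / (s - e'')\<^sup>2
        - (1 / 3) * ((5 * s - A) / ((s - e) * (s - e') * (s - e''))))"

definition potential_P ::
  "complex \<Rightarrow> complex \<Rightarrow> complex \<Rightarrow> complex \<Rightarrow> complex \<Rightarrow> complex" where
  "potential_P e e' e'' A x =
     - (1 / 4) * (1 / (x - e)\<^sup>2 + 1 / (x - e')\<^sup>2 + 1 / (x - e'')\<^sup>2
        - (2 * x - A) / ((x - e) * (x - e') * (x - e'')))"

definition solves :: "(complex \<Rightarrow> complex) \<Rightarrow> complex set \<Rightarrow> (complex \<Rightarrow> complex) \<Rightarrow> bool" where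
  "solves Q U \<psi> \<longleftrightarrow> \<psi> holomorphic_on U \<and> (\<forall>z\<in>U. deriv (deriv \<psi>) z = Q z * \<psi> z)"

text \<open>
  The change of independent variable \<open>z = g(t)\<close>, together with \<open>\<psi>\<^sub>z = \<surd>(dz/dt) \<psi>\<^sub>t\<close>, transforms the
  equation with potential \<open>Qt\<close> in \<open>D\<close> into the one with potential \<open>Qz\<close>; here \<open>r\<close> runs over the
  branches of the square root.
\<close>

definition transforms_to ::
  "complex set \<Rightarrow> (complex \<Rightarrow> complex) \<Rightarrow> (complex \<Rightarrow> complex) \<Rightarrow> (complex \<Rightarrow> complex) \<Rightarrow> bool" where
  "transforms_to D Qt g Qz \<longleftrightarrow>
     (\<forall>U r \<psi>t \<psi>z. open U \<and> U \<subseteq> D \<and> g holomorphic_on U \<and> inj_on g U \<and>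
        r holomorphic_on U \<and> (\<forall>t\<in>U. (r t)\<^sup>2 = deriv g t) \<and> (\<forall>t\<in>U. \<psi>z (g t) = r t * \<psi>t t)
        \<longrightarrow> (solves Qt U \<psi>t \<longleftrightarrow> solves Qz (g ` U) \<psi>z))"


section \<open>Analytic continuation and monodromy\<close>

text \<open>\<open>F t\<close> is a function element at \<open>\<gamma> t\<close>; neighbouring elements continue each other.\<close>

definition continuation_along ::
  "(real \<Rightarrow> complex) \<Rightarrow> (real \<Rightarrow> complex \<Rightarrow> complex) \<Rightarrow> bool" where
  "continuation_along \<gamma> F \<longleftrightarrow>
     (\<forall>t\<in>{0..1}. \<exists>\<epsilon>>0. \<exists>\<delta>>0. F t holomorphic_on ball (\<gamma> t) \<epsilon> \<and>
        (\<forall>t'\<in>{0..1}. \<bar>t' - t\<bar> < \<delta> \<longrightarrow>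
           \<gamma> t' \<in> ball (\<gamma> t) \<epsilon> \<and> eventually (\<lambda>z. F t' z = F t z) (nhds (\<gamma> t'))))"

text \<open>The germ of \<open>f\<close> at the start of \<open>\<gamma>\<close> is continued along \<open>\<gamma>\<close> to the germ of \<open>g\<close> at its end.\<close>

definition continues_to ::
  "(real \<Rightarrow> complex) \<Rightarrow> (complex \<Rightarrow> complex) \<Rightarrow> (complex \<Rightarrow> complex) \<Rightarrow> bool" where
  "continues_to \<gamma> f g \<longleftrightarrow>
     (\<exists>F. continuation_along \<gamma> F \<and>
        eventually (\<lambda>z. F 0 z = f z) (nhds (pathstart \<gamma>)) \<and>
        eventually (\<lambda>z. F 1 z = g z) (nhds (pathfinish \<gamma>)))"

definition fundamental_system ::
  "(complex \<Rightarrow> complex) \<Rightarrow> complex \<Rightarrow> (complex \<Rightarrow> complex) \<Rightarrow> (complex \<Rightarrow> complex) \<Rightarrow> bool" where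
  "fundamental_system Q z0 \<psi>1 \<psi>2 \<longleftrightarrow>
     (\<exists>\<epsilon>>0. solves Q (ball z0 \<epsilon>) \<psi>1 \<and> solves Q (ball z0 \<epsilon>) \<psi>2 \<and>
        (\<forall>c1 c2. (\<forall>z\<in>ball z0 \<epsilon>. c1 * \<psi>1 z + c2 * \<psi>2 z = 0) \<longrightarrow> c1 = 0 \<and> c2 = 0))"

text \<open>
  The row order is chosen such that continuation along the loop acts on \<open>\<tau> = \<psi>2 / \<psi>1\<close> as the
  Moebius transformation of the matrix.  The matrices have determinant 1, as the Wronskian is
  constant.
\<close>

definition monodromy_group ::
  "complex set \<Rightarrow> complex \<Rightarrow> (complex \<Rightarrow> complex) \<Rightarrow> (complex \<Rightarrow> complex) \<Rightarrow> (complex^2^2) set" where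
  "monodromy_group D z0 \<psi>1 \<psi>2 =
     {M. \<exists>\<gamma>. path \<gamma> \<and> path_image \<gamma> \<subseteq> D \<and> pathstart \<gamma> = z0 \<and> pathfinish \<gamma> = z0 \<and>
        continues_to \<gamma> \<psi>2 (\<lambda>z. M$1$1 * \<psi>2 z + M$1$2 * \<psi>1 z) \<and>
        continues_to \<gamma> \<psi>1 (\<lambda>z. M$2$1 * \<psi>2 z + M$2$2 * \<psi>1 z)}"


section \<open>Fuchsian groups and their genus\<close>

abbreviation upper_half_plane :: "complex set" where
  "upper_half_plane \<equiv> {\<tau>. 0 < Im \<tau>}"

definition fuchsian_group :: "(real^2^2) set \<Rightarrow> bool" where
  "fuchsian_group G \<longleftrightarrow>
     mat 1 \<in> G \<and> (\<forall>M\<in>G. \<forall>N\<in>G. M ** N \<in> G) \<and> (\<forall>M\<in>G. matrix_inv M \<in> G) \<and>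
     (\<forall>M\<in>G. det M = 1) \<and> discrete G"

definition moebius_action :: "real^2^2 \<Rightarrow> complex \<Rightarrow> complex" where
  "moebius_action M \<tau> =
     (of_real (M$1$1) * \<tau> + of_real (M$1$2)) / (of_real (M$2$1) * \<tau> + of_real (M$2$2))"

definition orbit_of :: "(real^2^2) set \<Rightarrow> complex \<Rightarrow> complex set" where
  "orbit_of G \<tau> = (\<lambda>M. moebius_action M \<tau>) ` G"

text \<open>The quotient of the upper half-plane by \<open>G\<close>, with the quotient topology.\<close>

definition orbit_space :: "(real^2^2) set \<Rightarrow> complex set topology" where
  "orbit_space G = topology (\<lambda>V. V \<subseteq> orbit_of G ` upper_half_plane \<and>
     open {\<tau> \<in> upper_half_plane. orbit_of G \<tau> \<in> V})"

lemma openin_orbit_space: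
  "openin (orbit_space G) V \<longleftrightarrow> V \<subseteq> orbit_of G ` upper_half_plane \<and>
     open {\<tau> \<in> upper_half_plane. orbit_of G \<tau> \<in> V}"
proof -
  define H where "H = upper_half_plane"
  have "istopology (\<lambda>V. V \<subseteq> orbit_of G ` H \<and> open {\<tau> \<in> H. orbit_of G \<tau> \<in> V})"
    (is "istopology ?L")
    unfolding istopology_def
  proof (rule conjI; intro allI impI)
    fix S T assume S: "?L S" and T: "?L T"
    have "{\<tau> \<in> H. orbit_of G \<tau> \<in> S \<inter> T} =
        {\<tau> \<in> H. orbit_of G \<tau> \<in> S} \<inter> {\<tau> \<in> H. orbit_of G \<tau> \<in> T}"
      by blast
    moreover have "open ({\<tau> \<in> H. orbit_of G \<tau> \<in> S} \<inter> {\<tau> \<in> H. orbit_of G \<tau> \<in> T})"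
      by (rule open_Int[OF conjunct2[OF S] conjunct2[OF T]])
    ultimately show "?L (S \<inter> T)" using S by (simp only:) blast
  next
    fix \<K> assume K: "\<forall>S\<in>\<K>. ?L S"
    have "{\<tau> \<in> H. orbit_of G \<tau> \<in> \<Union>\<K>} = (\<Union>S\<in>\<K>. {\<tau> \<in> H. orbit_of G \<tau> \<in> S})"
      by blast
    moreover have "open (\<Union>S\<in>\<K>. {\<tau> \<in> H. orbit_of G \<tau> \<in> S})"
      by (rule open_UN) (use K in blast)
    ultimately show "?L (\<Union>\<K>)" using K by (simp only:) blast
  qed
  then show ?thesis
    unfolding orbit_space_def H_def[symmetric] by (simp only: topology_inverse')
qed

text \<open>
  The genus of a connected orientable surface is the largest number of disjoint simple closed
  curves along which it can be cut without becoming disconnected.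
\<close>

definition simple_closed_curve :: "'a topology \<Rightarrow> 'a set \<Rightarrow> bool" where
  "simple_closed_curve X C \<longleftrightarrow>
     (\<exists>c. embedding_map (top_of_set (sphere (0::complex) 1)) X c \<and> C = c ` sphere 0 1)"

definition finite_genus :: "'a topology \<Rightarrow> bool" where
  "finite_genus X \<longleftrightarrow>
     (\<exists>n. \<forall>\<C>. finite \<C> \<and> card \<C> > n \<and> pairwise disjnt \<C> \<and> (\<forall>C\<in>\<C>. simple_closed_curve X C)
        \<longrightarrow> \<not> connected_space (subtopology X (topspace X - \<Union>\<C>)))"


section \<open>The \<open>A\<close>-parameter problem\<close>

text \<open>
  The single-valued function \<open>\<xi>\<close> on the upper half-plane inverts the multivalued ratio
  \<open>\<tau> = \<psi>2 / \<psi>1\<close>: for every value of \<open>\<tau>\<close> at \<open>z\<close> obtained by continuation in \<open>D\<close>, \<open>\<xi>(\<tau>) = z\<close>.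
\<close>

definition inverts_ratio ::
  "complex set \<Rightarrow> complex \<Rightarrow> (complex \<Rightarrow> complex) \<Rightarrow> (complex \<Rightarrow> complex) \<Rightarrow> (complex \<Rightarrow> complex) \<Rightarrow> bool" where
  "inverts_ratio D z0 \<psi>1 \<psi>2 \<xi> \<longleftrightarrow>
     \<xi> holomorphic_on upper_half_plane \<and>
     (\<forall>\<gamma> \<phi>1 \<phi>2. path \<gamma> \<and> path_image \<gamma> \<subseteq> D \<and> pathstart \<gamma> = z0 \<and>
        continues_to \<gamma> \<psi>1 \<phi>1 \<and> continues_to \<gamma> \<psi>2 \<phi>2 \<longrightarrow>
        (let z = pathfinish \<gamma> in
           \<phi>1 z \<noteq> 0 \<and> \<phi>2 z / \<phi>1 z \<in> upper_half_plane \<and> \<xi> (\<phi>2 z / \<phi>1 z) = z))"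

text \<open>
  The independent variable of \<open>\<psi>'' = Q \<psi>\<close> in \<open>D\<close> is the function \<open>\<xi>\<close> of the ratio of two linearly
  independent solutions, the monodromy group being Fuchsian of finite genus.  The two solutions are
  chosen such that the disc on which this group acts is the upper half-plane; on this disc \<open>\<xi>\<close> is
  single-valued and analytic.
\<close>

definition fuchsian_inversion ::
  "complex set \<Rightarrow> (complex \<Rightarrow> complex) \<Rightarrow> (complex \<Rightarrow> complex) \<Rightarrow> bool" where
  "fuchsian_inversion D Q \<xi> \<longleftrightarrow>
     (\<exists>z0\<in>D. \<exists>\<psi>1 \<psi>2 G. fundamental_system Q z0 \<psi>1 \<psi>2 \<and>
        monodromy_group D z0 \<psi>1 \<psi>2 = map_matrix of_real ` G \<and>
        fuchsian_group G \<and> finite_genus (orbit_space G) \<and>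
        inverts_ratio D z0 \<psi>1 \<psi>2 \<xi>)"

text \<open>\<open>Q A\<close> is the potential with parameter \<open>A\<close>.\<close>

definition solves_A_problem ::
  "complex set \<Rightarrow> (complex \<Rightarrow> complex \<Rightarrow> complex) \<Rightarrow> complex \<Rightarrow> bool" where
  "solves_A_problem D Q A \<longleftrightarrow> (\<exists>\<xi>. fuchsian_inversion D (Q A) \<xi>)"

end

theory Submission
  imports Defs
begin

text \<open>
  Write \<open>\<H>\<close> for the upper half-plane, \<open>L\<close> for the set of poles of \<open>\<wp>\<close>, and (T), (P), (L) for the
  equations in the variables \<open>v\<close>, \<open>x = \<wp>(v/2)\<close>, \<open>s = \<wp>(v)\<close>.  Three facts about \<open>\<wp>\<close> drive everything:
  its poles are its periods, it is even with fibres \<open>\<plusminus>v + L\<close>, and \<open>\<wp>(2u) = dup(\<wp>(u))\<close>.  They follow from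
  uniqueness for initial value problems alone: \<open>1/\<wp>\<close> solves one and the same such problem at every pole,
  and so does the duplication formula (\<open>pole_symmetry\<close>, \<open>fibre\<close>, \<open>duplication\<close>).

  The duplication formula makes Halphen's chain algebraic: the covers \<open>x = \<wp>(v/2)\<close> and \<open>s = \<wp>(2u)\<close> are cut out
  by \<open>dup(x) = \<wp>(v)\<close> and \<open>s = dup(\<wp>(u))\<close>, and on these curves the passage from one cover to the other is
  an exchange of coordinates together with the derivative of the formula (\<open>halphen_birational\<close>).

  A change of variable \<open>z = g(t)\<close> transforms \<open>\<psi>'' = Q \<psi>\<close> into another equation of this form through the
  Schwarzian derivative of \<open>g\<close> (\<open>pulls_back\<close>).  For \<open>\<wp>\<close> and \<open>\<wp>(v/2)\<close> this is a polynomial identity, and \<open>dup\<close>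
  follows by cancellation (\<open>pulls_back_dup\<close>).

  For the parameter problems the monodromy is replaced by a property of the inverse function \<open>\<xi>\<close> alone:
  \<open>\<xi>\<close> satisfies the Schwarzian equation of \<open>Q\<close> and paths in the domain \<open>D\<close> of the equation lift through it
  (\<open>uniformizes\<close>).  The problem implies this property by continuing the ratio of solutions
  (\<open>fuchsian_inversion_imp_uniformizes\<close>).  Conversely, lifting loops turns the property into a monodromy group of real
  matrices which leave \<open>\<xi>\<close> invariant.  It is discrete because \<open>\<xi>\<close> is locally injective over \<open>D\<close>, and if it
  acts transitively on all fibres of \<open>\<xi>\<close>, then \<open>\<xi>\<close> embeds the orbit space into the plane, and its genus is
  0 by the Jordan curve theorem (\<open>uniformizes_imp_fuchsian_inversion\<close>).

  The property travels between the equations with the same \<open>A\<close>.  From (T) it passes to (L) and (P) by composition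
  with \<open>\<wp>\<close>, since local inverses of \<open>\<wp>\<close>, branches of the elliptic integral, continue along all paths that avoid
  \<open>e, e', e''\<close> (\<open>sections_on_ball\<close>, \<open>lifts_paths_P\<close>).  In the other direction \<open>v\<close> is an elliptic integral of
  \<open>ds / \<surd>(4s\<^sup>3 - as - b)\<close> over the half-plane (\<open>L_imp_T\<close>, \<open>P_imp_T\<close>).  The integrand is holomorphic and without
  zeros there because the indicial equations leave no choice (\<open>pulls_back_order\<close>): \<open>v\<close> omits the poles, \<open>x\<close> omits the
  branch points, and \<open>s\<close> takes them with multiplicity two, as \<open>\<wp>\<close> does.
\<close>

no_notation fps_nth (infixl "$" 75)

section \<open>Analytic continuation along paths\<close>

lemma analytic_germ_eq_on:
  assumes "f holomorphic_on S" "g holomorphic_on S" "open S" "connected S" "z \<in> S" "w \<in> S"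
    and "\<forall>\<^sub>F x in nhds z. f x = g x"
  shows "f w = g w"
proof -
  obtain U where U: "open U" "z \<in> U" "\<forall>x\<in>U. f x = g x"
    using assms(7) by (auto simp: eventually_nhds)
  show ?thesis
    by (rule analytic_continuation_open[of "U \<inter> S" S f g])
       (use assms U in \<open>auto\<close>)
qed

text \<open>
  The relation that continuation along a path requires of neighbouring elements, over an arbitrary set
  of parameters, as cutting and gluing of paths need it.  The discs and the modulus of continuity are
  hidden in the filters.
\<close>

definition continuation_on ::
  "real set \<Rightarrow> (real \<Rightarrow> complex) \<Rightarrow> (real \<Rightarrow> complex \<Rightarrow> complex) \<Rightarrow> bool" where
  "continuation_on I \<gamma> F \<longleftrightarrow>
     (\<forall>t\<in>I. F t analytic_on {\<gamma> t} \<and>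
        (\<forall>\<^sub>F t' in at t within I. \<forall>\<^sub>F z in nhds (\<gamma> t'). F t' z = F t z))"

lemma eventually_at_withinD:
  assumes "\<forall>\<^sub>F s in at (t::real) within I. Q s" "Q t"
  obtains \<delta> where "\<delta> > 0" "\<And>s. s \<in> I \<Longrightarrow> \<bar>s - t\<bar> < \<delta> \<Longrightarrow> Q s"
proof -
  obtain d where d: "d > 0" "\<forall>s\<in>I. s \<noteq> t \<and> dist s t < d \<longrightarrow> Q s"
    using assms(1) by (auto simp: eventually_at)
  show ?thesis
    by (rule that[of d]) (use d assms(2) in \<open>auto simp: dist_real_def\<close>)
qed

lemma continuation_along_iff:
  assumes "path \<gamma>"
  shows "continuation_along \<gamma> F \<longleftrightarrow> continuation_on {0..1} \<gamma> F"
proof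
  assume L: "continuation_along \<gamma> F"
  show "continuation_on {0..1} \<gamma> F"
    unfolding continuation_on_def
  proof (intro ballI conjI)
    fix t :: real assume "t \<in> {0..1}"
    then obtain \<epsilon> \<delta> where *: "\<epsilon> > 0" "\<delta> > 0" "F t holomorphic_on ball (\<gamma> t) \<epsilon>"
      "\<forall>t'\<in>{0..1}. \<bar>t' - t\<bar> < \<delta> \<longrightarrow>
           \<gamma> t' \<in> ball (\<gamma> t) \<epsilon> \<and> eventually (\<lambda>z. F t' z = F t z) (nhds (\<gamma> t'))"
      using L unfolding continuation_along_def by meson
    show "F t analytic_on {\<gamma> t}"
      using * analytic_at_ball by blast
    show "\<forall>\<^sub>F t' in at t within {0..1}. \<forall>\<^sub>F z in nhds (\<gamma> t'). F t' z = F t z"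
      unfolding eventually_at using * by (intro exI[of _ \<delta>]) (auto simp: dist_real_def)
  qed
next
  assume R: "continuation_on {0..1} \<gamma> F"
  show "continuation_along \<gamma> F"
    unfolding continuation_along_def
  proof
    fix t :: real assume t: "t \<in> {0..1}"
    obtain \<epsilon> where e: "\<epsilon> > 0" "F t holomorphic_on ball (\<gamma> t) \<epsilon>"
      using R t unfolding continuation_on_def analytic_at_ball by blast
    have "\<forall>\<^sub>F t' in at t within {0..1}. \<gamma> t' \<in> ball (\<gamma> t) \<epsilon>"
      using assms t e(1) unfolding path_def continuous_on_def
      by (metis centre_in_ball open_ball topological_tendstoD)
    moreover have "\<forall>\<^sub>F t' in at t within {0..1}. \<forall>\<^sub>F z in nhds (\<gamma> t'). F t' z = F t z"
      using R t unfolding continuation_on_def by blast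
    ultimately have "\<forall>\<^sub>F t' in at t within {0..1}. \<gamma> t' \<in> ball (\<gamma> t) \<epsilon> \<and>
        eventually (\<lambda>z. F t' z = F t z) (nhds (\<gamma> t'))"
      by eventually_elim auto
    then obtain \<delta> where "\<delta> > 0" "\<And>s. s \<in> {0..1} \<Longrightarrow> \<bar>s - t\<bar> < \<delta> \<Longrightarrow>
        \<gamma> s \<in> ball (\<gamma> t) \<epsilon> \<and> eventually (\<lambda>z. F s z = F t z) (nhds (\<gamma> s))"
      by (rule eventually_at_withinD) (use e in auto)
    then show "\<exists>\<epsilon>>0. \<exists>\<delta>>0. F t holomorphic_on ball (\<gamma> t) \<epsilon> \<and>
        (\<forall>t'\<in>{0..1}. \<bar>t' - t\<bar> < \<delta> \<longrightarrow>
           \<gamma> t' \<in> ball (\<gamma> t) \<epsilon> \<and> eventually (\<lambda>z. F t' z = F t z) (nhds (\<gamma> t')))"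
      using e by blast
  qed
qed

lemma continuation_on_const:
  assumes "\<And>t. t \<in> I \<Longrightarrow> f analytic_on {\<gamma> t}"
  shows "continuation_on I \<gamma> (\<lambda>_. f)"
  using assms by (auto simp: continuation_on_def)

lemma continuation_on_binop:
  assumes "continuation_on I \<gamma> F" "continuation_on I \<gamma> G"
    and "\<And>t. t \<in> I \<Longrightarrow> (\<lambda>z. h (F t z) (G t z)) analytic_on {\<gamma> t}"
  shows "continuation_on I \<gamma> (\<lambda>t z. h (F t z) (G t z))"
  unfolding continuation_on_def
proof (intro ballI conjI)
  fix t assume t: "t \<in> I"
  have "\<forall>\<^sub>F t' in at t within I. \<forall>\<^sub>F z in nhds (\<gamma> t'). F t' z = F t z"
    "\<forall>\<^sub>F t' in at t within I. \<forall>\<^sub>F z in nhds (\<gamma> t'). G t' z = G t z"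
    using assms t by (auto simp: continuation_on_def)
  then show "\<forall>\<^sub>F t' in at t within I. \<forall>\<^sub>F z in nhds (\<gamma> t'). h (F t' z) (G t' z) = h (F t z) (G t z)"
  proof eventually_elim
    case (elim t')
    then show ?case by eventually_elim auto
  qed
qed (use assms in auto)

lemma continuation_on_compose:
  assumes "continuation_on I \<gamma> F" "\<And>t. t \<in> I \<Longrightarrow> k analytic_on {F t (\<gamma> t)}"
  shows "continuation_on I \<gamma> (\<lambda>t z. k (F t z))"
proof (rule continuation_on_binop[OF assms(1) assms(1)])
  fix t assume t: "t \<in> I"
  have "F t analytic_on {\<gamma> t}" using assms t by (auto simp: continuation_on_def)
  then have "(k \<circ> F t) analytic_on {\<gamma> t}"
    by (rule analytic_on_compose) (use assms t in auto)
  then show "(\<lambda>z. k (F t z)) analytic_on {\<gamma> t}" by (simp add: o_def)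
qed

lemma continuation_on_mult:
  assumes "continuation_on I \<gamma> F" "continuation_on I \<gamma> G"
  shows "continuation_on I \<gamma> (\<lambda>t z. F t z * G t z)"
  by (rule continuation_on_binop[OF assms])
     (use assms in \<open>auto simp: continuation_on_def intro!: analytic_intros\<close>)

lemma continuation_on_lincomb:
  assumes "continuation_on I \<gamma> F" "continuation_on I \<gamma> G"
  shows "continuation_on I \<gamma> (\<lambda>t z. c * F t z + d * G t z)"
  by (rule continuation_on_binop[OF assms])
     (use assms in \<open>auto simp: continuation_on_def intro!: analytic_intros\<close>)

lemma continuation_on_continuous:
  assumes "continuation_on I \<gamma> F" "continuous_on I \<gamma>"
  shows "continuous_on I (\<lambda>t. F t (\<gamma> t))"
  unfolding continuous_on_def
proof
  fix t assume t: "t \<in> I"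
  have "F t analytic_on {\<gamma> t}" "\<forall>\<^sub>F t' in at t within I. \<forall>\<^sub>F z in nhds (\<gamma> t'). F t' z = F t z"
    using assms t by (auto simp: continuation_on_def)
  then have "isCont (F t) (\<gamma> t)" by (simp add: analytic_at_imp_isCont)
  moreover have "(\<gamma> \<longlongrightarrow> \<gamma> t) (at t within I)" using assms(2) t by (simp add: continuous_on_def)
  ultimately have "((\<lambda>s. F t (\<gamma> s)) \<longlongrightarrow> F t (\<gamma> t)) (at t within I)"
    by (rule isCont_tendsto_compose)
  moreover have "\<forall>\<^sub>F t' in at t within I. F t (\<gamma> t') = F t' (\<gamma> t')"
    using \<open>\<forall>\<^sub>F t' in at t within I. \<forall>\<^sub>F z in nhds (\<gamma> t'). F t' z = F t z\<close>
    by eventually_elim (auto dest: eventually_nhds_x_imp_x)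
  ultimately show "((\<lambda>t. F t (\<gamma> t)) \<longlongrightarrow> F t (\<gamma> t)) (at t within I)"
    by (rule Lim_transform_eventually)
qed

lemma continuation_on_common_ball:
  assumes "continuation_on I \<gamma> F" "continuous_on I \<gamma>" "t \<in> I" "0 < r"
  obtains \<epsilon> \<delta> where "0 < \<epsilon>" "\<epsilon> \<le> r" "0 < \<delta>" "F t holomorphic_on ball (\<gamma> t) \<epsilon>"
    "\<And>s. s \<in> I \<Longrightarrow> \<bar>s - t\<bar> < \<delta> \<Longrightarrow> \<gamma> s \<in> ball (\<gamma> t) \<epsilon> \<and> (\<forall>\<^sub>F z in nhds (\<gamma> s). F s z = F t z)"
proof -
  obtain e where e: "e > 0" "F t holomorphic_on ball (\<gamma> t) e"
    using assms unfolding continuation_on_def analytic_at_ball by blast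
  define \<epsilon> where "\<epsilon> = min e r"
  have "\<forall>\<^sub>F s in at t within I. \<gamma> s \<in> ball (\<gamma> t) \<epsilon>"
    using assms e(1) unfolding continuous_on_def \<epsilon>_def
    by (metis centre_in_ball min_less_iff_conj open_ball topological_tendstoD)
  moreover have "\<forall>\<^sub>F s in at t within I. \<forall>\<^sub>F z in nhds (\<gamma> s). F s z = F t z"
    using assms unfolding continuation_on_def by blast
  ultimately have "\<forall>\<^sub>F s in at t within I. \<gamma> s \<in> ball (\<gamma> t) \<epsilon> \<and> (\<forall>\<^sub>F z in nhds (\<gamma> s). F s z = F t z)"
    by eventually_elim auto
  then obtain \<delta> where "\<delta> > 0" "\<And>s. s \<in> I \<Longrightarrow> \<bar>s - t\<bar> < \<delta> \<Longrightarrow>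
        \<gamma> s \<in> ball (\<gamma> t) \<epsilon> \<and> (\<forall>\<^sub>F z in nhds (\<gamma> s). F s z = F t z)"
    by (rule eventually_at_withinD) (use e assms(4) in \<open>auto simp: \<epsilon>_def\<close>)
  then show ?thesis
    by (intro that[of \<epsilon> \<delta>]) (use e assms(4) in \<open>auto simp: \<epsilon>_def elim: holomorphic_on_subset\<close>)
qed

lemma connected_induction_real:
  fixes I :: "real set"
  assumes "connected I" "a \<in> I" "b \<in> I" "P a"
    and "\<And>t. t \<in> I \<Longrightarrow> \<exists>\<delta>>0. \<forall>x\<in>I. \<forall>y\<in>I. \<bar>x - t\<bar> < \<delta> \<longrightarrow> \<bar>y - t\<bar> < \<delta> \<longrightarrow> P x \<longrightarrow> P y"
  shows "P b"
proof (rule connected_induction_simple[OF assms(1-3), of P])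
  fix t assume "t \<in> I"
  then obtain \<delta> where "\<delta> > 0" and \<delta>: "\<forall>x\<in>I. \<forall>y\<in>I. \<bar>x - t\<bar> < \<delta> \<longrightarrow> \<bar>y - t\<bar> < \<delta> \<longrightarrow> P x \<longrightarrow> P y"
    using assms(5) by blast
  show "\<exists>T. openin (top_of_set I) T \<and> t \<in> T \<and> (\<forall>x\<in>T. \<forall>y\<in>T. P x \<longrightarrow> P y)"
  proof (intro exI conjI)
    show "openin (top_of_set I) (I \<inter> ball t \<delta>)" by (simp add: openin_open_Int)
  qed (use \<delta> \<open>\<delta> > 0\<close> \<open>t \<in> I\<close> in \<open>auto simp: dist_real_def abs_minus_commute\<close>)
qed (use assms in auto)

text \<open>
  Agreement of germs is an open and closed condition on the parameter, because near each parameter the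
  elements of both families are restrictions of functions on one disc.
\<close>

lemma continuation_on_unique:
  assumes F: "continuation_on I \<gamma> F" and G: "continuation_on I \<gamma> G"
    and \<gamma>: "continuous_on I \<gamma>" and I: "connected I" "a \<in> I" "t \<in> I"
    and eq: "\<forall>\<^sub>F z in nhds (\<gamma> a). F a z = G a z"
  shows "\<forall>\<^sub>F z in nhds (\<gamma> t). F t z = G t z"
proof (rule connected_induction_real[OF I, of "\<lambda>t. \<forall>\<^sub>F z in nhds (\<gamma> t). F t z = G t z"])
  show "\<forall>\<^sub>F z in nhds (\<gamma> a). F a z = G a z" by fact
  fix t assume t: "t \<in> I"
  obtain \<epsilon>1 \<delta>1 where 1: "0 < \<epsilon>1" "\<epsilon>1 \<le> 1" "0 < \<delta>1" "F t holomorphic_on ball (\<gamma> t) \<epsilon>1"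
    "\<And>s. s \<in> I \<Longrightarrow> \<bar>s - t\<bar> < \<delta>1 \<Longrightarrow> \<gamma> s \<in> ball (\<gamma> t) \<epsilon>1 \<and> (\<forall>\<^sub>F z in nhds (\<gamma> s). F s z = F t z)"
    by (rule continuation_on_common_ball[OF F \<gamma> t, of 1]) auto
  obtain \<epsilon>2 \<delta>2 where 2: "0 < \<epsilon>2" "\<epsilon>2 \<le> \<epsilon>1" "0 < \<delta>2" "G t holomorphic_on ball (\<gamma> t) \<epsilon>2"
    "\<And>s. s \<in> I \<Longrightarrow> \<bar>s - t\<bar> < \<delta>2 \<Longrightarrow> \<gamma> s \<in> ball (\<gamma> t) \<epsilon>2 \<and> (\<forall>\<^sub>F z in nhds (\<gamma> s). G s z = G t z)"
    by (rule continuation_on_common_ball[OF G \<gamma> t, of \<epsilon>1]) (use 1 in auto)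
  have hol: "F t holomorphic_on ball (\<gamma> t) \<epsilon>2"
    using 1(4) by (rule holomorphic_on_subset) (use 2 in auto)
  show "\<exists>\<delta>>0. \<forall>x\<in>I. \<forall>y\<in>I. \<bar>x - t\<bar> < \<delta> \<longrightarrow> \<bar>y - t\<bar> < \<delta> \<longrightarrow>
      (\<forall>\<^sub>F z in nhds (\<gamma> x). F x z = G x z) \<longrightarrow> (\<forall>\<^sub>F z in nhds (\<gamma> y). F y z = G y z)"
  proof (intro exI[of _ "min \<delta>1 \<delta>2"] conjI ballI impI)
    fix x y assume x: "x \<in> I" "\<bar>x - t\<bar> < min \<delta>1 \<delta>2" and y: "y \<in> I" "\<bar>y - t\<bar> < min \<delta>1 \<delta>2"
      and P: "\<forall>\<^sub>F z in nhds (\<gamma> x). F x z = G x z"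
    have "\<forall>\<^sub>F z in nhds (\<gamma> x). F x z = F t z" "\<forall>\<^sub>F z in nhds (\<gamma> x). G x z = G t z"
      using 1(5) 2(5) x by auto
    with P have "\<forall>\<^sub>F z in nhds (\<gamma> x). F t z = G t z" by eventually_elim auto
    then have eq: "F t w = G t w" if "w \<in> ball (\<gamma> t) \<epsilon>2" for w
      using that 2(5) x by (intro analytic_germ_eq_on[OF hol 2(4), of "\<gamma> x"]) auto
    have "\<forall>\<^sub>F z in nhds (\<gamma> y). z \<in> ball (\<gamma> t) \<epsilon>2"
      using 2(5)[of y] y by (intro eventually_nhds_in_open) auto
    moreover have "\<forall>\<^sub>F z in nhds (\<gamma> y). F y z = F t z" "\<forall>\<^sub>F z in nhds (\<gamma> y). G y z = G t z"
      using 1(5) 2(5) y by auto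
    ultimately show "\<forall>\<^sub>F z in nhds (\<gamma> y). F y z = G y z"
      by eventually_elim (use eq in auto)
  qed (use 1 2 in auto)
qed

lemma continuation_on_subset:
  "continuation_on I \<gamma> F \<Longrightarrow> J \<subseteq> I \<Longrightarrow> continuation_on J \<gamma> F"
  unfolding continuation_on_def using filter_leD[OF at_le] by (meson subsetD)

lemma continuation_on_reparam:
  assumes F: "continuation_on I \<gamma> F" and h: "continuous_on J h" "h ` J \<subseteq> I"
    and eq: "\<And>t. t \<in> J \<Longrightarrow> \<gamma>' t = \<gamma> (h t)"
  shows "continuation_on J \<gamma>' (\<lambda>t. F (h t))"
  unfolding continuation_on_def
proof (intro ballI conjI)
  fix t assume t: "t \<in> J"
  then have ht: "h t \<in> I" using h by auto
  show "F (h t) analytic_on {\<gamma>' t}" using F ht eq[OF t] by (auto simp: continuation_on_def)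
  have "\<forall>\<^sub>F s in at (h t) within I. \<forall>\<^sub>F z in nhds (\<gamma> s). F s z = F (h t) z"
    using F ht by (auto simp: continuation_on_def)
  then obtain \<delta> where d: "\<delta> > 0" "\<And>s. s \<in> I \<Longrightarrow> \<bar>s - h t\<bar> < \<delta> \<Longrightarrow> \<forall>\<^sub>F z in nhds (\<gamma> s). F s z = F (h t) z"
    by (rule eventually_at_withinD) auto
  have "\<forall>\<^sub>F s in at t within J. dist (h s) (h t) < \<delta>"
    using h(1) t d(1) by (auto simp: continuous_on_def tendsto_iff)
  moreover have "\<forall>\<^sub>F s in at t within J. s \<in> J" by (simp add: eventually_at_filter)
  ultimately show "\<forall>\<^sub>F s in at t within J. \<forall>\<^sub>F z in nhds (\<gamma>' s). F (h s) z = F (h t) z"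
  proof eventually_elim
    case (elim s)
    then show ?case using d(2)[of "h s"] h(2) eq[of s] by (auto simp: dist_real_def)
  qed
qed

lemma continuation_on_glue:
  assumes F: "continuation_on {a..x} \<gamma> F" and G: "continuation_on {x..b} \<gamma> G"
    and \<gamma>: "continuous_on {a..b} \<gamma>" and ab: "a \<le> x" "x \<le> b"
    and eq: "\<forall>\<^sub>F z in nhds (\<gamma> x). F x z = G x z"
  shows "continuation_on {a..b} \<gamma> (\<lambda>t. if t \<le> x then F t else G t)"
    (is "continuation_on _ _ ?K")
  unfolding continuation_on_def
proof (intro ballI conjI)
  fix t assume t: "t \<in> {a..b}"
  show "?K t analytic_on {\<gamma> t}" using F G t by (auto simp: continuation_on_def)
  consider "t < x" | "t = x" | "t > x" by linarith
  then show "\<forall>\<^sub>F s in at t within {a..b}. \<forall>\<^sub>F z in nhds (\<gamma> s). ?K s z = ?K t z"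
  proof cases
    case 1
    have "\<forall>\<^sub>F s in at t within {a..x}. \<forall>\<^sub>F z in nhds (\<gamma> s). F s z = F t z"
      using F t 1 by (auto simp: continuation_on_def)
    then obtain \<delta> where d: "\<delta> > 0" "\<And>s. s \<in> {a..x} \<Longrightarrow> \<bar>s - t\<bar> < \<delta> \<Longrightarrow> \<forall>\<^sub>F z in nhds (\<gamma> s). F s z = F t z"
      by (rule eventually_at_withinD) auto
    show ?thesis unfolding eventually_at
    proof (intro exI[of _ "min \<delta> (x - t)"] conjI ballI impI)
      fix s assume "s \<in> {a..b}" "s \<noteq> t \<and> dist s t < min \<delta> (x - t)"
      then show "\<forall>\<^sub>F z in nhds (\<gamma> s). ?K s z = ?K t z"
        using d(2)[of s] 1 by (auto simp: dist_real_def)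
    qed (use d 1 in auto)
  next
    case 3
    have "\<forall>\<^sub>F s in at t within {x..b}. \<forall>\<^sub>F z in nhds (\<gamma> s). G s z = G t z"
      using G t 3 by (auto simp: continuation_on_def)
    then obtain \<delta> where d: "\<delta> > 0" "\<And>s. s \<in> {x..b} \<Longrightarrow> \<bar>s - t\<bar> < \<delta> \<Longrightarrow> \<forall>\<^sub>F z in nhds (\<gamma> s). G s z = G t z"
      by (rule eventually_at_withinD) auto
    show ?thesis unfolding eventually_at
    proof (intro exI[of _ "min \<delta> (t - x)"] conjI ballI impI)
      fix s assume "s \<in> {a..b}" "s \<noteq> t \<and> dist s t < min \<delta> (t - x)"
      then show "\<forall>\<^sub>F z in nhds (\<gamma> s). ?K s z = ?K t z"
        using d(2)[of s] 3 by (auto simp: dist_real_def)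
    qed (use d 3 in auto)
  next
    case 2
    have "\<forall>\<^sub>F s in at t within {a..x}. \<forall>\<^sub>F z in nhds (\<gamma> s). F s z = F t z"
      "\<forall>\<^sub>F s in at t within {x..b}. \<forall>\<^sub>F z in nhds (\<gamma> s). G s z = G t z"
      using F G t 2 by (auto simp: continuation_on_def)
    then obtain \<delta>1 \<delta>2 where d: "\<delta>1 > 0" "\<delta>2 > 0"
      "\<And>s. s \<in> {a..x} \<Longrightarrow> \<bar>s - t\<bar> < \<delta>1 \<Longrightarrow> \<forall>\<^sub>F z in nhds (\<gamma> s). F s z = F t z"
      "\<And>s. s \<in> {x..b} \<Longrightarrow> \<bar>s - t\<bar> < \<delta>2 \<Longrightarrow> \<forall>\<^sub>F z in nhds (\<gamma> s). G s z = G t z"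
      by (elim eventually_at_withinD) auto
    have "\<forall>\<^sub>F w in nhds (\<gamma> x). \<forall>\<^sub>F z in nhds w. F x z = G x z"
      using eq by (simp add: eventually_eventually)
    then obtain U where U: "open U" "\<gamma> x \<in> U" "\<And>w. w \<in> U \<Longrightarrow> \<forall>\<^sub>F z in nhds w. F x z = G x z"
      by (auto simp: eventually_nhds)
    have "\<forall>\<^sub>F s in at t within {a..b}. \<gamma> s \<in> U"
      using \<gamma> t U 2 unfolding continuous_on_def by (metis topological_tendstoD)
    then obtain \<delta>3 where d3: "\<delta>3 > 0" "\<And>s. s \<in> {a..b} \<Longrightarrow> \<bar>s - t\<bar> < \<delta>3 \<Longrightarrow> \<gamma> s \<in> U"
      by (rule eventually_at_withinD) (use U 2 in auto)
    show ?thesis unfolding eventually_at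
    proof (intro exI[of _ "min \<delta>1 (min \<delta>2 \<delta>3)"] conjI ballI impI)
      fix s assume s: "s \<in> {a..b}" "s \<noteq> t \<and> dist s t < min \<delta>1 (min \<delta>2 \<delta>3)"
      show "\<forall>\<^sub>F z in nhds (\<gamma> s). ?K s z = ?K t z"
      proof (cases "s \<le> x")
        case True
        then show ?thesis using d(3)[of s] s 2 by (auto simp: dist_real_def)
      next
        case False
        have "\<forall>\<^sub>F z in nhds (\<gamma> s). G s z = G t z" using d(4)[of s] s False by (auto simp: dist_real_def)
        moreover have "\<forall>\<^sub>F z in nhds (\<gamma> s). F x z = G x z"
          using U d3 s by (auto simp: dist_real_def)
        ultimately have "\<forall>\<^sub>F z in nhds (\<gamma> s). G s z = F t z"
          unfolding 2 by eventually_elim auto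
        then show ?thesis using 2 False by simp
      qed
    qed (use d d3 in auto)
  qed
qed

text \<open>
  A class of function elements in which every element near a point of \<open>D\<close> extends to a disc of
  fixed size about that point can be continued along all paths of \<open>D\<close>.
\<close>

lemma germ_continuation:
  assumes \<gamma>: "path \<gamma>" "path_image \<gamma> \<subseteq> D"
    and ext: "\<And>z. z \<in> D \<Longrightarrow> \<exists>r>0. \<forall>z'\<in>ball z r. \<forall>f. A z' f \<longrightarrow>
        (\<exists>g. g holomorphic_on ball z r \<and> (\<forall>w\<in>ball z r. A w g) \<and> (\<forall>\<^sub>F w in nhds z'. f w = g w))"
    and f: "A (\<gamma> 0) f" "f analytic_on {\<gamma> 0}"
  obtains F where "continuation_on {0..1} \<gamma> F" "F 0 = f" "\<And>t. t \<in> {0..1} \<Longrightarrow> A (\<gamma> t) (F t)"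
proof -
  have cont: "continuous_on {0..1} \<gamma>" using \<gamma> by (simp add: path_def)
  define R where "R y \<longleftrightarrow> (\<exists>F. continuation_on {0..y} \<gamma> F \<and> F 0 = f \<and> (\<forall>t\<in>{0..y}. A (\<gamma> t) (F t)))"
    for y :: real
  have "R 1"
  proof (rule connected_induction_real[of "{0..1}" 0 1 R])
    show "R 0" unfolding R_def
      using f by (intro exI[of _ "\<lambda>_. f"]) (auto intro!: continuation_on_const)
    fix t :: real assume t: "t \<in> {0..1}"
    then have "\<gamma> t \<in> D" using \<gamma> by (auto simp: path_image_def)
    then obtain r where r: "r > 0" "\<And>z' f. z'\<in>ball (\<gamma> t) r \<Longrightarrow> A z' f \<Longrightarrow>
        (\<exists>g. g holomorphic_on ball (\<gamma> t) r \<and> (\<forall>w\<in>ball (\<gamma> t) r. A w g) \<and> (\<forall>\<^sub>F w in nhds z'. f w = g w))"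
      using ext by meson
    have "\<forall>\<^sub>F s in at t within {0..1}. \<gamma> s \<in> ball (\<gamma> t) r"
      using cont t r(1) unfolding continuous_on_def
      by (metis centre_in_ball open_ball topological_tendstoD)
    then obtain \<delta> where d: "\<delta> > 0" "\<And>s. s \<in> {0..1} \<Longrightarrow> \<bar>s - t\<bar> < \<delta> \<Longrightarrow> \<gamma> s \<in> ball (\<gamma> t) r"
      by (rule eventually_at_withinD) (use r in auto)
    have "R y" if x: "x \<in> {0..1}" "\<bar>x - t\<bar> < \<delta>" "R x" and y: "y \<in> {0..1}" "\<bar>y - t\<bar> < \<delta>" for x y
    proof -
      obtain F where F: "continuation_on {0..x} \<gamma> F" "F 0 = f" "\<forall>t\<in>{0..x}. A (\<gamma> t) (F t)"
        using x unfolding R_def by (elim exE conjE)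
      show ?thesis
      proof (cases "y \<le> x")
        case True
        then show ?thesis unfolding R_def using F
          by (intro exI[of _ F]) (auto elim: continuation_on_subset)
      next
        case False
        obtain g where g: "g holomorphic_on ball (\<gamma> t) r" "\<forall>w\<in>ball (\<gamma> t) r. A w g"
          "\<forall>\<^sub>F w in nhds (\<gamma> x). F x w = g w"
          using r(2)[of "\<gamma> x" "F x"] F d(2)[of x] x by auto
        have in_ball: "\<gamma> s \<in> ball (\<gamma> t) r" if "s \<in> {x..y}" for s
          using that x y d(2)[of s] by auto
        have "continuation_on {x..y} \<gamma> (\<lambda>_. g)"
          using g(1) in_ball by (intro continuation_on_const) (meson analytic_at open_ball)
        then have "continuation_on {0..y} \<gamma> (\<lambda>t. if t \<le> x then F t else g)"
          using F g x y False
          by (intro continuation_on_glue) (auto intro: continuous_on_subset[OF cont])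
        moreover have "A (\<gamma> s) (if s \<le> x then F s else g)" if "s \<in> {0..y}" for s
          using that F(3) g(2) in_ball[of s] by auto
        ultimately show ?thesis unfolding R_def using F(2) x
          by (intro exI[of _ "\<lambda>t. if t \<le> x then F t else g"]) auto
      qed
    qed
    then show "\<exists>\<delta>>0. \<forall>x\<in>{0..1}. \<forall>y\<in>{0..1}. \<bar>x - t\<bar> < \<delta> \<longrightarrow> \<bar>y - t\<bar> < \<delta> \<longrightarrow> R x \<longrightarrow> R y"
      using d(1) by blast
  qed auto
  then obtain F where "continuation_on {0..1} \<gamma> F" "F 0 = f" "\<forall>t\<in>{0..1}. A (\<gamma> t) (F t)"
    unfolding R_def by (elim exE conjE)
  then show ?thesis by (intro that[of F]) auto
qed

lemma continues_to_cong:
  assumes "continues_to \<gamma> f g" "\<forall>\<^sub>F z in nhds (pathstart \<gamma>). f z = f' z"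
    "\<forall>\<^sub>F z in nhds (pathfinish \<gamma>). g z = g' z"
  shows "continues_to \<gamma> f' g'"
proof -
  obtain F where F: "continuation_along \<gamma> F" "\<forall>\<^sub>F z in nhds (pathstart \<gamma>). F 0 z = f z"
    "\<forall>\<^sub>F z in nhds (pathfinish \<gamma>). F 1 z = g z"
    using assms(1) unfolding continues_to_def by (elim exE conjE)
  have "\<forall>\<^sub>F z in nhds (pathstart \<gamma>). F 0 z = f' z" using F(2) assms(2) by eventually_elim auto
  moreover have "\<forall>\<^sub>F z in nhds (pathfinish \<gamma>). F 1 z = g' z" using F(3) assms(3) by eventually_elim auto
  ultimately show ?thesis using F unfolding continues_to_def by (intro exI[of _ F]) simp
qed

lemma continues_toI:
  assumes "path \<gamma>" "continuation_on {0..1} \<gamma> F"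
  shows "continues_to \<gamma> (F 0) (F 1)"
  unfolding continues_to_def continuation_along_iff[OF assms(1)]
  using assms(2) by (intro exI[of _ F]) simp

lemma continues_toE:
  assumes "continues_to \<gamma> f g" "path \<gamma>"
  obtains F where "continuation_on {0..1} \<gamma> F" "\<forall>\<^sub>F z in nhds (\<gamma> 0). F 0 z = f z"
    "\<forall>\<^sub>F z in nhds (\<gamma> 1). F 1 z = g z"
  using assms(1) unfolding continues_to_def continuation_along_iff[OF assms(2)] pathstart_def pathfinish_def
  by (elim exE conjE) (rule that)

lemma continues_to_lincomb:
  assumes "continues_to \<gamma> f f'" "continues_to \<gamma> g g'" "path \<gamma>"
  shows "continues_to \<gamma> (\<lambda>z. c * f z + d * g z) (\<lambda>z. c * f' z + d * g' z)"
proof -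
  obtain F where F: "continuation_on {0..1} \<gamma> F" "\<forall>\<^sub>F z in nhds (\<gamma> 0). F 0 z = f z"
    "\<forall>\<^sub>F z in nhds (\<gamma> 1). F 1 z = f' z" using assms(1,3) by (rule continues_toE)
  obtain G where G: "continuation_on {0..1} \<gamma> G" "\<forall>\<^sub>F z in nhds (\<gamma> 0). G 0 z = g z"
    "\<forall>\<^sub>F z in nhds (\<gamma> 1). G 1 z = g' z" using assms(2,3) by (rule continues_toE)
  have "continues_to \<gamma> (\<lambda>z. c * F 0 z + d * G 0 z) (\<lambda>z. c * F 1 z + d * G 1 z)"
    using continues_toI[OF assms(3) continuation_on_lincomb[OF F(1) G(1)]] .
  moreover have "\<forall>\<^sub>F z in nhds (\<gamma> 0). c * F 0 z + d * G 0 z = c * f z + d * g z"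
    using F(2) G(2) by eventually_elim auto
  moreover have "\<forall>\<^sub>F z in nhds (\<gamma> 1). c * F 1 z + d * G 1 z = c * f' z + d * g' z"
    using F(3) G(3) by eventually_elim auto
  ultimately show ?thesis
    by (rule continues_to_cong[unfolded pathstart_def pathfinish_def])
qed

lemma continues_to_trivial:
  assumes "f analytic_on {z}" shows "continues_to (linepath z z) f f"
  by (rule continues_toI[OF path_linepath])
     (use assms in \<open>auto intro!: continuation_on_const simp: linepath_refl\<close>)

lemma continues_to_reversepath:
  assumes "continues_to \<gamma> f g" "path \<gamma>"
  shows "continues_to (reversepath \<gamma>) g f"
proof -
  obtain F where F: "continuation_on {0..1} \<gamma> F" "\<forall>\<^sub>F z in nhds (\<gamma> 0). F 0 z = f z"
    "\<forall>\<^sub>F z in nhds (\<gamma> 1). F 1 z = g z" using assms(1,2) by (rule continues_toE)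
  have "continuation_on {0..1} (reversepath \<gamma>) (\<lambda>t. F (1 - t))"
    by (rule continuation_on_reparam[OF F(1)]) (auto simp: reversepath_def intro!: continuous_intros)
  then have "continues_to (reversepath \<gamma>) (F 1) (F 0)"
    using continues_toI[of "reversepath \<gamma>" "\<lambda>t. F (1 - t)"] assms(2) by (simp add: path_reversepath)
  then show ?thesis
    by (rule continues_to_cong) (use F in \<open>simp_all add: pathstart_def pathfinish_def reversepath_def\<close>)
qed

lemma continues_to_joinpaths:
  assumes "continues_to \<gamma> f g" "continues_to \<gamma>' g h" "path \<gamma>" "path \<gamma>'" "pathfinish \<gamma> = pathstart \<gamma>'"
  shows "continues_to (\<gamma> +++ \<gamma>') f h"
proof -
  obtain F where F: "continuation_on {0..1} \<gamma> F" "\<forall>\<^sub>F z in nhds (\<gamma> 0). F 0 z = f z"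
    "\<forall>\<^sub>F z in nhds (\<gamma> 1). F 1 z = g z" using assms(1,3) by (rule continues_toE)
  obtain G where G: "continuation_on {0..1} \<gamma>' G" "\<forall>\<^sub>F z in nhds (\<gamma>' 0). G 0 z = g z"
    "\<forall>\<^sub>F z in nhds (\<gamma>' 1). G 1 z = h z" using assms(2,4) by (rule continues_toE)
  have link: "\<gamma> 1 = \<gamma>' 0" using assms(5) by (simp add: pathfinish_def pathstart_def)
  let ?p = "\<gamma> +++ \<gamma>'"
  have p: "path ?p" using assms by simp
  have "continuation_on {0..1/2} ?p (\<lambda>t. F (2 * t))"
    by (rule continuation_on_reparam[OF F(1)]) (auto simp: joinpaths_def intro!: continuous_intros)
  moreover have "continuation_on {1/2..1} ?p (\<lambda>t. G (2 * t - 1))"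
    proof (rule continuation_on_reparam[OF G(1)])
    fix t :: real assume t: "t \<in> {1/2..1}"
    show "?p t = \<gamma>' (2 * t - 1)"
    proof (cases "t = 1/2")
      case True
      show ?thesis unfolding True by (simp add: joinpaths_def link)
    qed (use t in \<open>auto simp: joinpaths_def\<close>)
  qed (auto intro!: continuous_intros)
  moreover have "\<forall>\<^sub>F z in nhds (?p (1/2)). F (2 * (1/2)) z = G (2 * (1/2) - 1) z"
  proof -
    have "\<forall>\<^sub>F z in nhds (\<gamma> 1). F 1 z = G 0 z"
      using F(3) G(2) unfolding link by eventually_elim auto
    then show ?thesis by (simp add: joinpaths_def)
  qed
  ultimately have "continuation_on {0..1} ?p (\<lambda>t. if t \<le> 1/2 then F (2 * t) else G (2 * t - 1))"
    using p by (intro continuation_on_glue) (auto simp: path_def)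
  then have "continues_to ?p (F 0) (G 1)"
    using continues_toI[OF p] by fastforce
  then show ?thesis
    by (rule continues_to_cong) (use F G in \<open>simp_all add: pathstart_def pathfinish_def joinpaths_def\<close>)
qed

section \<open>Linear differential equations of second order\<close>

text \<open>
  The recursion which \<open>\<psi>'' = Q \<psi>\<close> imposes on the Taylor coefficients of \<open>\<psi>\<close>, if \<open>q\<close> are those of \<open>Q\<close>.
\<close>

fun ode_coeff :: "(nat \<Rightarrow> complex) \<Rightarrow> complex \<Rightarrow> complex \<Rightarrow> nat \<Rightarrow> complex" where
  "ode_coeff q c0 c1 0 = c0"
| "ode_coeff q c0 c1 (Suc 0) = c1"
| "ode_coeff q c0 c1 (Suc (Suc n)) =
     (\<Sum>k\<le>n. q k * ode_coeff q c0 c1 (n - k)) / (of_nat (n + 2) * of_nat (n + 1))"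

text \<open>
  The bound passes through the recursion: of the \<open>j + 1\<close> terms of the sum each contributes at most
  \<open>K C\<close>, and the division by \<open>(j + 2)(j + 1)\<close> leaves \<open>K r\<^sup>2 C\<close> at most.
\<close>

lemma ode_coeff_bound:
  assumes q: "\<And>k. norm (q k) * r ^ k \<le> K" and r: "0 \<le> r" "K * r\<^sup>2 \<le> 1" "0 \<le> K"
    and C: "norm c0 \<le> C" "norm c1 * r \<le> C"
  shows "norm (ode_coeff q c0 c1 n) * r ^ n \<le> C"
proof (induction n rule: less_induct)
  case (less n)
  have C0: "0 \<le> C" using C(1) norm_ge_zero order_trans by blast
  show ?case
  proof (cases n)
    case 0
    then show ?thesis using C by simp
  next
    case (Suc m)
    show ?thesis
    proof (cases m)
      case 0
      then show ?thesis using C Suc by simp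
    next
      case (Suc j)
      define S where "S = (\<Sum>k\<le>j. q k * ode_coeff q c0 c1 (j - k))"
      have "norm S * r ^ j \<le> (\<Sum>k\<le>j. norm (q k * ode_coeff q c0 c1 (j - k))) * r ^ j"
        unfolding S_def by (intro mult_right_mono norm_sum) (use r in auto)
      also have "\<dots> = (\<Sum>k\<le>j. (norm (q k) * r ^ k) * (norm (ode_coeff q c0 c1 (j - k)) * r ^ (j - k)))"
        unfolding sum_distrib_right
      proof (rule sum.cong[OF refl])
        fix k assume "k \<in> {..j}"
        then have "r ^ j = r ^ k * r ^ (j - k)" by (simp flip: power_add)
        then show "norm (q k * ode_coeff q c0 c1 (j - k)) * r ^ j =
            (norm (q k) * r ^ k) * (norm (ode_coeff q c0 c1 (j - k)) * r ^ (j - k))"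
          by (simp add: norm_mult)
      qed
      also have "\<dots> \<le> (\<Sum>k\<le>j. K * C)"
        by (intro sum_mono mult_mono q less) (use \<open>n = Suc m\<close> Suc r in auto)
      also have "\<dots> = real (j + 1) * (K * C)" by simp
      finally have S: "norm S * r ^ j \<le> real (j + 1) * (K * C)" .
      have "norm (ode_coeff q c0 c1 n) * r ^ n = (norm S * r ^ j) * r\<^sup>2 / (real (j + 2) * real (j + 1))"
        using \<open>n = Suc m\<close> Suc by (simp add: S_def norm_divide norm_mult power2_eq_square del: of_nat_Suc)
      also have "\<dots> \<le> (real (j + 1) * (K * C)) * r\<^sup>2 / (real (j + 2) * real (j + 1))"
        by (intro divide_right_mono mult_right_mono S) auto
      also have "\<dots> = (K * r\<^sup>2) * C / real (j + 2)"
      proof -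
        have "J * (K * C) * r\<^sup>2 / (Z * J) = (K * r\<^sup>2) * C / Z" if "J \<noteq> 0" for J Z :: real
          using that by (simp add: field_simps)
        then show ?thesis by (metis of_nat_eq_0_iff add_is_0 one_neq_zero)
      qed
      also have "\<dots> \<le> 1 * C / real (j + 2)"
        by (intro divide_right_mono mult_right_mono r C0) auto
      also have "\<dots> \<le> C" using C0 by (simp add: field_simps)
      finally show ?thesis .
    qed
  qed
qed

lemma conv_radius_ge_of_bounded:
  fixes c :: "nat \<Rightarrow> complex"
  assumes "\<And>n. norm (c n) * r ^ n \<le> C" "0 < r"
  shows "conv_radius c \<ge> ereal r"
proof (rule conv_radius_geI_ex')
  fix s :: real assume s: "0 < s" "ereal s < ereal r"
  show "summable (\<lambda>n. c n * of_real s ^ n)"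
  proof (rule summable_comparison_test')
    show "summable (\<lambda>n. C * (s / r) ^ n)"
      using s by (intro summable_mult summable_geometric) auto
    fix n assume "n \<ge> (0::nat)"
    have "norm (c n * of_real s ^ n) = (norm (c n) * r ^ n) * (s / r) ^ n"
      using s assms(2) by (simp add: norm_mult norm_power power_divide)
    also have "\<dots> \<le> C * (s / r) ^ n" by (intro mult_right_mono assms) (use s assms in auto)
    finally show "norm (c n * of_real s ^ n) \<le> C * (s / r) ^ n" .
  qed
qed

text \<open>
  The power series is forced by the equation, and the recursion preserves a geometric bound on
  the coefficients, so it converges in a disc which does not depend on the initial values.
\<close>

lemma linear_ode_centre:
  assumes Q: "Q holomorphic_on ball z0 R" "0 < R"
  obtains r where "0 < r" "r \<le> R"
    "\<And>c0 c1. \<exists>f. solves Q (ball z0 r) f \<and> f z0 = c0 \<and> deriv f z0 = c1"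
proof -
  define q where "q = fps_nth (fps_expansion Q z0)"
  have radq: "fps_conv_radius (fps_expansion Q z0) \<ge> ereal R"
    by (rule conv_radius_fps_expansion) (use Q in auto)
  have "summable (\<lambda>n. norm (q n * of_real (R/2) ^ n))"
    unfolding q_def by (rule norm_summable_fps)
      (use Q(2) in \<open>auto intro!: less_le_trans[OF _ radq]\<close>)
  then have "Bseq (\<lambda>n. q n * of_real (R/2) ^ n)"
    using summable_LIMSEQ_zero summable_norm_cancel by (metis convergentI convergent_imp_Bseq)
  then obtain K where K: "0 < K" "\<And>n. norm (q n * of_real (R/2) ^ n) \<le> K" by (auto simp: Bseq_def)
  define r where "r = min (R / 2) (1 / sqrt K)"
  have r: "0 < r" "r \<le> R / 2" "r \<le> 1 / sqrt K" using Q(2) K(1) by (auto simp: r_def)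
  have "K * r\<^sup>2 \<le> K * (1 / sqrt K)\<^sup>2"
    using K(1) r by (intro mult_left_mono power_mono) auto
  also have "\<dots> = 1" using K(1) by (simp add: power_divide)
  finally have Kr: "K * r\<^sup>2 \<le> 1" .
  have qr: "norm (q k) * r ^ k \<le> K" for k
  proof -
    have "norm (q k) * r ^ k \<le> norm (q k) * (R / 2) ^ k"
      using r by (intro mult_left_mono power_mono) auto
    also have "\<dots> = norm (q k * of_real (R/2) ^ k)" using Q(2) by (simp add: norm_mult norm_power norm_divide)
    also have "\<dots> \<le> K" by (rule K)
    finally show ?thesis .
  qed
  have "\<exists>f. solves Q (ball z0 r) f \<and> f z0 = c0 \<and> deriv f z0 = c1" for c0 c1
  proof -
    define F where "F = Abs_fps (ode_coeff q c0 c1)"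
    have rF: "fps_conv_radius F \<ge> ereal r" unfolding fps_conv_radius_def F_def
    proof (rule conv_radius_ge_of_bounded)
      show "norm (fps_nth (Abs_fps (ode_coeff q c0 c1)) n) * r ^ n \<le> max (norm c0) (norm c1 * r)" for n
        using ode_coeff_bound[OF qr _ Kr, of c0 "max (norm c0) (norm c1 * r)" c1 n] K r by auto
    qed (use r in auto)
    have rF': "fps_conv_radius (fps_deriv F) \<ge> ereal r"
      using rF fps_conv_radius_deriv order_trans by blast
    have rF'': "fps_conv_radius (fps_deriv (fps_deriv F)) \<ge> ereal r"
      using rF' fps_conv_radius_deriv order_trans by blast
    have eq: "fps_deriv (fps_deriv F) = fps_expansion Q z0 * F"
    proof (rule fps_ext)
      fix n
      have "fps_nth (fps_deriv (fps_deriv F)) n = of_nat (n + 1) * (of_nat (n + 2) * ode_coeff q c0 c1 (n + 2))"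
        by (simp add: F_def)
      also have "\<dots> = (\<Sum>k\<le>n. q k * ode_coeff q c0 c1 (n - k))"
        by (simp add: add_2_eq_Suc' del: of_nat_Suc)
      finally show "fps_nth (fps_deriv (fps_deriv F)) n = fps_nth (fps_expansion Q z0 * F) n"
        by (simp add: fps_mult_nth F_def q_def atLeast0AtMost)
    qed
    define f where "f z = eval_fps F (z - z0)" for z
    have small: "ereal (norm (z - z0)) < ereal r" if "z \<in> ball z0 r" for z
      using that by (simp add: dist_norm norm_minus_commute)
    have f_fun: "f = (\<lambda>z. eval_fps F (z - z0))" by (simp add: f_def fun_eq_iff)
    have sh: "((\<lambda>z. z - z0) has_field_derivative 1) (at z)" for z
      by (auto intro!: derivative_eq_intros)
    have d1: "(f has_field_derivative eval_fps (fps_deriv F) (z - z0)) (at z)" if "z \<in> ball z0 r" for z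
    proof -
      have "(eval_fps F has_field_derivative eval_fps (fps_deriv F) (z - z0)) (at (z - z0))"
        by (rule has_field_derivative_eval_fps) (rule less_le_trans[OF small[OF that] rF])
      from DERIV_chain2[OF this sh] show ?thesis by (simp add: f_fun)
    qed
    have d2: "((\<lambda>z. eval_fps (fps_deriv F) (z - z0)) has_field_derivative
        eval_fps (fps_deriv (fps_deriv F)) (z - z0)) (at z)" if "z \<in> ball z0 r" for z
    proof -
      have "(eval_fps (fps_deriv F) has_field_derivative eval_fps (fps_deriv (fps_deriv F)) (z - z0)) (at (z - z0))"
        by (rule has_field_derivative_eval_fps) (rule less_le_trans[OF small[OF that] rF'])
      from DERIV_chain2[OF this sh] show ?thesis by simp
    qed
    have df: "deriv f z = eval_fps (fps_deriv F) (z - z0)" if "z \<in> ball z0 r" for z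
      using d1[OF that] by (rule DERIV_imp_deriv)
    have "deriv (deriv f) z = Q z * f z" if z: "z \<in> ball z0 r" for z
    proof -
      have "deriv (deriv f) z = deriv (\<lambda>z. eval_fps (fps_deriv F) (z - z0)) z"
      proof (rule deriv_cong_ev)
        show "\<forall>\<^sub>F x in nhds z. deriv f x = eval_fps (fps_deriv F) (x - z0)"
          using eventually_nhds_in_open[OF open_ball z] by eventually_elim (rule df)
      qed simp
      also have "\<dots> = eval_fps (fps_expansion Q z0 * F) (z - z0)"
        using d2[OF z] unfolding eq by (rule DERIV_imp_deriv)
      also have "\<dots> = eval_fps (fps_expansion Q z0) (z - z0) * eval_fps F (z - z0)"
        using z r by (intro eval_fps_mult less_le_trans[OF small[OF z]] rF order_trans[OF _ radq]) auto
      also have "eval_fps (fps_expansion Q z0) (z - z0) = Q z"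
        by (rule eval_fps_expansion[of _ _ "ereal R"]) (use Q z r in auto)
      finally show ?thesis by (simp add: f_fun)
    qed
    moreover have "f holomorphic_on ball z0 r"
      unfolding holomorphic_on_open[OF open_ball] using d1 by blast
    moreover have "f z0 = c0" "deriv f z0 = c1"
      using df[of z0] r by (simp_all add: f_def eval_fps_at_0 F_def)
    ultimately show ?thesis unfolding solves_def by blast
  qed
  then show ?thesis using r Q(2) by (intro that[of r]) auto
qed

lemma holomorphic_deriv_at:
  assumes "f holomorphic_on S" "open S" "z \<in> S"
  shows "(f has_field_derivative deriv f z) (at z)"
  using assms holomorphic_derivI by blast

text \<open>
  By the equation and Leibniz's rule every derivative of \<open>f\<close> at \<open>z0\<close> is a combination of lower ones.
\<close>

lemma linear_ode_unique:
  assumes f: "f holomorphic_on U" "\<And>z. z \<in> U \<Longrightarrow> deriv (deriv f) z = K z * f z"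
    and K: "K holomorphic_on U" and U: "open U" "connected U" "z0 \<in> U" "z \<in> U"
    and init: "f z0 = 0" "deriv f z0 = 0"
  shows "f z = 0"
proof (rule holomorphic_fun_eq_0_on_connected[OF f(1) U(1,2) _ U(3,4)])
  fix n show "(deriv ^^ n) f z0 = 0"
  proof (induction n rule: less_induct)
    case (less n)
    consider "n = 0" | "n = 1" | m where "n = Suc (Suc m)"
      by (metis One_nat_def old.nat.exhaust)
    then show ?case
    proof cases
      case 3
      have "(deriv ^^ n) f z0 = (deriv ^^ m) (deriv (deriv f)) z0"
        unfolding 3 by (simp add: funpow_Suc_right del: funpow.simps)
      also have "\<dots> = (deriv ^^ m) (\<lambda>z. K z * f z) z0"
        by (rule higher_deriv_cong_ev)
          (use eventually_nhds_in_open[OF U(1,3)] f(2) in \<open>auto elim: eventually_mono\<close>)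
      also have "\<dots> = (\<Sum>i = 0..m. of_nat (m choose i) * (deriv ^^ i) K z0 * (deriv ^^ (m - i)) f z0)"
        by (rule higher_deriv_mult[OF K f(1) U(1,3)])
      also have "\<dots> = 0" by (rule sum.neutral) (use less 3 in auto)
      finally show ?thesis .
    qed (use init in auto)
  qed
qed

lemma solves_lincomb:
  assumes "solves Q U f" "solves Q U g" "open U"
  shows "solves Q U (\<lambda>z. c * f z + d * g z)"
proof -
  have f: "f holomorphic_on U" and g: "g holomorphic_on U" using assms by (auto simp: solves_def)
  have D: "deriv (\<lambda>z. c * f z + d * g z) z = c * deriv f z + d * deriv g z" if "z \<in> U" for z
    by (rule DERIV_imp_deriv)
      (auto intro!: derivative_eq_intros holomorphic_deriv_at[OF f assms(3) that] holomorphic_deriv_at[OF g assms(3) that])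
  have "deriv (deriv (\<lambda>z. c * f z + d * g z)) z = Q z * (c * f z + d * g z)" if z: "z \<in> U" for z
  proof -
    have "deriv (deriv (\<lambda>z. c * f z + d * g z)) z = deriv (\<lambda>z. c * deriv f z + d * deriv g z) z"
      by (rule deriv_cong_ev) (use eventually_nhds_in_open[OF assms(3) z] D in \<open>auto elim: eventually_mono\<close>)
    also have "\<dots> = c * deriv (deriv f) z + d * deriv (deriv g) z"
      by (rule DERIV_imp_deriv)
        (auto intro!: derivative_eq_intros holomorphic_deriv_at[OF holomorphic_deriv[OF f assms(3)] assms(3) z]
          holomorphic_deriv_at[OF holomorphic_deriv[OF g assms(3)] assms(3) z])
    finally show ?thesis using assms z by (simp add: solves_def algebra_simps)
  qed
  then show ?thesis unfolding solves_def using f g by (auto intro!: holomorphic_intros)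
qed

lemma solves_subset: "solves Q U f \<Longrightarrow> V \<subseteq> U \<Longrightarrow> solves Q V f"
  by (auto simp: solves_def elim: holomorphic_on_subset)

lemma solves_unique:
  assumes "solves Q U f" "solves Q U g" "Q holomorphic_on U" "open U" "connected U" "z0 \<in> U" "z \<in> U"
    "f z0 = g z0" "deriv f z0 = deriv g z0"
  shows "f z = g z"
proof -
  have s: "solves Q U (\<lambda>z. 1 * f z + (-1) * g z)" using assms by (intro solves_lincomb)
  have f: "f holomorphic_on U" and g: "g holomorphic_on U" using assms by (auto simp: solves_def)
  have "deriv (\<lambda>z. 1 * f z + (-1) * g z) z0 = 0"
    by (rule DERIV_imp_deriv)
      (auto intro!: derivative_eq_intros holomorphic_deriv_at[OF f assms(4,6)] holomorphic_deriv_at[OF g assms(4,6)] simp: assms)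
  moreover have "1 * f z0 + (-1) * g z0 = 0" using assms(8) by simp
  ultimately have "1 * f z + (-1) * g z = 0"
    by (intro linear_ode_unique[of "\<lambda>z. 1 * f z + (-1) * g z" U Q z0 z, OF _ _ assms(3-7)])
       (use s in \<open>unfold solves_def, blast+\<close>)
  then show ?thesis by simp
qed

lemma wronskian_constant:
  assumes "solves Q U f" "solves Q U g" "open U" "connected U" "z \<in> U" "w \<in> U"
  shows "f z * deriv g z - g z * deriv f z = f w * deriv g w - g w * deriv f w"
proof -
  have f: "f holomorphic_on U" and g: "g holomorphic_on U" using assms by (auto simp: solves_def)
  have "((\<lambda>z. f z * deriv g z - g z * deriv f z) has_field_derivative 0) (at x)" if x: "x \<in> U" for x
    using assms x
    by (auto intro!: derivative_eq_intros holomorphic_deriv_at[OF f assms(3) x] holomorphic_deriv_at[OF g assms(3) x]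
        holomorphic_deriv_at[OF holomorphic_deriv[OF f assms(3)] assms(3) x]
        holomorphic_deriv_at[OF holomorphic_deriv[OF g assms(3)] assms(3) x] simp: solves_def)
  then have "(\<lambda>z. f z * deriv g z - g z * deriv f z) constant_on U"
    by (rule has_field_derivative_0_imp_constant_on) (use assms in auto)
  then obtain c where "\<And>x. x \<in> U \<Longrightarrow> f x * deriv g x - g x * deriv f x = c"
    unfolding constant_on_def by blast
  then show ?thesis using assms by simp
qed

text \<open>
  The initial values may be prescribed at any point of the disc: the solutions with initial values
  \<open>(1, 0)\<close> and \<open>(0, 1)\<close> at the centre have Wronskian 1 everywhere, and Cramer's rule applies.  The
  fixed size of the disc is what makes continuation along paths possible.
\<close>

lemma linear_ode_local:
  assumes Q: "Q holomorphic_on ball z0 R" "0 < R"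
  obtains r where "0 < r" "r \<le> R"
    "\<And>z1 c0 c1. z1 \<in> ball z0 r \<Longrightarrow> \<exists>f. solves Q (ball z0 r) f \<and> f z1 = c0 \<and> deriv f z1 = c1"
proof -
  obtain r where r: "0 < r" "r \<le> R"
    "\<And>c0 c1. \<exists>f. solves Q (ball z0 r) f \<and> f z0 = c0 \<and> deriv f z0 = c1"
    by (rule linear_ode_centre[OF Q]) (rule that)
  obtain f where f: "solves Q (ball z0 r) f" "f z0 = 1" "deriv f z0 = 0" using r(3) by blast
  obtain g where g: "solves Q (ball z0 r) g" "g z0 = 0" "deriv g z0 = 1" using r(3) by blast
  have "\<exists>h. solves Q (ball z0 r) h \<and> h z1 = c0 \<and> deriv h z1 = c1" if z1: "z1 \<in> ball z0 r" for z1 c0 c1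
  proof -
    have W: "f z1 * deriv g z1 - g z1 * deriv f z1 = 1"
      using wronskian_constant[OF f(1) g(1), of z1 z0] z1 r f g by simp
    define h where "h z = (c0 * deriv g z1 - c1 * g z1) * f z + (c1 * f z1 - c0 * deriv f z1) * g z" for z
    have hf: "f holomorphic_on ball z0 r" and hg: "g holomorphic_on ball z0 r" using f g by (auto simp: solves_def)
    have "solves Q (ball z0 r) h" unfolding h_def using f g by (intro solves_lincomb) auto
    moreover have "h z1 = c0 * (f z1 * deriv g z1 - g z1 * deriv f z1)" by (simp add: h_def algebra_simps)
    moreover have "deriv h z1 = (c0 * deriv g z1 - c1 * g z1) * deriv f z1 + (c1 * f z1 - c0 * deriv f z1) * deriv g z1"
      unfolding h_def by (rule DERIV_imp_deriv)
        (auto intro!: derivative_eq_intros holomorphic_deriv_at[OF hf open_ball z1] holomorphic_deriv_at[OF hg open_ball z1])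
    moreover have "\<dots> = c1 * (f z1 * deriv g z1 - g z1 * deriv f z1)" by (simp add: algebra_simps)
    ultimately show ?thesis using W by auto
  qed
  then show ?thesis using r by (intro that[of r]) auto
qed

lemma deriv_eq_germ:
  assumes "\<forall>\<^sub>F w in nhds z. f w = g w" shows "deriv f z = deriv g z"
  by (rule deriv_cong_ev[OF assms refl])

lemma solution_continuation:
  assumes \<gamma>: "path \<gamma>" "path_image \<gamma> \<subseteq> D" and D: "open D" "Q holomorphic_on D"
    and f: "solves Q (ball (\<gamma> 0) \<epsilon>) f" "0 < \<epsilon>"
  obtains F where "continuation_on {0..1} \<gamma> F" "F 0 = f"
    "\<And>t. t \<in> {0..1} \<Longrightarrow> \<exists>\<epsilon>>0. solves Q (ball (\<gamma> t) \<epsilon>) (F t)"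
proof -
  define A where "A z f \<longleftrightarrow> (\<exists>\<epsilon>>0. solves Q (ball z \<epsilon>) f)" for z f
  have ext: "\<exists>r>0. \<forall>z'\<in>ball z r. \<forall>f. A z' f \<longrightarrow>
      (\<exists>g. g holomorphic_on ball z r \<and> (\<forall>w\<in>ball z r. A w g) \<and> (\<forall>\<^sub>F w in nhds z'. f w = g w))"
    if z: "z \<in> D" for z
  proof -
    obtain R where R: "R > 0" "ball z R \<subseteq> D" using D(1) z openE by blast
    then have QR: "Q holomorphic_on ball z R" using D(2) holomorphic_on_subset by blast
    obtain r where r: "0 < r" "r \<le> R"
      "\<And>z1 c0 c1. z1 \<in> ball z r \<Longrightarrow> \<exists>f. solves Q (ball z r) f \<and> f z1 = c0 \<and> deriv f z1 = c1"
      by (rule linear_ode_local[OF QR R(1)]) (rule that)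
    have "\<exists>g. g holomorphic_on ball z r \<and> (\<forall>w\<in>ball z r. A w g) \<and> (\<forall>\<^sub>F w in nhds z'. f w = g w)"
      if z': "z' \<in> ball z r" and f: "A z' f" for z' f
    proof -
      obtain g where g: "solves Q (ball z r) g" "g z' = f z'" "deriv g z' = deriv f z'" using r(3)[OF z'] by blast
      have "A w g" if "w \<in> ball z r" for w
        using that g(1) unfolding A_def by (meson openE open_ball solves_subset)
      moreover
      obtain e where e: "e > 0" "solves Q (ball z' e) f" using f unfolding A_def by blast
      obtain e' where e': "e' > 0" "ball z' e' \<subseteq> ball z r" using z' openE open_ball by metis
      define d where "d = min e e'"
      have sub: "ball z' d \<subseteq> ball z' e" "ball z' d \<subseteq> ball z r"
        using e' by (auto simp: d_def)
      have "f w = g w" if "w \<in> ball z' d" for w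
      proof (rule solves_unique[of Q "ball z' d" f g z'])
        show "solves Q (ball z' d) f" "solves Q (ball z' d) g"
          using e(2) g(1) sub solves_subset by blast+
        show "Q holomorphic_on ball z' d"
          by (rule holomorphic_on_subset[OF QR]) (use sub(2) r(2) in \<open>auto dest: subsetD\<close>)
      qed (use that g e e' in \<open>auto simp: d_def\<close>)
      then have "\<forall>\<^sub>F w in nhds z'. f w = g w"
        using e e' by (intro eventually_nhds_in_open[THEN eventually_mono, of "ball z' d"]) (auto simp: d_def)
      ultimately show ?thesis using g(1) unfolding solves_def by blast
    qed
    then show ?thesis using r(1) by blast
  qed
  have "A (\<gamma> 0) f" using f unfolding A_def by blast
  moreover have "f analytic_on {\<gamma> 0}" using f unfolding solves_def analytic_at_ball by blast
  ultimately obtain F where F: "continuation_on {0..1} \<gamma> F" "F 0 = f" "\<And>t. t \<in> {0..1} \<Longrightarrow> A (\<gamma> t) (F t)"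
    using germ_continuation[OF \<gamma>, of A f, OF ext] by (metis (no_types, lifting))
  show ?thesis by (rule that[of F]) (use F in \<open>auto simp: A_def\<close>)
qed

section \<open>Change of the independent variable\<close>

text \<open>
  The transformation law \<open>Qt = (Qz \<circ> g) g'\<^sup>2 - {g, t} / 2\<close> at a point, with the Schwarzian derivative
  \<open>{g, t} = g''' / g' - 3/2 (g'' / g')\<^sup>2\<close>, cleared of denominators.  In this form the law does not
  involve a branch of \<open>\<surd>g'\<close> and can be composed, cancelled and passed to the limit point by point.  For
  \<open>Qt = 0\<close> it says that \<open>t\<close>, as a function of \<open>z = g(t)\<close>, is a ratio of solutions of the equation of \<open>Qz\<close>.
\<close>

definition pulls_back ::
  "(complex \<Rightarrow> complex) \<Rightarrow> (complex \<Rightarrow> complex) \<Rightarrow> (complex \<Rightarrow> complex) \<Rightarrow> complex \<Rightarrow> bool" where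
  "pulls_back Qt g Qz t \<longleftrightarrow> deriv g t \<noteq> 0 \<and>
     2 * Qz (g t) * deriv g t ^ 4
       - (deriv (deriv (deriv g)) t * deriv g t - 3 / 2 * (deriv (deriv g) t)\<^sup>2)
     = 2 * Qt t * (deriv g t)\<^sup>2"

lemma deriv_cong_open:
  assumes "open U" "t \<in> U" "\<And>x. x \<in> U \<Longrightarrow> f x = g x"
  shows "deriv f t = deriv g t"
  by (rule deriv_cong_ev) (use eventually_nhds_in_open[OF assms(1,2)] assms(3) in \<open>auto elim: eventually_mono\<close>)

lemma deriv_compose_three:
  assumes f: "f holomorphic_on U" "open U" and g: "g holomorphic_on V" "open V"
    and sub: "f ` U \<subseteq> V" and t: "t \<in> U"
  shows "deriv (\<lambda>x. g (f x)) t = deriv g (f t) * deriv f t"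
    and "deriv (deriv (\<lambda>x. g (f x))) t =
           deriv (deriv g) (f t) * (deriv f t)\<^sup>2 + deriv g (f t) * deriv (deriv f) t"
    and "deriv (deriv (deriv (\<lambda>x. g (f x)))) t =
           deriv (deriv (deriv g)) (f t) * deriv f t ^ 3
           + 3 * deriv (deriv g) (f t) * deriv f t * deriv (deriv f) t
           + deriv g (f t) * deriv (deriv (deriv f)) t"
proof -
  have f1: "deriv f holomorphic_on U" using f by (rule holomorphic_deriv)
  have f2: "deriv (deriv f) holomorphic_on U" using f1 f(2) by (rule holomorphic_deriv)
  have g1: "deriv g holomorphic_on V" using g by (rule holomorphic_deriv)
  have g2: "deriv (deriv g) holomorphic_on V" using g1 g(2) by (rule holomorphic_deriv)
  have V: "f x \<in> V" if "x \<in> U" for x using sub that by auto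
  note df = holomorphic_deriv_at[OF f(1,2)] holomorphic_deriv_at[OF f1 f(2)] holomorphic_deriv_at[OF f2 f(2)]
  have ch: "((\<lambda>x. h (f x)) has_field_derivative deriv h (f x) * deriv f x) (at x)"
    if "x \<in> U" "h holomorphic_on V" for h x
    using DERIV_chain2[OF holomorphic_deriv_at[OF that(2) g(2) V[OF that(1)]] df(1)[OF that(1)]] .
  have 1: "deriv (\<lambda>x. g (f x)) x = deriv g (f x) * deriv f x" if "x \<in> U" for x
    by (rule DERIV_imp_deriv) (rule ch[OF that g(1)])
  show "deriv (\<lambda>x. g (f x)) t = deriv g (f t) * deriv f t" by (rule 1[OF t])
  have 2: "deriv (deriv (\<lambda>x. g (f x))) x =
      deriv (deriv g) (f x) * (deriv f x)\<^sup>2 + deriv g (f x) * deriv (deriv f) x" if x: "x \<in> U" for x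
  proof -
    have "deriv (deriv (\<lambda>x. g (f x))) x = deriv (\<lambda>x. deriv g (f x) * deriv f x) x"
      by (rule deriv_cong_open[OF f(2) x 1])
    also have "\<dots> = deriv (deriv g) (f x) * deriv f x * deriv f x + deriv (deriv f) x * deriv g (f x)"
      by (rule DERIV_imp_deriv) (rule DERIV_mult[OF ch[OF x g1] df(2)[OF x]])
    finally show ?thesis by (simp add: power2_eq_square)
  qed
  show "deriv (deriv (\<lambda>x. g (f x))) t =
      deriv (deriv g) (f t) * (deriv f t)\<^sup>2 + deriv g (f t) * deriv (deriv f) t" by (rule 2[OF t])
  have "deriv (deriv (deriv (\<lambda>x. g (f x)))) t =
      deriv (\<lambda>x. deriv (deriv g) (f x) * (deriv f x)\<^sup>2 + deriv g (f x) * deriv (deriv f) x) t"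
    by (rule deriv_cong_open[OF f(2) t 2])
  also have "\<dots> = (deriv (deriv (deriv g)) (f t) * deriv f t) * (deriv f t)\<^sup>2
      + deriv (deriv g) (f t) * (2 * deriv f t * deriv (deriv f) t)
      + ((deriv (deriv g) (f t) * deriv f t) * deriv (deriv f) t + deriv g (f t) * deriv (deriv (deriv f)) t)"
    by (rule DERIV_imp_deriv)
      (auto intro!: derivative_eq_intros ch[OF t g2] ch[OF t g1] df[OF t] simp: power2_eq_square algebra_simps)
  finally show "deriv (deriv (deriv (\<lambda>x. g (f x)))) t =
      deriv (deriv (deriv g)) (f t) * deriv f t ^ 3
      + 3 * deriv (deriv g) (f t) * deriv f t * deriv (deriv f) t
      + deriv g (f t) * deriv (deriv (deriv f)) t"
    by (simp add: power2_eq_square power3_eq_cube algebra_simps)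
qed

lemma analytic_compose_nbhd:
  assumes "f analytic_on {t}" "g analytic_on {f t}"
  obtains U V where "open U" "t \<in> U" "f holomorphic_on U" "open V" "g holomorphic_on V" "f ` U \<subseteq> V"
proof -
  obtain V where V: "open V" "f t \<in> V" "g holomorphic_on V" using assms(2) by (auto simp: analytic_at)
  obtain U where U: "open U" "t \<in> U" "f holomorphic_on U" using assms(1) by (auto simp: analytic_at)
  have "open (U \<inter> f -` V)"
    using continuous_open_preimage[OF holomorphic_on_imp_continuous_on[OF U(3)] U(1) V(1)] by simp
  then show ?thesis
    by (intro that[of "U \<inter> f -` V" V]) (use U V in \<open>auto elim: holomorphic_on_subset\<close>)
qed

text \<open>
  The cocycle property of the Schwarzian derivative.  The law for an inner function is not only
  sufficient but also necessary for the law of the composite; the converse lets the law be lifted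
  from \<open>\<wp> \<circ> v\<close> to \<open>v\<close>.
\<close>

lemma pulls_back_compose_iff:
  assumes an: "f analytic_on {t}" "g analytic_on {f t}" and g: "pulls_back Q1 g Q2 (f t)"
  shows "pulls_back Q0 (\<lambda>x. g (f x)) Q2 t \<longleftrightarrow> pulls_back Q0 f Q1 t"
proof -
  obtain U V where UV: "open U" "t \<in> U" "f holomorphic_on U" "open V" "g holomorphic_on V" "f ` U \<subseteq> V"
    by (rule analytic_compose_nbhd[OF an])
  note d = deriv_compose_three[OF UV(3,1,5,4,6,2)]
  have key: "2 * Q2 (g (f t)) * (g1 * f1) ^ 4 - ((g3 * f1 ^ 3 + 3 * g2 * f1 * f2 + g1 * f3) * (g1 * f1)
        - 3 / 2 * (g2 * f1\<^sup>2 + g1 * f2)\<^sup>2)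
      = f1 ^ 4 * (2 * Q2 (g (f t)) * g1 ^ 4 - (g3 * g1 - 3 / 2 * g2\<^sup>2)) - g1\<^sup>2 * (f3 * f1 - 3 / 2 * f2\<^sup>2)"
    for f1 f2 f3 g1 g2 g3 :: complex
    by (simp add: power2_eq_square power3_eq_cube power4_eq_xxxx field_simps)
  let ?g1 = "deriv g (f t)" and ?f1 = "deriv f t"
  have g': "?g1 \<noteq> 0" "2 * Q2 (g (f t)) * ?g1 ^ 4
       - (deriv (deriv (deriv g)) (f t) * ?g1 - 3 / 2 * (deriv (deriv g) (f t))\<^sup>2)
     = 2 * Q1 (f t) * ?g1\<^sup>2" using g by (auto simp: pulls_back_def)
  define X where "X = deriv (deriv (deriv f)) t * ?f1 - 3 / 2 * (deriv (deriv f) t)\<^sup>2"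
  have "pulls_back Q0 (\<lambda>x. g (f x)) Q2 t \<longleftrightarrow> ?f1 \<noteq> 0 \<and>
      ?f1 ^ 4 * (2 * Q1 (f t) * ?g1\<^sup>2) - ?g1\<^sup>2 * X = 2 * Q0 t * (?g1 * ?f1)\<^sup>2"
    unfolding pulls_back_def d key g'(2) X_def using g'(1) by auto
  also have "?f1 ^ 4 * (2 * Q1 (f t) * ?g1\<^sup>2) - ?g1\<^sup>2 * X = 2 * Q0 t * (?g1 * ?f1)\<^sup>2 \<longleftrightarrow>
      ?g1\<^sup>2 * (2 * Q1 (f t) * ?f1 ^ 4 - X) = ?g1\<^sup>2 * (2 * Q0 t * ?f1\<^sup>2)"
    by (simp add: power_mult_distrib algebra_simps)
  also have "\<dots> \<longleftrightarrow> 2 * Q1 (f t) * ?f1 ^ 4 - X = 2 * Q0 t * ?f1\<^sup>2" using g'(1) by simp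
  finally show ?thesis unfolding pulls_back_def X_def .
qed

lemma pulls_back_cancel_inner:
  assumes an: "f analytic_on {t}" "g analytic_on {f t}" and f: "pulls_back Q0 f Q1 t"
    and gf: "pulls_back Q0 (\<lambda>x. g (f x)) Q2 t"
  shows "pulls_back Q1 g Q2 (f t)"
proof -
  obtain U V where UV: "open U" "t \<in> U" "f holomorphic_on U" "open V" "g holomorphic_on V" "f ` U \<subseteq> V"
    by (rule analytic_compose_nbhd[OF an])
  note d = deriv_compose_three[OF UV(3,1,5,4,6,2)]
  have key: "2 * q2 * (g1 * f1) ^ 4 - ((g3 * f1 ^ 3 + 3 * g2 * f1 * f2 + g1 * f3) * (g1 * f1)
        - 3 / 2 * (g2 * f1\<^sup>2 + g1 * f2)\<^sup>2)
      = f1 ^ 4 * (2 * q2 * g1 ^ 4 - (g3 * g1 - 3 / 2 * g2\<^sup>2)) 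
        + g1\<^sup>2 * (2 * q1 * f1 ^ 4 - (f3 * f1 - 3 / 2 * f2\<^sup>2)) - f1 ^ 4 * (2 * q1 * g1\<^sup>2)"
    for f1 f2 f3 g1 g2 g3 q1 q2 :: complex
    by (simp add: power2_eq_square power3_eq_cube power4_eq_xxxx field_simps)
  have f1: "deriv f t \<noteq> 0" and f': "2 * Q1 (f t) * deriv f t ^ 4
       - (deriv (deriv (deriv f)) t * deriv f t - 3 / 2 * (deriv (deriv f) t)\<^sup>2) = 2 * Q0 t * (deriv f t)\<^sup>2"
    using f by (auto simp: pulls_back_def)
  have gf': "deriv g (f t) \<noteq> 0" "deriv f t ^ 4 * (2 * Q2 (g (f t)) * deriv g (f t) ^ 4 -
      (deriv (deriv (deriv g)) (f t) * deriv g (f t) - 3 / 2 * (deriv (deriv g) (f t))\<^sup>2))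
      + (deriv g (f t))\<^sup>2 * (2 * Q0 t * (deriv f t)\<^sup>2) - deriv f t ^ 4 * (2 * Q1 (f t) * (deriv g (f t))\<^sup>2)
      = 2 * Q0 t * (deriv g (f t) * deriv f t)\<^sup>2"
    using gf unfolding pulls_back_def d key[of _ _ _ _ _ _ _ "Q1 (f t)"] f' by auto
  then have "deriv f t ^ 4 * (2 * Q2 (g (f t)) * deriv g (f t) ^ 4 -
      (deriv (deriv (deriv g)) (f t) * deriv g (f t) - 3 / 2 * (deriv (deriv g) (f t))\<^sup>2))
      = deriv f t ^ 4 * (2 * Q1 (f t) * (deriv g (f t))\<^sup>2)"
    by (simp add: power_mult_distrib)
  then show ?thesis using f1 gf'(1) by (simp add: pulls_back_def)
qed

lemma pulls_back_cong:
  assumes "pulls_back Qt f Qz t" "\<forall>\<^sub>F x in nhds t. f x = g x"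
  shows "pulls_back Qt g Qz t"
proof -
  have e: "\<forall>\<^sub>F x in nhds t. deriv h x = deriv k x" if "\<forall>\<^sub>F x in nhds t. h x = k x" for h k :: "complex \<Rightarrow> complex"
  proof -
    have "\<forall>\<^sub>F x in nhds t. \<forall>\<^sub>F y in nhds x. h y = k y" using that by (simp only: eventually_eventually)
    then show ?thesis by eventually_elim (rule deriv_eq_germ)
  qed
  note e1 = assms(2) note e2 = e[OF e1] note e3 = e[OF e2] note e4 = e[OF e3]
  show ?thesis using assms(1)
    unfolding pulls_back_def eventually_nhds_x_imp_x[OF e1] eventually_nhds_x_imp_x[OF e2]
      eventually_nhds_x_imp_x[OF e3] eventually_nhds_x_imp_x[OF e4] .
qed

lemma pulls_back_id: "pulls_back Q (\<lambda>x. x) Q t"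
proof -
  have "deriv (\<lambda>x::complex. x) = (\<lambda>_. 1)" "deriv (\<lambda>x::complex. 1 :: complex) = (\<lambda>_. 0)" by auto
  then show ?thesis by (simp add: pulls_back_def)
qed

text \<open>
  The derivative of the ratio is a constant, the Wronskian, over \<open>f\<^sup>2\<close>; so its Schwarzian derivative
  is \<open>-2 f'' / f\<close>.
\<close>

lemma pulls_back_ratio:
  assumes s: "solves Q U f" "solves Q U h" "open U" "connected U" "t \<in> U" "\<And>x. x \<in> U \<Longrightarrow> f x \<noteq> 0"
    and nz: "deriv (\<lambda>x. h x / f x) t \<noteq> 0"
  shows "pulls_back Q (\<lambda>x. h x / f x) (\<lambda>_. 0) t"
proof -
  define c where "c = f t * deriv h t - h t * deriv f t"
  have hf: "f holomorphic_on U" and hh: "h holomorphic_on U" using s by (auto simp: solves_def)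
  note df = holomorphic_deriv_at[OF hf s(3)] holomorphic_deriv_at[OF holomorphic_deriv[OF hf s(3)] s(3)]
  note dh = holomorphic_deriv_at[OF hh s(3)]
  have 1: "deriv (\<lambda>x. h x / f x) x = c / (f x)\<^sup>2" if x: "x \<in> U" for x
  proof -
    have "deriv (\<lambda>x. h x / f x) x = (deriv h x * f x - h x * deriv f x) / (f x * f x)"
      by (rule DERIV_imp_deriv) (rule DERIV_divide[OF dh[OF x] df(1)[OF x] s(6)[OF x]])
    also have "deriv h x * f x - h x * deriv f x = c"
      using wronskian_constant[OF s(1,2,3,4) x s(5)] by (simp add: c_def mult.commute)
    finally show ?thesis by (simp add: power2_eq_square)
  qed
  have 2: "deriv (deriv (\<lambda>x. h x / f x)) x = - 2 * c * deriv f x / f x ^ 3" if x: "x \<in> U" for x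
  proof -
    have "deriv (deriv (\<lambda>x. h x / f x)) x = deriv (\<lambda>x. c / (f x)\<^sup>2) x" by (rule deriv_cong_open[OF s(3) x 1])
    also have "\<dots> = - 2 * c * deriv f x / f x ^ 3"
      by (rule DERIV_imp_deriv)
        (use s(6)[OF x] in \<open>auto intro!: derivative_eq_intros df[OF x] simp: field_simps power2_eq_square power3_eq_cube\<close>)
    finally show ?thesis .
  qed
  have 3: "deriv (deriv (deriv (\<lambda>x. h x / f x))) t = - 2 * c * Q t / (f t)\<^sup>2 + 6 * c * (deriv f t)\<^sup>2 / f t ^ 4"
  proof -
    have "deriv (deriv (deriv (\<lambda>x. h x / f x))) t = deriv (\<lambda>x. - 2 * c * deriv f x / f x ^ 3) t"
      by (rule deriv_cong_open[OF s(3,5) 2])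
    also have "\<dots> = - 2 * c * deriv (deriv f) t / f t ^ 3 + 6 * c * (deriv f t)\<^sup>2 / f t ^ 4"
      by (rule DERIV_imp_deriv)
        (use s(6)[OF s(5)] in \<open>auto intro!: derivative_eq_intros df[OF s(5)] simp: field_simps power2_eq_square power3_eq_cube power4_eq_xxxx\<close>)
    also have "deriv (deriv f) t = Q t * f t" using s(1,5) by (auto simp: solves_def)
    finally show ?thesis using s(6)[OF s(5)] by (simp add: power2_eq_square power3_eq_cube)
  qed
  have c: "c \<noteq> 0" using nz 1[OF s(5)] by auto
  show ?thesis unfolding pulls_back_def 1[OF s(5)] 2[OF s(5)] 3
    using c s(6)[OF s(5)]
    by (simp add: power2_eq_square power3_eq_cube power4_eq_xxxx field_simps)
qed

text \<open>
  The factor \<open>r = \<surd>g'\<close> is chosen so that the first derivative of \<open>\<psi>t\<close> cancels when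
  \<open>\<psi>z \<circ> g = r \<psi>t\<close> is differentiated twice.
\<close>

lemma solves_change_variable:
  assumes U: "open U" and g: "g holomorphic_on U" "inj_on g U" and r: "r holomorphic_on U"
    and r2: "\<And>t. t \<in> U \<Longrightarrow> (r t)\<^sup>2 = deriv g t"
    and rel: "\<And>t. t \<in> U \<Longrightarrow> \<psi>z (g t) = r t * \<psi>t t"
    and pb: "\<And>t. t \<in> U \<Longrightarrow> pulls_back Qt g Qz t"
  shows "solves Qt U \<psi>t \<longleftrightarrow> solves Qz (g ` U) \<psi>z"
proof -
  obtain h where h: "h holomorphic_on (g ` U)" "\<And>z. z \<in> U \<Longrightarrow> h (g z) = z"
    using holomorphic_has_inverse[OF g(1) U g(2)] by metis
  have oV: "open (g ` U)" by (rule open_mapping_thm3[OF g(1) U g(2)])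
  have r0: "r t \<noteq> 0" if "t \<in> U" for t using r2[OF that] pb[OF that] by (auto simp: pulls_back_def)
  have hol_iff: "\<psi>t holomorphic_on U \<longleftrightarrow> \<psi>z holomorphic_on g ` U"
  proof
    assume "\<psi>t holomorphic_on U"
    then have "(\<lambda>t. r t * \<psi>t t) holomorphic_on U" using r by (intro holomorphic_intros)
    then have "((\<lambda>t. r t * \<psi>t t) \<circ> h) holomorphic_on g ` U"
      by (rule holomorphic_on_compose_gen[OF h(1)]) (use h(2) in auto)
    then show "\<psi>z holomorphic_on g ` U"
      by (rule holomorphic_transform) (use h(2) rel in auto)
  next
    assume "\<psi>z holomorphic_on g ` U"
    then have "(\<psi>z \<circ> g) holomorphic_on U" by (rule holomorphic_on_compose_gen[OF g(1)]) auto
    then have "(\<lambda>t. (\<psi>z \<circ> g) t / r t) holomorphic_on U" using r r0 by (intro holomorphic_intros)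
    then show "\<psi>t holomorphic_on U" by (rule holomorphic_transform) (use r0 rel in auto)
  qed
  have "deriv (deriv \<psi>t) t = Qt t * \<psi>t t \<longleftrightarrow> deriv (deriv \<psi>z) (g t) = Qz (g t) * \<psi>z (g t)"
    if hol: "\<psi>t holomorphic_on U" "\<psi>z holomorphic_on g ` U" and t: "t \<in> U" for t
  proof -
    note dc = deriv_compose_three[OF g(1) U hol(2) oV subset_refl]
    note hr = r holomorphic_deriv[OF r U] and hp = hol(1) holomorphic_deriv[OF hol(1) U]
    note dr = holomorphic_deriv_at[OF hr(1) U] holomorphic_deriv_at[OF hr(2) U]
    note dp = holomorphic_deriv_at[OF hp(1) U] holomorphic_deriv_at[OF hp(2) U]
    have A: "deriv \<psi>z (g x) * deriv g x = deriv r x * \<psi>t x + r x * deriv \<psi>t x" if x: "x \<in> U" for x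
    proof -
      have "deriv (\<lambda>x. \<psi>z (g x)) x = deriv (\<lambda>x. r x * \<psi>t x) x"
        by (rule deriv_cong_open[OF U x rel])
      also have "\<dots> = deriv r x * \<psi>t x + deriv \<psi>t x * r x"
        by (rule DERIV_imp_deriv) (rule DERIV_mult[OF dr(1)[OF x] dp(1)[OF x]])
      finally show ?thesis using dc(1)[OF x] by (simp add: mult.commute)
    qed
    have B: "deriv (deriv \<psi>z) (g t) * (deriv g t)\<^sup>2 + deriv \<psi>z (g t) * deriv (deriv g) t
        = deriv (deriv r) t * \<psi>t t + 2 * deriv r t * deriv \<psi>t t + r t * deriv (deriv \<psi>t) t"
    proof -
      have "deriv (deriv (\<lambda>x. \<psi>z (g x))) t = deriv (\<lambda>x. deriv r x * \<psi>t x + r x * deriv \<psi>t x) t"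
        by (rule deriv_cong_open[OF U t]) (simp add: A dc(1))
      also have "\<dots> = deriv (deriv r) t * \<psi>t t + 2 * deriv r t * deriv \<psi>t t + r t * deriv (deriv \<psi>t) t"
        by (rule DERIV_imp_deriv)
          (auto intro!: derivative_eq_intros dr[OF t] dp[OF t] simp: algebra_simps)
      finally show ?thesis using dc(2)[OF t] by simp
    qed
    have g1: "deriv g x = (r x)\<^sup>2" if "x \<in> U" for x using r2[OF that] by simp
    have g2: "deriv (deriv g) x = 2 * r x * deriv r x" if x: "x \<in> U" for x
    proof -
      have "deriv (deriv g) x = deriv (\<lambda>x. (r x)\<^sup>2) x" by (rule deriv_cong_open[OF U x g1])
      also have "\<dots> = 2 * r x * deriv r x"
        by (rule DERIV_imp_deriv) (auto intro!: derivative_eq_intros dr[OF x])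
      finally show ?thesis .
    qed
    have g3: "deriv (deriv (deriv g)) t = 2 * (deriv r t)\<^sup>2 + 2 * r t * deriv (deriv r) t"
    proof -
      have "deriv (deriv (deriv g)) t = deriv (\<lambda>x. 2 * r x * deriv r x) t" by (rule deriv_cong_open[OF U t g2])
      also have "\<dots> = 2 * (deriv r t)\<^sup>2 + 2 * r t * deriv (deriv r) t"
        by (rule DERIV_imp_deriv)
          (auto intro!: derivative_eq_intros dr[OF t] simp: power2_eq_square algebra_simps)
      finally show ?thesis .
    qed
    define R where "R = r t" define R1 where "R1 = deriv r t" define R2 where "R2 = deriv (deriv r) t"
    define p where "p = \<psi>t t" define p1 where "p1 = deriv \<psi>t t" define p2 where "p2 = deriv (deriv \<psi>t) t"
    define a1 where "a1 = deriv \<psi>z (g t)" define a2 where "a2 = deriv (deriv \<psi>z) (g t)"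
    have R0: "R \<noteq> 0" using r0[OF t] by (simp add: R_def)
    have eA: "a1 * R\<^sup>2 = R1 * p + R * p1" using A[OF t] g1[OF t] by (simp add: a1_def R_def R1_def p_def p1_def)
    have eB: "a2 * R ^ 4 + a1 * (2 * R * R1) = R2 * p + 2 * R1 * p1 + R * p2"
      using B g1[OF t] g2[OF t] by (simp add: a1_def a2_def R_def R1_def R2_def p_def p1_def p2_def)
    have eP: "R\<^sup>2 * (Qz (g t) * R ^ 6) = R\<^sup>2 * (Qt t * R\<^sup>2 + R * R2 - 2 * R1\<^sup>2)"
    proof -
      have "2 * Qz (g t) * (R\<^sup>2) ^ 4 - ((2 * R1\<^sup>2 + 2 * R * R2) * R\<^sup>2 - 3 / 2 * (2 * R * R1)\<^sup>2) = 2 * Qt t * (R\<^sup>2)\<^sup>2"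
        using pb[OF t] unfolding pulls_back_def g1[OF t] g2[OF t] g3 R_def[symmetric] R1_def[symmetric] R2_def[symmetric]
        by simp
      then have "2 * (R\<^sup>2 * (Qz (g t) * R ^ 6)) = 2 * (R\<^sup>2 * (Qt t * R\<^sup>2 + R * R2 - 2 * R1\<^sup>2))"
        by (simp add: algebra_simps power_mult_distrib power2_eq_square power3_eq_cube power4_eq_xxxx
            eval_nat_numeral)
      then show ?thesis by (simp del: mult_cancel_left)
    qed
    then have eP': "Qz (g t) * R ^ 6 = Qt t * R\<^sup>2 + R * R2 - 2 * R1\<^sup>2" using R0 by simp
    have "a2 * R ^ 5 = R * (a2 * R ^ 4 + a1 * (2 * R * R1)) - 2 * R1 * (a1 * R\<^sup>2)"
      by (simp add: algebra_simps power2_eq_square eval_nat_numeral)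
    also have "\<dots> = R * R2 * p + R\<^sup>2 * p2 - 2 * R1\<^sup>2 * p"
      unfolding eA eB by (simp add: algebra_simps power2_eq_square)
    finally have a2: "a2 * R ^ 5 = R * R2 * p + R\<^sup>2 * p2 - 2 * R1\<^sup>2 * p" .
    have "a2 = Qz (g t) * (R * p) \<longleftrightarrow> R ^ 5 * a2 = R ^ 5 * (Qz (g t) * (R * p))" using R0 by simp
    also have "R ^ 5 * a2 = R * R2 * p + R\<^sup>2 * p2 - 2 * R1\<^sup>2 * p" using a2 by (simp add: mult.commute)
    also have "R ^ 5 * (Qz (g t) * (R * p)) = (Qz (g t) * R ^ 6) * p" by (simp add: eval_nat_numeral)
    also have "\<dots> = (Qt t * R\<^sup>2 + R * R2 - 2 * R1\<^sup>2) * p" unfolding eP' ..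
    also have "R * R2 * p + R\<^sup>2 * p2 - 2 * R1\<^sup>2 * p = (Qt t * R\<^sup>2 + R * R2 - 2 * R1\<^sup>2) * p \<longleftrightarrow>
        R\<^sup>2 * p2 = R\<^sup>2 * (Qt t * p)" by (auto simp: algebra_simps)
    also have "\<dots> \<longleftrightarrow> p2 = Qt t * p" using R0 by simp
    finally show ?thesis using rel[OF t] by (simp add: a2_def R_def p_def p2_def)
  qed
  then show ?thesis unfolding solves_def using hol_iff by auto
qed

text \<open>
  An injective holomorphic function has no critical points, so the law is only asked for where \<open>g' \<noteq> 0\<close>.
\<close>

lemma transforms_toI:
  assumes "\<And>t. t \<in> D \<Longrightarrow> g analytic_on {t} \<Longrightarrow> deriv g t \<noteq> 0 \<Longrightarrow> pulls_back Qt g Qz t"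
  shows "transforms_to D Qt g Qz"
  unfolding transforms_to_def
proof (intro allI impI)
  fix U r \<psi>t \<psi>z
  assume *: "open U \<and> U \<subseteq> D \<and> g holomorphic_on U \<and> inj_on g U \<and>
        r holomorphic_on U \<and> (\<forall>t\<in>U. (r t)\<^sup>2 = deriv g t) \<and> (\<forall>t\<in>U. \<psi>z (g t) = r t * \<psi>t t)"
  then have "pulls_back Qt g Qz t" if "t \<in> U" for t
    using that holomorphic_injective_imp_regular[of g U t]
    by (intro assms) (auto simp: analytic_at)
  with * show "solves Qt U \<psi>t \<longleftrightarrow> solves Qz (g ` U) \<psi>z"
    by (intro solves_change_variable[of U g r]) auto
qed

lemma deriv_power_factor:
  assumes "G holomorphic_on ball w r" "t \<in> ball w r" 
  shows "(t - w) * deriv (\<lambda>x. (x - w) ^ k * G x) t = (t - w) ^ k * (of_nat k * G t + (t - w) * deriv G t)"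
proof -
  have "deriv (\<lambda>x. (x - w) ^ k * G x) t = of_nat k * (t - w) ^ (k - 1) * G t + deriv G t * (t - w) ^ k"
    by (rule DERIV_imp_deriv)
      (auto intro!: derivative_eq_intros holomorphic_deriv_at[OF assms(1) open_ball assms(2)])
  moreover have "(t - w) * (of_nat k * (t - w) ^ (k - 1)) = of_nat k * (t - w) ^ k"
    by (cases k) auto
  ultimately show ?thesis by (simp only: ring_distribs mult.assoc[symmetric]) (simp add: mult_ac)
qed

text \<open>
  The indicial equation.  If \<open>\<xi> - c\<close> vanishes to the order \<open>k\<close>, then \<open>{\<xi>, t}\<close> has the principal part
  \<open>(1 - k\<^sup>2) / (2 (t - w)\<^sup>2)\<close> and \<open>(Q \<circ> \<xi>) \<xi>'\<^sup>2\<close> has \<open>q0 k\<^sup>2 / (t - w)\<^sup>2\<close>.  Two values of \<open>q0\<close> occur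
  below: \<open>-1/4\<close>, for which no order is possible, so that \<open>\<xi>\<close> does not take the value \<open>c\<close> at all, and
  \<open>-3/16\<close>, which gives \<open>k = 2\<close>.
\<close>

lemma pulls_back_order:
  assumes \<xi>: "\<xi> holomorphic_on S" "open S" "connected S" "w \<in> S" "\<not> \<xi> constant_on S" "\<xi> w = c"
    and ev: "\<forall>\<^sub>F t in at w. pulls_back (\<lambda>_. 0) \<xi> Q t"
    and lim: "((\<lambda>z. (z - c)\<^sup>2 * Q z) \<longlongrightarrow> q0) (at c)"
  obtains k r g where "0 < k" "0 < r" "ball w r \<subseteq> S" "g holomorphic_on ball w r"
    "\<And>t. t \<in> ball w r \<Longrightarrow> \<xi> t - c = (t - w) ^ k * g t" "\<And>t. t \<in> ball w r \<Longrightarrow> g t \<noteq> 0"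
    "1 - (of_nat k)\<^sup>2 = 4 * q0 * (of_nat k)\<^sup>2"
proof -
  have "\<not> (\<lambda>t. \<xi> t - c) constant_on S" using \<xi>(5) unfolding constant_on_def
    by (metis (no_types, opaque_lifting) add.commute diff_add_cancel)
  moreover have "(\<lambda>t. \<xi> t - c) holomorphic_on S" using \<xi>(1) by (intro holomorphic_intros)
  moreover have "\<xi> w - c = 0" using \<xi>(6) by simp
  ultimately obtain g r k where k: "0 < k" "0 < r" "ball w r \<subseteq> S" "g holomorphic_on ball w r"
    and fac: "\<And>t. t \<in> ball w r \<Longrightarrow> \<xi> t - c = (t - w) ^ k * g t" and g0: "\<And>t. t \<in> ball w r \<Longrightarrow> g t \<noteq> 0"
    using holomorphic_factor_zero_nonconstant[of "\<lambda>t. \<xi> t - c" S w, OF _ \<xi>(2,3,4)] by metis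
  (* G1, G2, G3 are the holomorphic factors of (t - w) ^ j times the j-th derivative *)
  define G1 where "G1 = (\<lambda>t. of_nat k * g t + (t - w) * deriv g t)"
  define G2 where "G2 = (\<lambda>t. of_nat k * G1 t + (t - w) * deriv G1 t - G1 t)"
  define G3 where "G3 = (\<lambda>t. of_nat k * G2 t + (t - w) * deriv G2 t - 2 * G2 t)"
  have h1: "G1 holomorphic_on ball w r" unfolding G1_def using k(4) by (auto intro!: holomorphic_intros)
  have h2: "G2 holomorphic_on ball w r" unfolding G2_def using h1 by (auto intro!: holomorphic_intros)
  have h3: "G3 holomorphic_on ball w r" unfolding G3_def using h2 by (auto intro!: holomorphic_intros)
  have hx: "\<xi> holomorphic_on ball w r" using \<xi>(1) k(3) holomorphic_on_subset by blast
  note hx1 = holomorphic_deriv[OF hx open_ball] 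
  note hx2 = holomorphic_deriv[OF hx1 open_ball]
  note dx = holomorphic_deriv_at[OF hx open_ball] holomorphic_deriv_at[OF hx1 open_ball]
    holomorphic_deriv_at[OF hx2 open_ball]
  have e1: "(t - w) * deriv \<xi> t = (t - w) ^ k * G1 t" if t: "t \<in> ball w r" for t
  proof -
    have "deriv \<xi> t = deriv (\<lambda>t. \<xi> t - c) t"
      by (rule DERIV_imp_deriv[symmetric]) (auto intro!: derivative_eq_intros dx[OF t])
    also have "\<dots> = deriv (\<lambda>x. (x - w) ^ k * g x) t" by (rule deriv_cong_open[OF open_ball t fac])
    finally show ?thesis using deriv_power_factor[OF k(4) t] by (simp add: G1_def)
  qed
  have e2: "(t - w)\<^sup>2 * deriv (deriv \<xi>) t = (t - w) ^ k * G2 t" if t: "t \<in> ball w r" for t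
  proof -
    have "deriv (\<lambda>t. (t - w) * deriv \<xi> t) t = deriv (\<lambda>x. (x - w) ^ k * G1 x) t"
      by (rule deriv_cong_open[OF open_ball t e1])
    moreover have "deriv (\<lambda>t. (t - w) * deriv \<xi> t) t = deriv \<xi> t + (t - w) * deriv (deriv \<xi>) t"
      by (rule DERIV_imp_deriv) (auto intro!: derivative_eq_intros dx[OF t])
    ultimately have eq: "deriv \<xi> t + (t - w) * deriv (deriv \<xi>) t = deriv (\<lambda>x. (x - w) ^ k * G1 x) t" by simp
    have "(t - w) * (deriv \<xi> t + (t - w) * deriv (deriv \<xi>) t)
        = (t - w) ^ k * (of_nat k * G1 t + (t - w) * deriv G1 t)"
      unfolding eq by (rule deriv_power_factor[OF h1 t])
    moreover have "q * (x + q * y) = q * x + q\<^sup>2 * y" for q x y :: complex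
      by (simp add: power2_eq_square algebra_simps)
    ultimately have "(t - w) * deriv \<xi> t + (t - w)\<^sup>2 * deriv (deriv \<xi>) t
        = (t - w) ^ k * (of_nat k * G1 t + (t - w) * deriv G1 t)" by simp
    then show ?thesis unfolding e1[OF t] G2_def by (simp add: algebra_simps)
  qed
  have e3: "(t - w) ^ 3 * deriv (deriv (deriv \<xi>)) t = (t - w) ^ k * G3 t" if t: "t \<in> ball w r" for t
  proof -
    have "deriv (\<lambda>t. (t - w)\<^sup>2 * deriv (deriv \<xi>) t) t = deriv (\<lambda>x. (x - w) ^ k * G2 x) t"
      by (rule deriv_cong_open[OF open_ball t e2])
    moreover have "deriv (\<lambda>t. (t - w)\<^sup>2 * deriv (deriv \<xi>) t) t =
        2 * (t - w) * deriv (deriv \<xi>) t + (t - w)\<^sup>2 * deriv (deriv (deriv \<xi>)) t"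
      by (rule DERIV_imp_deriv) (auto intro!: derivative_eq_intros dx[OF t])
    ultimately have eq: "2 * (t - w) * deriv (deriv \<xi>) t + (t - w)\<^sup>2 * deriv (deriv (deriv \<xi>)) t
        = deriv (\<lambda>x. (x - w) ^ k * G2 x) t" by simp
    have "(t - w) * (2 * (t - w) * deriv (deriv \<xi>) t + (t - w)\<^sup>2 * deriv (deriv (deriv \<xi>)) t)
        = (t - w) ^ k * (of_nat k * G2 t + (t - w) * deriv G2 t)"
      unfolding eq by (rule deriv_power_factor[OF h2 t])
    moreover have "q * (2 * q * x + q\<^sup>2 * y) = 2 * (q\<^sup>2 * x) + q ^ 3 * y" for q x y :: complex
      by (simp add: power2_eq_square power3_eq_cube algebra_simps)
    ultimately have "2 * ((t - w)\<^sup>2 * deriv (deriv \<xi>) t) + (t - w) ^ 3 * deriv (deriv (deriv \<xi>)) t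
        = (t - w) ^ k * (of_nat k * G2 t + (t - w) * deriv G2 t)" by (simp only:)
    then show ?thesis unfolding e2[OF t] G3_def by (simp add: algebra_simps)
  qed
  define R where "R = (\<lambda>t. (\<xi> t - c)\<^sup>2 * Q (\<xi> t))"
  have in_ball: "\<forall>\<^sub>F t in at w. t \<in> ball w r - {w}"
    using k(2) eventually_at_ball'[of r w UNIV] by (auto simp: eventually_at_filter elim: eventually_mono)
  have "(\<xi> \<longlongrightarrow> c) (at w)"
    using dx(1)[of w] k(2) \<xi>(6) DERIV_isCont isContD by fastforce
  moreover have "\<forall>\<^sub>F t in at w. \<xi> t \<noteq> c"
    using in_ball by eventually_elim (use fac g0 in force)
  ultimately have "filterlim \<xi> (at c) (at w)" by (simp add: filterlim_at)
  then have R: "(R \<longlongrightarrow> q0) (at w)" unfolding R_def using lim by (rule filterlim_compose[rotated])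
  have cont: "(f \<longlongrightarrow> f w) (at w)" if "f holomorphic_on ball w r" for f
    using that k(2) holomorphic_deriv_at[OF that open_ball, of w] DERIV_isCont isContD by fastforce
  have "\<forall>\<^sub>F t in at w. (G3 t * G1 t - 3 / 2 * (G2 t)\<^sup>2) * (g t)\<^sup>2 = 2 * R t * G1 t ^ 4"
    using in_ball ev
  proof eventually_elim
    case (elim t)
    then have t: "t \<in> ball w r" "t - w \<noteq> 0" by auto
    define q where "q = t - w"
    define x1 where "x1 = deriv \<xi> t" define x2 where "x2 = deriv (deriv \<xi>) t"
    define x3 where "x3 = deriv (deriv (deriv \<xi>)) t"
    have q0: "q ^ k \<noteq> 0" using t by (simp add: q_def)
    have eqs: "q * x1 = q ^ k * G1 t" "q\<^sup>2 * x2 = q ^ k * G2 t" "q ^ 3 * x3 = q ^ k * G3 t"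
      "R t = (q ^ k * g t)\<^sup>2 * Q (\<xi> t)"
      using e1[OF t(1)] e2[OF t(1)] e3[OF t(1)] fac[OF t(1)] by (simp_all add: q_def x1_def x2_def x3_def R_def)
    have pb: "x3 * x1 - 3 / 2 * x2\<^sup>2 = 2 * Q (\<xi> t) * x1 ^ 4"
      using elim(2) unfolding pulls_back_def x1_def x2_def x3_def by simp
    have "(q ^ k)\<^sup>2 * (G3 t * G1 t - 3 / 2 * (G2 t)\<^sup>2) = (q ^ k * G3 t) * (q ^ k * G1 t) - 3 / 2 * (q ^ k * G2 t)\<^sup>2"
      by (simp add: power2_eq_square algebra_simps)
    also have "\<dots> = q ^ 4 * (x3 * x1 - 3 / 2 * x2\<^sup>2)"
      unfolding eqs[symmetric] by (simp add: power2_eq_square power3_eq_cube power4_eq_xxxx algebra_simps)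
    also have "\<dots> = 2 * Q (\<xi> t) * (q * x1) ^ 4" unfolding pb by (simp add: power_mult_distrib)
    also have "\<dots> = (q ^ k)\<^sup>2 * (2 * Q (\<xi> t) * (q ^ k)\<^sup>2 * G1 t ^ 4)"
      unfolding eqs by (simp add: power2_eq_square power4_eq_xxxx algebra_simps)
    finally have "G3 t * G1 t - 3 / 2 * (G2 t)\<^sup>2 = 2 * Q (\<xi> t) * (q ^ k)\<^sup>2 * G1 t ^ 4" using q0 by auto
    then show ?case unfolding eqs(4) by (simp add: power_mult_distrib)
  qed
  moreover have "((\<lambda>t. (G3 t * G1 t - 3 / 2 * (G2 t)\<^sup>2) * (g t)\<^sup>2) \<longlongrightarrow>
      (G3 w * G1 w - 3 / 2 * (G2 w)\<^sup>2) * (g w)\<^sup>2) (at w)"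
    by (intro tendsto_intros cont h1 h2 h3 k(4))
  ultimately have "((\<lambda>t. 2 * R t * G1 t ^ 4) \<longlongrightarrow> (G3 w * G1 w - 3 / 2 * (G2 w)\<^sup>2) * (g w)\<^sup>2) (at w)"
    by (rule Lim_transform_eventually[rotated])
  moreover have "((\<lambda>t. 2 * R t * G1 t ^ 4) \<longlongrightarrow> 2 * q0 * G1 w ^ 4) (at w)"
    by (intro tendsto_intros cont h1 R)
  ultimately have "(G3 w * G1 w - 3 / 2 * (G2 w)\<^sup>2) * (g w)\<^sup>2 = 2 * q0 * G1 w ^ 4"
    by (rule tendsto_unique[OF at_neq_bot])
  moreover define K where "K = (of_nat k :: complex)"
  have "G1 w = K * g w" "G2 w = K * (K * g w) - K * g w"
    "G3 w = K * (K * (K * g w) - K * g w) - 2 * (K * (K * g w) - K * g w)"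
    by (simp_all add: G1_def G2_def G3_def K_def)
  moreover have "2 * (((K * (K * (K * h) - K * h) - 2 * (K * (K * h) - K * h)) * (K * h)
      - 3 / 2 * (K * (K * h) - K * h)\<^sup>2) * h\<^sup>2) = (h ^ 4 * K\<^sup>2) * (1 - K\<^sup>2)" for h :: complex
    by (simp add: power2_eq_square power4_eq_xxxx field_simps)
  ultimately have "(g w ^ 4 * K\<^sup>2) * (1 - K\<^sup>2) = 2 * (2 * q0 * (K * g w) ^ 4)" by metis
  also have "\<dots> = (g w ^ 4 * K\<^sup>2) * (4 * q0 * K\<^sup>2)"
    by (simp add: power2_eq_square power4_eq_xxxx algebra_simps)
  finally have "1 - K\<^sup>2 = 4 * q0 * K\<^sup>2"
    using g0[of w] k(1,2) unfolding mult_cancel_left by (auto simp: K_def)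
  then have "1 - (of_nat k)\<^sup>2 = 4 * q0 * (of_nat k)\<^sup>2" unfolding K_def .
  then show ?thesis using that[OF k(1-4) fac g0] by blast
qed

section \<open>Uniformizing functions\<close>

abbreviation (input) "\<H> \<equiv> upper_half_plane"

lemma H_props: "open \<H>" "connected \<H>" "convex \<H>" "path_connected \<H>" "\<i> \<in> \<H>"
  by (auto simp: open_halfspace_Im_gt convex_halfspace_Im_gt intro!: convex_connected convex_imp_path_connected)

definition lifts_paths :: "(complex \<Rightarrow> complex) \<Rightarrow> complex set \<Rightarrow> complex set \<Rightarrow> bool" where
  "lifts_paths \<xi> S D \<longleftrightarrow> (\<forall>\<gamma> \<tau>. path \<gamma> \<and> path_image \<gamma> \<subseteq> D \<and> \<tau> \<in> S \<and> \<xi> \<tau> = \<gamma> 0 \<longrightarrow>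
     (\<exists>g. path g \<and> path_image g \<subseteq> S \<and> g 0 = \<tau> \<and> (\<forall>t\<in>{0..1}. \<xi> (g t) = \<gamma> t)))"

lemma lifts_pathsE:
  assumes "lifts_paths \<xi> S D" "path \<gamma>" "path_image \<gamma> \<subseteq> D" "\<tau> \<in> S" "\<xi> \<tau> = \<gamma> 0"
  obtains g where "path g" "path_image g \<subseteq> S" "g 0 = \<tau>" "\<And>t. t \<in> {0..1} \<Longrightarrow> \<xi> (g t) = \<gamma> t"
  using assms unfolding lifts_paths_def by metis

text \<open>
  The single-valued inverse function as the half-plane sees it: over \<open>D\<close> it satisfies the Schwarzian
  equation, and paths of \<open>D\<close> can be lifted from every point of every fibre.  Base point, solutions and
  group have disappeared, which is why the parameter problems are compared in this form.
\<close>

definition uniformizes ::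
  "complex set \<Rightarrow> (complex \<Rightarrow> complex) \<Rightarrow> (complex \<Rightarrow> complex) \<Rightarrow> bool" where
  "uniformizes D Q \<xi> \<longleftrightarrow> \<xi> holomorphic_on \<H> \<and> (\<exists>\<tau>\<in>\<H>. \<xi> \<tau> \<in> D) \<and>
     (\<forall>\<tau>\<in>\<H>. \<xi> \<tau> \<in> D \<longrightarrow> pulls_back (\<lambda>_. 0) \<xi> Q \<tau>) \<and> lifts_paths \<xi> \<H> D"

text \<open>
  Agreement is an open condition by local injectivity, and a closed one by continuity.
\<close>

lemma unique_lift:
  fixes g p :: "real \<Rightarrow> complex"
  assumes g: "continuous_on I g" and p: "continuous_on I p" and I: "connected I" "a \<in> I" "t \<in> I"
    and eq: "\<And>t. t \<in> I \<Longrightarrow> \<xi> (g t) = \<xi> (p t)" "g a = p a"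
    and inj: "\<And>t. t \<in> I \<Longrightarrow> \<exists>U. open U \<and> g t \<in> U \<and> inj_on \<xi> U"
  shows "g t = p t"
proof (rule connected_induction_real[OF I, of "\<lambda>t. g t = p t"])
  show "g a = p a" by fact
  fix t assume t: "t \<in> I"
  have lim: "(g \<longlongrightarrow> g t) (at t within I)" "(p \<longlongrightarrow> p t) (at t within I)"
    using g p t by (auto simp: continuous_on_def)
  show "\<exists>\<delta>>0. \<forall>x\<in>I. \<forall>y\<in>I. \<bar>x - t\<bar> < \<delta> \<longrightarrow> \<bar>y - t\<bar> < \<delta> \<longrightarrow> g x = p x \<longrightarrow> g y = p y"
  proof (cases "g t = p t")
    case True
    obtain U where U: "open U" "g t \<in> U" "inj_on \<xi> U" using inj[OF t] by blast
    have "\<forall>\<^sub>F s in at t within I. g s \<in> U \<and> p s \<in> U"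
      using topological_tendstoD[OF lim(1) U(1,2)] topological_tendstoD[OF lim(2) U(1)] U(2) True
      by (auto intro: eventually_conj)
    then obtain \<delta> where d: "\<delta> > 0" "\<And>s. s \<in> I \<Longrightarrow> \<bar>s - t\<bar> < \<delta> \<Longrightarrow> g s \<in> U \<and> p s \<in> U"
      by (rule eventually_at_withinD) (use U True in auto)
    have "g y = p y" if "y \<in> I" "\<bar>y - t\<bar> < \<delta>" for y
      using inj_onD[OF U(3) eq(1)[OF that(1)]] d(2)[OF that] by blast
    then show ?thesis using d(1) by blast
  next
    case False
    have "((\<lambda>s. g s - p s) \<longlongrightarrow> g t - p t) (at t within I)" by (intro tendsto_diff lim)
    then have "\<forall>\<^sub>F s in at t within I. g s - p s \<noteq> 0"
      using False by (intro tendsto_imp_eventually_ne) auto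
    then obtain \<delta> where d: "\<delta> > 0" "\<And>s. s \<in> I \<Longrightarrow> \<bar>s - t\<bar> < \<delta> \<Longrightarrow> g s - p s \<noteq> 0"
      by (rule eventually_at_withinD) (use False in auto)
    have "g x \<noteq> p x" if "x \<in> I" "\<bar>x - t\<bar> < \<delta>" for x using d(2)[OF that] by simp
    then show ?thesis using d(1) by blast
  qed
qed

lemma local_section:
  assumes "\<xi> holomorphic_on S" "open S" "\<tau> \<in> S" "deriv \<xi> \<tau> \<noteq> 0"
  obtains V \<sigma> where "open V" "\<tau> \<in> V" "V \<subseteq> S" "inj_on \<xi> V" "open (\<xi> ` V)" "\<sigma> holomorphic_on (\<xi> ` V)"
    "\<And>x. x \<in> V \<Longrightarrow> \<sigma> (\<xi> x) = x"
proof -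
  obtain r where r: "r > 0" "ball \<tau> r \<subseteq> S" "open (\<xi> ` ball \<tau> r)" "inj_on \<xi> (ball \<tau> r)"
    by (rule has_complex_derivative_locally_invertible[OF assms(1,3,2,4)]) (rule that)
  have "\<xi> holomorphic_on ball \<tau> r" using assms(1) r(2) holomorphic_on_subset by blast
  then obtain \<sigma> where "\<sigma> holomorphic_on (\<xi> ` ball \<tau> r)" "\<And>z. z \<in> ball \<tau> r \<Longrightarrow> \<sigma> (\<xi> z) = z"
    using holomorphic_has_inverse[OF _ open_ball r(4)] by metis
  then show ?thesis using r by (intro that[of "ball \<tau> r" \<sigma>]) auto
qed

lemma locally_inj:
  assumes "\<xi> holomorphic_on S" "open S" "\<tau> \<in> S" "deriv \<xi> \<tau> \<noteq> 0"
  shows "\<exists>U. open U \<and> \<tau> \<in> U \<and> inj_on \<xi> U"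
  by (rule local_section[OF assms]) blast

definition is_section :: "(complex \<Rightarrow> complex) \<Rightarrow> complex \<Rightarrow> (complex \<Rightarrow> complex) \<Rightarrow> bool" where
  "is_section \<xi> z \<sigma> \<longleftrightarrow> \<sigma> analytic_on {z} \<and> (\<forall>\<^sub>F w in nhds z. \<xi> (\<sigma> w) = w)"

lemma section_exists:
  assumes "\<xi> holomorphic_on S" "open S" "\<tau> \<in> S" "deriv \<xi> \<tau> \<noteq> 0"
  shows "\<exists>\<sigma>. is_section \<xi> (\<xi> \<tau>) \<sigma> \<and> \<sigma> (\<xi> \<tau>) = \<tau>"
proof -
  obtain V \<sigma> where V: "open V" "\<tau> \<in> V" "V \<subseteq> S" "inj_on \<xi> V" "open (\<xi> ` V)" "\<sigma> holomorphic_on (\<xi> ` V)"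
    "\<And>x. x \<in> V \<Longrightarrow> \<sigma> (\<xi> x) = x" by (rule local_section[OF assms]) (rule that)
  have "\<forall>\<^sub>F w in nhds (\<xi> \<tau>). w \<in> \<xi> ` V" using V by (intro eventually_nhds_in_open) auto
  then have "\<forall>\<^sub>F w in nhds (\<xi> \<tau>). \<xi> (\<sigma> w) = w" by eventually_elim (use V(7) in auto)
  moreover have "\<sigma> analytic_on {\<xi> \<tau>}" using V by (auto simp: analytic_at)
  ultimately show ?thesis using V(2,7) unfolding is_section_def by blast
qed

lemma section_unique:
  assumes "is_section \<xi> z \<sigma>1" "is_section \<xi> z \<sigma>2" "\<sigma>1 z = \<sigma>2 z"
    and "\<exists>U. open U \<and> \<sigma>1 z \<in> U \<and> inj_on \<xi> U"
  shows "\<forall>\<^sub>F w in nhds z. \<sigma>1 w = \<sigma>2 w"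
proof -
  obtain U where U: "open U" "\<sigma>1 z \<in> U" "inj_on \<xi> U" using assms(4) by blast
  have ev: "\<forall>\<^sub>F w in nhds z. \<sigma> w \<in> U" if sec: "is_section \<xi> z \<sigma>" and "\<sigma> z \<in> U" for \<sigma>
  proof -
    have "isCont \<sigma> z" using sec by (simp add: is_section_def analytic_at_imp_isCont)
    then obtain N where "open N" "z \<in> N" "\<forall>x\<in>N. \<sigma> x \<in> U"
      using U(1) \<open>\<sigma> z \<in> U\<close> unfolding continuous_at_open by blast
    then show ?thesis unfolding eventually_nhds by blast
  qed
  have "\<forall>\<^sub>F w in nhds z. \<xi> (\<sigma>1 w) = w" "\<forall>\<^sub>F w in nhds z. \<xi> (\<sigma>2 w) = w"
    using assms by (auto simp: is_section_def)
  moreover have "\<forall>\<^sub>F w in nhds z. \<sigma>1 w \<in> U" "\<forall>\<^sub>F w in nhds z. \<sigma>2 w \<in> U"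
    using ev assms U by auto
  ultimately show ?thesis
    by eventually_elim (use U(3) in \<open>auto simp: inj_on_def\<close>)
qed

text \<open>
  A path of points in the half-plane is the path of values of a continuation of local inverses.
\<close>

lemma section_continuation:
  assumes \<xi>: "\<xi> holomorphic_on S" "open S" and g: "continuous_on I g" "g ` I \<subseteq> S"
    and d: "\<And>t. t \<in> I \<Longrightarrow> deriv \<xi> (g t) \<noteq> 0"
  obtains \<sigma> where "continuation_on I (\<lambda>t. \<xi> (g t)) \<sigma>" "\<And>t. t \<in> I \<Longrightarrow> is_section \<xi> (\<xi> (g t)) (\<sigma> t)"
    "\<And>t. t \<in> I \<Longrightarrow> \<sigma> t (\<xi> (g t)) = g t"
proof -
  define \<sigma> where "\<sigma> t = (SOME \<sigma>. is_section \<xi> (\<xi> (g t)) \<sigma> \<and> \<sigma> (\<xi> (g t)) = g t)" for t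
  have \<sigma>: "is_section \<xi> (\<xi> (g t)) (\<sigma> t) \<and> \<sigma> t (\<xi> (g t)) = g t" if "t \<in> I" for t
  proof -
    have "\<exists>\<sigma>. is_section \<xi> (\<xi> (g t)) \<sigma> \<and> \<sigma> (\<xi> (g t)) = g t"
      by (rule section_exists[OF \<xi>]) (use g(2) d that in auto)
    then show ?thesis unfolding \<sigma>_def by (rule someI_ex)
  qed
  have "continuation_on I (\<lambda>t. \<xi> (g t)) \<sigma>"
    unfolding continuation_on_def
  proof (intro ballI conjI)
    fix t assume t: "t \<in> I"
    show "\<sigma> t analytic_on {\<xi> (g t)}" using \<sigma>[OF t] by (simp add: is_section_def)
    have gt: "g t \<in> S" using g t by auto
    obtain V \<rho> where V: "open V" "g t \<in> V" "V \<subseteq> S" "inj_on \<xi> V" "open (\<xi> ` V)" "\<rho> holomorphic_on (\<xi> ` V)"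
      "\<And>x. x \<in> V \<Longrightarrow> \<rho> (\<xi> x) = x" by (rule local_section[OF \<xi> gt d[OF t]]) (rule that)
    have \<rho>_sec: "is_section \<xi> z \<rho>" if "z \<in> \<xi> ` V" for z
    proof -
      have "\<forall>\<^sub>F w in nhds z. w \<in> \<xi> ` V" using V that by (intro eventually_nhds_in_open) auto
      then have "\<forall>\<^sub>F w in nhds z. \<xi> (\<rho> w) = w" by eventually_elim (use V(7) in auto)
      then show ?thesis using V that by (auto simp: is_section_def analytic_at)
    qed
    have eq: "\<forall>\<^sub>F z in nhds (\<xi> (g s)). \<sigma> s z = \<rho> z" if "s \<in> I" "g s \<in> V" for s
      by (rule section_unique[OF _ \<rho>_sec]) (use \<sigma> that V in auto)
    have "\<forall>\<^sub>F z in nhds (\<xi> (g t)). \<forall>\<^sub>F w in nhds z. \<sigma> t w = \<rho> w"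
      using eq[OF t V(2)] by (simp only: eventually_eventually)
    then obtain N where N: "open N" "\<xi> (g t) \<in> N" "\<And>z. z \<in> N \<Longrightarrow> \<forall>\<^sub>F w in nhds z. \<sigma> t w = \<rho> w"
      by (auto simp: eventually_nhds)
    have gl: "(g \<longlongrightarrow> g t) (at t within I)" using g t by (auto simp: continuous_on_def)
    have "isCont \<xi> (g t)" using \<xi> gt holomorphic_on_imp_continuous_on continuous_on_eq_continuous_at by blast
    then have "((\<lambda>s. \<xi> (g s)) \<longlongrightarrow> \<xi> (g t)) (at t within I)" using gl by (rule isCont_tendsto_compose)
    then have "\<forall>\<^sub>F s in at t within I. \<xi> (g s) \<in> N" using N(1,2) by (rule topological_tendstoD)
    moreover have "\<forall>\<^sub>F s in at t within I. g s \<in> V" using gl V(1,2) by (rule topological_tendstoD)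
    moreover have "\<forall>\<^sub>F s in at t within I. s \<in> I" by (simp add: eventually_at_filter)
    ultimately show "\<forall>\<^sub>F s in at t within I. \<forall>\<^sub>F z in nhds (\<xi> (g s)). \<sigma> s z = \<sigma> t z"
    proof eventually_elim
      case (elim s)
      show ?case using eq[OF elim(3,2)] N(3)[OF elim(1)] by eventually_elim auto
    qed
  qed
  then show ?thesis using \<sigma> by (intro that[of \<sigma>]) auto
qed

lemma nonconstant_from_pullback:
  assumes "pulls_back (\<lambda>_. 0) \<xi> Q \<tau>" "\<tau> \<in> S" "open S"
  shows "\<not> \<xi> constant_on S"
proof
  assume "\<xi> constant_on S"
  then obtain c where c: "\<And>x. x \<in> S \<Longrightarrow> \<xi> x = c" by (auto simp: constant_on_def)
  have "deriv \<xi> \<tau> = deriv (\<lambda>_. c) \<tau>" by (rule deriv_cong_open[OF assms(3,2) c])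
  then show False using assms(1) by (simp add: pulls_back_def)
qed

lemma countable_preimage:
  assumes "\<xi> holomorphic_on S" "open S" "connected S" "\<not> \<xi> constant_on S" "countable C"
  shows "countable {\<tau>\<in>S. \<xi> \<tau> \<in> C}"
proof -
  have "countable {\<tau>\<in>S. \<xi> \<tau> - c = 0}" for c
  proof (rule holomorphic_countable_zeros[OF _ assms(2,3)])
    obtain C :: "nat \<Rightarrow> complex set" where "\<And>n. compact (C n)" "\<Union>(range C) = S"
      using open_Union_compact_subsets[OF assms(2)] by metis
    then show "fsigma S" unfolding fsigma_Union_compact by (intro exI[of _ C]) auto
    show "\<not> (\<lambda>\<tau>. \<xi> \<tau> - c) constant_on S" using assms(4) unfolding constant_on_def
      by (metis (no_types, opaque_lifting) add.commute diff_add_cancel)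
  qed (use assms in \<open>auto intro!: holomorphic_intros\<close>)
  then have "countable (\<Union>c\<in>C. {\<tau>\<in>S. \<xi> \<tau> - c = 0})" using assms(5) by blast
  then show ?thesis by (rule countable_subset[rotated]) auto
qed

lemma domain_path_connected:
  assumes \<xi>: "\<xi> holomorphic_on \<H>" "\<not> \<xi> constant_on \<H>" and D: "countable (- D)"
  shows "path_connected {\<tau>\<in>\<H>. \<xi> \<tau> \<in> D}"
proof -
  have "countable {\<tau>\<in>\<H>. \<xi> \<tau> \<in> - D}"
    by (rule countable_preimage[OF \<xi>(1) H_props(1,2) \<xi>(2) D])
  then have "path_connected (\<H> - {\<tau>\<in>\<H>. \<xi> \<tau> \<in> - D})"
    by (intro path_connected_open_diff_countable H_props) auto
  also have "\<H> - {\<tau>\<in>\<H>. \<xi> \<tau> \<in> - D} = {\<tau>\<in>\<H>. \<xi> \<tau> \<in> D}" by auto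
  finally show ?thesis .
qed

lemma path_connectedE:
  assumes "path_connected S" "x \<in> S" "y \<in> S"
  obtains p where "path p" "path_image p \<subseteq> S" "p 0 = x" "p 1 = y"
  using assms unfolding path_connected_def pathstart_def pathfinish_def by metis

lemma path_image_in: "path_image g \<subseteq> S \<Longrightarrow> t \<in> {0..1} \<Longrightarrow> g t \<in> S"
  by (auto simp: path_image_def)

lemma continues_to_subpath:
  assumes "continuation_on {0..1} \<gamma> F" "path \<gamma>" "u \<in> {0..1}"
  shows "path (\<lambda>t. \<gamma> (u * t))" "continues_to (\<lambda>t. \<gamma> (u * t)) (F 0) (F u)"
proof -
  have sub: "(\<lambda>t. u * t) ` {0..1} \<subseteq> {0..1}" using assms(3) by (auto intro: mult_le_one)
  have "continuous_on {0..1} (\<lambda>t. \<gamma> (u * t))"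
    by (rule continuous_on_compose2[OF _ _ sub]) (use assms in \<open>auto simp: path_def intro!: continuous_intros\<close>)
  then show p: "path (\<lambda>t. \<gamma> (u * t))" by (simp add: path_def)
  have "continuation_on {0..1} (\<lambda>t. \<gamma> (u * t)) (\<lambda>t. F (u * t))"
    by (rule continuation_on_reparam[OF assms(1) _ sub]) (auto intro!: continuous_intros)
  from continues_toI[OF p this] show "continues_to (\<lambda>t. \<gamma> (u * t)) (F 0) (F u)" by simp
qed

text \<open>
  Along a path from the base point the continued ratio \<open>R\<close> satisfies \<open>\<xi> \<circ> R = id\<close>, by the identity
  theorem for continuations.  So the values of \<open>R\<close> form a lift of the path, and the law of the ratio
  turns into the Schwarzian equation for \<open>\<xi>\<close> along this lift.  Every point of the half-plane over \<open>D\<close>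
  is reached in this way: as \<open>-D\<close> is countable, so are the exceptional points in the half-plane, and a
  path which avoids them leads from the base point to the given one; its image is a path of \<open>D\<close>,
  and the lift of this image is the path itself by uniqueness.
\<close>

theorem fuchsian_inversion_imp_uniformizes:
  assumes D: "open D" "countable (- D)" "Q holomorphic_on D" and fi: "fuchsian_inversion D Q \<xi>"
  shows "uniformizes D Q \<xi>"
proof -
  obtain z0 \<psi>1 \<psi>2 where z0: "z0 \<in> D" and fs: "fundamental_system Q z0 \<psi>1 \<psi>2"
    and inv: "inverts_ratio D z0 \<psi>1 \<psi>2 \<xi>" using fi unfolding fuchsian_inversion_def by blast
  obtain \<epsilon>0 where e0: "\<epsilon>0 > 0" "solves Q (ball z0 \<epsilon>0) \<psi>1" "solves Q (ball z0 \<epsilon>0) \<psi>2"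
    using fs unfolding fundamental_system_def by blast
  obtain \<epsilon>1 where e1: "\<epsilon>1 > 0" "ball z0 \<epsilon>1 \<subseteq> D" using D(1) z0 openE by blast
  define \<epsilon> where "\<epsilon> = min \<epsilon>0 \<epsilon>1"
  have e: "\<epsilon> > 0" "ball z0 \<epsilon> \<subseteq> D" "solves Q (ball z0 \<epsilon>) \<psi>1" "solves Q (ball z0 \<epsilon>) \<psi>2"
    using e0 e1 by (auto simp: \<epsilon>_def elim: solves_subset)
  have hol\<xi>: "\<xi> holomorphic_on \<H>" using inv unfolding inverts_ratio_def by blast
  have val: "\<phi>1 (\<gamma> 1) \<noteq> 0 \<and> \<phi>2 (\<gamma> 1) / \<phi>1 (\<gamma> 1) \<in> \<H> \<and> \<xi> (\<phi>2 (\<gamma> 1) / \<phi>1 (\<gamma> 1)) = \<gamma> 1"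
    if "path \<gamma>" "path_image \<gamma> \<subseteq> D" "\<gamma> 0 = z0" "continues_to \<gamma> \<psi>1 \<phi>1" "continues_to \<gamma> \<psi>2 \<phi>2" for \<gamma> \<phi>1 \<phi>2
    using inv that unfolding inverts_ratio_def Let_def pathstart_def pathfinish_def by blast
  have base: "\<psi>1 w \<noteq> 0 \<and> \<psi>2 w / \<psi>1 w \<in> \<H> \<and> \<xi> (\<psi>2 w / \<psi>1 w) = w" if w: "w \<in> ball z0 \<epsilon>" for w
  proof -
    have seg: "path_image (linepath z0 w) \<subseteq> ball z0 \<epsilon>"
      using w e(1) convex_contains_segment[of "ball z0 \<epsilon>"] by (simp add: path_image_linepath)
    have "continues_to (linepath z0 w) \<psi> \<psi>" if "solves Q (ball z0 \<epsilon>) \<psi>" for \<psi>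
    proof (rule continues_toI[OF path_linepath])
      show "continuation_on {0..1} (linepath z0 w) (\<lambda>_. \<psi>)"
      proof (rule continuation_on_const)
        fix t :: real assume "t \<in> {0..1}"
        then have "linepath z0 w t \<in> ball z0 \<epsilon>" using seg path_image_in by blast
        then show "\<psi> analytic_on {linepath z0 w t}"
          using that unfolding solves_def analytic_at by blast
      qed
    qed
    then have "continues_to (linepath z0 w) \<psi>1 \<psi>1" "continues_to (linepath z0 w) \<psi>2 \<psi>2" using e(3,4) by blast+
    moreover have "path_image (linepath z0 w) \<subseteq> D" using seg e(2) by blast
    moreover have "linepath z0 w 0 = z0" "linepath z0 w 1 = w" by (simp_all add: linepath_0' linepath_1')
    ultimately show ?thesis using val[OF path_linepath, of z0 w \<psi>1 \<psi>2] by simp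
  qed
  have base_nhds: "\<forall>\<^sub>F w in nhds z0. w \<in> ball z0 \<epsilon>" using e(1) by (intro eventually_nhds_in_open) auto
  (* the lift of a path from the base point, by the continued ratio *)
  have follow: "\<exists>g. path g \<and> path_image g \<subseteq> \<H> \<and> g 0 = \<psi>2 z0 / \<psi>1 z0 \<and> (\<forall>t\<in>{0..1}. \<xi> (g t) = \<gamma> t \<and>
      pulls_back (\<lambda>_. 0) \<xi> Q (g t))" if \<gamma>: "path \<gamma>" "path_image \<gamma> \<subseteq> D" "\<gamma> 0 = z0" for \<gamma>
  proof -
    obtain F1 where F1: "continuation_on {0..1} \<gamma> F1" "F1 0 = \<psi>1"
      "\<And>t. t \<in> {0..1} \<Longrightarrow> \<exists>\<epsilon>>0. solves Q (ball (\<gamma> t) \<epsilon>) (F1 t)"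
      by (rule solution_continuation[OF \<gamma>(1,2) D(1,3), of \<epsilon> \<psi>1]) (use e \<gamma>(3) in auto)
    obtain F2 where F2: "continuation_on {0..1} \<gamma> F2" "F2 0 = \<psi>2"
      "\<And>t. t \<in> {0..1} \<Longrightarrow> \<exists>\<epsilon>>0. solves Q (ball (\<gamma> t) \<epsilon>) (F2 t)"
      by (rule solution_continuation[OF \<gamma>(1,2) D(1,3), of \<epsilon> \<psi>2]) (use e \<gamma>(3) in auto)
    define R where "R = (\<lambda>t z. F2 t z / F1 t z)"
    have vt: "F1 t (\<gamma> t) \<noteq> 0 \<and> R t (\<gamma> t) \<in> \<H> \<and> \<xi> (R t (\<gamma> t)) = \<gamma> t" if t: "t \<in> {0..1}" for t
    proof -
      have "path_image (\<lambda>s. \<gamma> (t * s)) \<subseteq> path_image \<gamma>"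
        using t by (auto simp: path_image_def intro!: imageI mult_le_one)
      then show ?thesis
        using val[of "\<lambda>s. \<gamma> (t * s)" "F1 t" "F2 t"] continues_to_subpath[OF F1(1) \<gamma>(1) t]
          continues_to_subpath[OF F2(1) \<gamma>(1) t] \<gamma> F1(2) F2(2) by (auto simp: R_def)
    qed
    have Ran: "R t analytic_on {\<gamma> t}" if "t \<in> {0..1}" for t
      unfolding R_def using that vt F1(1) F2(1) by (auto simp: continuation_on_def intro!: analytic_intros)
    have contR: "continuation_on {0..1} \<gamma> R"
      unfolding R_def by (rule continuation_on_binop[OF F2(1) F1(1)]) (use Ran in \<open>auto simp: R_def\<close>)
    have "continuation_on {0..1} \<gamma> (\<lambda>t z. \<xi> (R t z))"
      by (rule continuation_on_compose[OF contR]) (use vt hol\<xi> H_props(1) in \<open>auto simp: analytic_at\<close>)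
    moreover have "continuation_on {0..1} \<gamma> (\<lambda>t z. z)" by (rule continuation_on_const) (simp add: analytic_on_ident)
    moreover have "\<forall>\<^sub>F z in nhds (\<gamma> 0). \<xi> (R 0 z) = z"
      using base_nhds unfolding \<gamma>(3) by eventually_elim (use base F1 F2 in \<open>auto simp: R_def\<close>)
    ultimately have idR: "\<forall>\<^sub>F z in nhds (\<gamma> t). \<xi> (R t z) = z" if "t \<in> {0..1}" for t
      using that \<gamma>(1) by (intro continuation_on_unique[of "{0..1}" \<gamma> "\<lambda>t z. \<xi> (R t z)" "\<lambda>_ z. z" 0 t])
        (auto simp: path_def)
    have "pulls_back (\<lambda>_. 0) \<xi> Q (R t (\<gamma> t))" if t: "t \<in> {0..1}" for t
    proof -
      obtain r1 r2 where r: "r1 > 0" "solves Q (ball (\<gamma> t) r1) (F1 t)" "r2 > 0" "solves Q (ball (\<gamma> t) r2) (F2 t)"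
        using F1(3)[OF t] F2(3)[OF t] by blast
      have "isCont (F1 t) (\<gamma> t)" using F1(1) t by (auto simp: continuation_on_def analytic_at_imp_isCont)
      then obtain r3 where r3: "r3 > 0" "\<And>z. z \<in> ball (\<gamma> t) r3 \<Longrightarrow> F1 t z \<noteq> 0"
        using vt[OF t] continuous_at_avoid[of "\<gamma> t" "F1 t" 0] by (auto simp: dist_commute)
      define \<rho> where "\<rho> = min r1 (min r2 r3)"
      have \<rho>: "\<rho> > 0" "solves Q (ball (\<gamma> t) \<rho>) (F1 t)" "solves Q (ball (\<gamma> t) \<rho>) (F2 t)"
        "\<And>z. z \<in> ball (\<gamma> t) \<rho> \<Longrightarrow> F1 t z \<noteq> 0"
        using r r3 by (auto simp: \<rho>_def elim: solves_subset)
      have an\<xi>: "\<xi> analytic_on {R t (\<gamma> t)}" using vt[OF t] hol\<xi> H_props(1) by (auto simp: analytic_at)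
      obtain U V where UV: "open U" "\<gamma> t \<in> U" "R t holomorphic_on U" "open V" "\<xi> holomorphic_on V" "R t ` U \<subseteq> V"
        by (rule analytic_compose_nbhd[OF Ran[OF t] an\<xi>]) (rule that)
      have "deriv (\<lambda>z. \<xi> (R t z)) (\<gamma> t) = deriv \<xi> (R t (\<gamma> t)) * deriv (R t) (\<gamma> t)"
        by (rule deriv_compose_three(1)[OF UV(3,1,5,4,6,2)])
      moreover have "deriv (\<lambda>z. \<xi> (R t z)) (\<gamma> t) = deriv (\<lambda>z. z) (\<gamma> t)"
        by (rule deriv_eq_germ[OF idR[OF t]])
      ultimately have "deriv (R t) (\<gamma> t) \<noteq> 0" by auto
      then have pR: "pulls_back Q (R t) (\<lambda>_. 0) (\<gamma> t)" unfolding R_def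
        by (intro pulls_back_ratio[of Q "ball (\<gamma> t) \<rho>"]) (use \<rho> in auto)
      have pid: "pulls_back Q (\<lambda>z. \<xi> (R t z)) Q (\<gamma> t)"
        by (rule pulls_back_cong[OF pulls_back_id]) (use idR[OF t] in \<open>auto elim: eventually_mono\<close>)
      show ?thesis by (rule pulls_back_cancel_inner[OF Ran[OF t] an\<xi> pR pid])
    qed
    moreover have "path (\<lambda>t. R t (\<gamma> t))"
      using continuation_on_continuous[OF contR] \<gamma>(1) by (simp add: path_def)
    ultimately show ?thesis
      using vt F1(2) F2(2) \<gamma>(3) by (intro exI[of _ "\<lambda>t. R t (\<gamma> t)"]) (auto simp: path_image_def R_def)
  qed
  define \<tau>0 where "\<tau>0 = \<psi>2 z0 / \<psi>1 z0"
  have \<tau>0: "\<tau>0 \<in> \<H>" "\<xi> \<tau>0 = z0" using base[of z0] e(1) by (auto simp: \<tau>0_def)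
  have pb0: "pulls_back (\<lambda>_. 0) \<xi> Q \<tau>0"
  proof -
    have "path (\<lambda>_::real. z0)" "path_image (\<lambda>_. z0) \<subseteq> D"
      using z0 by (auto simp: path_def path_image_def)
    from follow[OF this refl] obtain g :: "real \<Rightarrow> complex" where
      g: "g 0 = \<tau>0" "\<forall>t\<in>{0..1}. \<xi> (g t) = z0 \<and> pulls_back (\<lambda>_. 0) \<xi> Q (g t)"
      unfolding \<tau>0_def by (elim exE conjE)
    show ?thesis using bspec[OF g(2), of 0] g(1) by simp
  qed
  have nc: "\<not> \<xi> constant_on \<H>" by (rule nonconstant_from_pullback[OF pb0 \<tau>0(1) H_props(1)])
  define W where "W = {\<tau>\<in>\<H>. \<xi> \<tau> \<in> D}"
  have Wpc: "path_connected W" unfolding W_def by (rule domain_path_connected[OF hol\<xi> nc D(2)])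
  have cont\<xi>: "continuous_on \<H> \<xi>" by (rule holomorphic_on_imp_continuous_on[OF hol\<xi>])
  (* the lift of a path from an arbitrary point, as the second half of a lift from the base point *)
  have reach: "\<exists>g. path g \<and> path_image g \<subseteq> \<H> \<and> g 0 = \<tau> \<and>
      (\<forall>t\<in>{0..1}. \<xi> (g t) = \<gamma> t \<and> pulls_back (\<lambda>_. 0) \<xi> Q (g t))"
    if \<tau>: "\<tau> \<in> W" and \<gamma>: "path \<gamma>" "path_image \<gamma> \<subseteq> D" "\<xi> \<tau> = \<gamma> 0" for \<tau> \<gamma>
  proof -
    obtain p where p: "path p" "path_image p \<subseteq> W" "p 0 = \<tau>0" "p 1 = \<tau>"
      by (rule path_connectedE[OF Wpc, of \<tau>0 \<tau>]) (use \<tau> \<tau>0 z0 in \<open>auto simp: W_def\<close>)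
    have pH: "p t \<in> \<H>" "\<xi> (p t) \<in> D" if "t \<in> {0..1}" for t using path_image_in[OF p(2) that] by (auto simp: W_def)
    have q: "path (\<xi> \<circ> p)"
      by (rule path_continuous_image[OF p(1)]) (rule continuous_on_subset[OF cont\<xi>], use p(2) in \<open>auto simp: W_def\<close>)
    have link: "pathfinish (\<xi> \<circ> p) = pathstart \<gamma>" using \<gamma>(3) p(4) by (simp add: pathfinish_def pathstart_def)
    let ?c = "(\<xi> \<circ> p) +++ \<gamma>"
    have "path ?c" using q \<gamma>(1) link by simp
    moreover have "path_image ?c \<subseteq> D"
      using \<gamma>(2) pH(2) by (intro subset_path_image_join) (auto simp: path_image_def)
    moreover have "?c 0 = z0" using p(3) \<tau>0(2) by (simp add: joinpaths_def)
    ultimately obtain g where g: "path g" "path_image g \<subseteq> \<H>" "g 0 = \<tau>0"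
      "\<And>t. t \<in> {0..1} \<Longrightarrow> \<xi> (g t) = ?c t \<and> pulls_back (\<lambda>_. 0) \<xi> Q (g t)"
      using follow[of ?c] unfolding \<tau>0_def by blast
    have gc: "continuous_on {0..1} g" using g(1) by (simp add: path_def)
    have "g (1/2) = p (2 * (1/2))"
    proof (rule unique_lift[of "{0..1/2}" g "\<lambda>t. p (2 * t)" 0 "1/2" \<xi>])
      show "continuous_on {0..1/2} g" by (rule continuous_on_subset[OF gc]) auto
      show "continuous_on {0..1/2} (\<lambda>t. p (2 * t))"
        by (rule continuous_on_compose2[of "{0..1}" p]) (use p(1) in \<open>auto simp: path_def intro!: continuous_intros\<close>)
      show "\<xi> (g t) = \<xi> (p (2 * t))" if "t \<in> {0..1/2}" for t
        using g(4)[of t] that by (auto simp: joinpaths_def)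
      show "\<exists>U. open U \<and> g t \<in> U \<and> inj_on \<xi> U" if "t \<in> {0..1/2}" for t
        using that g(4)[of t] path_image_in[OF g(2), of t]
        by (intro locally_inj[OF hol\<xi> H_props(1)]) (auto simp: pulls_back_def)
    qed (use p g in auto)
    then have half: "g (1/2) = \<tau>" using p(4) by simp
    have "path (\<lambda>t. g ((t + 1) / 2))" unfolding path_def
      by (rule continuous_on_compose2[OF gc]) (auto intro!: continuous_intros)
    moreover have "\<xi> (g ((t + 1) / 2)) = \<gamma> t" if t: "t \<in> {0..1}" for t
    proof (cases "t = 0")
      case True
      then show ?thesis using half \<gamma>(3) by simp
    next
      case False
      then show ?thesis using g(4)[of "(t + 1) / 2"] t by (auto simp: joinpaths_def field_simps)
    qed
    ultimately show ?thesis using half g(4) path_image_in[OF g(2)]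
      by (intro exI[of _ "\<lambda>t. g ((t + 1) / 2)"]) (auto simp: path_image_def)
  qed
  show ?thesis unfolding uniformizes_def
  proof (intro conjI ballI impI)
    show "\<exists>\<tau>\<in>\<H>. \<xi> \<tau> \<in> D" using \<tau>0 z0 by blast
    show "pulls_back (\<lambda>_. 0) \<xi> Q \<tau>" if \<tau>: "\<tau> \<in> \<H>" "\<xi> \<tau> \<in> D" for \<tau>
    proof -
      have "path (\<lambda>_::real. \<xi> \<tau>)" "path_image (\<lambda>_. \<xi> \<tau>) \<subseteq> D" "\<tau> \<in> W"
        using \<tau> by (auto simp: path_def path_image_def W_def)
      from reach[OF this(3,1,2) refl] obtain g :: "real \<Rightarrow> complex" where
        g: "g 0 = \<tau>" "\<forall>t\<in>{0..1}. \<xi> (g t) = \<xi> \<tau> \<and> pulls_back (\<lambda>_. 0) \<xi> Q (g t)"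
        by (elim exE conjE)
      show ?thesis using bspec[OF g(2), of 0] g(1) by simp
    qed
    show "lifts_paths \<xi> \<H> D" unfolding lifts_paths_def
    proof (intro allI impI, elim conjE)
      fix \<gamma> \<tau> assume *: "path \<gamma>" "path_image \<gamma> \<subseteq> D" "\<tau> \<in> \<H>" "\<xi> \<tau> = \<gamma> 0"
      then have "\<tau> \<in> W" using path_image_in[OF *(2), of 0] by (auto simp: W_def)
      then show "\<exists>g. path g \<and> path_image g \<subseteq> \<H> \<and> g 0 = \<tau> \<and> (\<forall>t\<in>{0..1}. \<xi> (g t) = \<gamma> t)"
        using reach[OF _ *(1,2,4)] by blast
    qed
  qed (rule hol\<xi>)
qed

section \<open>Real Moebius transformations\<close>

lemma matrix_proportional:
  fixes a b c d n11 n12 n21 n22 :: "'a :: idom"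
  assumes "a * d - b * c = 1" "n11 * c = a * n21" "n12 * d = b * n22" "n11 * d + n12 * c = a * n22 + b * n21"
  obtains \<kappa> where "n11 = \<kappa> * a" "n12 = \<kappa> * b" "n21 = \<kappa> * c" "n22 = \<kappa> * d"
proof (rule that[of "n11 * d - b * n21"])
  show "n11 = (n11 * d - b * n21) * a" using assms by algebra
  show "n12 = (n11 * d - b * n21) * b" using assms by algebra
  show "n21 = (n11 * d - b * n21) * c" using assms by algebra
  show "n22 = (n11 * d - b * n21) * d" using assms by algebra
qed

lemma moebius_det1_Im_nonneg:
  assumes W: "\<H> \<subseteq> closure W" and f: "\<And>\<tau>. \<tau> \<in> W \<Longrightarrow> \<exists>\<eta>\<in>\<H>. \<eta> * (c * \<tau> + d) = a * \<tau> + b"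
    and \<tau>: "0 \<le> Im \<tau>"
  shows "0 \<le> Im ((a * \<tau> + b) * cnj (c * \<tau> + d))"
proof -
  let ?k = "\<lambda>\<tau>. Im ((a * \<tau> + b) * cnj (c * \<tau> + d))"
  have "closed {\<tau>. 0 \<le> ?k \<tau>}" by (intro closed_Collect_le continuous_intros)
  moreover have "W \<subseteq> {\<tau>. 0 \<le> ?k \<tau>}"
  proof
    fix \<tau> assume "\<tau> \<in> W"
    then obtain \<eta> where \<eta>: "\<eta> \<in> \<H>" "\<eta> * (c * \<tau> + d) = a * \<tau> + b" using f by blast
    have "(a * \<tau> + b) * cnj (c * \<tau> + d) = \<eta> * of_real ((cmod (c * \<tau> + d))\<^sup>2)"
      unfolding \<eta>(2)[symmetric] complex_norm_square by (simp add: mult.assoc)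
    then have "?k \<tau> = Im \<eta> * (cmod (c * \<tau> + d))\<^sup>2" by (simp only: Im_complex_of_real Re_complex_of_real times_complex.sel)
    then show "\<tau> \<in> {\<tau>. 0 \<le> ?k \<tau>}" using \<eta>(1) by simp
  qed
  ultimately have "closure W \<subseteq> {\<tau>. 0 \<le> ?k \<tau>}" by (rule closure_minimal[rotated])
  moreover have "closure \<H> \<subseteq> closure W" by (rule closure_minimal[OF W closed_closure])
  moreover have "\<tau> \<in> closure \<H>"
  proof -
    have "((\<lambda>n. \<tau> + of_real (inverse (real (Suc n))) * \<i>) \<longlongrightarrow> \<tau> + of_real 0 * \<i>) sequentially"
      by (intro tendsto_intros LIMSEQ_inverse_real_of_nat)
    then show ?thesis unfolding closure_sequential using \<tau>
      by (intro exI[of _ "\<lambda>n. \<tau> + of_real (inverse (real (Suc n))) * \<i>"]) (auto intro!: add_nonneg_pos)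
  qed
  ultimately show ?thesis by blast
qed

text \<open>
  A Moebius transformation which, together with its inverse, maps a dense part of the half-plane into
  the half-plane maps the real line to itself.  So its matrix is proportional to the conjugate matrix; the factor
  \<open>-1\<close> would interchange the half-planes.
\<close>

lemma moebius_preserving_imp_real:
  fixes a b c d :: complex
  assumes det: "a * d - b * c = 1" and W: "W \<subseteq> \<H>" "\<H> \<subseteq> closure W" "W \<noteq> {}"
    and f: "\<And>\<tau>. \<tau> \<in> W \<Longrightarrow> \<exists>\<eta>\<in>\<H>. \<eta> * (c * \<tau> + d) = a * \<tau> + b"
    and f': "\<And>\<tau>. \<tau> \<in> W \<Longrightarrow> \<exists>\<eta>\<in>\<H>. \<eta> * (- c * \<tau> + a) = d * \<tau> + - b"
  shows "a \<in> \<real>" "b \<in> \<real>" "c \<in> \<real>" "d \<in> \<real>"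
proof -
  let ?k = "\<lambda>\<tau>. Im ((a * \<tau> + b) * cnj (c * \<tau> + d))"
  note k = moebius_det1_Im_nonneg[OF W(2) f] and k' = moebius_det1_Im_nonneg[OF W(2) f']
  have sgn_k: "Im ((a * \<tau> + b) / (c * \<tau> + d)) = ?k \<tau> / (cmod (c * \<tau> + d))\<^sup>2" for \<tau>
    by (simp only: complex_div_cnj[of "a * \<tau> + b"] Im_divide_of_real flip: of_real_power)
  have kt: "?k (of_real t) = 0" for t :: real
  proof (rule ccontr)
    assume n0: "?k (of_real t) \<noteq> 0"
    then have pos: "?k (of_real t) > 0" using k[of "of_real t"] by simp
    have den: "c * of_real t + d \<noteq> 0"
    proof
      assume 0: "c * of_real t + d = 0"
      show False using n0 unfolding 0 by simp
    qed
    have "((\<lambda>n. of_real t - of_real (inverse (real (Suc n))) * \<i>) \<longlongrightarrow> of_real t - of_real 0 * \<i>) sequentially"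
      by (intro tendsto_intros LIMSEQ_inverse_real_of_nat)
    then have lim: "((\<lambda>n. of_real t - of_real (inverse (real (Suc n))) * \<i>) \<longlongrightarrow> of_real t) sequentially" by simp
    have "isCont ?k (of_real t)" unfolding isCont_def by (intro tendsto_intros)
    from isCont_tendsto_compose[OF this lim]
    have "\<forall>\<^sub>F n in sequentially. ?k (of_real t - of_real (inverse (real (Suc n))) * \<i>) > 0"
      using pos by (rule order_tendstoD(1))
    moreover have "isCont (\<lambda>\<tau>. c * \<tau> + d) (of_real t)" unfolding isCont_def by (intro tendsto_intros)
    from isCont_tendsto_compose[OF this lim]
    have "\<forall>\<^sub>F n in sequentially. c * (of_real t - of_real (inverse (real (Suc n))) * \<i>) + d \<noteq> 0"
      using den by (rule tendsto_imp_eventually_ne)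
    ultimately have "\<forall>\<^sub>F n in sequentially. ?k (of_real t - of_real (inverse (real (Suc n))) * \<i>) > 0 \<and>
        c * (of_real t - of_real (inverse (real (Suc n))) * \<i>) + d \<noteq> 0" by (rule eventually_conj)
    then obtain n where n: "?k (of_real t - of_real (inverse (real (Suc n))) * \<i>) > 0"
      "c * (of_real t - of_real (inverse (real (Suc n))) * \<i>) + d \<noteq> 0"
      by (auto simp: eventually_sequentially)
    define \<tau> where "\<tau> = of_real t - of_real (inverse (real (Suc n))) * \<i>"
    have \<tau>: "Im \<tau> < 0" "?k \<tau> > 0" "c * \<tau> + d \<noteq> 0" using n by (auto simp: \<tau>_def)
    define \<eta> where "\<eta> = (a * \<tau> + b) / (c * \<tau> + d)"
    have "Im \<eta> > 0" using \<tau> unfolding \<eta>_def sgn_k by simp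
    then have ge: "0 \<le> Im ((d * \<eta> + - b) * cnj (- c * \<eta> + a))" by (intro k') auto
    have e: "- c * \<eta> + a = 1 / (c * \<tau> + d)" "d * \<eta> + - b = \<tau> / (c * \<tau> + d)"
      unfolding \<eta>_def using \<tau>(3) det by (simp_all add: divide_simps) (algebra)+
    have "(d * \<eta> + - b) * cnj (- c * \<eta> + a) = \<tau> / of_real ((cmod (c * \<tau> + d))\<^sup>2)"
      unfolding e complex_norm_square by simp
    then have "Im ((d * \<eta> + - b) * cnj (- c * \<eta> + a)) = Im \<tau> / (cmod (c * \<tau> + d))\<^sup>2"
      by (simp only: Im_divide_of_real)
    moreover have "Im \<tau> / (cmod (c * \<tau> + d))\<^sup>2 < 0" using \<tau> by (simp add: divide_neg_pos)
    ultimately show False using ge by linarith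
  qed
  have re: "z = cnj z" if "Im z = 0" for z using that by (simp add: complex_eq_iff)
  have 0: "b * cnj d = cnj b * d" using re[OF kt[of 0]] by simp
  have 1: "(a + b) * (cnj c + cnj d) = (cnj a + cnj b) * (c + d)" using re[OF kt[of 1]] by simp
  have 2: "(b - a) * (cnj d - cnj c) = (cnj b - cnj a) * (d - c)" using re[OF kt[of "-1"]] by simp
  have 3: "cnj a * c = a * cnj c" using 0 1 2 by algebra
  have 4: "cnj a * d + cnj b * c = a * cnj d + b * cnj c" using 0 1 3 by algebra
  obtain \<kappa> where \<kappa>: "cnj a = \<kappa> * a" "cnj b = \<kappa> * b" "cnj c = \<kappa> * c" "cnj d = \<kappa> * d"
    using matrix_proportional[OF det 3 0[symmetric] 4] .
  have "\<kappa>\<^sup>2 * (a * d - b * c) = cnj (a * d - b * c)" by (simp add: \<kappa> power2_eq_square algebra_simps)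
  then have "\<kappa>\<^sup>2 = 1" using det by simp
  moreover have "\<kappa> \<noteq> -1"
  proof
    assume m: "\<kappa> = -1"
    obtain \<tau> where \<tau>: "\<tau> \<in> W" using W by blast
    have "(a * \<tau> + b) * cnj (c * \<tau> + d) - cnj ((a * \<tau> + b) * cnj (c * \<tau> + d)) = - (a * d - b * c) * (\<tau> - cnj \<tau>)"
      by (simp add: \<kappa> m algebra_simps)
    moreover have "Im z = - Im t" if "z - cnj z = - 1 * (t - cnj t)" for z t :: complex
      using that by (simp add: complex_eq_iff)
    ultimately have "?k \<tau> = - Im \<tau>" unfolding det by blast
    moreover have "Im \<tau> > 0" using \<tau> W(1) by auto
    ultimately show False using k[of \<tau>] by linarith
  qed
  ultimately have "\<kappa> = 1" by (simp add: power2_eq_1_iff)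
  then show "a \<in> \<real>" "b \<in> \<real>" "c \<in> \<real>" "d \<in> \<real>" using \<kappa> by (simp_all add: Reals_cnj_iff)
qed

lemma moebius_denominator_nonzero:
  fixes R :: "real^2^2"
  assumes "det R = 1" "\<tau> \<in> \<H>"
  shows "complex_of_real (R$2$1) * \<tau> + of_real (R$2$2) \<noteq> 0"
proof
  assume "complex_of_real (R$2$1) * \<tau> + of_real (R$2$2) = 0"
  then have "R$2$1 * Im \<tau> = 0" "R$2$1 * Re \<tau> + R$2$2 = 0" by (auto simp: complex_eq_iff)
  then have "R$2$1 = 0" "R$2$2 = 0" using assms(2) by auto
  then show False using assms(1) by (simp add: det_2)
qed

lemma moebius_action_in_H:
  fixes R :: "real^2^2"
  assumes "det R = 1" "\<tau> \<in> \<H>"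
  shows "moebius_action R \<tau> \<in> \<H>"
proof -
  let ?n = "complex_of_real (R$1$1) * \<tau> + of_real (R$1$2)" and ?m = "complex_of_real (R$2$1) * \<tau> + of_real (R$2$2)"
  have "Im (moebius_action R \<tau>) = Im (?n * cnj ?m) / (cmod ?m)\<^sup>2"
    unfolding moebius_action_def complex_div_cnj[of ?n] by (simp only: Im_divide_of_real flip: of_real_power)
  also have "Im (?n * cnj ?m) = det R * Im \<tau>" by (simp add: det_2 algebra_simps)
  finally show ?thesis using assms moebius_denominator_nonzero[OF assms] by simp
qed

lemma moebius_action_mult:
  fixes M N :: "real^2^2"
  assumes "det M = 1" "det N = 1" "\<tau> \<in> \<H>"
  shows "moebius_action (M ** N) \<tau> = moebius_action M (moebius_action N \<tau>)"
proof -
  note d = moebius_denominator_nonzero[OF assms(2,3)]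
    moebius_denominator_nonzero[OF assms(1) moebius_action_in_H[OF assms(2,3)]]
  have dMN: "det (M ** N) = 1" using assms by (simp add: det_mul)
  note d3 = moebius_denominator_nonzero[OF dMN assms(3)]
  show ?thesis using d d3 unfolding moebius_action_def
    by (simp add: matrix_matrix_mult_def sum_2 divide_simps) (simp add: algebra_simps)
qed

lemma moebius_action_holomorphic:
  fixes R :: "real^2^2"
  assumes "det R = 1" shows "moebius_action R holomorphic_on \<H>"
  unfolding moebius_action_def
  by (intro holomorphic_intros) (use moebius_denominator_nonzero[OF assms] in auto)

definition adjugate :: "real^2^2 \<Rightarrow> real^2^2" where
  "adjugate R = (\<chi> i j. if i = 1 then (if j = 1 then R$2$2 else - R$1$2)
                         else (if j = 1 then - R$2$1 else R$1$1))"

lemma adjugate_inverse: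
  fixes R :: "real^2^2"
  assumes "det R = 1"
  shows "R ** adjugate R = mat 1" "adjugate R ** R = mat 1" "matrix_inv R = adjugate R" "det (adjugate R) = 1"
proof -
  show 1: "R ** adjugate R = mat 1" "adjugate R ** R = mat 1"
    using assms by (auto simp: vec_eq_iff forall_2 matrix_matrix_mult_def sum_2 adjugate_def mat_def det_2 algebra_simps)
  show "det (adjugate R) = 1" using assms by (simp add: det_2 adjugate_def mult.commute)
  have "\<exists>B. R ** B = mat 1 \<and> B ** R = mat 1" using 1 by blast
  then have "matrix_inv R ** R = mat 1"
    unfolding matrix_inv_def by (rule someI2_ex) blast
  then have "matrix_inv R ** (R ** adjugate R) = adjugate R" by (simp add: matrix_mul_assoc)
  then show "matrix_inv R = adjugate R" using 1 by simp
qed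

lemma moebius_action_one: "moebius_action (mat 1) \<tau> = \<tau>"
  by (simp add: moebius_action_def mat_def)

lemma moebius_action_agree:
  fixes M N :: "real^2^2"
  assumes "det M = 1" "det N = 1" "open U" "U \<noteq> {}" "U \<subseteq> \<H>"
    and eq: "\<And>\<tau>. \<tau> \<in> U \<Longrightarrow> moebius_action M \<tau> = moebius_action N \<tau>"
    and \<tau>: "\<tau> \<in> \<H>"
  shows "moebius_action M \<tau> = moebius_action N \<tau>"
  by (rule analytic_continuation_open[OF assms(3) H_props(1) assms(4) H_props(2) assms(5)
      moebius_action_holomorphic[OF assms(1)] moebius_action_holomorphic[OF assms(2)] eq \<tau>])

text \<open>The conjugates of the two roots would be roots as well.\<close>

lemma real_quadratic_two_roots:
  fixes p q r :: real
  assumes "of_real p * \<tau>\<^sup>2 + of_real q * \<tau> + of_real r = 0" "of_real p * \<eta>\<^sup>2 + of_real q * \<eta> + of_real r = (0::complex)"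
    and "\<tau> \<in> \<H>" "\<eta> \<in> \<H>" "\<tau> \<noteq> \<eta>"
  shows "p = 0" "q = 0" "r = 0"
proof -
  have "of_real p * (\<tau> - \<eta>) * (\<tau> + \<eta>) + of_real q * (\<tau> - \<eta>) = 0"
    using assms(1,2) by algebra
  then have "(\<tau> - \<eta>) * (of_real p * (\<tau> + \<eta>) + of_real q) = 0" by (simp add: algebra_simps)
  then have 0: "of_real p * (\<tau> + \<eta>) + of_real q = 0" using assms(5) by simp
  then have "p * (Im \<tau> + Im \<eta>) = 0" by (simp add: complex_eq_iff)
  then show p: "p = 0" using assms(3,4) by auto
  show q: "q = 0" using 0 p by simp
  show "r = 0" using assms(1) p q by simp
qed

lemma moebius_action_eq_imp:
  fixes M N :: "real^2^2"
  assumes "det M = 1" "det N = 1" "\<tau> \<in> \<H>" "\<eta> \<in> \<H>" "\<tau> \<noteq> \<eta>"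
    and "moebius_action N \<tau> = moebius_action M \<tau>" "moebius_action N \<eta> = moebius_action M \<eta>"
  shows "N = M \<or> N = - M"
proof -
  define p where "p = N$1$1 * M$2$1 - M$1$1 * N$2$1"
  define q where "q = N$1$1 * M$2$2 + N$1$2 * M$2$1 - M$1$1 * N$2$2 - M$1$2 * N$2$1"
  define r where "r = N$1$2 * M$2$2 - M$1$2 * N$2$2"
  have root: "of_real p * x\<^sup>2 + of_real q * x + of_real r = (0::complex)"
    if "x \<in> \<H>" "moebius_action N x = moebius_action M x" for x
    using that(2) moebius_denominator_nonzero[OF assms(1) that(1)] moebius_denominator_nonzero[OF assms(2) that(1)]
    unfolding moebius_action_def p_def q_def r_def
    by (simp add: frac_eq_eq power2_eq_square algebra_simps)
  have "p = 0" "q = 0" "r = 0"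
    using real_quadratic_two_roots[OF root[OF assms(3,6)] root[OF assms(4,7)] assms(3,4,5)] by auto
  then obtain \<kappa> where \<kappa>: "N$1$1 = \<kappa> * M$1$1" "N$1$2 = \<kappa> * M$1$2" "N$2$1 = \<kappa> * M$2$1" "N$2$2 = \<kappa> * M$2$2"
    using matrix_proportional[of "M$1$1" "M$2$2" "M$1$2" "M$2$1" "N$1$1" "N$2$1" "N$1$2" "N$2$2"] assms(1)
    by (auto simp: p_def q_def r_def det_2)
  have "\<kappa>\<^sup>2 * det M = det N" unfolding det_2 \<kappa> by (simp add: power2_eq_square algebra_simps)
  then have "\<kappa> = 1 \<or> \<kappa> = -1" using assms by (simp add: power2_eq_1_iff)
  then show ?thesis using \<kappa> by (auto simp: vec_eq_iff forall_2)
qed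

section \<open>The deck transformations of a uniformizing function\<close>

locale uniformization =
  fixes D :: "complex set" and Q \<xi> :: "complex \<Rightarrow> complex"
  assumes openD: "open D" and countD: "countable (- D)" and holQ: "Q holomorphic_on D"
    and unif: "uniformizes D Q \<xi>"
begin

definition W where "W = {\<tau>\<in>\<H>. \<xi> \<tau> \<in> D}"

lemma hol\<xi>: "\<xi> holomorphic_on \<H>" using unif by (simp add: uniformizes_def)

lemma cont\<xi>: "continuous_on \<H> \<xi>" by (rule holomorphic_on_imp_continuous_on[OF hol\<xi>])

lemma pb: "\<tau> \<in> W \<Longrightarrow> pulls_back (\<lambda>_. 0) \<xi> Q \<tau>" using unif by (auto simp: uniformizes_def W_def)

lemma deriv_nz: "\<tau> \<in> W \<Longrightarrow> deriv \<xi> \<tau> \<noteq> 0" using pb by (simp add: pulls_back_def)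

lemma W_nonempty: "W \<noteq> {}" using unif by (auto simp: uniformizes_def W_def)

lemma WH: "\<tau> \<in> W \<Longrightarrow> \<tau> \<in> \<H>" "W \<subseteq> \<H>" by (auto simp: W_def)

lemma WD: "\<tau> \<in> W \<Longrightarrow> \<xi> \<tau> \<in> D" by (auto simp: W_def)

lemma nonconst: "\<not> \<xi> constant_on \<H>"
  using W_nonempty nonconstant_from_pullback[OF pb WH(1) H_props(1)] by blast

lemma openW: "open W"
proof -
  have "open (\<H> \<inter> \<xi> -` D)" by (rule continuous_open_preimage[OF cont\<xi> H_props(1) openD])
  also have "\<H> \<inter> \<xi> -` D = W" by (auto simp: W_def)
  finally show ?thesis .
qed

lemma hol\<xi>W: "\<xi> holomorphic_on W" using hol\<xi> WH(2) holomorphic_on_subset by blast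

lemma W_path_connected: "path_connected W"
  unfolding W_def by (rule domain_path_connected[OF hol\<xi> nonconst countD])

lemma W_dense: "\<H> \<subseteq> closure W"
proof
  fix \<tau> assume \<tau>: "\<tau> \<in> \<H>"
  show "\<tau> \<in> closure W"
  proof (rule ccontr)
    assume "\<tau> \<notin> closure W"
    then have "open (\<H> - closure W)" "\<tau> \<in> \<H> - closure W" using \<tau> H_props(1) by (auto simp: open_Diff)
    then obtain r where r: "r > 0" "ball \<tau> r \<subseteq> \<H> - closure W" using openE by blast
    have "countable {\<tau>\<in>\<H>. \<xi> \<tau> \<in> - D}"
      by (rule countable_preimage[OF hol\<xi> H_props(1,2) nonconst countD])
    moreover have "ball \<tau> r \<subseteq> {\<tau>\<in>\<H>. \<xi> \<tau> \<in> - D}"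
      using r(2) closure_subset[of W] by (auto simp: W_def)
    ultimately have "countable (ball \<tau> r)" by (rule countable_subset[rotated])
    then show False using uncountable_ball[OF r(1)] by blast
  qed
qed

lemma lift:
  assumes "path \<gamma>" "path_image \<gamma> \<subseteq> D" "\<tau> \<in> W" "\<xi> \<tau> = \<gamma> 0"
  obtains g where "path g" "path_image g \<subseteq> W" "g 0 = \<tau>" "\<And>t. t \<in> {0..1} \<Longrightarrow> \<xi> (g t) = \<gamma> t"
proof -
  obtain g where g: "path g" "path_image g \<subseteq> \<H>" "g 0 = \<tau>" "\<And>t. t \<in> {0..1} \<Longrightarrow> \<xi> (g t) = \<gamma> t"
    using lifts_pathsE[of \<xi> \<H> D \<gamma> \<tau>] unif assms WH by (auto simp: uniformizes_def)
  have "path_image g \<subseteq> W" using g(2,4) assms(2) by (auto simp: path_image_def W_def)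
  then show ?thesis using g by (intro that[of g])
qed

lemma project:
  assumes "path p" "path_image p \<subseteq> W"
  shows "path (\<lambda>t. \<xi> (p t))" "path_image (\<lambda>t. \<xi> (p t)) \<subseteq> D"
proof -
  have "path (\<xi> \<circ> p)"
    by (rule path_continuous_image[OF assms(1)]) (rule continuous_on_subset[OF cont\<xi>], use assms WH in blast)
  then show "path (\<lambda>t. \<xi> (p t))" by (simp add: o_def)
  show "path_image (\<lambda>t. \<xi> (p t)) \<subseteq> D" using assms(2) WD by (auto simp: path_image_def)
qed

lemma sections_along:
  assumes "path p" "path_image p \<subseteq> W"
  obtains S where "continuation_on {0..1} (\<lambda>t. \<xi> (p t)) S"
    "\<And>t. t \<in> {0..1} \<Longrightarrow> is_section \<xi> (\<xi> (p t)) (S t) \<and> S t (\<xi> (p t)) = p t"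
proof -
  have "continuous_on {0..1} p" "p ` {0..1} \<subseteq> W" using assms by (auto simp: path_def path_image_def)
  moreover have "\<And>t. t \<in> {0..1} \<Longrightarrow> deriv \<xi> (p t) \<noteq> 0" using path_image_in[OF assms(2)] deriv_nz by blast
  ultimately obtain S where "continuation_on {0..1} (\<lambda>t. \<xi> (p t)) S" "\<And>t. t \<in> {0..1} \<Longrightarrow> is_section \<xi> (\<xi> (p t)) (S t)"
    "\<And>t. t \<in> {0..1} \<Longrightarrow> S t (\<xi> (p t)) = p t"
    using section_continuation[OF hol\<xi>W openW, of "{0..1}" p] by metis
  then show ?thesis by (intro that[of S]) auto
qed

lemma section_unique_W:
  assumes "is_section \<xi> z s1" "is_section \<xi> z s2" "s1 z = s2 z" "s1 z \<in> W"
  shows "\<forall>\<^sub>F w in nhds z. s1 w = s2 w"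
  by (rule section_unique[OF assms(1-3)]) (rule locally_inj[OF hol\<xi>W openW assms(4) deriv_nz[OF assms(4)]])

text \<open>
  A Moebius relation between two local inverses at the same point propagates along all paths,
  so that the Moebius transformation maps \<open>W\<close> to itself and preserves \<open>\<xi>\<close>.
\<close>

lemma deck_relation:
  assumes \<tau>01: "\<tau>0 \<in> W" "\<tau>1 \<in> W" "\<xi> \<tau>1 = \<xi> \<tau>0"
    and s: "is_section \<xi> (\<xi> \<tau>0) s0" "s0 (\<xi> \<tau>0) = \<tau>0" "is_section \<xi> (\<xi> \<tau>0) s1" "s1 (\<xi> \<tau>0) = \<tau>1"
    and rel: "\<forall>\<^sub>F z in nhds (\<xi> \<tau>0). s1 z * (c * s0 z + d) = a * s0 z + b"
    and \<tau>: "\<tau> \<in> W"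
  shows "\<exists>\<eta>\<in>W. \<xi> \<eta> = \<xi> \<tau> \<and> \<eta> * (c * \<tau> + d) = a * \<tau> + b"
proof -
  obtain p where p: "path p" "path_image p \<subseteq> W" "p 0 = \<tau>0" "p 1 = \<tau>"
    by (rule path_connectedE[OF W_path_connected \<tau>01(1) \<tau>]) (rule that)
  note pr = project[OF p(1,2)]
  obtain q where q: "path q" "path_image q \<subseteq> W" "q 0 = \<tau>1" "\<And>t. t \<in> {0..1} \<Longrightarrow> \<xi> (q t) = \<xi> (p t)"
    by (rule lift[OF pr \<tau>01(2)]) (use \<tau>01 p in auto)
  obtain Sp where Sp: "continuation_on {0..1} (\<lambda>t. \<xi> (p t)) Sp"
    "\<And>t. t \<in> {0..1} \<Longrightarrow> is_section \<xi> (\<xi> (p t)) (Sp t) \<and> Sp t (\<xi> (p t)) = p t"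
    by (rule sections_along[OF p(1,2)]) (rule that)
  obtain Sq where Sq: "continuation_on {0..1} (\<lambda>t. \<xi> (q t)) Sq"
    "\<And>t. t \<in> {0..1} \<Longrightarrow> is_section \<xi> (\<xi> (q t)) (Sq t) \<and> Sq t (\<xi> (q t)) = q t"
    by (rule sections_along[OF q(1,2)]) (rule that)
  have Sq': "continuation_on {0..1} (\<lambda>t. \<xi> (p t)) Sq"
    using continuation_on_reparam[OF Sq(1), of "{0..1}" "\<lambda>t. t" "\<lambda>t. \<xi> (p t)"] q(4) by auto
  have an: "Sp t analytic_on {\<xi> (p t)}" "Sq t analytic_on {\<xi> (p t)}" if "t \<in> {0..1}" for t
    using that Sp(1) Sq' by (auto simp: continuation_on_def)
  have L: "continuation_on {0..1} (\<lambda>t. \<xi> (p t)) (\<lambda>t z. Sq t z * (c * Sp t z + d))"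
    by (rule continuation_on_binop[OF Sq' Sp(1)]) (use an in \<open>auto intro!: analytic_intros\<close>)
  have R: "continuation_on {0..1} (\<lambda>t. \<xi> (p t)) (\<lambda>t z. a * Sp t z + b)"
    by (rule continuation_on_binop[OF Sp(1) Sp(1)]) (use an in \<open>auto intro!: analytic_intros\<close>)
  have "\<forall>\<^sub>F z in nhds (\<xi> (p 0)). Sp 0 z = s0 z"
    by (rule section_unique_W) (use Sp(2)[of 0] s p \<tau>01 in auto)
  moreover have "\<forall>\<^sub>F z in nhds (\<xi> (p 0)). Sq 0 z = s1 z"
    by (rule section_unique_W) (use Sq(2)[of 0] s p q(3) q(4)[of 0] \<tau>01 in auto)
  moreover have "\<forall>\<^sub>F z in nhds (\<xi> (p 0)). s1 z * (c * s0 z + d) = a * s0 z + b" using rel p(3) by simp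
  ultimately have "\<forall>\<^sub>F z in nhds (\<xi> (p 0)). Sq 0 z * (c * Sp 0 z + d) = a * Sp 0 z + b"
    by eventually_elim auto
  then have "\<forall>\<^sub>F z in nhds (\<xi> (p 1)). Sq 1 z * (c * Sp 1 z + d) = a * Sp 1 z + b"
    using pr(1) by (intro continuation_on_unique[OF L R, of 0 1]) (auto simp: path_def)
  then have "Sq 1 (\<xi> (p 1)) * (c * Sp 1 (\<xi> (p 1)) + d) = a * Sp 1 (\<xi> (p 1)) + b"
    by (rule eventually_nhds_x_imp_x)
  then have "q 1 * (c * \<tau> + d) = a * \<tau> + b"
    using Sp(2)[of 1] Sq(2)[of 1] q(4)[of 1] p(4) by simp
  moreover have "q 1 \<in> W" "\<xi> (q 1) = \<xi> \<tau>" using path_image_in[OF q(2), of 1] q(4)[of 1] p(4) by auto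
  ultimately show ?thesis by blast
qed

text \<open>
  The inverse relation is of the same kind, so that the Moebius transformation and its inverse both map
  \<open>W\<close> to itself; this makes the matrix real.
\<close>

lemma deck_matrix:
  fixes a b c d :: complex
  assumes \<tau>01: "\<tau>0 \<in> W" "\<tau>1 \<in> W" "\<xi> \<tau>1 = \<xi> \<tau>0"
    and s: "is_section \<xi> (\<xi> \<tau>0) s0" "s0 (\<xi> \<tau>0) = \<tau>0" "is_section \<xi> (\<xi> \<tau>0) s1" "s1 (\<xi> \<tau>0) = \<tau>1"
    and rel: "\<forall>\<^sub>F z in nhds (\<xi> \<tau>0). s1 z * (c * s0 z + d) = a * s0 z + b"
    and det: "a * d - b * c = 1"
  obtains R :: "real^2^2" where "det R = 1" "a = of_real (R$1$1)" "b = of_real (R$1$2)" "c = of_real (R$2$1)"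
    "d = of_real (R$2$2)" "moebius_action R \<tau>0 = \<tau>1" "\<And>\<tau>. \<tau> \<in> \<H> \<Longrightarrow> \<xi> (moebius_action R \<tau>) = \<xi> \<tau>"
proof -
  note rel_fwd = deck_relation[OF \<tau>01 s rel]
  have "\<forall>\<^sub>F z in nhds (\<xi> \<tau>0). s0 z * (- c * s1 z + a) = d * s1 z + - b"
    using rel
  proof eventually_elim
    case (elim z)
    have nz: "c * s0 z + d \<noteq> 0"
    proof
      assume 0: "c * s0 z + d = 0"
      then have "a * s0 z + b = 0" using elim by simp
      then show False using 0 det by algebra
    qed
    have "(c * s0 z + d) * (s0 z * (- c * s1 z + a)) = (c * s0 z + d) * (d * s1 z + - b)" using elim det by algebra
    then show ?case using nz by simp
  qed
  then have rel_bwd: "\<exists>\<eta>\<in>W. \<xi> \<eta> = \<xi> \<tau> \<and> \<eta> * (- c * \<tau> + a) = d * \<tau> + - b" if "\<tau> \<in> W" for \<tau>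
    using that \<tau>01 s by (intro deck_relation[of \<tau>1 \<tau>0 s1 s0]) simp_all
  have "a \<in> \<real>" "b \<in> \<real>" "c \<in> \<real>" "d \<in> \<real>"
    using moebius_preserving_imp_real[OF det WH(2) W_dense W_nonempty] rel_fwd rel_bwd WH(1) by blast+
  then obtain ra rb rc rd where r: "a = of_real ra" "b = of_real rb" "c = of_real rc" "d = of_real rd"
    by (auto elim!: Reals_cases)
  define R :: "real^2^2" where "R = (\<chi> i j. if i = 1 then (if j = 1 then ra else rb) else (if j = 1 then rc else rd))"
  have R: "R$1$1 = ra" "R$1$2 = rb" "R$2$1 = rc" "R$2$2 = rd" by (simp_all add: R_def)
  have "complex_of_real (ra * rd - rb * rc) = of_real 1" using det r by simp
  then have detR: "det R = 1" unfolding det_2 R of_real_eq_iff .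
  have act: "moebius_action R \<tau> = \<eta>" if "\<eta> * (c * \<tau> + d) = a * \<tau> + b" "\<tau> \<in> \<H>" for \<tau> \<eta>
    using moebius_denominator_nonzero[OF detR that(2)] that(1)
    unfolding moebius_action_def R r by (simp add: divide_simps)
  have onW: "\<xi> (moebius_action R \<tau>) = \<xi> \<tau>" if "\<tau> \<in> W" for \<tau>
    using rel_fwd[OF that] act WH(1)[OF that] by auto
  have hol: "(\<lambda>\<tau>. \<xi> (moebius_action R \<tau>)) holomorphic_on \<H>"
    using holomorphic_on_compose_gen[OF moebius_action_holomorphic[OF detR] hol\<xi>] moebius_action_in_H[OF detR]
    by (auto simp: o_def)
  have "\<xi> (moebius_action R \<tau>) = \<xi> \<tau>" if "\<tau> \<in> \<H>" for \<tau>
    by (rule analytic_continuation_open[OF openW H_props(1) W_nonempty H_props(2) WH(2) hol hol\<xi> onW that])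
  moreover have "moebius_action R \<tau>0 = \<tau>1"
    using act eventually_nhds_x_imp_x[OF rel] s WH(1)[OF \<tau>01(1)] by simp
  ultimately show ?thesis using detR r R by (intro that[of R]) auto
qed

subsection \<open>Solutions attached to a uniformizing function\<close>

text \<open>
  At a point \<open>\<tau>0\<close> of \<open>W\<close> the local inverse \<open>\<sigma>\<close> of \<open>\<xi>\<close> is the ratio of the solutions \<open>\<psi>\<close> and
  \<open>\<sigma> \<psi>\<close>, where \<open>\<psi>\<^sup>2 = \<xi>' \<circ> \<sigma>\<close>.
\<close>

definition base where
  "base \<tau>0 \<epsilon> \<sigma> \<psi> \<longleftrightarrow> \<epsilon> > 0 \<and> ball (\<xi> \<tau>0) \<epsilon> \<subseteq> D \<and> \<sigma> holomorphic_on ball (\<xi> \<tau>0) \<epsilon> \<and> \<sigma> (\<xi> \<tau>0) = \<tau>0 \<and>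
     (\<forall>z\<in>ball (\<xi> \<tau>0) \<epsilon>. \<sigma> z \<in> W \<and> \<xi> (\<sigma> z) = z \<and> \<psi> z \<noteq> 0 \<and> (\<psi> z)\<^sup>2 = deriv \<xi> (\<sigma> z)) \<and>
     solves Q (ball (\<xi> \<tau>0) \<epsilon>) \<psi> \<and> solves Q (ball (\<xi> \<tau>0) \<epsilon>) (\<lambda>z. \<sigma> z * \<psi> z)"

lemma base_exists:
  assumes \<tau>0: "\<tau>0 \<in> W"
  obtains \<epsilon> \<sigma> \<psi> where "base \<tau>0 \<epsilon> \<sigma> \<psi>"
proof -
  obtain V \<sigma> where V: "open V" "\<tau>0 \<in> V" "V \<subseteq> W" "inj_on \<xi> V" "open (\<xi> ` V)" "\<sigma> holomorphic_on (\<xi> ` V)"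
    "\<And>x. x \<in> V \<Longrightarrow> \<sigma> (\<xi> x) = x" by (rule local_section[OF hol\<xi>W openW \<tau>0 deriv_nz[OF \<tau>0]]) (rule that)
  obtain \<rho> where \<rho>: "\<rho> > 0" "ball \<tau>0 \<rho> \<subseteq> V" using V(1,2) openE by blast
  define U where "U = ball \<tau>0 \<rho>"
  have U: "open U" "\<tau>0 \<in> U" "U \<subseteq> V" "U \<subseteq> W" "contractible U" using \<rho> V(3)
    by (auto simp: U_def convex_imp_contractible)
  have holU: "\<xi> holomorphic_on U" using hol\<xi>W U(4) holomorphic_on_subset by blast
  have injU: "inj_on \<xi> U" using V(4) U(3) inj_on_subset by blast
  obtain r where r: "r holomorphic_on U" "\<And>z. z \<in> U \<Longrightarrow> deriv \<xi> z = (r z)\<^sup>2"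
    using contractible_imp_holomorphic_sqrt[OF holomorphic_deriv[OF holU U(1)] U(5)] deriv_nz U(4) by blast
  have oU: "open (\<xi> ` U)" by (rule open_mapping_thm3[OF holU U(1) injU])
  have s0: "solves (\<lambda>_. 0) U (\<lambda>_. 1)" "solves (\<lambda>_. 0) U (\<lambda>t. t)"
  proof -
    have "deriv (\<lambda>x::complex. x) = (\<lambda>_. 1)" "deriv (\<lambda>x::complex. 1 :: complex) = (\<lambda>_. 0)" by auto
    then show "solves (\<lambda>_. 0) U (\<lambda>_. 1)" "solves (\<lambda>_. 0) U (\<lambda>t. t)" by (simp_all add: solves_def)
  qed
  have ch: "solves Q (\<xi> ` U) \<psi>z" if "solves (\<lambda>_. 0) U f" "\<And>t. t \<in> U \<Longrightarrow> \<psi>z (\<xi> t) = r t * f t" for f \<psi>z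
    using solves_change_variable[OF U(1) holU injU r(1), of \<psi>z f "\<lambda>_. 0" Q] r(2) that pb U(4) by auto
  define \<psi> where "\<psi> z = r (\<sigma> z)" for z
  have \<sigma>U: "\<sigma> (\<xi> t) = t" if "t \<in> U" for t using V(7) U(3) that by auto
  have S1: "solves Q (\<xi> ` U) \<psi>" by (rule ch[OF s0(1)]) (simp add: \<psi>_def \<sigma>U)
  have S2: "solves Q (\<xi> ` U) (\<lambda>z. \<sigma> z * \<psi> z)" by (rule ch[OF s0(2)]) (simp add: \<psi>_def \<sigma>U mult.commute)
  obtain \<epsilon> where e: "\<epsilon> > 0" "ball (\<xi> \<tau>0) \<epsilon> \<subseteq> \<xi> ` U" using oU U(2) by (meson imageI openE)
  have "\<sigma> z \<in> W \<and> \<xi> (\<sigma> z) = z \<and> \<psi> z \<noteq> 0 \<and> (\<psi> z)\<^sup>2 = deriv \<xi> (\<sigma> z)" if z: "z \<in> ball (\<xi> \<tau>0) \<epsilon>" for z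
  proof -
    obtain t where t: "t \<in> U" "z = \<xi> t" using z e(2) by blast
    then have "deriv \<xi> t \<noteq> 0" using deriv_nz U(4) by blast
    then show ?thesis using t \<sigma>U[OF t(1)] r(2)[OF t(1)] U(4) by (auto simp: \<psi>_def)
  qed
  moreover have "\<sigma> holomorphic_on ball (\<xi> \<tau>0) \<epsilon>"
    by (rule holomorphic_on_subset[OF V(6)]) (use e(2) U(3) in blast)
  moreover have "ball (\<xi> \<tau>0) \<epsilon> \<subseteq> D" using e(2) U(4) WD by blast
  ultimately have "base \<tau>0 \<epsilon> \<sigma> \<psi>"
    unfolding base_def using e \<sigma>U[OF U(2)] solves_subset[OF S1 e(2)] solves_subset[OF S2 e(2)] by blast
  then show ?thesis by (rule that)
qed

lemma baseD:
  assumes "base \<tau>0 \<epsilon> \<sigma> \<psi>"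
  shows "\<epsilon> > 0" "ball (\<xi> \<tau>0) \<epsilon> \<subseteq> D" "\<sigma> holomorphic_on ball (\<xi> \<tau>0) \<epsilon>" "\<sigma> (\<xi> \<tau>0) = \<tau>0" "\<tau>0 \<in> W"
    "\<And>z. z \<in> ball (\<xi> \<tau>0) \<epsilon> \<Longrightarrow> \<sigma> z \<in> W" "\<And>z. z \<in> ball (\<xi> \<tau>0) \<epsilon> \<Longrightarrow> \<xi> (\<sigma> z) = z"
    "\<And>z. z \<in> ball (\<xi> \<tau>0) \<epsilon> \<Longrightarrow> \<psi> z \<noteq> 0" "\<And>z. z \<in> ball (\<xi> \<tau>0) \<epsilon> \<Longrightarrow> (\<psi> z)\<^sup>2 = deriv \<xi> (\<sigma> z)"
    "solves Q (ball (\<xi> \<tau>0) \<epsilon>) \<psi>" "solves Q (ball (\<xi> \<tau>0) \<epsilon>) (\<lambda>z. \<sigma> z * \<psi> z)"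
    "is_section \<xi> (\<xi> \<tau>0) \<sigma>" "\<forall>\<^sub>F z in nhds (\<xi> \<tau>0). z \<in> ball (\<xi> \<tau>0) \<epsilon>"
proof -
  show *: "\<epsilon> > 0" "ball (\<xi> \<tau>0) \<epsilon> \<subseteq> D" "\<sigma> holomorphic_on ball (\<xi> \<tau>0) \<epsilon>" "\<sigma> (\<xi> \<tau>0) = \<tau>0"
    "solves Q (ball (\<xi> \<tau>0) \<epsilon>) \<psi>" "solves Q (ball (\<xi> \<tau>0) \<epsilon>) (\<lambda>z. \<sigma> z * \<psi> z)"
    using assms unfolding base_def by simp_all
  show **: "\<sigma> z \<in> W" "\<xi> (\<sigma> z) = z" "\<psi> z \<noteq> 0" "(\<psi> z)\<^sup>2 = deriv \<xi> (\<sigma> z)" if "z \<in> ball (\<xi> \<tau>0) \<epsilon>" for z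
    using assms that unfolding base_def by simp_all
  show "\<tau>0 \<in> W" using **(1)[of "\<xi> \<tau>0"] * by simp
  show ev: "\<forall>\<^sub>F z in nhds (\<xi> \<tau>0). z \<in> ball (\<xi> \<tau>0) \<epsilon>" using *(1) by (intro eventually_nhds_in_open) auto
  show "is_section \<xi> (\<xi> \<tau>0) \<sigma>" unfolding is_section_def
    using ev **(2) *(1,3) by (auto simp: analytic_at_ball elim: eventually_mono)
qed

text \<open>
  Continuation along a path is controlled by its lift: the ratio of the two continued solutions is
  the local inverse at the end of the lift.
\<close>

lemma base_continuation:
  assumes b: "base \<tau>0 \<epsilon> \<sigma> \<psi>" and \<gamma>: "path \<gamma>"
    and g: "path g" "path_image g \<subseteq> W" "g 0 = \<tau>0" "\<And>t. t \<in> {0..1} \<Longrightarrow> \<xi> (g t) = \<gamma> t"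
    and F: "continues_to \<gamma> \<psi> \<phi>1" "continues_to \<gamma> (\<lambda>z. \<sigma> z * \<psi> z) \<phi>2"
  obtains s where "is_section \<xi> (\<gamma> 1) s" "s (\<gamma> 1) = g 1"
    "\<forall>\<^sub>F z in nhds (\<gamma> 1). (\<phi>1 z)\<^sup>2 = deriv \<xi> (s z)" "\<forall>\<^sub>F z in nhds (\<gamma> 1). \<phi>2 z = s z * \<phi>1 z"
proof -
  note b' = baseD[OF b]
  obtain F1 where F1: "continuation_on {0..1} \<gamma> F1" "\<forall>\<^sub>F z in nhds (\<gamma> 0). F1 0 z = \<psi> z"
    "\<forall>\<^sub>F z in nhds (\<gamma> 1). F1 1 z = \<phi>1 z" by (rule continues_toE[OF F(1) \<gamma>]) (rule that)
  obtain F2 where F2: "continuation_on {0..1} \<gamma> F2" "\<forall>\<^sub>F z in nhds (\<gamma> 0). F2 0 z = \<sigma> z * \<psi> z"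
    "\<forall>\<^sub>F z in nhds (\<gamma> 1). F2 1 z = \<phi>2 z" by (rule continues_toE[OF F(2) \<gamma>]) (rule that)
  obtain S where S: "continuation_on {0..1} (\<lambda>t. \<xi> (g t)) S"
    "\<And>t. t \<in> {0..1} \<Longrightarrow> is_section \<xi> (\<xi> (g t)) (S t) \<and> S t (\<xi> (g t)) = g t"
    by (rule sections_along[OF g(1,2)]) (rule that)
  have S': "continuation_on {0..1} \<gamma> S"
    using continuation_on_reparam[OF S(1), of "{0..1}" "\<lambda>t. t" \<gamma>] g(4) by auto
  have \<gamma>0: "\<gamma> 0 = \<xi> \<tau>0" using g(4)[of 0] g(3) by simp
  have \<gamma>c: "continuous_on {0..1} \<gamma>" using \<gamma> by (simp add: path_def)
  have ev0: "\<forall>\<^sub>F z in nhds (\<gamma> 0). z \<in> ball (\<xi> \<tau>0) \<epsilon>" using b'(13) \<gamma>0 by simp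
  have S0: "\<forall>\<^sub>F z in nhds (\<gamma> 0). S 0 z = \<sigma> z"
    unfolding \<gamma>0 by (rule section_unique_W) (use S(2)[of 0] g(3) b' in auto)
  have "continuation_on {0..1} \<gamma> (\<lambda>t z. deriv \<xi> (S t z))"
  proof (rule continuation_on_compose[OF S'])
    fix t :: real assume t: "t \<in> {0..1}"
    have "S t (\<gamma> t) \<in> W" using S(2)[OF t] g(4)[OF t] path_image_in[OF g(2) t] by auto
    then show "deriv \<xi> analytic_on {S t (\<gamma> t)}"
      using holomorphic_deriv[OF hol\<xi>W openW] openW by (auto simp: analytic_at)
  qed
  moreover have "\<forall>\<^sub>F z in nhds (\<gamma> 0). F1 0 z * F1 0 z = deriv \<xi> (S 0 z)"
    using F1(2) S0 ev0 by eventually_elim (use b'(9) in \<open>auto simp: power2_eq_square\<close>)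
  ultimately have 1: "\<forall>\<^sub>F z in nhds (\<gamma> 1). F1 1 z * F1 1 z = deriv \<xi> (S 1 z)"
    by (intro continuation_on_unique[OF continuation_on_mult[OF F1(1) F1(1)] _ \<gamma>c, of _ 0 1]) auto
  have "\<forall>\<^sub>F z in nhds (\<gamma> 0). F2 0 z = S 0 z * F1 0 z"
    using F1(2) F2(2) S0 by eventually_elim auto
  then have 2: "\<forall>\<^sub>F z in nhds (\<gamma> 1). F2 1 z = S 1 z * F1 1 z"
    by (intro continuation_on_unique[OF F2(1) continuation_on_mult[OF S' F1(1)] \<gamma>c, of 0 1]) auto
  show ?thesis
  proof (rule that[of "S 1"])
    show "is_section \<xi> (\<gamma> 1) (S 1)" "S 1 (\<gamma> 1) = g 1" using S(2)[of 1] g(4)[of 1] by auto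
    show "\<forall>\<^sub>F z in nhds (\<gamma> 1). (\<phi>1 z)\<^sup>2 = deriv \<xi> (S 1 z)"
      using 1 F1(3) by eventually_elim (auto simp: power2_eq_square)
    show "\<forall>\<^sub>F z in nhds (\<gamma> 1). \<phi>2 z = S 1 z * \<phi>1 z"
      using 2 F1(3) F2(3) by eventually_elim auto
  qed
qed

lemma section_deriv:
  assumes "is_section \<xi> z s" "s z \<in> W"
  shows "deriv s z * deriv \<xi> (s z) = 1"
proof -
  have an: "s analytic_on {z}" "\<xi> analytic_on {s z}"
    using assms hol\<xi>W openW by (auto simp: is_section_def analytic_at)
  obtain U V where UV: "open U" "z \<in> U" "s holomorphic_on U" "open V" "\<xi> holomorphic_on V" "s ` U \<subseteq> V"
    by (rule analytic_compose_nbhd[OF an]) (rule that)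
  have "deriv \<xi> (s z) * deriv s z = deriv (\<lambda>z. \<xi> (s z)) z"
    by (rule deriv_compose_three(1)[OF UV(3,1,5,4,6,2), symmetric])
  also have "\<dots> = deriv (\<lambda>z. z) z" by (rule deriv_eq_germ) (use assms in \<open>simp add: is_section_def\<close>)
  finally show ?thesis by (simp add: mult.commute)
qed

text \<open>
  The matrix of a continuation along a loop has determinant 1, since \<open>\<psi>\<^sup>2\<close> is the inverse of the
  derivative of the ratio both before and after the continuation.
\<close>

lemma loop_matrix:
  fixes a b c d :: complex
  assumes bs: "base \<tau>0 \<epsilon> \<sigma> \<psi>" and \<gamma>: "path \<gamma>" "\<gamma> 1 = \<xi> \<tau>0"
    and g: "path g" "path_image g \<subseteq> W" "g 0 = \<tau>0" "\<And>t. t \<in> {0..1} \<Longrightarrow> \<xi> (g t) = \<gamma> t"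
    and F: "continues_to \<gamma> \<psi> (\<lambda>z. c * (\<sigma> z * \<psi> z) + d * \<psi> z)"
      "continues_to \<gamma> (\<lambda>z. \<sigma> z * \<psi> z) (\<lambda>z. a * (\<sigma> z * \<psi> z) + b * \<psi> z)"
  obtains R :: "real^2^2" where "det R = 1" "a = of_real (R$1$1)" "b = of_real (R$1$2)" "c = of_real (R$2$1)"
    "d = of_real (R$2$2)" "moebius_action R \<tau>0 = g 1" "\<And>\<tau>. \<tau> \<in> \<H> \<Longrightarrow> \<xi> (moebius_action R \<tau>) = \<xi> \<tau>"
proof -
  note b' = baseD[OF bs]
  obtain s where s: "is_section \<xi> (\<xi> \<tau>0) s" "s (\<xi> \<tau>0) = g 1"
    "\<forall>\<^sub>F z in nhds (\<xi> \<tau>0). (c * (\<sigma> z * \<psi> z) + d * \<psi> z)\<^sup>2 = deriv \<xi> (s z)"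
    "\<forall>\<^sub>F z in nhds (\<xi> \<tau>0). a * (\<sigma> z * \<psi> z) + b * \<psi> z = s z * (c * (\<sigma> z * \<psi> z) + d * \<psi> z)"
    by (rule base_continuation[OF bs \<gamma>(1) g F, unfolded \<gamma>(2)]) (assumption, rule that)
  have g1: "g 1 \<in> W" "\<xi> (g 1) = \<xi> \<tau>0" using path_image_in[OF g(2), of 1] g(4)[of 1] \<gamma>(2) by auto
  have rel: "\<forall>\<^sub>F z in nhds (\<xi> \<tau>0). s z * (c * \<sigma> z + d) = a * \<sigma> z + b"
    using s(4) b'(13)
  proof eventually_elim
    case (elim z)
    have "\<psi> z * (s z * (c * \<sigma> z + d)) = \<psi> z * (a * \<sigma> z + b)" using elim(1) by (simp add: algebra_simps)
    then show ?case using b'(8)[OF elim(2)] by simp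
  qed
  define z0 where "z0 = \<xi> \<tau>0"
  have ball: "z0 \<in> ball (\<xi> \<tau>0) \<epsilon>" using b'(1) by (simp add: z0_def)
  have dsig: "deriv \<sigma> z0 * (\<psi> z0)\<^sup>2 = 1" using section_deriv[OF b'(12)] b'(4,5) b'(9)[OF ball] by (simp add: z0_def)
  have ds: "deriv s z0 * (c * (\<sigma> z0 * \<psi> z0) + d * \<psi> z0)\<^sup>2 = 1"
    using section_deriv[OF s(1)] s(2) g1 eventually_nhds_x_imp_x[OF s(3)] by (simp add: z0_def)
  have an: "\<sigma> analytic_on {z0}" "s analytic_on {z0}" using b'(12) s(1) by (auto simp: is_section_def z0_def)
  then have D: "(\<sigma> has_field_derivative deriv \<sigma> z0) (at z0)" "(s has_field_derivative deriv s z0) (at z0)"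
    by (auto intro: analytic_derivI)
  have "deriv (\<lambda>z. s z * (c * \<sigma> z + d)) z0 = deriv (\<lambda>z. a * \<sigma> z + b) z0"
    by (rule deriv_eq_germ) (use rel in \<open>simp add: z0_def\<close>)
  moreover have "deriv (\<lambda>z. s z * (c * \<sigma> z + d)) z0 = deriv s z0 * (c * \<sigma> z0 + d) + s z0 * (c * deriv \<sigma> z0)"
    by (rule DERIV_imp_deriv) (auto intro!: derivative_eq_intros D)
  moreover have "deriv (\<lambda>z. a * \<sigma> z + b) z0 = a * deriv \<sigma> z0"
    by (rule DERIV_imp_deriv) (auto intro!: derivative_eq_intros D)
  ultimately have e1: "deriv s z0 * (c * \<sigma> z0 + d) + s z0 * (c * deriv \<sigma> z0) = a * deriv \<sigma> z0" by simp
  have e2: "s z0 * (c * \<sigma> z0 + d) = a * \<sigma> z0 + b" using eventually_nhds_x_imp_x[OF rel] by (simp add: z0_def)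
  have e3: "deriv s z0 * (c * \<sigma> z0 + d)\<^sup>2 * (\<psi> z0)\<^sup>2 = 1" using ds by (simp add: algebra_simps power2_eq_square)
  have "a * d - b * c = 1"
  proof -
    have "deriv s z0 * (c * \<sigma> z0 + d)\<^sup>2 = deriv \<sigma> z0 * (a * d - b * c)" using e1 e2 by algebra
    then have "deriv \<sigma> z0 * (\<psi> z0)\<^sup>2 * (a * d - b * c) = 1" using e3 by algebra
    then show ?thesis using dsig by simp
  qed
  then show ?thesis
    using deck_matrix[OF b'(5) g1 b'(12,4) s(1,2) rel] that by blast
qed

lemma solution_span:
  assumes bs: "base \<tau>0 \<epsilon> \<sigma> \<psi>" and f: "solves Q (ball (\<xi> \<tau>0) \<rho>) f" "\<rho> > 0"
  obtains c d where "\<forall>\<^sub>F z in nhds (\<xi> \<tau>0). f z = c * (\<sigma> z * \<psi> z) + d * \<psi> z"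
proof -
  note b' = baseD[OF bs]
  define z0 where "z0 = \<xi> \<tau>0"
  define \<rho>' where "\<rho>' = min \<rho> \<epsilon>"
  have \<rho>': "\<rho>' > 0" "ball z0 \<rho>' \<subseteq> ball (\<xi> \<tau>0) \<rho>" "ball z0 \<rho>' \<subseteq> ball (\<xi> \<tau>0) \<epsilon>"
    using f(2) b'(1) by (auto simp: \<rho>'_def z0_def)
  have z0: "z0 \<in> ball z0 \<rho>'" "z0 \<in> ball (\<xi> \<tau>0) \<epsilon>" using \<rho>' b'(1) by (auto simp: z0_def)
  have sol: "solves Q (ball z0 \<rho>') f" "solves Q (ball z0 \<rho>') \<psi>" "solves Q (ball z0 \<rho>') (\<lambda>z. \<sigma> z * \<psi> z)"
    using solves_subset f(1) b'(10,11) \<rho>'(2,3) by blast+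
  have holp: "\<psi> holomorphic_on ball (\<xi> \<tau>0) \<epsilon>" using b'(10) by (simp add: solves_def)
  note D = holomorphic_deriv_at[OF b'(3) open_ball z0(2)] holomorphic_deriv_at[OF holp open_ball z0(2)]
  let ?s = "\<sigma> z0" and ?s1 = "deriv \<sigma> z0" and ?p = "\<psi> z0" and ?p1 = "deriv \<psi> z0"
  have dsig: "?s1 * ?p\<^sup>2 = 1" using section_deriv[OF b'(12)] b'(4,5) b'(9)[OF z0(2)] by (simp add: z0_def)
  have du: "deriv (\<lambda>z. \<sigma> z * \<psi> z) z0 = ?s1 * ?p + ?s * ?p1"
    by (rule DERIV_imp_deriv) (auto intro!: derivative_eq_intros D)
  define c where "c = deriv f z0 * ?p - f z0 * ?p1"
  define d where "d = f z0 * (?s1 * ?p + ?s * ?p1) - deriv f z0 * (?s * ?p)"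
  have "f z = c * (\<sigma> z * \<psi> z) + d * \<psi> z" if z: "z \<in> ball z0 \<rho>'" for z
  proof (rule solves_unique[of Q "ball z0 \<rho>'", OF sol(1) solves_lincomb[OF sol(3,2) open_ball] _ open_ball _ z0(1) z])
    show "Q holomorphic_on ball z0 \<rho>'" using holQ b'(2) \<rho>'(3) by (meson holomorphic_on_subset order_trans)
    have "c * (?s * ?p) + d * ?p = f z0 * (?s1 * ?p\<^sup>2)" by (simp add: c_def d_def power2_eq_square algebra_simps)
    then show "f z0 = c * (?s * ?p) + d * ?p" using dsig by simp
    have "deriv (\<lambda>z. c * (\<sigma> z * \<psi> z) + d * \<psi> z) z0 = c * (?s1 * ?p + ?s * ?p1) + d * ?p1"
      by (rule DERIV_imp_deriv) (auto intro!: derivative_eq_intros D simp: algebra_simps)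
    also have "\<dots> = deriv f z0 * (?s1 * ?p\<^sup>2)" by (simp add: c_def d_def power2_eq_square algebra_simps)
    finally show "deriv f z0 = deriv (\<lambda>z. c * (\<sigma> z * \<psi> z) + d * \<psi> z) z0" using dsig by simp
  qed auto
  then have "\<forall>\<^sub>F z in nhds (\<xi> \<tau>0). f z = c * (\<sigma> z * \<psi> z) + d * \<psi> z"
    using \<rho>'(1) by (intro eventually_nhds_in_open[THEN eventually_mono, of "ball z0 \<rho>'"]) (auto simp: z0_def)
  then show ?thesis by (rule that)
qed

end

section \<open>Planar surfaces have genus 0\<close>

lemma simple_closed_curve_image:
  assumes C: "simple_closed_curve X C" and j: "continuous_map X euclidean j" "inj_on j (topspace X)"
  obtains p :: "real \<Rightarrow> complex" where "simple_path p" "pathfinish p = pathstart p" "path_image p = j ` C" "C \<subseteq> topspace X"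
proof -
  obtain c where c: "embedding_map (top_of_set (sphere (0::complex) 1)) X c" "C = c ` sphere 0 1"
    using C unfolding simple_closed_curve_def by blast
  have hc: "homeomorphic_map (top_of_set (sphere (0::complex) 1)) (subtopology X (c ` sphere 0 1)) c"
    using c(1) by (simp add: embedding_map_def)
  have cont: "continuous_map (top_of_set (sphere (0::complex) 1)) X c"
    using homeomorphic_imp_continuous_map[OF hc] by (simp add: continuous_map_in_subtopology)
  have inj: "inj_on c (sphere 0 1)" using homeomorphic_imp_injective_map[OF hc] by simp
  have sub: "C \<subseteq> topspace X" using continuous_map_image_subset_topspace[OF cont] c(2) by simp
  have "continuous_map (top_of_set (sphere (0::complex) 1)) euclidean (j \<circ> c)"
    by (rule continuous_map_compose[OF cont j(1)])
  then have cjc: "continuous_on (sphere 0 1) (j \<circ> c)" by simp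
  have ijc: "inj_on (j \<circ> c) (sphere 0 1)"
    by (rule comp_inj_on[OF inj]) (rule inj_on_subset[OF j(2)], use sub c(2) in blast)
  let ?p = "(j \<circ> c) \<circ> circlepath 0 1"
  have pi: "path_image (circlepath 0 1) = sphere (0::complex) 1" by simp
  have "simple_path ?p"
    by (rule simple_path_continuous_image) (use cjc ijc in \<open>simp_all add: simple_path_circlepath\<close>)
  moreover have "pathfinish ?p = pathstart ?p" by (simp add: pathfinish_compose pathstart_compose)
  moreover have "path_image ?p = j ` C" unfolding path_image_compose pi c(2) by (simp add: image_comp)
  ultimately show ?thesis using sub by (rule that)
qed

text \<open>
  By the Jordan curve theorem a simple closed curve separates the plane, and both sides of it
  come arbitrarily close to each of its points, so that they meet every open set around the curve.
\<close>

lemma finite_genus_planar: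
  fixes j :: "'a \<Rightarrow> complex"
  assumes j: "continuous_map X euclidean j" "inj_on j (topspace X)" and op: "open (j ` topspace X)"
  shows "finite_genus X"
  unfolding finite_genus_def
proof (intro exI[of _ 0] allI impI notI, elim conjE)
  fix \<C> assume fin: "finite \<C>" and card: "0 < card \<C>" and disj: "pairwise disjnt \<C>"
    and scc: "\<forall>C\<in>\<C>. simple_closed_curve X C" and con: "connected_space (subtopology X (topspace X - \<Union>\<C>))"
  obtain C where C: "C \<in> \<C>" using card by (metis card_gt_0_iff ex_in_conv)
  obtain p :: "real \<Rightarrow> complex" where p: "simple_path p" "pathfinish p = pathstart p" "path_image p = j ` C" "C \<subseteq> topspace X"
    by (rule simple_closed_curve_image[OF _ j, of C]) (use scc C in blast, rule that)
  define K where "K = j ` C"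
  have J: "open (inside K)" "open (outside K)" "inside K \<inter> outside K = {}" "inside K \<union> outside K = - K"
    "frontier (inside K) = K" "frontier (outside K) = K"
    using Jordan_inside_outside[OF p(1,2)] unfolding p(3) K_def by auto
  have closedC: "closed (j ` C')" and subC: "C' \<subseteq> topspace X" if C': "C' \<in> \<C>" for C'
  proof -
    obtain q :: "real \<Rightarrow> complex" where "simple_path q" "path_image q = j ` C'" "C' \<subseteq> topspace X"
      by (rule simple_closed_curve_image[OF _ j, of C']) (use scc C' in blast, rule that)
    then show "closed (j ` C')" "C' \<subseteq> topspace X"
      using closed_path_image simple_path_imp_path by metis+
  qed
  define V where "V = j ` topspace X - (\<Union>C'\<in>\<C> - {C}. j ` C')"
  have "open V" unfolding V_def
    by (intro open_Diff op closed_UN) (use fin closedC in auto)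
  have KV: "K \<subseteq> V"
  proof
    fix z assume "z \<in> K"
    then obtain x where x: "x \<in> C" "z = j x" by (auto simp: K_def)
    have "z \<notin> j ` C'" if "C' \<in> \<C> - {C}" for C'
    proof
      assume "z \<in> j ` C'"
      then obtain y where y: "y \<in> C'" "j y = j x" using x by auto
      then have "y = x" using j(2) subC[of C'] p(4) x(1) that by (auto dest!: inj_onD)
      then show False using disj C that x(1) y(1) by (auto simp: pairwise_def disjnt_def)
    qed
    then show "z \<in> V" using x p(4) by (auto simp: V_def)
  qed
  have "K \<noteq> {}" using p(3) path_image_nonempty[of p] by (simp add: K_def)
  then obtain z where z: "z \<in> K" by blast
  have meets: "S \<inter> V \<noteq> {}" if "frontier S = K" for S
  proof -
    have "z \<in> closure S" using z that by (auto simp: frontier_def)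
    then show ?thesis using \<open>open V\<close> KV z by (metis closure_iff_nhds_not_empty disjoint_iff interior_open order_refl subsetD)
  qed
  let ?Y = "subtopology X (topspace X - \<Union>\<C>)"
  define E where "E S = {x \<in> topspace ?Y. j x \<in> S}" for S
  have contY: "continuous_map ?Y euclidean j" by (rule continuous_map_from_subtopology[OF j(1)])
  have opE: "openin ?Y (E S)" if "open S" for S
    unfolding E_def using openin_continuous_map_preimage[OF contY] that by simp
  have neE: "E S \<noteq> {}" if S: "frontier S = K" "S \<inter> K = {}" for S
  proof -
    obtain w where w: "w \<in> S" "w \<in> V" using meets[OF S(1)] by blast
    then obtain x where x: "x \<in> topspace X" "w = j x" by (auto simp: V_def)
    have "x \<notin> C'" if "C' \<in> \<C>" for C'
    proof (cases "C' = C")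
      case True
      then show ?thesis using S(2) w(1) x by (auto simp: K_def)
    next
      case False
      then show ?thesis using w(2) x that by (auto simp: V_def)
    qed
    then have "x \<in> E S" using w x by (auto simp: E_def)
    then show ?thesis by blast
  qed
  have "topspace ?Y \<subseteq> E (inside K) \<union> E (outside K)"
  proof
    fix x assume x: "x \<in> topspace ?Y"
    then have "x \<in> topspace X" "x \<notin> C" using C by auto
    then have "j x \<notin> K" using j(2) p(4) by (auto simp: K_def dest!: inj_onD)
    then consider "j x \<in> inside K" | "j x \<in> outside K" using J(4) by blast
    then show "x \<in> E (inside K) \<union> E (outside K)" by cases (use x in \<open>auto simp: E_def\<close>)
  qed
  moreover have "E (inside K) \<inter> E (outside K) = {}" using J(3) unfolding E_def by blast
  moreover have "inside K \<inter> K = {}" "outside K \<inter> K = {}" using J(4) by blast+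
  then have "E (inside K) \<noteq> {}" "E (outside K) \<noteq> {}" using neE[OF J(5)] neE[OF J(6)] by blast+
  ultimately show False using con opE[OF J(1)] opE[OF J(2)] unfolding connected_space_def by blast
qed

section \<open>From uniformizing functions to Fuchsian inversions\<close>

text \<open>The condition under which \<open>\<xi>\<close> separates the orbits of its symmetries.\<close>

definition deck_transitive :: "(complex \<Rightarrow> complex) \<Rightarrow> bool" where
  "deck_transitive \<xi> \<longleftrightarrow> (\<forall>\<tau>1\<in>\<H>. \<forall>\<tau>2\<in>\<H>. \<xi> \<tau>1 = \<xi> \<tau>2 \<longrightarrow>
     (\<exists>R :: real^2^2. det R = 1 \<and> moebius_action R \<tau>1 = \<tau>2 \<and> (\<forall>\<tau>\<in>\<H>. \<xi> (moebius_action R \<tau>) = \<xi> \<tau>)))"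

context uniformization
begin

lemma monodromy_real:
  fixes M :: "complex^2^2"
  assumes bs: "base \<tau>0 \<epsilon> \<sigma> \<psi>" and M: "M \<in> monodromy_group D (\<xi> \<tau>0) \<psi> (\<lambda>z. \<sigma> z * \<psi> z)"
  obtains R :: "real^2^2" where "M = map_matrix of_real R" "det R = 1" "\<And>\<tau>. \<tau> \<in> \<H> \<Longrightarrow> \<xi> (moebius_action R \<tau>) = \<xi> \<tau>"
proof -
  note b' = baseD[OF bs]
  obtain \<gamma> where \<gamma>: "path \<gamma>" "path_image \<gamma> \<subseteq> D" "\<gamma> 0 = \<xi> \<tau>0" "\<gamma> 1 = \<xi> \<tau>0"
    and F: "continues_to \<gamma> \<psi> (\<lambda>z. M$2$1 * (\<sigma> z * \<psi> z) + M$2$2 * \<psi> z)"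
      "continues_to \<gamma> (\<lambda>z. \<sigma> z * \<psi> z) (\<lambda>z. M$1$1 * (\<sigma> z * \<psi> z) + M$1$2 * \<psi> z)"
    using M unfolding monodromy_group_def pathstart_def pathfinish_def by blast
  obtain g where g: "path g" "path_image g \<subseteq> W" "g 0 = \<tau>0" "\<And>t. t \<in> {0..1} \<Longrightarrow> \<xi> (g t) = \<gamma> t"
    by (rule lift[OF \<gamma>(1,2) b'(5)]) (use \<gamma>(3) in simp, rule that)
  obtain R :: "real^2^2" where R: "det R = 1" "M$1$1 = of_real (R$1$1)" "M$1$2 = of_real (R$1$2)" "M$2$1 = of_real (R$2$1)"
    "M$2$2 = of_real (R$2$2)" "moebius_action R \<tau>0 = g 1" "\<And>\<tau>. \<tau> \<in> \<H> \<Longrightarrow> \<xi> (moebius_action R \<tau>) = \<xi> \<tau>"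
    by (rule loop_matrix[OF bs \<gamma>(1,4) g F]) (assumption, rule that)
  have "M = map_matrix of_real R" using R by (simp add: vec_eq_iff forall_2)
  then show ?thesis using R(1,7) by (rule that)
qed

text \<open>
  Every point of the fibre is reached by the monodromy: a path in \<open>W\<close> between two points of the fibre
  projects to a loop, and the continuation along the loop moves one of them to the other.
\<close>

lemma monodromy_exists:
  assumes bs: "base \<tau>0 \<epsilon> \<sigma> \<psi>" and \<tau>1: "\<tau>1 \<in> W" "\<xi> \<tau>1 = \<xi> \<tau>0"
  obtains R :: "real^2^2" where "map_matrix of_real R \<in> monodromy_group D (\<xi> \<tau>0) \<psi> (\<lambda>z. \<sigma> z * \<psi> z)"
    "det R = 1" "moebius_action R \<tau>0 = \<tau>1" "\<And>\<tau>. \<tau> \<in> \<H> \<Longrightarrow> \<xi> (moebius_action R \<tau>) = \<xi> \<tau>"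
proof -
  note b' = baseD[OF bs]
  obtain p where p: "path p" "path_image p \<subseteq> W" "p 0 = \<tau>0" "p 1 = \<tau>1"
    by (rule path_connectedE[OF W_path_connected b'(5) \<tau>1(1)]) (rule that)
  define \<gamma> where "\<gamma> = (\<lambda>t. \<xi> (p t))"
  have \<gamma>: "path \<gamma>" "path_image \<gamma> \<subseteq> D" "\<gamma> 0 = \<xi> \<tau>0" "\<gamma> 1 = \<xi> \<tau>0"
    using project[OF p(1,2)] p(3,4) \<tau>1(2) by (simp_all add: \<gamma>_def)
  have g: "\<And>t. t \<in> {0..1} \<Longrightarrow> \<xi> (p t) = \<gamma> t" by (simp add: \<gamma>_def)
  have ex: "\<exists>c d. continues_to \<gamma> f (\<lambda>z. c * (\<sigma> z * \<psi> z) + d * \<psi> z)" if f: "solves Q (ball (\<xi> \<tau>0) \<epsilon>) f" for f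
  proof -
    obtain F where F: "continuation_on {0..1} \<gamma> F" "F 0 = f" "\<And>t. t \<in> {0..1} \<Longrightarrow> \<exists>\<epsilon>>0. solves Q (ball (\<gamma> t) \<epsilon>) (F t)"
      by (rule solution_continuation[OF \<gamma>(1,2) openD holQ, unfolded \<gamma>(3), OF f b'(1)]) (rule that)
    obtain r where r: "r > 0" "solves Q (ball (\<xi> \<tau>0) r) (F 1)" using F(3)[of 1] \<gamma>(4) by auto
    obtain c d where cd: "\<forall>\<^sub>F z in nhds (\<xi> \<tau>0). F 1 z = c * (\<sigma> z * \<psi> z) + d * \<psi> z"
      by (rule solution_span[OF bs r(2,1)]) (rule that)
    have "continues_to \<gamma> (F 0) (F 1)" by (rule continues_toI[OF \<gamma>(1) F(1)])
    then have "continues_to \<gamma> f (\<lambda>z. c * (\<sigma> z * \<psi> z) + d * \<psi> z)"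
      by (rule continues_to_cong) (use F(2) cd \<gamma>(4) in \<open>simp_all add: pathfinish_def\<close>)
    then show ?thesis by blast
  qed
  obtain c d where cd: "continues_to \<gamma> \<psi> (\<lambda>z. c * (\<sigma> z * \<psi> z) + d * \<psi> z)" using ex[OF b'(10)] by blast
  obtain a b where ab: "continues_to \<gamma> (\<lambda>z. \<sigma> z * \<psi> z) (\<lambda>z. a * (\<sigma> z * \<psi> z) + b * \<psi> z)" using ex[OF b'(11)] by blast
  obtain R :: "real^2^2" where R: "det R = 1" "a = of_real (R$1$1)" "b = of_real (R$1$2)" "c = of_real (R$2$1)"
    "d = of_real (R$2$2)" "moebius_action R \<tau>0 = p 1" "\<And>\<tau>. \<tau> \<in> \<H> \<Longrightarrow> \<xi> (moebius_action R \<tau>) = \<xi> \<tau>"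
    by (rule loop_matrix[OF bs \<gamma>(1,4) p(1-3) g cd ab]) (assumption, rule that)
  have "map_matrix of_real R \<in> monodromy_group D (\<xi> \<tau>0) \<psi> (\<lambda>z. \<sigma> z * \<psi> z)"
    unfolding monodromy_group_def mem_Collect_eq using \<gamma> ab cd R(2-5)
    by (intro exI[of _ \<gamma>]) (simp add: pathstart_def pathfinish_def)
  then show ?thesis using R(1,6,7) p(4) by (intro that[of R]) auto
qed

lemma deck_exists:
  assumes "\<tau>0 \<in> W" "\<tau>1 \<in> W" "\<xi> \<tau>1 = \<xi> \<tau>0"
  obtains R :: "real^2^2" where "det R = 1" "moebius_action R \<tau>0 = \<tau>1" "\<And>\<tau>. \<tau> \<in> \<H> \<Longrightarrow> \<xi> (moebius_action R \<tau>) = \<xi> \<tau>"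
proof -
  obtain \<epsilon> \<sigma> \<psi> where bs: "base \<tau>0 \<epsilon> \<sigma> \<psi>" by (rule base_exists[OF assms(1)]) (rule that)
  show ?thesis by (rule monodromy_exists[OF bs assms(2,3)]) (rule that)
qed

lemma deck_transitive_if_no_exceptions:
  assumes "\<And>\<tau>. \<tau> \<in> \<H> \<Longrightarrow> \<xi> \<tau> \<in> D"
  shows "deck_transitive \<xi>"
  unfolding deck_transitive_def
proof (intro ballI impI)
  fix \<tau>1 \<tau>2 assume "\<tau>1 \<in> \<H>" "\<tau>2 \<in> \<H>" "\<xi> \<tau>1 = \<xi> \<tau>2"
  then have W: "\<tau>1 \<in> W" "\<tau>2 \<in> W" "\<xi> \<tau>2 = \<xi> \<tau>1" using assms by (auto simp: W_def)
  obtain R :: "real^2^2" where "det R = 1" "moebius_action R \<tau>1 = \<tau>2" "\<And>\<tau>. \<tau> \<in> \<H> \<Longrightarrow> \<xi> (moebius_action R \<tau>) = \<xi> \<tau>"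
    by (rule deck_exists[OF W]) (rule that)
  then show "\<exists>R :: real^2^2. det R = 1 \<and> moebius_action R \<tau>1 = \<tau>2 \<and> (\<forall>\<tau>\<in>\<H>. \<xi> (moebius_action R \<tau>) = \<xi> \<tau>)" by blast
qed

text \<open>
  Near the common value \<open>\<xi>\<close> is injective, so that the two transformations agree on an open set.
\<close>

lemma deck_agree:
  fixes M N :: "real^2^2"
  assumes M: "det M = 1" "\<And>\<tau>. \<tau> \<in> \<H> \<Longrightarrow> \<xi> (moebius_action M \<tau>) = \<xi> \<tau>"
    and N: "det N = 1" "\<And>\<tau>. \<tau> \<in> \<H> \<Longrightarrow> \<xi> (moebius_action N \<tau>) = \<xi> \<tau>"
    and \<tau>0: "\<tau>0 \<in> W" "moebius_action M \<tau>0 = moebius_action N \<tau>0" and \<tau>: "\<tau> \<in> \<H>"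
  shows "moebius_action M \<tau> = moebius_action N \<tau>"
proof -
  let ?\<eta> = "moebius_action M \<tau>0"
  have "?\<eta> \<in> \<H>" by (rule moebius_action_in_H[OF M(1) WH(1)[OF \<tau>0(1)]])
  then have \<eta>: "?\<eta> \<in> W" using M(2) WH(1)[OF \<tau>0(1)] WD[OF \<tau>0(1)] by (auto simp: W_def)
  obtain U where U: "open U" "?\<eta> \<in> U" "inj_on \<xi> U" using locally_inj[OF hol\<xi>W openW \<eta> deriv_nz[OF \<eta>]] by blast
  have cont: "continuous_on \<H> (moebius_action M)" "continuous_on \<H> (moebius_action N)"
    using moebius_action_holomorphic M(1) N(1) holomorphic_on_imp_continuous_on by blast+
  define V where "V = (\<H> \<inter> moebius_action M -` U) \<inter> (\<H> \<inter> moebius_action N -` U)"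
  have "open V" unfolding V_def
    by (intro open_Int continuous_open_preimage[OF cont(1) H_props(1) U(1)]
        continuous_open_preimage[OF cont(2) H_props(1) U(1)])
  moreover have "\<tau>0 \<in> V" using U(2) \<tau>0 WH(1) by (auto simp: V_def)
  moreover have "moebius_action M x = moebius_action N x" if "x \<in> V" for x
    using that M(2)[of x] N(2)[of x] U(3) by (auto simp: V_def inj_on_def)
  moreover have "V \<subseteq> \<H>" by (auto simp: V_def)
  ultimately show ?thesis
    by (intro moebius_action_agree[OF M(1) N(1) _ _ _ _ \<tau>, of V]) blast+
qed

text \<open>
  The group is discrete because \<open>\<xi>\<close> is locally injective: an element close to \<open>M\<close> has the same
  values as \<open>M\<close> at two given points.
\<close>

lemma deck_discrete:
  fixes G :: "(real^2^2) set"
  assumes G: "\<And>R. R \<in> G \<Longrightarrow> det R = 1" "\<And>R \<tau>. R \<in> G \<Longrightarrow> \<tau> \<in> \<H> \<Longrightarrow> \<xi> (moebius_action R \<tau>) = \<xi> \<tau>"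
  shows "discrete G"
proof (rule discreteI)
  fix M assume M: "M \<in> G"
  have nb: "\<exists>T. open T \<and> M \<in> T \<and> (\<forall>N\<in>T \<inter> G. moebius_action N \<tau> = moebius_action M \<tau>)" if \<tau>: "\<tau> \<in> W" for \<tau>
  proof -
    let ?\<eta> = "moebius_action M \<tau>"
    have "?\<eta> \<in> \<H>" by (rule moebius_action_in_H[OF G(1)[OF M] WH(1)[OF \<tau>]])
    then have \<eta>: "?\<eta> \<in> W" using G(2)[OF M] WH(1)[OF \<tau>] WD[OF \<tau>] by (auto simp: W_def)
    obtain U where U: "open U" "?\<eta> \<in> U" "inj_on \<xi> U" using locally_inj[OF hol\<xi>W openW \<eta> deriv_nz[OF \<eta>]] by blast
    define A where "A = {N :: real^2^2. complex_of_real (N$2$1) * \<tau> + of_real (N$2$2) \<noteq> 0}"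
    have oA: "open A" unfolding A_def by (intro open_Collect_neq continuous_intros)
    have "continuous_on A (\<lambda>N. moebius_action N \<tau>)"
      unfolding moebius_action_def A_def by (intro continuous_intros) auto
    then have oB: "open (A \<inter> (\<lambda>N. moebius_action N \<tau>) -` U)" by (rule continuous_open_preimage[OF _ oA U(1)])
    have "M \<in> A" using moebius_denominator_nonzero[OF G(1)[OF M] WH(1)[OF \<tau>]] by (simp add: A_def)
    then have MB: "M \<in> A \<inter> (\<lambda>N. moebius_action N \<tau>) -` U" using U(2) by simp
    have "moebius_action N \<tau> = moebius_action M \<tau>" if N: "moebius_action N \<tau> \<in> U" "N \<in> G" for N
    proof (rule inj_onD[OF U(3) _ N(1) U(2)])
      show "\<xi> (moebius_action N \<tau>) = \<xi> (moebius_action M \<tau>)"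
        using G(2)[OF N(2) WH(1)[OF \<tau>]] G(2)[OF M WH(1)[OF \<tau>]] by simp
    qed
    then show ?thesis using oB MB by blast
  qed
  obtain \<tau> where \<tau>: "\<tau> \<in> W" using W_nonempty by blast
  obtain r where "r > 0" "ball \<tau> r \<subseteq> W" using openW \<tau> openE by blast
  then obtain \<eta> where \<eta>: "\<eta> \<in> W" "\<tau> \<noteq> \<eta>"
    by (intro that[of "\<tau> + of_real (r/2)"]) (auto simp: dist_norm intro: subsetD)
  obtain T1 where T1: "open T1" "M \<in> T1" "\<forall>N\<in>T1 \<inter> G. moebius_action N \<tau> = moebius_action M \<tau>" using nb[OF \<tau>] by blast
  obtain T2 where T2: "open T2" "M \<in> T2" "\<forall>N\<in>T2 \<inter> G. moebius_action N \<eta> = moebius_action M \<eta>" using nb[OF \<eta>(1)] by blast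
  (* two points determine the matrix only up to the sign, hence the exclusion of - M *)
  define T where "T = T1 \<inter> T2 - {- M}"
  have "M \<noteq> - M"
  proof
    assume "M = - M"
    then have "M$i$j = - (M$i$j)" for i j by (metis vector_uminus_component)
    then have "M$i$j = 0" for i j by (metis equal_neg_zero)
    then show False using G(1)[OF M] by (simp add: det_2)
  qed
  then have "open T" "M \<in> T" using T1 T2 by (auto simp: T_def open_Diff)
  moreover have "N = M" if "N \<in> T" "N \<in> G" for N
    using moebius_action_eq_imp[OF G(1)[OF M] G(1)[OF that(2)] WH(1)[OF \<tau>] WH(1)[OF \<eta>(1)] \<eta>(2)] T1(3) T2(3) that
    by (auto simp: T_def)
  ultimately show "M isolated_in G" unfolding isolated_in_def using M by blast
qed

text \<open>
  The solutions are \<open>\<psi>\<close> and \<open>\<sigma> \<psi>\<close> at a base point, whose ratio is a local inverse of \<open>\<xi>\<close>.  Since the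
  monodromy group acts transitively on the fibres of \<open>\<xi>\<close>, the orbit space is mapped injectively onto the
  open set \<open>\<xi>(\<H>)\<close> of the plane, and it has genus 0.
\<close>

theorem uniformizes_imp_fuchsian_inversion:
  assumes deck: "deck_transitive \<xi>"
  shows "fuchsian_inversion D Q \<xi>"
proof -
  obtain \<tau>0 where \<tau>0: "\<tau>0 \<in> W" using W_nonempty by blast
  obtain \<epsilon> \<sigma> \<psi> where bs: "base \<tau>0 \<epsilon> \<sigma> \<psi>" by (rule base_exists[OF \<tau>0]) (rule that)
  note b' = baseD[OF bs]
  define z0 where "z0 = \<xi> \<tau>0"
  let ?\<phi> = "\<lambda>z. \<sigma> z * \<psi> z"
  let ?M = "monodromy_group D z0 \<psi> ?\<phi>"
  define G where "G = {R :: real^2^2. map_matrix of_real R \<in> ?M}"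
  have z0: "z0 \<in> D" "z0 \<in> ball (\<xi> \<tau>0) \<epsilon>" using WD[OF \<tau>0] b'(1) by (auto simp: z0_def)
  have fs: "fundamental_system Q z0 \<psi> ?\<phi>" unfolding fundamental_system_def
  proof (intro exI[of _ \<epsilon>] conjI allI impI)
    fix c1 c2 assume z: "\<forall>z\<in>ball z0 \<epsilon>. c1 * \<psi> z + c2 * ?\<phi> z = 0"
    have c: "c1 + c2 * \<sigma> z = 0" if "z \<in> ball z0 \<epsilon>" for z
    proof -
      have "\<psi> z * (c1 + c2 * \<sigma> z) = 0" using z that by (auto simp: algebra_simps)
      then show ?thesis using b'(8)[of z] that by (auto simp: z0_def)
    qed
    define z1 where "z1 = z0 + of_real (\<epsilon> / 2)"
    have z1: "z1 \<in> ball z0 \<epsilon>" "z1 \<noteq> z0" using b'(1) by (auto simp: z1_def dist_norm)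
    have "\<sigma> z1 \<noteq> \<sigma> z0" using b'(7)[of z1] b'(7)[of z0] z1 z0 by (auto simp: z0_def)
    moreover have "c1 + c2 * \<sigma> z0 = 0" using c[of z0] b'(1) by simp
    then have "c2 * (\<sigma> z1 - \<sigma> z0) = 0" using c[OF z1(1)] by algebra
    ultimately show "c2 = 0" by simp
    then show "c1 = 0" using c[of z0] b'(1) by simp
  qed (use b'(1,10,11) in \<open>auto simp: z0_def\<close>)
  have G_props: "det R = 1 \<and> (\<forall>\<tau>\<in>\<H>. \<xi> (moebius_action R \<tau>) = \<xi> \<tau>)" if R: "R \<in> G" for R
  proof -
    obtain R' :: "real^2^2" where "map_matrix of_real R = (map_matrix of_real R' :: complex^2^2)" "det R' = 1"
      "\<And>\<tau>. \<tau> \<in> \<H> \<Longrightarrow> \<xi> (moebius_action R' \<tau>) = \<xi> \<tau>"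
      by (rule monodromy_real[OF bs, of "map_matrix of_real R"]) (use R in \<open>simp add: G_def z0_def\<close>, rule that)
    moreover from this(1) have "R = R'" by (simp add: vec_eq_iff map_matrix_def)
    ultimately show ?thesis by blast
  qed
  have GM: "?M = map_matrix of_real ` G"
  proof (intro equalityI subsetI)
    fix M assume M: "M \<in> ?M"
    obtain R :: "real^2^2" where "M = map_matrix of_real R"
      by (rule monodromy_real[OF bs M[unfolded z0_def]]) (rule that)
    then show "M \<in> map_matrix of_real ` G" using M by (auto simp: G_def)
  qed (auto simp: G_def)
  have GI: "R \<in> G" if "path \<gamma>" "path_image \<gamma> \<subseteq> D" "\<gamma> 0 = z0" "\<gamma> 1 = z0"
    "continues_to \<gamma> ?\<phi> (\<lambda>z. of_real (R$1$1) * ?\<phi> z + of_real (R$1$2) * \<psi> z)"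
    "continues_to \<gamma> \<psi> (\<lambda>z. of_real (R$2$1) * ?\<phi> z + of_real (R$2$2) * \<psi> z)" for R \<gamma>
    unfolding G_def monodromy_group_def mem_Collect_eq using that
    by (intro exI[of _ \<gamma>]) (simp add: pathstart_def pathfinish_def)
  have GE: "\<exists>\<gamma>. path \<gamma> \<and> path_image \<gamma> \<subseteq> D \<and> \<gamma> 0 = z0 \<and> \<gamma> 1 = z0 \<and>
    continues_to \<gamma> ?\<phi> (\<lambda>z. of_real (R$1$1) * ?\<phi> z + of_real (R$1$2) * \<psi> z) \<and>
    continues_to \<gamma> \<psi> (\<lambda>z. of_real (R$2$1) * ?\<phi> z + of_real (R$2$2) * \<psi> z)" if "R \<in> G" for R
    using that unfolding G_def monodromy_group_def mem_Collect_eq pathstart_def pathfinish_def by simp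
  have an: "\<psi> analytic_on {z0}" "?\<phi> analytic_on {z0}"
    using b'(1,10,11) by (auto simp: solves_def analytic_at_ball z0_def)
  have one: "mat 1 \<in> G"
  proof (rule GI[of "linepath z0 z0"])
    show "continues_to (linepath z0 z0) ?\<phi> (\<lambda>z. of_real ((mat 1 :: real^2^2)$1$1) * ?\<phi> z + of_real ((mat 1 :: real^2^2)$1$2) * \<psi> z)"
      using continues_to_trivial[OF an(2)] by (simp add: mat_def)
    show "continues_to (linepath z0 z0) \<psi> (\<lambda>z. of_real ((mat 1 :: real^2^2)$2$1) * ?\<phi> z + of_real ((mat 1 :: real^2^2)$2$2) * \<psi> z)"
      using continues_to_trivial[OF an(1)] by (simp add: mat_def)
  qed (use z0 in \<open>auto simp: linepath_refl path_image_def path_def\<close>)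
  have mult: "M ** N \<in> G" if MN: "M \<in> G" "N \<in> G" for M N
  proof -
    obtain \<gamma> where \<gamma>: "path \<gamma>" "path_image \<gamma> \<subseteq> D" "\<gamma> 0 = z0" "\<gamma> 1 = z0"
      and cM: "continues_to \<gamma> ?\<phi> (\<lambda>z. of_real (M$1$1) * ?\<phi> z + of_real (M$1$2) * \<psi> z)"
      "continues_to \<gamma> \<psi> (\<lambda>z. of_real (M$2$1) * ?\<phi> z + of_real (M$2$2) * \<psi> z)" using GE[OF MN(1)] by blast
    obtain \<delta> where \<delta>: "path \<delta>" "path_image \<delta> \<subseteq> D" "\<delta> 0 = z0" "\<delta> 1 = z0"
      and cN: "continues_to \<delta> ?\<phi> (\<lambda>z. of_real (N$1$1) * ?\<phi> z + of_real (N$1$2) * \<psi> z)"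
      "continues_to \<delta> \<psi> (\<lambda>z. of_real (N$2$1) * ?\<phi> z + of_real (N$2$2) * \<psi> z)" using GE[OF MN(2)] by blast
    have link: "pathfinish \<gamma> = pathstart \<delta>" using \<gamma> \<delta> by (simp add: pathfinish_def pathstart_def)
    note comb = continues_to_joinpaths[OF _ continues_to_lincomb[OF cN \<delta>(1)] \<gamma>(1) \<delta>(1) link]
    have j34: "(\<gamma> +++ \<delta>) 0 = z0" "(\<gamma> +++ \<delta>) 1 = z0" using \<gamma>(3) \<delta>(4) by (simp_all add: joinpaths_def)
    note j = path_join_imp[OF \<gamma>(1) \<delta>(1) link] subset_path_image_join[OF \<gamma>(2) \<delta>(2)] j34
    show ?thesis
    proof (rule GI[OF j])
      show "continues_to (\<gamma> +++ \<delta>) ?\<phi> (\<lambda>z. of_real ((M ** N)$1$1) * ?\<phi> z + of_real ((M ** N)$1$2) * \<psi> z)"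
        by (rule continues_to_cong[OF comb[OF cM(1)]])
          (auto simp: matrix_matrix_mult_def sum_2 algebra_simps intro!: always_eventually)
      show "continues_to (\<gamma> +++ \<delta>) \<psi> (\<lambda>z. of_real ((M ** N)$2$1) * ?\<phi> z + of_real ((M ** N)$2$2) * \<psi> z)"
        by (rule continues_to_cong[OF comb[OF cM(2)]])
          (auto simp: matrix_matrix_mult_def sum_2 algebra_simps intro!: always_eventually)
    qed
  qed
  have inv: "matrix_inv M \<in> G" if M: "M \<in> G" for M
  proof -
    obtain \<gamma> where \<gamma>: "path \<gamma>" "path_image \<gamma> \<subseteq> D" "\<gamma> 0 = z0" "\<gamma> 1 = z0"
      and cM: "continues_to \<gamma> ?\<phi> (\<lambda>z. of_real (M$1$1) * ?\<phi> z + of_real (M$1$2) * \<psi> z)"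
      "continues_to \<gamma> \<psi> (\<lambda>z. of_real (M$2$1) * ?\<phi> z + of_real (M$2$2) * \<psi> z)" using GE[OF M] by blast
    have det: "det M = 1" using G_props[OF M] by blast
    then have det': "of_real (M$1$1) * of_real (M$2$2) - of_real (M$1$2) * of_real (M$2$1) = (1::complex)"
      by (simp add: det_2 flip: of_real_mult of_real_diff)
    note comb = continues_to_lincomb[OF continues_to_reversepath[OF cM(1) \<gamma>(1)] continues_to_reversepath[OF cM(2) \<gamma>(1)]
        path_reversepath[THEN iffD2, OF \<gamma>(1)]]
    have rev12: "path (reversepath \<gamma>)" "path_image (reversepath \<gamma>) \<subseteq> D" using \<gamma>(1,2) by simp_all
    have rev34: "reversepath \<gamma> 0 = z0" "reversepath \<gamma> 1 = z0" using \<gamma>(3,4) by (simp_all add: reversepath_def)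
    note rev = rev12 rev34
    have adj: "adjugate M \<in> G"
    proof (rule GI[OF rev])
      have e: "p * (a * x + b * y) + q * (c * x + d * y) = (p * a + q * c) * x + (p * b + q * d) * y" 
        for p q a b c d x y :: complex by (simp add: algebra_simps)
      show "continues_to (reversepath \<gamma>) ?\<phi> (\<lambda>z. of_real (adjugate M$1$1) * ?\<phi> z + of_real (adjugate M$1$2) * \<psi> z)"
      proof (rule continues_to_cong[OF comb[of "of_real (M$2$2)" "- of_real (M$1$2)"]])
        have "of_real (M$2$2) * of_real (M$1$1) + - of_real (M$1$2) * of_real (M$2$1) = (1::complex)"
          "of_real (M$2$2) * of_real (M$1$2) + - of_real (M$1$2) * of_real (M$2$2) = (0::complex)"
          using det' by (simp_all add: algebra_simps)
        then show "\<forall>\<^sub>F z in nhds (pathstart (reversepath \<gamma>)). of_real (M$2$2) * (of_real (M$1$1) * ?\<phi> z + of_real (M$1$2) * \<psi> z)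
           + - of_real (M$1$2) * (of_real (M$2$1) * ?\<phi> z + of_real (M$2$2) * \<psi> z) = ?\<phi> z"
          unfolding e by simp
      qed (simp add: adjugate_def)
      show "continues_to (reversepath \<gamma>) \<psi> (\<lambda>z. of_real (adjugate M$2$1) * ?\<phi> z + of_real (adjugate M$2$2) * \<psi> z)"
      proof (rule continues_to_cong[OF comb[of "- of_real (M$2$1)" "of_real (M$1$1)"]])
        have "- of_real (M$2$1) * of_real (M$1$1) + of_real (M$1$1) * of_real (M$2$1) = (0::complex)"
          "- of_real (M$2$1) * of_real (M$1$2) + of_real (M$1$1) * of_real (M$2$2) = (1::complex)"
          using det' by (simp_all add: algebra_simps)
        then show "\<forall>\<^sub>F z in nhds (pathstart (reversepath \<gamma>)). - of_real (M$2$1) * (of_real (M$1$1) * ?\<phi> z + of_real (M$1$2) * \<psi> z)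
           + of_real (M$1$1) * (of_real (M$2$1) * ?\<phi> z + of_real (M$2$2) * \<psi> z) = \<psi> z"
          unfolding e by simp
      qed (simp add: adjugate_def)
    qed
    then show ?thesis using adjugate_inverse(3)[OF det] by simp
  qed
  have fg: "fuchsian_group G" unfolding fuchsian_group_def
    using one mult inv G_props deck_discrete[of G] by blast
  (* a deck transformation agrees with an element of G at a point of W, hence everywhere *)
  have orbit_eq: "orbit_of G \<tau>1 = orbit_of G \<tau>2 \<longleftrightarrow> \<xi> \<tau>1 = \<xi> \<tau>2" if \<tau>: "\<tau>1 \<in> \<H>" "\<tau>2 \<in> \<H>" for \<tau>1 \<tau>2
  proof
    assume eq: "orbit_of G \<tau>1 = orbit_of G \<tau>2"
    have "\<tau>1 \<in> orbit_of G \<tau>1" using one moebius_action_one[of \<tau>1] unfolding orbit_of_def by (metis imageI)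
    then have "\<tau>1 \<in> orbit_of G \<tau>2" by (simp only: eq)
    then obtain M where M: "M \<in> G" "\<tau>1 = moebius_action M \<tau>2" unfolding orbit_of_def by (elim imageE)
    show "\<xi> \<tau>1 = \<xi> \<tau>2" unfolding M(2) using G_props[OF M(1)] \<tau>(2) by blast
  next
    have sub: "orbit_of G y \<subseteq> orbit_of G x" if xy: "x \<in> \<H>" "y \<in> \<H>" "\<xi> x = \<xi> y" for x y
    proof
      fix w assume "w \<in> orbit_of G y"
      then obtain N where N: "N \<in> G" "w = moebius_action N y" unfolding orbit_of_def by (elim imageE)
      obtain R :: "real^2^2" where R: "det R = 1" "moebius_action R x = y" "\<forall>\<tau>\<in>\<H>. \<xi> (moebius_action R \<tau>) = \<xi> \<tau>"
        using deck xy unfolding deck_transitive_def by blast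
      define \<tau>1 where "\<tau>1 = moebius_action R \<tau>0"
      have \<tau>1: "\<tau>1 \<in> W" "\<xi> \<tau>1 = \<xi> \<tau>0"
        using moebius_action_in_H[OF R(1) WH(1)[OF \<tau>0]] R(3) WH(1)[OF \<tau>0] WD[OF \<tau>0] by (auto simp: \<tau>1_def W_def)
      obtain R' :: "real^2^2" where R': "map_matrix of_real R' \<in> monodromy_group D (\<xi> \<tau>0) \<psi> ?\<phi>"
        "det R' = 1" "moebius_action R' \<tau>0 = \<tau>1" "\<And>\<tau>. \<tau> \<in> \<H> \<Longrightarrow> \<xi> (moebius_action R' \<tau>) = \<xi> \<tau>"
        by (rule monodromy_exists[OF bs \<tau>1]) (rule that)
      have "R' \<in> G" using R'(1) by (simp add: G_def z0_def)
      have "moebius_action R' x = moebius_action R x"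
        by (rule deck_agree[OF R'(2,4) R(1) _ \<tau>0 _ xy(1)]) (use R(3) R'(3) \<tau>1_def in auto)
      then have "moebius_action R' x = y" using R(2) by simp
      then have "w = moebius_action (N ** R') x"
        using moebius_action_mult[of N R' x] G_props[OF N(1)] R'(2) xy(1) N(2) by simp
      then show "w \<in> orbit_of G x" using mult[OF N(1) \<open>R' \<in> G\<close>] unfolding orbit_of_def by blast
    qed
    assume "\<xi> \<tau>1 = \<xi> \<tau>2"
    then show "orbit_of G \<tau>1 = orbit_of G \<tau>2" using sub[of \<tau>1 \<tau>2] sub[of \<tau>2 \<tau>1] \<tau> by auto
  qed
  have fin: "finite_genus (orbit_space G)"
  proof -
    define j where "j B = \<xi> (SOME \<tau>. \<tau> \<in> \<H> \<and> orbit_of G \<tau> = B)" for B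
    have j: "j (orbit_of G \<tau>) = \<xi> \<tau>" if "\<tau> \<in> \<H>" for \<tau>
    proof -
      have "\<exists>\<tau>'. \<tau>' \<in> \<H> \<and> orbit_of G \<tau>' = orbit_of G \<tau>" using that by blast
      from someI_ex[OF this] show ?thesis unfolding j_def using orbit_eq that by blast
    qed
    have top: "topspace (orbit_space G) = orbit_of G ` \<H>"
    proof -
      have e: "{\<tau> \<in> \<H>. orbit_of G \<tau> \<in> orbit_of G ` \<H>} = \<H>" by auto
      have "openin (orbit_space G) (orbit_of G ` \<H>)" unfolding openin_orbit_space e using H_props(1) by simp
      moreover have "U \<subseteq> orbit_of G ` \<H>" if "openin (orbit_space G) U" for U
        using that by (simp add: openin_orbit_space)
      ultimately show ?thesis unfolding topspace_def by blast
    qed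
    have "continuous_map (orbit_space G) euclidean j" unfolding continuous_map
    proof (intro conjI allI impI)
      fix U :: "complex set" assume U: "openin euclidean U"
      have "{\<tau> \<in> \<H>. orbit_of G \<tau> \<in> {x \<in> topspace (orbit_space G). j x \<in> U}} = \<H> \<inter> \<xi> -` U"
        using j by (auto simp: top)
      moreover have "open (\<H> \<inter> \<xi> -` U)"
        by (rule continuous_open_preimage[OF cont\<xi> H_props(1)]) (use U in simp)
      ultimately show "openin (orbit_space G) {x \<in> topspace (orbit_space G). j x \<in> U}"
        unfolding openin_orbit_space using top by auto
    qed auto
    moreover have "inj_on j (topspace (orbit_space G))"
      unfolding top inj_on_def using j orbit_eq by auto
    moreover have "j ` topspace (orbit_space G) = \<xi> ` \<H>" unfolding top using j by (auto simp: image_iff)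
    moreover have "open (\<xi> ` \<H>)"
      by (rule open_mapping_thm[OF hol\<xi> H_props(1,2,1) subset_refl nonconst])
    ultimately show ?thesis by (intro finite_genus_planar[of _ j]) auto
  qed
  have ir: "inverts_ratio D z0 \<psi> ?\<phi> \<xi>" unfolding inverts_ratio_def
  proof (intro conjI allI impI, rule hol\<xi>, elim conjE)
    fix \<gamma> \<phi>1 \<phi>2 assume \<gamma>: "path \<gamma>" "path_image \<gamma> \<subseteq> D" "pathstart \<gamma> = z0"
      and F: "continues_to \<gamma> \<psi> \<phi>1" "continues_to \<gamma> ?\<phi> \<phi>2"
    obtain g where g: "path g" "path_image g \<subseteq> W" "g 0 = \<tau>0" "\<And>t. t \<in> {0..1} \<Longrightarrow> \<xi> (g t) = \<gamma> t"
      by (rule lift[OF \<gamma>(1,2) \<tau>0]) (use \<gamma>(3) in \<open>simp add: z0_def pathstart_def\<close>, rule that)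
    obtain s where s: "is_section \<xi> (\<gamma> 1) s" "s (\<gamma> 1) = g 1"
      "\<forall>\<^sub>F z in nhds (\<gamma> 1). (\<phi>1 z)\<^sup>2 = deriv \<xi> (s z)" "\<forall>\<^sub>F z in nhds (\<gamma> 1). \<phi>2 z = s z * \<phi>1 z"
      by (rule base_continuation[OF bs \<gamma>(1) g F]) (assumption, rule that)
    have g1: "g 1 \<in> W" "\<xi> (g 1) = \<gamma> 1" using path_image_in[OF g(2), of 1] g(4)[of 1] by auto
    have "(\<phi>1 (\<gamma> 1))\<^sup>2 \<noteq> 0" using eventually_nhds_x_imp_x[OF s(3)] s(2) deriv_nz[OF g1(1)] by simp
    then have nz: "\<phi>1 (\<gamma> 1) \<noteq> 0" by simp
    then have "\<phi>2 (\<gamma> 1) / \<phi>1 (\<gamma> 1) = g 1" using eventually_nhds_x_imp_x[OF s(4)] s(2) by simp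
    then show "let z = pathfinish \<gamma> in \<phi>1 z \<noteq> 0 \<and> \<phi>2 z / \<phi>1 z \<in> \<H> \<and> \<xi> (\<phi>2 z / \<phi>1 z) = z"
      using nz g1 WH(1) unfolding Let_def pathfinish_def by simp
  qed
  show ?thesis unfolding fuchsian_inversion_def
    using z0(1) fs GM fg fin ir by blast
qed

end

section \<open>Regular points of the equation as punctures\<close>

lemma Im_pos_iff_cayley: "0 < Im w \<longleftrightarrow> cmod (w - \<i>) < cmod (w + \<i>)"
  unfolding cmod_def real_sqrt_less_iff by (simp add: power2_eq_square algebra_simps)

text \<open>
  A ratio of two solutions with values in the half-plane outside one point of a disc has its value
  in the half-plane there as well, by the open mapping theorem for its Cayley transform.
\<close>

lemma ratio_fills_puncture:
  assumes sol: "solves Q (ball z r) f1" "solves Q (ball z r) f2" and r: "0 < r"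
    and wr: "f1 z * deriv f2 z - f2 z * deriv f1 z \<noteq> 0"
    and nz: "\<And>w. w \<in> ball z r - {z} \<Longrightarrow> f1 w \<noteq> 0 \<and> 0 < Im (f2 w / f1 w)"
    and inj: "inj_on (\<lambda>w. f2 w / f1 w) (ball z r - {z})"
  shows "f1 z \<noteq> 0" "0 < Im (f2 z / f1 z)"
proof -
  have hol: "f1 holomorphic_on ball z r" "f2 holomorphic_on ball z r" using sol by (auto simp: solves_def)
  define N where "N w = f2 w - \<i> * f1 w" for w
  define M where "M w = f2 w + \<i> * f1 w" for w
  have holNM: "N holomorphic_on ball z r" "M holomorphic_on ball z r"
    unfolding N_def M_def using hol by (auto intro!: holomorphic_intros)
  have cay: "cmod (N w) < cmod (M w) \<longleftrightarrow> 0 < Im (f2 w / f1 w)" if "f1 w \<noteq> 0" for w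
  proof -
    have "N w = f1 w * (f2 w / f1 w - \<i>)" "M w = f1 w * (f2 w / f1 w + \<i>)"
      using that by (simp_all add: N_def M_def field_simps)
    then show ?thesis using that by (simp add: norm_mult Im_pos_iff_cayley)
  qed
  have less: "cmod (N w) < cmod (M w)" if "w \<in> ball z r - {z}" for w using nz[OF that] cay by blast
  have zb: "z \<in> ball z r" using r by simp
  have punct: "\<forall>\<^sub>F w in at z. w \<in> ball z r - {z}"
    using eventually_at_ball'[OF r, of z UNIV] by (auto elim: eventually_mono)
  have "isCont N z" "isCont M z"
    using holNM zb holomorphic_on_imp_continuous_on continuous_on_eq_continuous_at open_ball by blast+
  then have "((\<lambda>w. cmod (M w)) \<longlongrightarrow> cmod (M z)) (at z)" "((\<lambda>w. cmod (N w)) \<longlongrightarrow> cmod (N z)) (at z)"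
    by (auto simp: isCont_def intro: tendsto_norm)
  then have le: "cmod (N z) \<le> cmod (M z)"
    by (rule tendsto_le[OF at_neq_bot]) (use punct in \<open>eventually_elim, use less in force\<close>)
  have Mz: "M z \<noteq> 0"
  proof
    assume "M z = 0"
    then have "M z = 0" "N z = 0" using le by auto
    moreover have "2 * f2 z = M z + N z" "2 * (\<i> * f1 z) = M z - N z" by (simp_all add: M_def N_def)
    ultimately have "f1 z = 0" "f2 z = 0" by auto
    then show False using wr by simp
  qed
  have M0: "M w \<noteq> 0" if "w \<in> ball z r" for w
    using less[of w] Mz that by (cases "w = z") auto
  define h where "h w = N w / M w" for w
  have holh: "h holomorphic_on ball z r" unfolding h_def using holNM M0 by (intro holomorphic_intros)
  have "\<not> h constant_on ball z r"
  proof
    assume "h constant_on ball z r"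
    then obtain c where c: "\<And>w. w \<in> ball z r \<Longrightarrow> N w = c * M w"
      using M0 unfolding constant_on_def h_def by (metis nonzero_eq_divide_eq)
    define w1 where "w1 = z + of_real (r / 2)" define w2 where "w2 = z + of_real (r / 3)"
    have w: "w1 \<in> ball z r - {z}" "w2 \<in> ball z r - {z}" "w1 \<noteq> w2" using r by (auto simp: w1_def w2_def dist_norm)
    have rat: "(1 - c) * (f2 w / f1 w) = \<i> * (1 + c)" if "w \<in> ball z r - {z}" for w
    proof -
      have "(1 - c) * f2 w = \<i> * (1 + c) * f1 w" using c[of w] that by (simp add: N_def M_def algebra_simps)
      then show ?thesis using nz[OF that] by (simp add: field_simps)
    qed
    have "c \<noteq> 1" using rat[OF w(1)] by auto
    then have "f2 w1 / f1 w1 = f2 w2 / f1 w2" using rat[OF w(1)] rat[OF w(2)]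
      by (metis mult_cancel_left right_minus_eq)
    then show False using inj w by (auto simp: inj_on_def)
  qed
  then have "open (h ` ball z r)" by (intro open_mapping_thm[OF holh open_ball connected_ball open_ball subset_refl])
  moreover have "h ` ball z r \<subseteq> cball 0 1"
  proof
    fix y assume "y \<in> h ` ball z r"
    then obtain w where w: "w \<in> ball z r" "y = h w" by blast
    have "cmod (N w) \<le> cmod (M w)" using less[of w] le w(1) by (cases "w = z") auto
    then show "y \<in> cball 0 1" using M0[OF w(1)] w(2) by (simp add: h_def norm_divide)
  qed
  ultimately have "h ` ball z r \<subseteq> interior (cball 0 1)" by (intro interior_maximal)
  then have "h ` ball z r \<subseteq> ball 0 1" by simp
  then have "cmod (h z) < 1" using zb by force
  then have lz: "cmod (N z) < cmod (M z)" using Mz by (simp add: h_def norm_divide)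
  show "f1 z \<noteq> 0" using lz by (auto simp: N_def M_def)
  then show "0 < Im (f2 z / f1 z)" using lz cay by blast
qed

text \<open>
  Near a point \<open>z\<close> of \<open>D\<close> the two solutions that belong to a local inverse are single-valued, as the
  potential is regular at \<open>z\<close>.  Their ratio is a local inverse in the punctured disc, and by the previous
  lemma it extends to \<open>z\<close> with a value in the half-plane.  So local inverses extend to discs of a size that
  depends on \<open>z\<close> only, and paths through \<open>z\<close> can be lifted.
\<close>

lemma uniformizes_fill_punctures:
  assumes u: "uniformizes D' Q \<xi>" and D': "open D'" "countable (- D')" and D: "open D" "D' \<subseteq> D" "Q holomorphic_on D"
    and iso: "\<And>z. z \<in> D \<Longrightarrow> \<exists>r>0. ball z r \<subseteq> D \<and> ball z r - {z} \<subseteq> D'"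
    and pbD: "\<And>\<tau>. \<tau> \<in> \<H> \<Longrightarrow> \<xi> \<tau> \<in> D \<Longrightarrow> pulls_back (\<lambda>_. 0) \<xi> Q \<tau>"
  shows "uniformizes D Q \<xi>"
proof -
  have "Q holomorphic_on D'" using D holomorphic_on_subset by blast
  then interpret U: uniformization D' Q \<xi> by unfold_locales (use u D' in auto)
  define A where "A z f \<longleftrightarrow> is_section \<xi> z f \<and> f z \<in> \<H>" for z f
  have ext: "\<exists>r>0. \<forall>z'\<in>ball z r. \<forall>f. A z' f \<longrightarrow>
      (\<exists>g. g holomorphic_on ball z r \<and> (\<forall>w\<in>ball z r. A w g) \<and> (\<forall>\<^sub>F w in nhds z'. f w = g w))"
    if z: "z \<in> D" for z
  proof -
    obtain r0 where r0: "r0 > 0" "ball z r0 \<subseteq> D" "ball z r0 - {z} \<subseteq> D'" using iso[OF z] by blast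
    have "Q holomorphic_on ball z r0" using D(3) r0(2) holomorphic_on_subset by blast
    then obtain r where r: "0 < r" "r \<le> r0"
      "\<And>z1 c0 c1. z1 \<in> ball z r \<Longrightarrow> \<exists>f. solves Q (ball z r) f \<and> f z1 = c0 \<and> deriv f z1 = c1"
      by (rule linear_ode_local[OF _ r0(1)]) (rule that)
    have rD: "ball z r - {z} \<subseteq> D'" "Q holomorphic_on ball z r"
    proof -
      have "ball z r \<subseteq> ball z r0" using r(2) by (rule subset_ball)
      then show "ball z r - {z} \<subseteq> D'" "Q holomorphic_on ball z r"
        using r0(2,3) D(3) holomorphic_on_subset by blast+
    qed
    have "\<exists>g. g holomorphic_on ball z r \<and> (\<forall>w\<in>ball z r. A w g) \<and> (\<forall>\<^sub>F w in nhds z'. f w = g w)"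
      if z': "z' \<in> ball z r" and f: "A z' f" for z' f
    proof -
      have fan: "f analytic_on {z'}" and fsec: "\<forall>\<^sub>F w in nhds z'. \<xi> (f w) = w" and fH: "f z' \<in> \<H>"
        using f by (auto simp: A_def is_section_def)
      obtain e1 where e1: "e1 > 0" "f holomorphic_on ball z' e1" using fan analytic_at_ball by blast
      have "isCont f z'" using fan by (rule analytic_at_imp_isCont)
      then obtain N1 where N1: "open N1" "z' \<in> N1" "\<forall>w\<in>N1. f w \<in> \<H>"
        using fH H_props(1) unfolding continuous_at_open by blast
      obtain N2 where N2: "open N2" "z' \<in> N2" "\<forall>w\<in>N2. \<xi> (f w) = w" using fsec by (auto simp: eventually_nhds)
      have "open (ball z' e1 \<inter> N1 \<inter> N2 \<inter> ball z r)" using N1 N2 by auto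
      moreover have "z' \<in> ball z' e1 \<inter> N1 \<inter> N2 \<inter> ball z r" using N1 N2 e1 z' by auto
      ultimately obtain e where e: "e > 0" "ball z' e \<subseteq> ball z' e1 \<inter> N1 \<inter> N2 \<inter> ball z r" using openE by blast
      have holf: "f holomorphic_on ball z' e" using e1(2) e(2) by (meson holomorphic_on_subset le_inf_iff)
      have fe: "f w \<in> \<H>" "\<xi> (f w) = w" "w \<in> ball z r" if "w \<in> ball z' e" for w
        using that e(2) N1(3) N2(3) by auto
      obtain z1 where z1: "z1 \<in> ball z' e" "z1 \<noteq> z"
      proof (cases "z' = z")
        case True
        then show ?thesis using e(1) by (intro that[of "z' + of_real (e / 2)"]) (auto simp: dist_norm)
      next
        case False
        then show ?thesis using e(1) by (intro that[of z']) auto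
      qed
      have z1D: "z1 \<in> D'" "z1 \<in> ball z r" using fe(3)[OF z1(1)] z1(2) rD(1) by auto
      define \<tau>1 where "\<tau>1 = f z1"
      have \<tau>1: "\<tau>1 \<in> U.W" "\<xi> \<tau>1 = z1" using fe[OF z1(1)] z1D by (auto simp: \<tau>1_def U.W_def)
      obtain \<epsilon> \<sigma> \<psi> where bs: "U.base \<tau>1 \<epsilon> \<sigma> \<psi>" by (rule U.base_exists[OF \<tau>1(1)]) (rule that)
      note b' = U.baseD[OF bs, unfolded \<tau>1(2)]
      have extend: "\<exists>\<Psi>. solves Q (ball z r) \<Psi> \<and> (\<forall>\<^sub>F w in nhds z1. \<Psi> w = \<phi> w)" if \<phi>: "solves Q (ball z1 \<epsilon>) \<phi>" for \<phi>
      proof -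
        obtain \<Psi> where \<Psi>: "solves Q (ball z r) \<Psi>" "\<Psi> z1 = \<phi> z1" "deriv \<Psi> z1 = deriv \<phi> z1" using r(3)[OF z1D(2)] by blast
        obtain d where d: "d > 0" "ball z1 d \<subseteq> ball z1 \<epsilon> \<inter> ball z r"
          using b'(1) z1D(2) openE[of "ball z1 \<epsilon> \<inter> ball z r" z1] by auto
        have "\<Psi> w = \<phi> w" if w: "w \<in> ball z1 d" for w
        proof (rule solves_unique[of Q "ball z1 d" \<Psi> \<phi> z1])
          show "solves Q (ball z1 d) \<Psi>" "solves Q (ball z1 d) \<phi>" using \<Psi>(1) \<phi> d(2) solves_subset by blast+
          show "Q holomorphic_on ball z1 d" using rD(2) d(2) holomorphic_on_subset by blast
        qed (use w d \<Psi> in auto)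
        then have "\<forall>\<^sub>F w in nhds z1. \<Psi> w = \<phi> w"
          using d(1) by (intro eventually_nhds_in_open[THEN eventually_mono, of "ball z1 d"]) auto
        then show ?thesis using \<Psi>(1) by blast
      qed
      obtain \<Psi>1 where \<Psi>1: "solves Q (ball z r) \<Psi>1" "\<forall>\<^sub>F w in nhds z1. \<Psi>1 w = \<psi> w" using extend[OF b'(10)] by blast
      obtain \<Psi>2 where \<Psi>2: "solves Q (ball z r) \<Psi>2" "\<forall>\<^sub>F w in nhds z1. \<Psi>2 w = \<sigma> w * \<psi> w" using extend[OF b'(11)] by blast
      have holP: "\<Psi>1 holomorphic_on ball z r" "\<Psi>2 holomorphic_on ball z r" using \<Psi>1 \<Psi>2 by (auto simp: solves_def)
      define R where "R w = \<Psi>2 w / \<Psi>1 w" for w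
      have away: "\<Psi>1 w \<noteq> 0 \<and> R w \<in> \<H> \<and> \<xi> (R w) = w" if w: "w \<in> ball z r - {z}" for w
      proof -
        have "path_connected (ball z r - {z})"
          by (intro path_connected_open_delete) auto
        then obtain p where p: "path p" "path_image p \<subseteq> ball z r - {z}" "p 0 = z1" "p 1 = w"
          by (rule path_connectedE[of _ z1 w]) (use z1D z1 w in \<open>auto intro: that\<close>)
        have pD: "path_image p \<subseteq> D'" using p(2) rD(1) by blast
        obtain g where g: "path g" "path_image g \<subseteq> U.W" "g 0 = \<tau>1" "\<And>t. t \<in> {0..1} \<Longrightarrow> \<xi> (g t) = p t"
          by (rule U.lift[OF p(1) pD \<tau>1(1)]) (use \<tau>1(2) p(3) in simp, rule that)
        have const: "continues_to p \<Psi> \<Psi>" if "\<Psi> holomorphic_on ball z r" for \<Psi>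
        proof (rule continues_toI[OF p(1)], rule continuation_on_const)
          fix t :: real assume "t \<in> {0..1}"
          then have "p t \<in> ball z r" using path_image_in[OF p(2)] by blast
          then show "\<Psi> analytic_on {p t}" using that open_ball analytic_at by blast
        qed
        have c1: "continues_to p \<psi> \<Psi>1"
          by (rule continues_to_cong[OF const[OF holP(1)]]) (use \<Psi>1(2) p(3) in \<open>simp_all add: pathstart_def\<close>)
        have c2: "continues_to p (\<lambda>w. \<sigma> w * \<psi> w) \<Psi>2"
          by (rule continues_to_cong[OF const[OF holP(2)]]) (use \<Psi>2(2) p(3) in \<open>simp_all add: pathstart_def\<close>)
        obtain s where s: "is_section \<xi> (p 1) s" "s (p 1) = g 1"
          "\<forall>\<^sub>F z in nhds (p 1). (\<Psi>1 z)\<^sup>2 = deriv \<xi> (s z)" "\<forall>\<^sub>F z in nhds (p 1). \<Psi>2 z = s z * \<Psi>1 z"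
          by (rule U.base_continuation[OF bs p(1) g c1 c2]) (assumption, rule that)
        have g1: "g 1 \<in> U.W" "\<xi> (g 1) = w" using path_image_in[OF g(2), of 1] g(4)[of 1] p(4) by auto
        have "(\<Psi>1 w)\<^sup>2 \<noteq> 0" using eventually_nhds_x_imp_x[OF s(3)] s(2) U.deriv_nz[OF g1(1)] p(4) by simp
        then have nz: "\<Psi>1 w \<noteq> 0" by simp
        then have "R w = g 1" using eventually_nhds_x_imp_x[OF s(4)] s(2) p(4) by (simp add: R_def)
        then show ?thesis using nz g1 U.WH(1) by simp
      qed
      have injR: "inj_on R (ball z r - {z})" using away by (intro inj_on_inverseI[of _ \<xi>]) auto
      have wr: "\<Psi>1 z * deriv \<Psi>2 z - \<Psi>2 z * deriv \<Psi>1 z \<noteq> 0"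
      proof -
        have "\<Psi>1 z * deriv \<Psi>2 z - \<Psi>2 z * deriv \<Psi>1 z = \<Psi>1 z1 * deriv \<Psi>2 z1 - \<Psi>2 z1 * deriv \<Psi>1 z1"
          by (rule wronskian_constant[OF \<Psi>1(1) \<Psi>2(1)]) (use z1D r in auto)
        also have "\<dots> = \<psi> z1 * deriv (\<lambda>w. \<sigma> w * \<psi> w) z1 - \<sigma> z1 * \<psi> z1 * deriv \<psi> z1"
          using deriv_eq_germ[OF \<Psi>1(2)] deriv_eq_germ[OF \<Psi>2(2)] eventually_nhds_x_imp_x[OF \<Psi>1(2)]
            eventually_nhds_x_imp_x[OF \<Psi>2(2)] by simp
        also have "deriv (\<lambda>w. \<sigma> w * \<psi> w) z1 = deriv \<sigma> z1 * \<psi> z1 + deriv \<psi> z1 * \<sigma> z1"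
        proof -
          have zb: "z1 \<in> ball z1 \<epsilon>" using b'(1) by simp
          have "\<psi> holomorphic_on ball z1 \<epsilon>" using b'(10) by (simp add: solves_def)
          from DERIV_mult[OF holomorphic_deriv_at[OF b'(3) open_ball zb] holomorphic_deriv_at[OF this open_ball zb]]
          show ?thesis by (rule DERIV_imp_deriv)
        qed
        finally have "\<Psi>1 z * deriv \<Psi>2 z - \<Psi>2 z * deriv \<Psi>1 z = deriv \<sigma> z1 * (\<psi> z1)\<^sup>2"
          by (simp add: algebra_simps power2_eq_square)
        also have "\<dots> = 1"
          using U.section_deriv[OF b'(12)] b'(4,5) b'(9)[of z1] b'(1) by simp
        finally show ?thesis by simp
      qed
      have Rz: "\<Psi>1 z \<noteq> 0" "R z \<in> \<H>"
        using ratio_fills_puncture[OF \<Psi>1(1) \<Psi>2(1) r(1) wr] away injR unfolding R_def by auto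
      have nz: "\<Psi>1 w \<noteq> 0" "R w \<in> \<H>" if "w \<in> ball z r" for w
        using away[of w] Rz that by (cases "w = z"; auto)+
      have holR: "R holomorphic_on ball z r" unfolding R_def using holP nz by (intro holomorphic_intros)
      have zb: "z \<in> ball z r" using r(1) by simp
      have \<xi>R: "\<xi> (R w) = w" if w: "w \<in> ball z r" for w
      proof -
        have "R ` ball z r \<subseteq> \<H>" using nz(2) by blast
        from holomorphic_on_compose_gen[OF holR U.hol\<xi> this]
        have comp: "(\<lambda>w. \<xi> (R w)) holomorphic_on ball z r" by (simp add: o_def)
        show ?thesis
        proof (rule analytic_continuation_open[of "ball z r - {z}" "ball z r" "\<lambda>w. \<xi> (R w)" "\<lambda>w. w"])
          show "ball z r - {z} \<noteq> {}" using z1D(2) z1(2) by blast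
        qed (use comp away w in \<open>auto intro: open_delete\<close>)
      qed
      have secR: "is_section \<xi> w R" if "w \<in> ball z r" for w
        unfolding is_section_def using that holR \<xi>R
        by (auto simp: analytic_at intro!: exI[of _ "ball z r"] eventually_nhds_in_open[THEN eventually_mono, of "ball z r"])
      have "R z1 = \<tau>1"
        using eventually_nhds_x_imp_x[OF \<Psi>1(2)] eventually_nhds_x_imp_x[OF \<Psi>2(2)] b'(4) b'(8)[of z1] b'(1)
        by (simp add: R_def)
      moreover have "is_section \<xi> z1 f" unfolding is_section_def
        using z1(1) holf fe(2)
        by (auto simp: analytic_at intro!: exI[of _ "ball z' e"] eventually_nhds_in_open[THEN eventually_mono, of "ball z' e"])
      ultimately have "\<forall>\<^sub>F w in nhds z1. f w = R w"
        by (intro U.section_unique_W secR z1D) (use \<tau>1(1) in \<open>auto simp: \<tau>1_def\<close>)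
      then have "f w = R w" if "w \<in> ball z' e" for w
        using that z1(1) holf e(2)
        by (intro analytic_germ_eq_on[OF holf _ open_ball connected_ball z1(1) that])
           (auto intro: holomorphic_on_subset[OF holR])
      then have "\<forall>\<^sub>F w in nhds z'. f w = R w"
        using e(1) by (intro eventually_nhds_in_open[THEN eventually_mono, of "ball z' e"]) auto
      then show ?thesis using holR secR nz(2) unfolding A_def by blast
    qed
    then show ?thesis using r(1) by blast
  qed
  have "lifts_paths \<xi> \<H> D" unfolding lifts_paths_def
  proof (intro allI impI, elim conjE)
    fix \<gamma> \<tau> assume \<gamma>: "path \<gamma>" "path_image \<gamma> \<subseteq> D" and \<tau>: "\<tau> \<in> \<H>" "\<xi> \<tau> = \<gamma> 0"
    have "\<gamma> 0 \<in> D" using path_image_in[OF \<gamma>(2), of 0] by simp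
    then have "deriv \<xi> \<tau> \<noteq> 0" using pbD[OF \<tau>(1)] \<tau>(2) by (simp add: pulls_back_def)
    then obtain s where s: "is_section \<xi> (\<gamma> 0) s" "s (\<gamma> 0) = \<tau>"
      using section_exists[OF U.hol\<xi> H_props(1) \<tau>(1)] \<tau>(2) by auto
    have "A (\<gamma> 0) s" "s analytic_on {\<gamma> 0}" using s \<tau>(1) by (auto simp: A_def is_section_def)
    then obtain F where F: "continuation_on {0..1} \<gamma> F" "F 0 = s" "\<And>t. t \<in> {0..1} \<Longrightarrow> A (\<gamma> t) (F t)"
      using germ_continuation[OF \<gamma>, of A s, OF ext] by (metis (no_types, lifting))
    have "path (\<lambda>t. F t (\<gamma> t))"
      using continuation_on_continuous[OF F(1)] \<gamma>(1) by (simp add: path_def)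
    moreover have "F t (\<gamma> t) \<in> \<H>" "\<xi> (F t (\<gamma> t)) = \<gamma> t" if "t \<in> {0..1}" for t
      using F(3)[OF that] eventually_nhds_x_imp_x[of _ "\<gamma> t"] by (auto simp: A_def is_section_def)
    ultimately show "\<exists>g. path g \<and> path_image g \<subseteq> \<H> \<and> g 0 = \<tau> \<and> (\<forall>t\<in>{0..1}. \<xi> (g t) = \<gamma> t)"
      using F(2) s(2) by (intro exI[of _ "\<lambda>t. F t (\<gamma> t)"]) (auto simp: path_image_def)
  qed
  moreover have "\<exists>\<tau>\<in>\<H>. \<xi> \<tau> \<in> D" using U.W_nonempty D(2) by (auto simp: U.W_def)
  ultimately show ?thesis unfolding uniformizes_def using U.hol\<xi> pbD by blast
qed

section \<open>The Weierstrass function of a differential equation\<close>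

lemma filterlim_at_nonconst:
  fixes f :: "complex \<Rightarrow> complex"
  assumes "f holomorphic_on S" "open S" "connected S" "t \<in> S" "\<not> f constant_on S"
  shows "filterlim f (at (f t)) (at t)"
proof -
  obtain \<beta> where \<beta>: "\<beta> \<in> S" "f \<beta> - f t \<noteq> 0" using assms(4,5) unfolding constant_on_def by auto
  have h: "(\<lambda>z. f z - f t) holomorphic_on S" using assms(1) by (intro holomorphic_intros)
  obtain r where r: "0 < r" "ball t r \<subseteq> S" "\<And>z. z \<in> ball t r - {t} \<Longrightarrow> f z - f t \<noteq> 0"
    by (rule isolated_zeros[OF h assms(2,3,4) _ \<beta>]) (simp, rule that)
  have "\<forall>\<^sub>F z in at t. f z \<noteq> f t" using eventually_at_ball'[OF r(1), of t UNIV] by eventually_elim (use r(3) in auto)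
  moreover have "isCont f t"
    using assms(1,2,4) holomorphic_on_imp_continuous_on continuous_on_eq_continuous_at by blast
  ultimately show ?thesis by (intro filterlim_atI) (simp_all add: isCont_def)
qed

text \<open>
  The quotient of the derivatives is continuous with values \<open>1\<close> and \<open>-1\<close>, hence constant.
\<close>

lemma square_deriv_unique:
  assumes f: "f holomorphic_on N" "g holomorphic_on N" "open N" "connected N" "x \<in> N" "t \<in> N"
    and sq: "\<And>z. z \<in> N \<Longrightarrow> (deriv f z)\<^sup>2 = (deriv g z)\<^sup>2" and nz: "\<And>z. z \<in> N \<Longrightarrow> deriv g z \<noteq> 0"
    and init: "f x = g x" "deriv f x = deriv g x"
  shows "f t = g t"
proof -
  let ?q = "\<lambda>z. deriv f z / deriv g z"
  have cont: "continuous_on N ?q"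
    using nz by (intro holomorphic_on_imp_continuous_on holomorphic_intros holomorphic_deriv f) auto
  have "?q z \<in> {1, -1}" if "z \<in> N" for z
    using sq[OF that] nz[OF that] by (auto simp: power2_eq_iff)
  then have "?q ` N \<subseteq> {1, -1}" by blast
  then have "finite (?q ` N)" by (rule finite_subset) simp
  then have "?q constant_on N" by (rule continuous_finite_range_constant[OF f(4) cont])
  then obtain s where s: "\<And>z. z \<in> N \<Longrightarrow> ?q z = s" by (auto simp: constant_on_def)
  have "s = 1" using s[OF f(5)] init(2) nz[OF f(5)] by simp
  then have eq: "deriv f z = deriv g z" if "z \<in> N" for z using s[OF that] nz[OF that] by simp
  have "((\<lambda>z. f z - g z) has_field_derivative 0) (at z)" if "z \<in> N" for z
    using DERIV_diff[OF holomorphic_deriv_at[OF f(1,3) that] holomorphic_deriv_at[OF f(2,3) that]] eq[OF that] by simp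
  then have "(\<lambda>z. f z - g z) constant_on N" by (intro has_field_derivative_0_imp_constant_on f)
  then obtain k where k: "\<And>z. z \<in> N \<Longrightarrow> f z - g z = k" by (auto simp: constant_on_def)
  show ?thesis using k[OF f(5)] k[OF f(6)] init(1) by simp
qed

text \<open>
  The difference of two solutions satisfies a linear equation, with the coefficient \<open>k(f, g)\<close>.
\<close>

lemma nonlinear_ode_unique:
  fixes R :: "complex \<Rightarrow> complex"
  assumes f: "f holomorphic_on S" "g holomorphic_on S" and S: "open S" "connected S" "z0 \<in> S" "z \<in> S"
    and odef: "\<And>z. z \<in> S \<Longrightarrow> deriv (deriv f) z = R (f z)" and odeg: "\<And>z. z \<in> S \<Longrightarrow> deriv (deriv g) z = R (g z)"
    and k: "\<And>x y. R x - R y = k x y * (x - y)" "(\<lambda>z. k (f z) (g z)) holomorphic_on S"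
    and init: "f z0 = g z0" "deriv f z0 = deriv g z0"
  shows "f z = g z"
proof -
  define h where "h z = f z - g z" for z
  have holh: "h holomorphic_on S" unfolding h_def using f by (intro holomorphic_intros)
  have h1: "deriv h w = deriv f w - deriv g w" if "w \<in> S" for w
    unfolding h_def by (rule DERIV_imp_deriv)
      (intro DERIV_diff holomorphic_deriv_at[OF f(1) S(1) that] holomorphic_deriv_at[OF f(2) S(1) that])
  have h2: "deriv (deriv h) w = k (f w) (g w) * h w" if w: "w \<in> S" for w
  proof -
    have "deriv (deriv h) w = deriv (\<lambda>w. deriv f w - deriv g w) w" by (rule deriv_cong_open[OF S(1) w h1])
    also have "\<dots> = deriv (deriv f) w - deriv (deriv g) w"
      by (rule DERIV_imp_deriv)
        (intro DERIV_diff holomorphic_deriv_at[OF holomorphic_deriv[OF f(1) S(1)] S(1) w]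
          holomorphic_deriv_at[OF holomorphic_deriv[OF f(2) S(1)] S(1) w])
    finally show ?thesis using odef[OF w] odeg[OF w] k(1) by (simp add: h_def)
  qed
  have "h z = 0"
    by (rule linear_ode_unique[OF holh h2 k(2) S]) (use init h1[OF S(3)] in \<open>auto simp: h_def\<close>)
  then show ?thesis by (simp add: h_def)
qed

text \<open>Differentiation removes the ambiguity of sign in \<open>f'\<^sup>2 = q(f)\<close>, at the price of dividing by \<open>f'\<close>.\<close>

lemma first_to_second_order:
  assumes f: "f holomorphic_on S" "open S" "connected S" "\<not> f constant_on S"
    and ode: "\<And>z. z \<in> S \<Longrightarrow> (deriv f z)\<^sup>2 = q (f z)"
    and q: "\<And>x. (q has_field_derivative 2 * R x) (at x)" "continuous_on UNIV R"
    and z: "z \<in> S"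
  shows "deriv (deriv f) z = R (f z)"
proof -
  have f1: "deriv f holomorphic_on S" using f(1,2) by (rule holomorphic_deriv)
  have f2: "deriv (deriv f) holomorphic_on S" using f1 f(2) by (rule holomorphic_deriv)
  have ne: "deriv (deriv f) w = R (f w)" if w: "w \<in> S" "deriv f w \<noteq> 0" for w
  proof -
    have "deriv (\<lambda>w. (deriv f w)\<^sup>2) w = 2 * deriv f w * deriv (deriv f) w"
      by (rule DERIV_imp_deriv) (auto intro!: derivative_eq_intros holomorphic_deriv_at[OF f1 f(2) w(1)])
    moreover have "deriv (\<lambda>w. (deriv f w)\<^sup>2) w = deriv (\<lambda>w. q (f w)) w"
      by (rule deriv_cong_open[OF f(2) w(1) ode])
    moreover have "deriv (\<lambda>w. q (f w)) w = 2 * R (f w) * deriv f w"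
      by (rule DERIV_imp_deriv) (rule DERIV_chain2[OF q(1) holomorphic_deriv_at[OF f(1,2) w(1)]])
    ultimately show ?thesis using w(2) by auto
  qed
  show ?thesis
  proof (cases "deriv f z = 0")
    case False
    then show ?thesis using ne z by blast
  next
    case True
    have "\<exists>w\<in>S. deriv f w \<noteq> 0"
    proof (rule ccontr)
      assume "\<not> (\<exists>w\<in>S. deriv f w \<noteq> 0)"
      then have "(f has_field_derivative 0) (at w)" if "w \<in> S" for w
        using holomorphic_deriv_at[OF f(1,2) that] that by simp
      then show False using has_field_derivative_0_imp_constant_on[of S f] f by blast
    qed
    then obtain w where w: "w \<in> S" "deriv f w \<noteq> 0" by blast
    obtain r where r: "0 < r" "ball z r \<subseteq> S" "\<And>x. x \<in> ball z r - {z} \<Longrightarrow> deriv f x \<noteq> 0"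
      by (rule isolated_zeros[OF f1 f(2,3) z True w]) (rule that)
    have ev: "\<forall>\<^sub>F x in at z. deriv (deriv f) x = R (f x)"
      using eventually_at_ball'[OF r(1), of z UNIV] by eventually_elim (use ne r in auto)
    have "isCont (deriv (deriv f)) z" "isCont f z"
      using f2 f(1) z f(2) holomorphic_on_imp_continuous_on continuous_on_eq_continuous_at by blast+
    then have "((deriv (deriv f)) \<longlongrightarrow> deriv (deriv f) z) (at z)" "((\<lambda>x. R (f x)) \<longlongrightarrow> R (f z)) (at z)"
      using q(2) by (auto simp: isCont_def continuous_on_eq_continuous_at intro: isCont_tendsto_compose)
    then show ?thesis using tendsto_cong[OF ev] tendsto_unique[OF at_neq_bot] by blast
  qed
qed

definition cubic :: "complex \<Rightarrow> complex \<Rightarrow> complex \<Rightarrow> complex" where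
  "cubic a b x = 4 * x ^ 3 - a * x - b"

definition dup_num :: "complex \<Rightarrow> complex \<Rightarrow> complex \<Rightarrow> complex" where
  "dup_num a b x = (x\<^sup>2 + a / 4)\<^sup>2 + 2 * b * x"

text \<open>The equation satisfied by \<open>1 / \<wp>\<close>.\<close>

definition cubic_inf :: "complex \<Rightarrow> complex \<Rightarrow> complex \<Rightarrow> complex" where
  "cubic_inf a b h = 4 * h - a * h ^ 3 - b * h ^ 4"

lemma cubic_ode_unique:
  assumes f: "f holomorphic_on S" "g holomorphic_on S" and S: "open S" "connected S" "z0 \<in> S" "z \<in> S"
    and nc: "\<not> f constant_on S" "\<not> g constant_on S"
    and odef: "\<And>z. z \<in> S \<Longrightarrow> (deriv f z)\<^sup>2 = cubic a b (f z)" and odeg: "\<And>z. z \<in> S \<Longrightarrow> (deriv g z)\<^sup>2 = cubic a b (g z)"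
    and init: "f z0 = g z0" "deriv f z0 = deriv g z0"
  shows "f z = g z"
proof -
  have q: "(cubic a b has_field_derivative 2 * (6 * x\<^sup>2 - a / 2)) (at x)" for x
    unfolding cubic_def[abs_def] by (auto intro!: derivative_eq_intros simp: power2_eq_square)
  have c: "continuous_on UNIV (\<lambda>x. 6 * x\<^sup>2 - a / 2)" by (intro continuous_intros)
  show ?thesis
  proof (rule nonlinear_ode_unique[OF f S, of "\<lambda>x. 6 * x\<^sup>2 - a / 2" "\<lambda>x y. 6 * (x + y)"])
    show "deriv (deriv f) w = 6 * (f w)\<^sup>2 - a / 2" if "w \<in> S" for w
      by (rule first_to_second_order[OF f(1) S(1,2) nc(1) odef q c that])
    show "deriv (deriv g) w = 6 * (g w)\<^sup>2 - a / 2" if "w \<in> S" for w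
      by (rule first_to_second_order[OF f(2) S(1,2) nc(2) odeg q c that])
  qed (use f init in \<open>auto intro!: holomorphic_intros simp: power2_eq_square algebra_simps\<close>)
qed

lemma cubic_inf_second_order:
  assumes "f holomorphic_on S" "open S" "connected S" "\<not> f constant_on S"
    and "\<And>z. z \<in> S \<Longrightarrow> (deriv f z)\<^sup>2 = cubic_inf a b (f z)" and "z \<in> S"
  shows "deriv (deriv f) z = 2 - 3 * a / 2 * (f z)\<^sup>2 - 2 * b * f z ^ 3"
proof (rule first_to_second_order[OF assms(1-5) _ _ assms(6), of "\<lambda>x. 2 - 3 * a / 2 * x\<^sup>2 - 2 * b * x ^ 3"])
  show "(cubic_inf a b has_field_derivative 2 * (2 - 3 * a / 2 * x\<^sup>2 - 2 * b * x ^ 3)) (at x)" for x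
    unfolding cubic_inf_def[abs_def] by (auto intro!: derivative_eq_intros simp: power2_eq_square power3_eq_cube)
qed (auto intro!: continuous_intros)

lemma cubic_inf_ode_unique:
  assumes f: "f holomorphic_on S" "g holomorphic_on S" and S: "open S" "connected S" "z0 \<in> S" "z \<in> S"
    and nc: "\<not> f constant_on S" "\<not> g constant_on S"
    and odef: "\<And>z. z \<in> S \<Longrightarrow> (deriv f z)\<^sup>2 = cubic_inf a b (f z)" and odeg: "\<And>z. z \<in> S \<Longrightarrow> (deriv g z)\<^sup>2 = cubic_inf a b (g z)"
    and init: "f z0 = 0" "g z0 = 0"
  shows "f z = g z"
proof (rule nonlinear_ode_unique[OF f S, of "\<lambda>x. 2 - 3 * a / 2 * x\<^sup>2 - 2 * b * x ^ 3"
      "\<lambda>x y. - (3 * a / 2) * (x + y) - 2 * b * (x\<^sup>2 + x * y + y\<^sup>2)"])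
  show "deriv (deriv f) w = 2 - 3 * a / 2 * (f w)\<^sup>2 - 2 * b * f w ^ 3" if "w \<in> S" for w
    by (rule cubic_inf_second_order[OF f(1) S(1,2) nc(1) odef that])
  show "deriv (deriv g) w = 2 - 3 * a / 2 * (g w)\<^sup>2 - 2 * b * g w ^ 3" if "w \<in> S" for w
    by (rule cubic_inf_second_order[OF f(2) S(1,2) nc(2) odeg that])
  show "deriv f z0 = deriv g z0" using odef[OF S(3)] odeg[OF S(3)] init by (simp add: cubic_inf_def)
  show "(2 - 3 * a / 2 * x\<^sup>2 - 2 * b * x ^ 3) - (2 - 3 * a / 2 * y\<^sup>2 - 2 * b * y ^ 3) =
      (- (3 * a / 2) * (x + y) - 2 * b * (x\<^sup>2 + x * y + y\<^sup>2)) * (x - y)" for x y :: complex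
    by (simp add: power2_eq_square power3_eq_cube field_simps)
  show "(\<lambda>z. - (3 * a / 2) * (f z + g z) - 2 * b * ((f z)\<^sup>2 + f z * g z + (g z)\<^sup>2)) holomorphic_on S"
    using f by (intro holomorphic_intros)
qed (use init in auto)

lemma cubic_inverse: "x \<noteq> 0 \<Longrightarrow> cubic a b x = x ^ 4 * cubic_inf a b (inverse x)"
  by (simp add: cubic_def cubic_inf_def field_simps power2_eq_square power3_eq_cube power4_eq_xxxx)

locale weierstrass =
  fixes a b e e' e'' :: complex and P :: "complex \<Rightarrow> complex"
  assumes roots: "\<And>t. 4 * t ^ 3 - a * t - b = 4 * (t - e) * (t - e') * (t - e'')"
    and distinct: "e \<noteq> e'" "e \<noteq> e''" "e' \<noteq> e''"
    and wp: "weierstrass_p a b P"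
begin

definition L where "L = {z. is_pole P z}"

lemma nicely: "P nicely_meromorphic_on UNIV" and pole0: "0 \<in> L"
  using wp by (auto simp: weierstrass_p_def L_def)

lemma analytic: "z \<notin> L \<Longrightarrow> P analytic_on {z}"
  using nicely_meromorphic_on_imp_analytic_at[OF nicely] by (simp add: L_def)

lemma L_sparse: "L sparse_in UNIV"
proof -
  have "P meromorphic_on UNIV" using nicely by (simp add: nicely_meromorphic_on_def)
  then show ?thesis unfolding L_def
    by (meson open_UNIV meromorphic_on_isolated_singularity meromorphic_on_meromorphic_at not_islimpt_poles sparse_in_open)
qed

lemma countable_L: "countable L" using sparse_imp_countable[OF open_UNIV L_sparse] by simp

lemma closed_L: "closed L" by (rule sparse_in_UNIV_imp_closed[OF L_sparse])

lemma openD: "open (- L)" using closed_L by (simp add: open_Compl)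

lemma connectedD: "connected S \<Longrightarrow> open S \<Longrightarrow> countable C \<Longrightarrow> connected (S - C)" for S C :: "complex set"
  by (rule connected_open_diff_countable) auto

lemma connectedD': "connected (- L)"
  using connectedD[of UNIV L] countable_L by (simp add: Compl_eq_Diff_UNIV connected_UNIV)

lemma holP: "P holomorphic_on - L"
  by (intro analytic_imp_holomorphic, subst analytic_on_analytic_at) (use analytic in blast)

lemma ode: "z \<notin> L \<Longrightarrow> (deriv P z)\<^sup>2 = cubic a b (P z)"
  using wp by (auto simp: weierstrass_p_def L_def cubic_def)

lemma cubic_roots: "cubic a b t = 4 * (t - e) * (t - e') * (t - e'')"
  using roots by (simp add: cubic_def)

lemma cubic_zero: "cubic a b t = 0 \<longleftrightarrow> t \<in> {e, e', e''}" by (auto simp: cubic_roots)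

lemma at_pole_zero: "c \<in> L \<Longrightarrow> P c = 0"
  using nicely not_tendsto_and_filterlim_at_infinity[OF at_neq_bot, of P "P c" c]
  unfolding nicely_meromorphic_on_def L_def is_pole_def by blast

lemma nonconst_nbhd:
  assumes "c \<in> L" "0 < r" "ball c r - {c} \<subseteq> - L" shows "\<not> P constant_on (ball c r - {c})"
proof
  assume "P constant_on (ball c r - {c})"
  then obtain k where k: "\<And>x. x \<in> ball c r - {c} \<Longrightarrow> P x = k" by (auto simp: constant_on_def)
  have "\<forall>\<^sub>F x in at c. P x = k" using eventually_at_ball'[OF assms(2), of c UNIV] by eventually_elim (use k in auto)
  then have "(P \<longlongrightarrow> k) (at c)" by (simp add: tendsto_cong)
  then show False using assms(1) not_tendsto_and_filterlim_at_infinity[OF at_neq_bot] by (auto simp: L_def is_pole_def)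
qed

text \<open>
  At a pole of \<open>\<wp>\<close> the function \<open>1/\<wp>\<close> is holomorphic; its equation extends to the pole by continuity.
\<close>

lemma pole_nbhd:
  assumes "c \<in> L"
  obtains r where "0 < r" "ball c r - {c} \<subseteq> - L" "(\<lambda>t. inverse (P t)) holomorphic_on ball c r"
    "\<And>t. t \<in> ball c r - {c} \<Longrightarrow> P t \<noteq> 0" "\<not> (\<lambda>t. inverse (P t)) constant_on ball c r"
    "\<And>t. t \<in> ball c r \<Longrightarrow> (deriv (\<lambda>t. inverse (P t)) t)\<^sup>2 = cubic_inf a b (inverse (P t))"
proof -
  have "\<not> c islimpt L" using L_sparse by (auto simp: sparse_in_def)
  then obtain r1 where r1: "r1 > 0" "\<forall>x\<in>L. x = c \<or> r1 \<le> dist x c"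
    unfolding islimpt_approachable by (meson linorder_not_less)
  then have r1: "r1 > 0" "ball c r1 - {c} \<subseteq> - L" by (auto simp: dist_commute)
  have lim: "filterlim P at_infinity (at c)" using assms by (simp add: L_def is_pole_def)
  then have "\<forall>\<^sub>F x in at c. P x \<noteq> 0"
    by (auto simp: filterlim_at_infinity_conv_norm_at_top eventually_at_top_dense filterlim_at_top_dense elim!: allE[of _ 0] eventually_mono)
  then obtain r2 where r2: "r2 > 0" "\<And>x. x \<in> ball c r2 - {c} \<Longrightarrow> P x \<noteq> 0"
    by (auto simp: eventually_at dist_commute)
  define r where "r = min r1 r2"
  have r: "r > 0" "ball c r - {c} \<subseteq> - L" "\<And>x. x \<in> ball c r - {c} \<Longrightarrow> P x \<noteq> 0"
    using r1 r2 by (auto simp: r_def)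
  let ?h = "\<lambda>t. inverse (P t)"
  have "(\<lambda>x. if x = c then 0 else ?h x) holomorphic_on ball c r"
    by (rule is_pole_inverse_holomorphic) (use r assms holomorphic_on_subset[OF holP] in \<open>auto simp: L_def\<close>)
  moreover have "(\<lambda>x. if x = c then 0 else ?h x) = ?h" using at_pole_zero[OF assms] by auto
  ultimately have hol: "?h holomorphic_on ball c r" by simp
  have nc: "\<not> ?h constant_on ball c r"
  proof
    assume "?h constant_on ball c r"
    then have "P constant_on (ball c r - {c})" unfolding constant_on_def by (metis DiffD1 inverse_inverse_eq)
    then show False using nonconst_nbhd[OF assms r(1,2)] by blast
  qed
  have punct: "(deriv ?h t)\<^sup>2 = cubic_inf a b (?h t)" if t: "t \<in> ball c r - {c}" for t
  proof -
    have tL: "t \<in> - L" and P0: "P t \<noteq> 0" using t r by auto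
    have "deriv ?h t = - (deriv P t / (P t)\<^sup>2)"
      by (rule DERIV_imp_deriv)
        (use P0 in \<open>auto intro!: derivative_eq_intros holomorphic_deriv_at[OF holP openD tL] simp: power2_eq_square field_simps\<close>)
    then have "(deriv ?h t)\<^sup>2 = (deriv P t)\<^sup>2 / P t ^ 4" by (simp add: power_divide flip: power_mult)
    also have "\<dots> = cubic_inf a b (?h t)" using ode[of t] tL cubic_inverse[OF P0, of a b] P0 by simp
    finally show ?thesis .
  qed
  have cb: "c \<in> ball c r" using r by simp
  have "(deriv ?h c)\<^sup>2 = cubic_inf a b (?h c)"
  proof -
    have "isCont ?h c" "isCont (deriv ?h) c"
      using hol holomorphic_deriv[OF hol open_ball] cb holomorphic_on_imp_continuous_on continuous_on_eq_continuous_at open_ball by blast+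
    then have lims: "((\<lambda>t. (deriv ?h t)\<^sup>2) \<longlongrightarrow> (deriv ?h c)\<^sup>2) (at c)" "((\<lambda>t. cubic_inf a b (?h t)) \<longlongrightarrow> cubic_inf a b (?h c)) (at c)"
      unfolding cubic_inf_def isCont_def by (auto intro!: tendsto_intros)
    have ev: "\<forall>\<^sub>F t in at c. (deriv ?h t)\<^sup>2 = cubic_inf a b (?h t)"
      using eventually_at_ball'[OF r(1), of c UNIV] by eventually_elim (use punct in auto)
    show ?thesis by (rule tendsto_unique[OF at_neq_bot Lim_transform_eventually[OF lims(1) ev] lims(2)])
  qed
  then have "(deriv ?h t)\<^sup>2 = cubic_inf a b (?h t)" if "t \<in> ball c r" for t
    using punct[of t] that by (cases "t = c") auto
  then show ?thesis using that[OF r(1,2) hol r(3) nc] by blast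
qed

lemma nonconst:
  assumes S: "open S" "S \<noteq> {}" "S \<subseteq> - L"
  shows "\<not> P constant_on S"
proof
  assume "P constant_on S"
  then obtain k where k: "\<And>x. x \<in> S \<Longrightarrow> P x = k" by (auto simp: constant_on_def)
  have c: "P x = k" if "x \<in> - L" for x
    by (rule analytic_continuation_open[OF S(1) openD S(2) connectedD' S(3) holP, of "\<lambda>_. k"]) (use k that in auto)
  obtain r where r: "0 < r" "ball 0 r - {0} \<subseteq> - L" by (rule pole_nbhd[OF pole0]) (rule that)
  have "P constant_on (ball 0 r - {0})" unfolding constant_on_def using c r(2) by blast
  then show False using nonconst_nbhd[OF pole0 r] by blast
qed

end

context weierstrass
begin

section \<open>Periods, fibres and duplication\<close>

lemma affine_at: "\<sigma> \<noteq> 0 \<Longrightarrow> filterlim (\<lambda>x. s + \<sigma> * x) (at (s + \<sigma> * t)) (at t)" for s \<sigma> t :: complex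
  by (auto simp: filterlim_at eventually_at_filter intro!: tendsto_eq_intros)

lemma not_pole_eventually: "\<forall>\<^sub>F x in at t. x \<notin> L"
proof -
  have "\<not> t islimpt L" using L_sparse by (auto simp: sparse_in_def)
  then show ?thesis by (simp add: islimpt_iff_eventually)
qed

lemma limit_or_pole: "t \<in> L \<and> P t = 0 \<and> filterlim P at_infinity (at t) \<or> t \<notin> L \<and> (P \<longlongrightarrow> P t) (at t)"
proof (cases "t \<in> L")
  case True
  then show ?thesis using at_pole_zero by (simp add: L_def is_pole_def)
next
  case False
  then show ?thesis using analytic_at_imp_isCont[OF analytic[OF False]] by (simp add: isCont_def)
qed

text \<open>
  The identity theorem off the poles, a countable closed set which does not disconnect the plane.  At
  the poles the relation holds because they correspond to each other and carry the same dummy value.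
\<close>

lemma extend_symmetry:
  assumes \<sigma>: "\<sigma> \<noteq> 0" and ev: "open N" "N \<noteq> {}" "\<And>t. t \<in> N \<Longrightarrow> P (s + \<sigma> * t) = P t"
  shows "P (s + \<sigma> * t) = P t"
proof -
  let ?f = "\<lambda>t. P (s + \<sigma> * t)"
  define C where "C = L \<union> {t. s + \<sigma> * t \<in> L}"
  have i1: "inj_on (\<lambda>t. s + \<sigma> * t) {t. s + \<sigma> * t \<in> L}" using \<sigma> by (auto simp: inj_on_def)
  have "(\<lambda>t. s + \<sigma> * t) ` {t. s + \<sigma> * t \<in> L} \<subseteq> L" by blast
  then have i2: "countable ((\<lambda>t. s + \<sigma> * t) ` {t. s + \<sigma> * t \<in> L})" using countable_L by (rule countable_subset)
  have "countable {t. s + \<sigma> * t \<in> L}" by (rule countable_image_inj_on[OF i2 i1])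
  then have C: "countable C" using countable_L by (simp add: C_def)
  have "closed ((\<lambda>t. s + \<sigma> * t) -` L)" by (intro closed_vimage closed_L continuous_intros)
  then have "closed C" unfolding C_def using closed_L by (auto simp: vimage_def)
  then have oU: "open (- C)" by (simp add: open_Compl)
  have cU: "connected (- C)" using connectedD[of UNIV C] C by (simp add: Compl_eq_Diff_UNIV connected_UNIV)
  have hol1: "P holomorphic_on - C" by (rule holomorphic_on_subset[OF holP]) (auto simp: C_def)
  have "(P \<circ> (\<lambda>t. s + \<sigma> * t)) holomorphic_on - C"
    by (rule holomorphic_on_compose_gen[OF _ holP]) (auto simp: C_def intro!: holomorphic_intros)
  then have hol2: "?f holomorphic_on - C" by (simp add: o_def)
  have "N - C \<noteq> {}"
  proof
    assume "N - C = {}"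
    then have "N \<subseteq> C" by blast
    then have "countable N" using C by (rule countable_subset)
    moreover obtain x r where "r > 0" "ball x r \<subseteq> N" using ev(1,2) open_contains_ball by (metis ex_in_conv)
    ultimately show False using uncountable_ball[of r x] countable_subset by blast
  qed
  moreover have "N - C = N \<inter> - C" by blast
  ultimately have NC: "N \<inter> - C \<noteq> {}" "open (N \<inter> - C)" using ev(1) oU by auto
  have on: "?f x = P x" if "x \<in> - C" for x
    by (rule analytic_continuation_open[OF NC(2) oU NC(1) cU _ hol2 hol1 _ that]) (use ev(3) in auto)
  have "\<forall>\<^sub>F x in at t. x \<notin> L" "\<forall>\<^sub>F x in at t. s + \<sigma> * x \<notin> L"
    using not_pole_eventually affine_at[OF \<sigma>, of s t] by (auto simp: filterlim_iff)
  then have eq: "\<forall>\<^sub>F x in at t. ?f x = P x" by eventually_elim (use on in \<open>auto simp: C_def\<close>)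
  consider "filterlim P at_infinity (at (s + \<sigma> * t))" "?f t = 0" | "(P \<longlongrightarrow> ?f t) (at (s + \<sigma> * t))"
    using limit_or_pole by blast
  then show ?thesis
  proof cases
    case 1
    have "filterlim ?f at_infinity (at t)" by (rule filterlim_compose[OF 1(1) affine_at[OF \<sigma>]])
    then have "filterlim P at_infinity (at t)" by (rule filterlim_cong[OF refl refl eq, THEN iffD1])
    then have "P t = 0" using limit_or_pole[of t] not_tendsto_and_filterlim_at_infinity[OF at_neq_bot] by blast
    then show ?thesis using 1 by simp
  next
    case 2
    have "(?f \<longlongrightarrow> ?f t) (at t)" by (rule filterlim_compose[OF 2 affine_at[OF \<sigma>]])
    then have "(P \<longlongrightarrow> ?f t) (at t)" by (rule Lim_transform_eventually[OF _ eq])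
    moreover from this have "(P \<longlongrightarrow> P t) (at t)"
      using limit_or_pole[of t] not_tendsto_and_filterlim_at_infinity[OF at_neq_bot] by blast
    ultimately show ?thesis by (rule tendsto_unique[OF at_neq_bot])
  qed
qed

text \<open>
  Near a pole, \<open>1 / \<wp>\<close> is the solution with vanishing initial values of an equation that does
  not depend on the pole: every pole is a period, and \<open>\<wp>\<close> is even.
\<close>

lemma pole_symmetry:
  assumes c: "c \<in> L" and \<sigma>: "\<sigma>\<^sup>2 = 1"
  shows "P (c + \<sigma> * t) = P t"
proof -
  obtain r where r: "0 < r" "ball 0 r - {0} \<subseteq> - L" "(\<lambda>t. inverse (P t)) holomorphic_on ball 0 r"
    "\<And>t. t \<in> ball 0 r - {0} \<Longrightarrow> P t \<noteq> 0" "\<not> (\<lambda>t. inverse (P t)) constant_on ball 0 r"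
    "\<And>t. t \<in> ball 0 r \<Longrightarrow> (deriv (\<lambda>t. inverse (P t)) t)\<^sup>2 = cubic_inf a b (inverse (P t))"
    by (rule pole_nbhd[OF pole0]) (rule that)
  obtain r' where r': "0 < r'" "ball c r' - {c} \<subseteq> - L" "(\<lambda>t. inverse (P t)) holomorphic_on ball c r'"
    "\<And>t. t \<in> ball c r' - {c} \<Longrightarrow> P t \<noteq> 0" "\<not> (\<lambda>t. inverse (P t)) constant_on ball c r'"
    "\<And>t. t \<in> ball c r' \<Longrightarrow> (deriv (\<lambda>t. inverse (P t)) t)\<^sup>2 = cubic_inf a b (inverse (P t))"
    by (rule pole_nbhd[OF c]) (rule that)
  define \<rho> where "\<rho> = min r r'"
  define h where "h t = inverse (P t)" for t
  define f where "f t = h (c + \<sigma> * t)" for t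
  have \<rho>: "\<rho> > 0" "\<rho> \<le> r" "\<rho> \<le> r'" using r r' by (auto simp: \<rho>_def)
  have h_fun: "(\<lambda>t. inverse (P t)) = h" by (auto simp: h_def)
  note r = r[unfolded h_fun] and r' = r'[unfolded h_fun]
  have n\<sigma>: "norm \<sigma> = 1" 
    by (rule power2_eq_imp_eq) (use \<sigma> in \<open>simp_all flip: norm_power\<close>)
  have in_c: "c + \<sigma> * t \<in> ball c r'" if "t \<in> ball 0 \<rho>" for t
    using that \<rho>(3) n\<sigma> by (simp add: dist_norm norm_mult)
  have nzc: "P (c + \<sigma> * t) \<noteq> 0 \<and> c + \<sigma> * t \<notin> L" if "t \<in> ball 0 \<rho> - {0}" for t
    using r'(2) r'(4) in_c[of t] that n\<sigma> by fastforce
  have holh: "h holomorphic_on ball 0 \<rho>" using r(3) by (rule holomorphic_on_subset) (use \<rho> in auto)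
  have "(h \<circ> (\<lambda>t. c + \<sigma> * t)) holomorphic_on ball 0 \<rho>"
    by (rule holomorphic_on_compose_gen[OF _ r'(3)]) (use in_c in \<open>auto intro!: holomorphic_intros\<close>)
  then have holf: "f holomorphic_on ball 0 \<rho>" by (simp add: o_def f_def[abs_def])
  have df: "deriv f t = deriv h (c + \<sigma> * t) * \<sigma>" if "t \<in> ball 0 \<rho>" for t
    unfolding f_def[abs_def]
    by (rule DERIV_imp_deriv, rule DERIV_chain2[where f = h and g = "\<lambda>t. c + \<sigma> * t",
          OF holomorphic_deriv_at[OF r'(3) open_ball in_c[OF that]]])
      (auto intro!: derivative_eq_intros)
  have odef: "(deriv f t)\<^sup>2 = cubic_inf a b (f t)" if "t \<in> ball 0 \<rho>" for t
    unfolding df[OF that] f_def using r'(6)[OF in_c[OF that]] \<sigma> by (simp add: power_mult_distrib h_def)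
  have odeh: "(deriv h t)\<^sup>2 = cubic_inf a b (h t)" if "t \<in> ball 0 \<rho>" for t
    using r(6)[of t] that \<rho> by (simp add: h_def)
  have nc: "\<not> g constant_on ball 0 \<rho>" if "g 0 = 0" "\<And>t. t \<in> ball 0 \<rho> - {0} \<Longrightarrow> g t \<noteq> 0" for g :: "complex \<Rightarrow> complex"
  proof
    assume "g constant_on ball 0 \<rho>"
    then obtain k where "\<And>x. x \<in> ball 0 \<rho> \<Longrightarrow> g x = k" by (auto simp: constant_on_def)
    then have "g (of_real (\<rho> / 2)) = g 0" using \<rho>(1) by simp
    then show False using that(1) that(2)[of "of_real (\<rho> / 2)"] \<rho>(1) by simp
  qed
  have ini: "f 0 = 0" "h 0 = 0" using at_pole_zero[OF c] at_pole_zero[OF pole0] by (auto simp: f_def h_def)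
  have ncf: "\<not> f constant_on ball 0 \<rho>" by (rule nc[of f, OF ini(1)]) (use nzc in \<open>auto simp: f_def h_def\<close>)
  have nch: "\<not> h constant_on ball 0 \<rho>" by (rule nc[of h, OF ini(2)]) (use r(4) \<rho> in \<open>auto simp: h_def\<close>)
  have eq: "f t = h t" if "t \<in> ball 0 \<rho>" for t
    using \<rho>(1) by (intro cubic_inf_ode_unique[OF holf holh open_ball connected_ball _ that ncf nch odef odeh ini]) auto
  have s0: "\<sigma> \<noteq> 0" using \<sigma> by auto
  show ?thesis
    by (rule extend_symmetry[OF s0 open_ball, of 0 \<rho>])
      (use \<rho>(1) eq in \<open>auto simp: f_def h_def\<close>)
qed

lemma even: "P (- t) = P t" using pole_symmetry[OF pole0, of "-1" t] by simp

lemma period_iff: "is_period P l \<longleftrightarrow> l \<in> L"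
proof
  assume "l \<in> L"
  then show "is_period P l" using pole_symmetry[of l 1] by (simp add: is_period_def add.commute)
next
  assume "is_period P l"
  then have "(\<lambda>x. P (l + x)) = P" by (auto simp: is_period_def add.commute)
  then show "l \<in> L" using pole0 is_pole_shift_0[of P l] by (simp add: L_def)
qed

lemma period: "l \<in> L \<Longrightarrow> P (z + l) = P z" using period_iff by (auto simp: is_period_def)

lemma L_neg: "l \<in> L \<Longrightarrow> - l \<in> L"
  unfolding period_iff[symmetric] is_period_def by (metis add.commute add_minus_cancel)

lemma L_add: "l \<in> L \<Longrightarrow> m \<in> L \<Longrightarrow> l + m \<in> L"
  unfolding period_iff[symmetric] is_period_def by (metis add.assoc)

lemma L_diff: "l \<in> L \<Longrightarrow> m \<in> L \<Longrightarrow> l - m \<in> L" using L_add[OF _ L_neg] by simp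

lemma L_shift: "l \<in> L \<Longrightarrow> z + l \<in> L \<longleftrightarrow> z \<in> L" using L_add L_diff by (metis add_diff_cancel_right')

lemma L_neg_iff: "- z \<in> L \<longleftrightarrow> z \<in> L" using L_neg by fastforce

lemma derivP: "z \<notin> L \<Longrightarrow> (P has_field_derivative deriv P z) (at z)"
  using holomorphic_deriv_at[OF holP openD] by blast

lemma deriv_neg: "z \<notin> L \<Longrightarrow> deriv P (- z) = - deriv P z"
proof -
  assume z: "z \<notin> L"
  have "((\<lambda>t. P (- t)) has_field_derivative deriv P z * - 1) (at (- z))"
    by (rule DERIV_chain2) (use derivP[OF z] in \<open>auto intro!: derivative_eq_intros\<close>)
  then show ?thesis unfolding even by (simp add: DERIV_imp_deriv)
qed

lemma deriv_period: "l \<in> L \<Longrightarrow> z \<notin> L \<Longrightarrow> deriv P (z + l) = deriv P z"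
proof -
  assume l: "l \<in> L" and z: "z \<notin> L"
  then have "z + l \<notin> L" using L_shift by blast
  then have "((\<lambda>t. P (t + l)) has_field_derivative deriv P (z + l) * 1) (at z)"
    by (intro DERIV_chain2[OF derivP]) (auto intro!: derivative_eq_intros)
  then show ?thesis unfolding period[OF l] by (simp add: DERIV_imp_deriv)
qed

text \<open>
  The translates of \<open>\<wp>\<close> by \<open>z\<close> and by \<open>w\<close> solve the same initial value problem.
\<close>

lemma fibre_with_deriv:
  assumes zw: "z \<notin> L" "w \<notin> L" and eq: "P z = P w" "deriv P z = deriv P w"
  shows "z - w \<in> L"
proof -
  obtain r1 where r1: "r1 > 0" "ball z r1 \<subseteq> - L" using openE[OF openD, of z] zw(1) by blast
  obtain r2 where r2: "r2 > 0" "ball w r2 \<subseteq> - L" using openE[OF openD, of w] zw(2) by blast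
  define r where "r = min r1 r2"
  have r: "r > 0" "\<And>t. t \<in> ball 0 r \<Longrightarrow> z + t \<notin> L" "\<And>t. t \<in> ball 0 r \<Longrightarrow> w + t \<notin> L"
    using r1 r2 by (auto simp: r_def dist_norm subset_iff)
  have hol: "(\<lambda>t. P (x + t)) holomorphic_on ball 0 r" if "\<And>t. t \<in> ball 0 r \<Longrightarrow> x + t \<notin> L" for x
  proof -
    have "(P \<circ> (\<lambda>t. x + t)) holomorphic_on ball 0 r"
      by (rule holomorphic_on_compose_gen[OF _ holP]) (use that[of "_ - x"] in \<open>auto intro!: holomorphic_intros simp: dist_norm norm_minus_commute\<close>)
    then show ?thesis by (simp add: o_def)
  qed
  have d: "deriv (\<lambda>t. P (x + t)) t = deriv P (x + t)" if "x + t \<notin> L" for x t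
  proof -
    have "((\<lambda>t. P (x + t)) has_field_derivative deriv P (x + t) * 1) (at t)"
      by (rule DERIV_chain2[where f = P and g = "\<lambda>t. x + t", OF derivP[OF that]]) (auto intro!: derivative_eq_intros)
    then show ?thesis by (simp add: DERIV_imp_deriv)
  qed
  have nc: "\<not> (\<lambda>t. P (x + t)) constant_on ball 0 r" if x: "\<And>t. t \<in> ball 0 r \<Longrightarrow> x + t \<notin> L" for x
  proof
    assume "(\<lambda>t. P (x + t)) constant_on ball 0 r"
    then obtain k where k: "\<And>t. t \<in> ball 0 r \<Longrightarrow> P (x + t) = k" by (auto simp: constant_on_def)
    have y: "P y = k" "y \<notin> L" if y: "y \<in> ball x r" for y
    proof -
      have "y - x \<in> ball 0 r" using y by (simp add: dist_norm norm_minus_commute)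
      from k[OF this] x[OF this] show "P y = k" "y \<notin> L" by simp_all
    qed
    then have "P constant_on ball x r" unfolding constant_on_def by blast
    moreover have "ball x r \<subseteq> - L" using y(2) by blast
    ultimately show False using nonconst[of "ball x r"] r(1) by simp
  qed
  have eq: "P (z + t) = P (w + t)" if t: "t \<in> ball 0 r" for t
  proof (rule cubic_ode_unique[OF hol[OF r(2)] hol[OF r(3)] open_ball connected_ball _ t nc[OF r(2)] nc[OF r(3)], of 0 a b])
    show "(deriv (\<lambda>t. P (z + t)) u)\<^sup>2 = cubic a b (P (z + u))" if "u \<in> ball 0 r" for u
      unfolding d[OF r(2)[OF that]] by (rule ode[OF r(2)[OF that]])
    show "(deriv (\<lambda>t. P (w + t)) u)\<^sup>2 = cubic a b (P (w + u))" if "u \<in> ball 0 r" for u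
      unfolding d[OF r(3)[OF that]] by (rule ode[OF r(3)[OF that]])
    show "deriv (\<lambda>t. P (z + t)) 0 = deriv (\<lambda>t. P (w + t)) 0" using d[of z 0] d[of w 0] zw eq(2) by simp
  qed (use r(1) eq(1) in auto)
  have "P ((z - w) + 1 * t) = P t" if t: "t \<in> ball w r" for t
  proof -
    have "t - w \<in> ball 0 r" using t by (simp add: dist_norm norm_minus_commute)
    from eq[OF this] show ?thesis by (simp add: algebra_simps)
  qed
  note sym = this
  have "ball w r \<noteq> {}" using r(1) by simp
  then have "P ((z - w) + 1 * t) = P t" for t
    by (intro extend_symmetry[OF one_neq_zero open_ball _ sym])
  then show ?thesis unfolding period_iff[symmetric] is_period_def by (simp add: add.commute)
qed

lemma fibre:
  assumes "z \<notin> L" "w \<notin> L" "P z = P w"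
  shows "z - w \<in> L \<or> z + w \<in> L"
proof -
  have "(deriv P z)\<^sup>2 = (deriv P w)\<^sup>2" using ode[OF assms(1)] ode[OF assms(2)] assms(3) by simp
  then consider "deriv P z = deriv P w" | "deriv P z = - deriv P w" by (auto simp: power2_eq_iff)
  then show ?thesis
  proof cases
    case 1
    then show ?thesis using fibre_with_deriv assms by blast
  next
    case 2
    have "z - (- w) \<in> L"
      by (rule fibre_with_deriv) (use assms 2 L_neg_iff even deriv_neg[of w] in auto)
    then show ?thesis by simp
  qed
qed

text \<open>
  At the half-periods \<open>z\<close> and \<open>-z\<close> differ by a period, while \<open>\<wp>'\<close> is odd; conversely a zero of \<open>\<wp>'\<close>
  gives \<open>z\<close> and \<open>-z\<close> the same value and the same derivative.
\<close>

lemma deriv_zero_iff: "z \<notin> L \<Longrightarrow> deriv P z = 0 \<longleftrightarrow> 2 * z \<in> L"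
proof
  assume z: "z \<notin> L" "deriv P z = 0"
  have "z - (- z) \<in> L"
    by (rule fibre_with_deriv) (use z L_neg_iff even deriv_neg[of z] in auto)
  then show "2 * z \<in> L" by simp
next
  assume z: "z \<notin> L" "2 * z \<in> L"
  have "deriv P z = deriv P (- z + 2 * z)" by simp
  also have "\<dots> = deriv P (- z)" by (rule deriv_period) (use z L_neg_iff in auto)
  finally show "deriv P z = 0" using deriv_neg[OF z(1)] by simp
qed

lemma root_iff: "z \<notin> L \<Longrightarrow> P z \<in> {e, e', e''} \<longleftrightarrow> 2 * z \<in> L"
  unfolding cubic_zero[symmetric] using ode[of z] deriv_zero_iff[of z] by (simp flip: ode)

lemma L_double: "z \<in> L \<Longrightarrow> 2 * z \<in> L" using L_add[of z z] by simp

text \<open>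
  With \<open>y = 1/\<wp>\<close> at half the argument, \<open>n/d\<close> is the duplication formula for \<open>1/\<wp>\<close>; the identity
  expresses that it solves the equation of \<open>1/\<wp>\<close>.
\<close>

lemma dup_identity_inf:
  fixes y :: complex
  defines "n \<equiv> 4 * y - a * y ^ 3 - b * y ^ 4" and "d \<equiv> (1 + a / 4 * y\<^sup>2)\<^sup>2 + 2 * b * y ^ 3"
  shows "((4 - 3 * a * y\<^sup>2 - 4 * b * y ^ 3) * d - n * (a * y * (1 + a / 4 * y\<^sup>2) + 6 * b * y\<^sup>2))\<^sup>2
    = 4 * (4 * d ^ 3 - a * n\<^sup>2 * d - b * n ^ 3)"
  unfolding n_def d_def by (simp add: field_simps power2_eq_square power3_eq_cube power4_eq_xxxx)

text \<open>
  Near the origin \<open>1/\<wp>(v)\<close> and the duplication formula for it at \<open>v/2\<close> solve the same equation and both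
  vanish at 0.  The identity theorem carries the resulting relation to all \<open>v\<close>.
\<close>

lemma duplication_product:
  assumes v: "v \<notin> L"
  shows "P v * cubic a b (P (v / 2)) = dup_num a b (P (v / 2))"
proof -
  obtain r where r: "0 < r" "ball 0 r - {0} \<subseteq> - L" "(\<lambda>t. inverse (P t)) holomorphic_on ball 0 r"
    "\<And>t. t \<in> ball 0 r - {0} \<Longrightarrow> P t \<noteq> 0" "\<not> (\<lambda>t. inverse (P t)) constant_on ball 0 r"
    "\<And>t. t \<in> ball 0 r \<Longrightarrow> (deriv (\<lambda>t. inverse (P t)) t)\<^sup>2 = cubic_inf a b (inverse (P t))"
    by (rule pole_nbhd[OF pole0]) (rule that)
  define h where "h t = inverse (P t)" for t
  have h_fun: "(\<lambda>t. inverse (P t)) = h" by (auto simp: h_def)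
  note r = r[unfolded h_fun]
  define den where "den y = (1 + a / 4 * y\<^sup>2)\<^sup>2 + 2 * b * y ^ 3" for y :: complex
  define k where "k t = h (t / 2)" for t
  have half: "t / 2 \<in> ball 0 r" if "t \<in> ball 0 r" for t :: complex using that r(1) by (simp add: norm_divide)
  have "(h \<circ> (\<lambda>t. t / 2)) holomorphic_on ball 0 r"
    by (rule holomorphic_on_compose_gen[OF _ r(3)]) (use half in \<open>auto intro!: holomorphic_intros\<close>)
  then have holk: "k holomorphic_on ball 0 r" by (simp add: o_def k_def[abs_def])
  have h0: "h 0 = 0" using at_pole_zero[OF pole0] by (simp add: h_def)
  have "isCont (\<lambda>t. den (k t)) 0"
  proof -
    have "isCont k 0" using holk r(1) holomorphic_on_imp_continuous_on continuous_on_eq_continuous_at open_ball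
      by (metis centre_in_ball)
    then show ?thesis unfolding den_def by (intro continuous_intros)
  qed
  moreover have "den (k 0) \<noteq> 0" using h0 by (simp add: k_def den_def)
  ultimately obtain \<rho>0 where \<rho>0: "\<rho>0 > 0" "\<And>t. t \<in> ball 0 \<rho>0 \<Longrightarrow> den (k t) \<noteq> 0"
    using continuous_at_avoid[of 0 "\<lambda>t. den (k t)" 0] by (auto simp: dist_commute)
  define \<rho> where "\<rho> = min r \<rho>0"
  have \<rho>: "\<rho> > 0" "ball 0 \<rho> \<subseteq> ball 0 r" "\<And>t. t \<in> ball 0 \<rho> \<Longrightarrow> den (k t) \<noteq> 0" using r(1) \<rho>0 by (auto simp: \<rho>_def)
  define f where "f t = cubic_inf a b (k t) / den (k t)" for t
  have holk': "k holomorphic_on ball 0 \<rho>" using holk \<rho>(2) holomorphic_on_subset by blast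
  have holf: "f holomorphic_on ball 0 \<rho>"
    unfolding f_def using holk' \<rho>(3) unfolding cubic_inf_def den_def by (intro holomorphic_intros)
  have holh: "h holomorphic_on ball 0 \<rho>" using r(3) \<rho>(2) holomorphic_on_subset by blast
  have dk: "deriv k t = deriv h (t / 2) / 2" if "t \<in> ball 0 \<rho>" for t
  proof -
    have "t / 2 \<in> ball 0 r" using half \<rho>(2) that by blast
    then have "((\<lambda>t. h (t / 2)) has_field_derivative deriv h (t / 2) * (1 / 2)) (at t)"
      by (intro DERIV_chain2[OF holomorphic_deriv_at[OF r(3) open_ball]]) (auto intro!: derivative_eq_intros)
    then show ?thesis unfolding k_def[abs_def] by (simp add: DERIV_imp_deriv)
  qed
  have k2: "(deriv k t)\<^sup>2 = cubic_inf a b (k t) / 4" if t: "t \<in> ball 0 \<rho>" for t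
  proof -
    have "t / 2 \<in> ball 0 r" using half \<rho>(2) t by blast
    then show ?thesis unfolding dk[OF t] using r(6)[of "t / 2"] by (simp add: power_divide k_def h_def)
  qed
  have odef: "(deriv f t)\<^sup>2 = cubic_inf a b (f t)" if t: "t \<in> ball 0 \<rho>" for t
  proof -
    define y where "y = k t"
    define y1 where "y1 = deriv k t"
    define n where "n = 4 * y - a * y ^ 3 - b * y ^ 4"
    define d where "d = (1 + a / 4 * y\<^sup>2)\<^sup>2 + 2 * b * y ^ 3"
    define E where "E = (4 - 3 * a * y\<^sup>2 - 4 * b * y ^ 3) * d - n * (a * y * (1 + a / 4 * y\<^sup>2) + 6 * b * y\<^sup>2)"
    have d0: "d \<noteq> 0" using \<rho>(3)[OF t] by (simp add: d_def den_def y_def)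
    have kd: "(k has_field_derivative y1) (at t)" unfolding y1_def by (rule holomorphic_deriv_at[OF holk' open_ball t])
    have "deriv f t = E / d\<^sup>2 * y1"
    proof (rule DERIV_imp_deriv)
      have nd: "((\<lambda>t. cubic_inf a b (k t)) has_field_derivative (4 - 3 * a * y\<^sup>2 - 4 * b * y ^ 3) * y1) (at t)"
        unfolding cubic_inf_def y_def
        by (auto intro!: derivative_eq_intros kd simp: power2_eq_square power3_eq_cube algebra_simps)
      have dd: "((\<lambda>t. den (k t)) has_field_derivative (a * y * (1 + a / 4 * y\<^sup>2) + 6 * b * y\<^sup>2) * y1) (at t)"
        unfolding den_def y_def
        by (auto intro!: derivative_eq_intros kd simp: power2_eq_square power3_eq_cube field_simps)
      have "(f has_field_derivative ((4 - 3 * a * y\<^sup>2 - 4 * b * y ^ 3) * y1 * den (k t) -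
          cubic_inf a b (k t) * ((a * y * (1 + a / 4 * y\<^sup>2) + 6 * b * y\<^sup>2) * y1)) / (den (k t) * den (k t))) (at t)"
        unfolding f_def[abs_def] by (rule DERIV_divide[OF nd dd \<rho>(3)[OF t]])
      moreover have "den (k t) = d" "cubic_inf a b (k t) = n"
        by (simp_all add: d_def den_def y_def n_def cubic_inf_def)
      ultimately show "(f has_field_derivative E / d\<^sup>2 * y1) (at t)"
        by (simp add: E_def power2_eq_square algebra_simps)
    qed
    then have "(deriv f t)\<^sup>2 = E\<^sup>2 / d ^ 4 * y1\<^sup>2" by (simp add: power_mult_distrib power_divide flip: power_mult)
    also have "y1\<^sup>2 = n / 4" using k2[OF t] by (simp add: y1_def y_def n_def cubic_inf_def)
    also have "E\<^sup>2 = 4 * (4 * d ^ 3 - a * n\<^sup>2 * d - b * n ^ 3)"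
      unfolding E_def n_def d_def by (rule dup_identity_inf)
    also have "4 * (4 * d ^ 3 - a * n\<^sup>2 * d - b * n ^ 3) / d ^ 4 * (n / 4) = cubic_inf a b (n / d)"
      using d0 by (simp add: cubic_inf_def field_simps power2_eq_square power3_eq_cube power4_eq_xxxx)
    also have "n / d = f t" by (simp add: f_def n_def d_def den_def y_def cubic_inf_def)
    finally show ?thesis .
  qed
  have odeh: "(deriv h t)\<^sup>2 = cubic_inf a b (h t)" if "t \<in> ball 0 \<rho>" for t
    using r(6)[OF subsetD[OF \<rho>(2) that]] by (simp add: h_def)
  have ini: "f 0 = 0" "h 0 = 0" using h0 by (simp_all add: f_def k_def cubic_inf_def)
  have nch: "\<not> h constant_on ball 0 \<rho>"
  proof
    assume "h constant_on ball 0 \<rho>"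
    then obtain c where "\<And>t. t \<in> ball 0 \<rho> \<Longrightarrow> h t = c" by (auto simp: constant_on_def)
    then have "h (of_real (\<rho> / 2)) = h 0" using \<rho>(1) by simp
    moreover have "(of_real (\<rho> / 2) :: complex) \<in> ball 0 \<rho> - {0}" using \<rho>(1) by simp
    then have "(of_real (\<rho> / 2) :: complex) \<in> ball 0 r - {0}" using \<rho>(2) by blast
    ultimately show False using r(4) h0 by (simp add: h_def)
  qed
  have ncf: "\<not> f constant_on ball 0 \<rho>"
  proof
    assume "f constant_on ball 0 \<rho>"
    then obtain c0 where c0: "\<And>t. t \<in> ball 0 \<rho> \<Longrightarrow> f t = c0" by (auto simp: constant_on_def)
    have f0: "f t = 0" if "t \<in> ball 0 \<rho>" for t
      using c0[OF that] c0[of 0] ini(1) \<rho>(1) by simp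
    then have "deriv k t = 0" if t: "t \<in> ball 0 \<rho>" for t
      using k2[OF t] f0[OF t] \<rho>(3)[OF t] by (simp add: f_def)
    then have "(k has_field_derivative 0) (at t)" if "t \<in> ball 0 \<rho>" for t
      using holomorphic_deriv_at[OF holk' open_ball that] that by simp
    then have "k constant_on ball 0 \<rho>" by (rule has_field_derivative_0_imp_constant_on) auto
    then obtain c where c: "\<And>t. t \<in> ball 0 \<rho> \<Longrightarrow> k t = c" by (auto simp: constant_on_def)
    have "(of_real (\<rho> / 2) :: complex) \<in> ball 0 \<rho>" "(0::complex) \<in> ball 0 \<rho>" using \<rho>(1) by auto
    then have "k (of_real (\<rho> / 2)) = k 0" using c by simp
    then have "h (of_real (\<rho> / 2) / 2) = h 0" unfolding k_def by simp
    moreover have "(of_real (\<rho> / 2) / 2 :: complex) \<in> ball 0 \<rho> - {0}" using \<rho>(1) by (simp add: norm_divide)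
    then have "(of_real (\<rho> / 2) / 2 :: complex) \<in> ball 0 r - {0}" using \<rho>(2) by blast
    ultimately show False using r(4) h0 by (simp add: h_def)
  qed
  have eq: "f t = h t" if "t \<in> ball 0 \<rho>" for t
    using \<rho>(1) by (intro cubic_inf_ode_unique[OF holf holh open_ball connected_ball _ that ncf nch odef odeh ini]) auto
  have near: "P t * cubic a b (P (t / 2)) = dup_num a b (P (t / 2))" if t: "t \<in> ball 0 \<rho> - {0}" for t
  proof -
    have tr: "t \<in> ball 0 r - {0}" "t / 2 \<in> ball 0 r - {0}" using subsetD[OF \<rho>(2), of t] half[of t] t by auto
    define x where "x = P (t / 2)"
    have nz: "x \<noteq> 0" "P t \<noteq> 0" using r(4) tr by (auto simp: x_def)
    have "cubic_inf a b (inverse x) / den (inverse x) = inverse (P t)"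
      using eq[of t] t by (simp add: f_def k_def h_def x_def)
    moreover have "den (inverse x) \<noteq> 0" using \<rho>(3)[of t] t by (simp add: k_def h_def x_def)
    ultimately have *: "P t * cubic_inf a b (inverse x) = den (inverse x)" using nz by (simp add: field_simps)
    have "P t * (x ^ 4 * cubic_inf a b (inverse x)) = x ^ 4 * (P t * cubic_inf a b (inverse x))" by simp
    then have "P t * (x ^ 4 * cubic_inf a b (inverse x)) = x ^ 4 * den (inverse x)" unfolding * .
    moreover have "x ^ 4 * den (inverse x) = dup_num a b x"
      unfolding den_def dup_num_def using nz by (simp add: field_simps power2_eq_square power3_eq_cube power4_eq_xxxx)
    ultimately show ?thesis using cubic_inverse[OF nz(1), of a b] unfolding x_def by metis
  qed
  have halfD: "t / 2 \<in> - L" if "t \<in> - L" for t using that L_double[of "t / 2"] by auto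
  have "(P \<circ> (\<lambda>t. t / 2)) holomorphic_on - L"
    by (rule holomorphic_on_compose_gen[OF _ holP]) (use halfD in \<open>auto intro!: holomorphic_intros\<close>)
  then have holP2: "(\<lambda>t. P (t / 2)) holomorphic_on - L" by (simp add: o_def)
  show ?thesis
  proof (rule analytic_continuation_open[of "ball 0 \<rho> - {0}" "- L" "\<lambda>t. P t * cubic a b (P (t / 2))"
        "\<lambda>t. dup_num a b (P (t / 2))"])
    show "ball 0 \<rho> - {0} \<subseteq> - L" using \<rho>(2) r(2) by blast
    have "of_real (\<rho> / 2) \<in> ball 0 \<rho> - {0 :: complex}" using \<rho>(1) by auto
    then show "ball 0 \<rho> - {0 :: complex} \<noteq> {}" by blast
    show "(\<lambda>t. P t * cubic a b (P (t / 2))) holomorphic_on - L" "(\<lambda>t. dup_num a b (P (t / 2))) holomorphic_on - L"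
      unfolding cubic_def dup_num_def using holP holP2 by (auto intro!: holomorphic_intros)
  qed (use v near openD connectedD' in \<open>auto intro: open_delete\<close>)
qed

end

context weierstrass
begin

lemma half_not_pole: "v \<notin> L \<Longrightarrow> v / 2 \<notin> L" using L_double[of "v / 2"] by auto

lemma dup_eq: "dup a b x = dup_num a b x / cubic a b x"
  by (simp add: dup_def dup_num_def cubic_def)

lemma duplication:
  assumes "v \<notin> L"
  shows "cubic a b (P (v / 2)) \<noteq> 0" "P v = dup a b (P (v / 2))"
proof -
  show "cubic a b (P (v / 2)) \<noteq> 0"
    using root_iff[OF half_not_pole[OF assms]] assms unfolding cubic_zero by simp
  then show "P v = dup a b (P (v / 2))"
    using duplication_product[OF assms] unfolding dup_eq by (simp add: field_simps)
qed

lemma open_roots: "open (- {e, e', e''})" by (auto intro: finite_imp_closed simp: open_Compl)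

lemma countable_roots: "countable (- (- {e, e', e''}))" by simp

lemma connected_roots: "connected (- {e, e', e''})"
  using connectedD[of UNIV "{e, e', e''}"] by (simp add: Compl_eq_Diff_UNIV connected_UNIV)

lemma not_root_deriv_nonzero: "w \<notin> L \<Longrightarrow> P w \<notin> {e, e', e''} \<Longrightarrow> deriv P w \<noteq> 0"
  using ode[of w] cubic_zero[of "P w"] by auto

text \<open>
  A relation \<open>y = \<wp> \<circ> u\<close> spreads over the whole domain: where \<open>u\<close> had a pole of \<open>\<wp>\<close> as its
  value, \<open>y\<close> would be infinite.
\<close>

lemma relation_spreads:
  assumes S: "open S" "connected S" "u holomorphic_on S" "y holomorphic_on S" "\<And>t. t \<in> S \<Longrightarrow> deriv u t \<noteq> 0"
    and N: "open N" "N \<noteq> {}" "N \<subseteq> S" "\<And>t. t \<in> N \<Longrightarrow> u t \<notin> L \<and> P (u t) = y t" and t: "t \<in> S"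
  shows "u t \<notin> L \<and> P (u t) = y t"
proof -
  define C where "C = {x \<in> S. u x \<in> L}"
  have "\<not> u constant_on S"
  proof
    assume "u constant_on S"
    then obtain k where k: "\<And>z. z \<in> S \<Longrightarrow> u z = k" by (auto simp: constant_on_def)
    have "deriv u t = deriv (\<lambda>_. k) t" by (rule deriv_cong_open[OF S(1) t k])
    then show False using S(5)[OF t] by simp
  qed
  note nc = this
  have "countable C" unfolding C_def by (rule countable_preimage[OF S(3,1,2) nc countable_L])
  then have cC: "connected (S - C)" by (rule connectedD[OF S(2,1)])
  have "S - C = S \<inter> u -` (- L)" by (auto simp: C_def)
  then have oC: "open (S - C)"
    using continuous_open_preimage[OF holomorphic_on_imp_continuous_on[OF S(3)] S(1) openD] by simp
  have subN: "N \<subseteq> S - C" using N(3,4) by (auto simp: C_def)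
  have "(P \<circ> u) holomorphic_on (S - C)"
    by (rule holomorphic_on_compose_gen[OF holomorphic_on_subset[OF S(3)] holP]) (auto simp: C_def)
  then have holc: "(\<lambda>x. P (u x)) holomorphic_on (S - C)" by (simp add: o_def)
  have holy: "y holomorphic_on (S - C)" using S(4) by (rule holomorphic_on_subset) blast
  have on: "P (u x) = y x" if "x \<in> S - C" for x
    by (rule analytic_continuation_open[OF N(1) oC N(2) cC subN holc holy _ that]) (use N(4) in blast)
  have "C = {}"
  proof (rule ccontr)
    assume "C \<noteq> {}"
    then obtain c where c: "c \<in> S" "u c \<in> L" by (auto simp: C_def)
    have lim: "filterlim u (at (u c)) (at c)" by (rule filterlim_at_nonconst[OF S(3,1,2) c(1) nc])
    have "filterlim P at_infinity (at (u c))" using c(2) by (simp add: L_def is_pole_def)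
    then have inf: "filterlim (\<lambda>x. P (u x)) at_infinity (at c)" by (rule filterlim_compose[OF _ lim])
    have "\<forall>\<^sub>F x in at c. u x \<notin> L" using not_pole_eventually[of "u c"] lim unfolding filterlim_iff by blast
    moreover have "\<forall>\<^sub>F x in at c. x \<in> S" using S(1) c(1) by (rule eventually_at_in_open')
    ultimately have ev: "\<forall>\<^sub>F x in at c. y x = P (u x)" by eventually_elim (use on in \<open>auto simp: C_def\<close>)
    have "isCont y c" using S(4,1) c(1) holomorphic_on_imp_continuous_on continuous_on_eq_continuous_at by blast
    then have "(y \<longlongrightarrow> y c) (at c)" by (simp add: isCont_def)
    then have "((\<lambda>x. P (u x)) \<longlongrightarrow> y c) (at c)" by (rule Lim_transform_eventually[OF _ ev])
    then show False using not_tendsto_and_filterlim_at_infinity[OF at_neq_bot _ inf] by blast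
  qed
  then show ?thesis using on t by (auto simp: C_def)
qed

text \<open>
  A branch of the elliptic integral \<open>\<integral> dx / \<surd>(4x\<^sup>3 - ax - b)\<close> over a disc without branch points
  is an inverse of \<open>\<wp>\<close> on the whole disc.
\<close>

lemma sections_on_ball:
  assumes B: "ball x0 \<rho> \<subseteq> - {e, e', e''}" "x1 \<in> ball x0 \<rho>" and w: "w \<notin> L" "P w = x1"
  obtains \<sigma> where "\<sigma> holomorphic_on ball x0 \<rho>" "\<sigma> x1 = w"
    "\<And>x. x \<in> ball x0 \<rho> \<Longrightarrow> \<sigma> x \<notin> L \<and> P (\<sigma> x) = x"
proof -
  have nz: "cubic a b x \<noteq> 0" if "x \<in> ball x0 \<rho>" for x using that B(1) cubic_zero by blast
  have holc: "cubic a b holomorphic_on ball x0 \<rho>" unfolding cubic_def[abs_def] by (intro holomorphic_intros)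
  obtain r where r: "r holomorphic_on ball x0 \<rho>" "\<And>x. x \<in> ball x0 \<rho> \<Longrightarrow> cubic a b x = (r x)\<^sup>2"
    using contractible_imp_holomorphic_sqrt[OF holc convex_imp_contractible[OF convex_ball] nz] by blast
  have rnz: "r x \<noteq> 0" if "x \<in> ball x0 \<rho>" for x using r(2)[OF that] nz[OF that] by auto
  have "(\<lambda>x. 1 / r x) holomorphic_on ball x0 \<rho>" using r(1) rnz by (intro holomorphic_intros)
  then obtain F where "\<And>x. x \<in> ball x0 \<rho> \<Longrightarrow> (F has_field_derivative 1 / r x) (at x within ball x0 \<rho>)"
    using holomorphic_convex_primitive'[OF convex_ball open_ball] by blast
  then have F: "(F has_field_derivative 1 / r x) (at x)" if "x \<in> ball x0 \<rho>" for x
    using that by (simp add: at_within_open[OF _ open_ball])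
  have wroot: "P w \<notin> {e, e', e''}" using B w(2) by blast
  have wD: "w \<in> - L" using w(1) by blast
  obtain V \<sigma>0 where V: "open V" "w \<in> V" "V \<subseteq> - L" "inj_on P V" "open (P ` V)" "\<sigma>0 holomorphic_on (P ` V)"
    "\<And>x. x \<in> V \<Longrightarrow> \<sigma>0 (P x) = x"
    by (rule local_section[OF holP openD wD not_root_deriv_nonzero[OF w(1) wroot]]) (rule that)
  have "open (P ` V \<inter> ball x0 \<rho>)" "x1 \<in> P ` V \<inter> ball x0 \<rho>" using V B(2) w(2) by (auto intro: open_Int)
  then obtain \<epsilon> where \<epsilon>: "\<epsilon> > 0" "ball x1 \<epsilon> \<subseteq> P ` V \<inter> ball x0 \<rho>" by (rule openE)
  have s0: "\<sigma>0 y \<notin> L" "P (\<sigma>0 y) = y" if y: "y \<in> ball x1 \<epsilon>" for y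
  proof -
    obtain x where "x \<in> V" "y = P x" using y \<epsilon>(2) by blast
    then show "\<sigma>0 y \<notin> L" "P (\<sigma>0 y) = y" using V(3) V(7) by auto
  qed
  have hol0: "\<sigma>0 holomorphic_on ball x1 \<epsilon>" using V(6) by (rule holomorphic_on_subset) (use \<epsilon> in auto)
  have sq: "(deriv \<sigma>0 y)\<^sup>2 * (r y)\<^sup>2 = 1" if y: "y \<in> ball x1 \<epsilon>" for y
  proof -
    have "((\<lambda>y. P (\<sigma>0 y)) has_field_derivative deriv P (\<sigma>0 y) * deriv \<sigma>0 y) (at y)"
      by (rule DERIV_chain2[where f = P and g = \<sigma>0, OF derivP[OF s0(1)[OF y]] holomorphic_deriv_at[OF hol0 open_ball y]])
    then have "((\<lambda>y. y) has_field_derivative deriv P (\<sigma>0 y) * deriv \<sigma>0 y) (at y)"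
      by (rule has_field_derivative_transform_within_open[OF _ open_ball y]) (use s0(2) in auto)
    then have one: "deriv P (\<sigma>0 y) * deriv \<sigma>0 y = 1" using DERIV_unique DERIV_ident by blast
    have "(deriv P (\<sigma>0 y))\<^sup>2 = (r y)\<^sup>2" using ode[OF s0(1)[OF y]] s0(2)[OF y] r(2)[of y] \<epsilon>(2) y by auto
    then have "(deriv \<sigma>0 y)\<^sup>2 * (r y)\<^sup>2 = (deriv P (\<sigma>0 y) * deriv \<sigma>0 y)\<^sup>2" by (simp add: power_mult_distrib)
    then show ?thesis using one by simp
  qed
  have x1: "x1 \<in> ball x1 \<epsilon>" using \<epsilon>(1) by simp
  (* the sign of the square root for which the branch has the derivative of the local inverse *)
  define s where "s = deriv \<sigma>0 x1 * r x1"
  have s2: "s\<^sup>2 = 1" using sq[OF x1] by (simp add: s_def power_mult_distrib)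
  then have snz: "s \<noteq> 0" by auto
  define \<sigma> where "\<sigma> x = w + s * (F x - F x1)" for x
  have d\<sigma>: "(\<sigma> has_field_derivative s / r x) (at x)" if "x \<in> ball x0 \<rho>" for x
    unfolding \<sigma>_def[abs_def] by (auto intro!: derivative_eq_intros F[OF that])
  have der: "deriv \<sigma> x = s / r x" if "x \<in> ball x0 \<rho>" for x using d\<sigma>[OF that] by (rule DERIV_imp_deriv)
  have dnz: "deriv \<sigma> x \<noteq> 0" if "x \<in> ball x0 \<rho>" for x using der[OF that] snz rnz[OF that] by simp
  have hol: "\<sigma> holomorphic_on ball x0 \<rho>" unfolding holomorphic_on_open[OF open_ball] using d\<sigma> by blast
  have sub: "ball x1 \<epsilon> \<subseteq> ball x0 \<rho>" using \<epsilon>(2) by blast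
  have eq: "\<sigma>0 y = \<sigma> y" if y: "y \<in> ball x1 \<epsilon>" for y
  proof (rule square_deriv_unique[OF hol0 holomorphic_on_subset[OF hol sub] open_ball connected_ball x1 y])
    fix z assume z: "z \<in> ball x1 \<epsilon>"
    then have z0: "z \<in> ball x0 \<rho>" using sub by blast
    show "(deriv \<sigma>0 z)\<^sup>2 = (deriv \<sigma> z)\<^sup>2"
      using sq[OF z] rnz[OF z0] by (simp add: der[OF z0] power_divide s2 field_simps)
    show "deriv \<sigma> z \<noteq> 0" by (rule dnz[OF z0])
  next
    show "\<sigma>0 x1 = \<sigma> x1" using V(7)[OF V(2)] w(2) by (simp add: \<sigma>_def)
    show "deriv \<sigma>0 x1 = deriv \<sigma> x1" using rnz[OF B(2)] by (simp add: der[OF B(2)] s_def)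
  qed
  have near: "\<sigma> y \<notin> L \<and> P (\<sigma> y) = y" if "y \<in> ball x1 \<epsilon>" for y using s0[OF that] eq[OF that] by simp
  have ne: "ball x1 \<epsilon> \<noteq> {}" using x1 by blast
  have "\<sigma> x \<notin> L \<and> P (\<sigma> x) = x" if "x \<in> ball x0 \<rho>" for x
    by (rule relation_spreads[where y = "\<lambda>x. x", OF open_ball connected_ball hol holomorphic_on_ident dnz open_ball ne sub near that])
  moreover have "\<sigma> x1 = w" by (simp add: \<sigma>_def)
  ultimately show ?thesis using that hol by blast
qed

lemma roots_ball:
  assumes "x \<in> - {e, e', e''}"
  obtains r where "r > 0" "ball x r \<subseteq> - {e, e', e''}"
  using openE[OF open_roots assms] by blast

text \<open>
  Over a disc without branch points either all or none of the points are values, by the sections above;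
  the plane without the three branch points is connected.
\<close>

lemma value_attained:
  assumes "x \<in> - {e, e', e''}"
  shows "\<exists>w. w \<notin> L \<and> P w = x"
proof -
  let ?at = "\<lambda>x. \<exists>w. w \<notin> L \<and> P w = x"
  have "\<not> - L \<subseteq> {v. P v \<in> {e, e', e''}}"
  proof
    assume "- L \<subseteq> {v. P v \<in> {e, e', e''}}"
    then have "P ` (- L) \<subseteq> {e, e', e''}" by auto
    then have "finite (P ` (- L))" by (rule finite_subset) simp
    then have "P constant_on - L"
      by (rule continuous_finite_range_constant[OF connectedD' holomorphic_on_imp_continuous_on[OF holP]])
    moreover have "- L \<noteq> {}" using pole_nbhd[OF pole0] countable_L uncountable_UNIV_complex by (metis Compl_empty_eq double_compl)
    ultimately show False using nonconst[OF openD] by blast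
  qed
  then obtain v where v: "v \<notin> L" "P v \<in> - {e, e', e''}" by auto
  show ?thesis
  proof (rule connected_induction_simple[OF connected_roots v(2) assms])
    show "?at (P v)" using v by blast
    fix y assume "y \<in> - {e, e', e''}"
    then obtain r where r: "r > 0" "ball y r \<subseteq> - {e, e', e''}" by (rule roots_ball)
    have "?at z" if w: "w \<notin> L" "P w = x'" and x': "x' \<in> ball y r" and z: "z \<in> ball y r" for w x' z
    proof -
      obtain \<sigma> where \<sigma>: "\<sigma> holomorphic_on ball y r" "\<sigma> x' = w" "\<And>x. x \<in> ball y r \<Longrightarrow> \<sigma> x \<notin> L \<and> P (\<sigma> x) = x"
        by (rule sections_on_ball[OF r(2) x' w]) (rule that)
      show ?thesis using \<sigma>(3)[OF z] by blast
    qed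
    then have "\<forall>x\<in>ball y r. \<forall>z\<in>ball y r. ?at x \<longrightarrow> ?at z" by blast
    moreover have "openin (top_of_set (- {e, e', e''})) (ball y r)" using r(2) by (simp add: openin_open_eq[OF open_roots])
    moreover have "y \<in> ball y r" using r(1) by simp
    ultimately show "\<exists>T. openin (top_of_set (- {e, e', e''})) T \<and> y \<in> T \<and> (\<forall>x\<in>T. \<forall>z\<in>T. ?at x \<longrightarrow> ?at z)" by blast
  qed
qed

lemma is_section_on_ball:
  assumes "\<sigma> holomorphic_on ball x0 \<rho>" "\<And>x. x \<in> ball x0 \<rho> \<Longrightarrow> \<sigma> x \<notin> L \<and> P (\<sigma> x) = x" "x \<in> ball x0 \<rho>"
  shows "is_section P x \<sigma>"
proof -
  have "\<forall>\<^sub>F y in nhds x. y \<in> ball x0 \<rho>" using open_ball assms(3) by (rule eventually_nhds_in_open)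
  then have "\<forall>\<^sub>F y in nhds x. P (\<sigma> y) = y" by eventually_elim (use assms(2) in blast)
  moreover have "\<sigma> analytic_on {x}" using assms(1,3) open_ball by (auto simp: analytic_at)
  ultimately show ?thesis by (simp add: is_section_def)
qed

text \<open>
  The sections over discs of fixed size make the local inverses of \<open>\<wp>\<close> continuable along all paths
  that avoid the branch points.
\<close>

lemma lifts_paths_P: "lifts_paths P {v. v \<notin> L \<and> 2 * v \<notin> L} (- {e, e', e''})"
  unfolding lifts_paths_def
proof (intro allI impI, elim conjE)
  fix \<gamma> \<tau> assume \<gamma>: "path \<gamma>" "path_image \<gamma> \<subseteq> - {e, e', e''}" and \<tau>: "\<tau> \<in> {v. v \<notin> L \<and> 2 * v \<notin> L}" "P \<tau> = \<gamma> 0"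
  define A where "A x f \<longleftrightarrow> is_section P x f \<and> f x \<notin> L" for x f
  have in_im: "\<gamma> t \<in> - {e, e', e''}" if "t \<in> {0..1}" for t using \<gamma>(2) that by (rule path_image_in)
  have ext: "\<exists>r>0. \<forall>z'\<in>ball z r. \<forall>f. A z' f \<longrightarrow>
        (\<exists>g. g holomorphic_on ball z r \<and> (\<forall>w\<in>ball z r. A w g) \<and> (\<forall>\<^sub>F w in nhds z'. f w = g w))"
    if z: "z \<in> - {e, e', e''}" for z
  proof -
    obtain r where r: "r > 0" "ball z r \<subseteq> - {e, e', e''}" using z by (rule roots_ball)
    have "\<exists>g. g holomorphic_on ball z r \<and> (\<forall>w\<in>ball z r. A w g) \<and> (\<forall>\<^sub>F w in nhds z'. f w = g w)"
      if z': "z' \<in> ball z r" and f: "A z' f" for z' f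
    proof -
      have fs: "is_section P z' f" "f z' \<notin> L" using f by (auto simp: A_def)
      have pf: "P (f z') = z'" using fs(1) eventually_nhds_x_imp_x unfolding is_section_def by fast
      obtain \<sigma> where \<sigma>: "\<sigma> holomorphic_on ball z r" "\<sigma> z' = f z'" "\<And>x. x \<in> ball z r \<Longrightarrow> \<sigma> x \<notin> L \<and> P (\<sigma> x) = x"
        by (rule sections_on_ball[OF r(2) z' fs(2) pf]) (rule that)
      have s: "A w \<sigma>" if "w \<in> ball z r" for w
        using is_section_on_ball[OF \<sigma>(1,3) that] \<sigma>(3)[OF that] by (simp add: A_def)
      have fD: "f z' \<in> - L" using fs(2) by blast
      have "P (f z') \<notin> {e, e', e''}" using pf z' r(2) by auto
      then have inj: "\<exists>U. open U \<and> f z' \<in> U \<and> inj_on P U"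
        by (intro locally_inj[OF holP openD fD] not_root_deriv_nonzero[OF fs(2)])
      have "is_section P z' \<sigma>" using s[OF z'] by (simp add: A_def)
      then have "\<forall>\<^sub>F w in nhds z'. f w = \<sigma> w" by (rule section_unique[where ?\<sigma>1.0 = f and ?\<sigma>2.0 = \<sigma>, OF fs(1) _ \<sigma>(2)[symmetric] inj])
      then show ?thesis using \<sigma>(1) s by blast
    qed
    then show ?thesis using r(1) by blast
  qed
  have "\<gamma> 0 \<in> - {e, e', e''}" by (rule in_im) simp
  then obtain r where r: "r > 0" "ball (\<gamma> 0) r \<subseteq> - {e, e', e''}" by (rule roots_ball)
  have c: "\<gamma> 0 \<in> ball (\<gamma> 0) r" using r(1) by simp
  have \<tau>L: "\<tau> \<notin> L" using \<tau>(1) by blast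
  obtain \<sigma> where \<sigma>: "\<sigma> holomorphic_on ball (\<gamma> 0) r" "\<sigma> (\<gamma> 0) = \<tau>" "\<And>x. x \<in> ball (\<gamma> 0) r \<Longrightarrow> \<sigma> x \<notin> L \<and> P (\<sigma> x) = x"
    by (rule sections_on_ball[OF r(2) c \<tau>L \<tau>(2)]) (rule that)
  have sec: "is_section P (\<gamma> 0) \<sigma>" by (rule is_section_on_ball[OF \<sigma>(1,3) c])
  have A0: "A (\<gamma> 0) \<sigma>" using sec \<sigma>(2) \<tau>L by (simp add: A_def)
  have an: "\<sigma> analytic_on {\<gamma> 0}" using sec by (simp add: is_section_def)
  obtain F where F: "continuation_on {0..1} \<gamma> F" "F 0 = \<sigma>" "\<And>t. t \<in> {0..1} \<Longrightarrow> A (\<gamma> t) (F t)"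
    by (rule germ_continuation[OF \<gamma> ext A0 an]) (assumption, rule that)
  define g where "g t = F t (\<gamma> t)" for t
  have "continuous_on {0..1} \<gamma>" using \<gamma>(1) by (simp add: path_def)
  then have pg: "path g" unfolding path_def g_def by (rule continuation_on_continuous[OF F(1)])
  have Pg: "P (g t) = \<gamma> t" "g t \<notin> L" if t: "t \<in> {0..1}" for t
  proof -
    have *: "is_section P (\<gamma> t) (F t)" "F t (\<gamma> t) \<notin> L" using F(3)[OF t] by (auto simp: A_def)
    then show "g t \<notin> L" by (simp add: g_def)
    have "\<forall>\<^sub>F w in nhds (\<gamma> t). P (F t w) = w" using *(1) by (simp add: is_section_def)
    then show "P (g t) = \<gamma> t" unfolding g_def by (rule eventually_nhds_x_imp_x)
  qed
  have "2 * g t \<notin> L" if t: "t \<in> {0..1}" for t using root_iff[OF Pg(2)[OF t]] in_im[OF t] Pg(1)[OF t] by simp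
  then have "path_image g \<subseteq> {v. v \<notin> L \<and> 2 * v \<notin> L}" using Pg(2) by (auto simp: path_image_def)
  moreover have "g 0 = \<tau>" using F(2) \<sigma>(2) by (simp add: g_def)
  ultimately show "\<exists>g. path g \<and> path_image g \<subseteq> {v. v \<notin> L \<and> 2 * v \<notin> L} \<and> g 0 = \<tau> \<and> (\<forall>t\<in>{0..1}. P (g t) = \<gamma> t)"
    using pg Pg(1) by blast
qed

lemma second_deriv: "v \<notin> L \<Longrightarrow> deriv (deriv P) v = 6 * (P v)\<^sup>2 - a / 2"
proof (rule first_to_second_order[OF holP openD connectedD', of "cubic a b" "\<lambda>x. 6 * x\<^sup>2 - a / 2"])
  assume v: "v \<notin> L"
  show "\<not> P constant_on - L" using nonconst[OF openD] v by blast
  show "(cubic a b has_field_derivative 2 * (6 * x\<^sup>2 - a / 2)) (at x)" for x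
    unfolding cubic_def[abs_def] by (auto intro!: derivative_eq_intros simp: power2_eq_square)
  show "v \<in> - L" using v by simp
qed (use ode in \<open>auto intro!: continuous_intros\<close>)

lemma third_deriv: "v \<notin> L \<Longrightarrow> deriv (deriv (deriv P)) v = 12 * P v * deriv P v"
proof -
  assume v: "v \<notin> L"
  then have vD: "v \<in> - L" by simp
  have "deriv (deriv (deriv P)) v = deriv (\<lambda>v. 6 * (P v)\<^sup>2 - a / 2) v"
    by (rule deriv_cong_open[OF openD vD]) (simp add: second_deriv)
  also have "\<dots> = 12 * P v * deriv P v"
    by (rule DERIV_imp_deriv) (auto intro!: derivative_eq_intros derivP[OF v] simp: power2_eq_square)
  finally show ?thesis .
qed

text \<open>
  The equation of \<open>h = 1/\<wp>\<close> gives \<open>h(0) = h'(0) = 0\<close> and \<open>h''(0) = 2\<close>.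
\<close>

lemma pole_limit_zero: "((\<lambda>t. t\<^sup>2 * P t) \<longlongrightarrow> 1) (at 0)"
proof -
  obtain r where r: "0 < r" "ball 0 r - {0} \<subseteq> - L" "(\<lambda>t. inverse (P t)) holomorphic_on ball 0 r"
    "\<And>t. t \<in> ball 0 r - {0} \<Longrightarrow> P t \<noteq> 0" "\<not> (\<lambda>t. inverse (P t)) constant_on ball 0 r"
    "\<And>t. t \<in> ball 0 r \<Longrightarrow> (deriv (\<lambda>t. inverse (P t)) t)\<^sup>2 = cubic_inf a b (inverse (P t))"
    by (rule pole_nbhd[OF pole0]) (rule that)
  define h where "h t = inverse (P t)" for t
  have h_fun: "(\<lambda>t. inverse (P t)) = h" by (auto simp: h_def)
  note r = r[unfolded h_fun]
  have z: "(0::complex) \<in> ball 0 r" using r(1) by simp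
  have h0: "h 0 = 0" using at_pole_zero[OF pole0] by (simp add: h_def)
  have h1: "deriv h 0 = 0" using r(6)[OF z] at_pole_zero[OF pole0] by (simp add: cubic_inf_def)
  have odeh: "(deriv h t)\<^sup>2 = cubic_inf a b (h t)" if "t \<in> ball 0 r" for t using r(6)[OF that] by (simp add: h_def)
  have h2: "deriv (deriv h) 0 = 2"
    using cubic_inf_second_order[OF r(3) open_ball connected_ball r(5) odeh z] h0 by simp
  define g where "g t = (if t = 0 then deriv h 0 else (h t - h 0) / (t - 0))" for t
  have holg: "g holomorphic_on ball 0 r"
    unfolding g_def[abs_def] by (rule pole_lemma_open[OF r(3) open_ball])
  have hg: "h t = t * g t" for t using h0 by (simp add: g_def)
  have dg: "(g has_field_derivative deriv g t) (at t)" if "t \<in> ball 0 r" for t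
    by (rule holomorphic_deriv_at[OF holg open_ball that])
  have dh: "deriv h t = g t + t * deriv g t" if "t \<in> ball 0 r" for t
  proof -
    have "((\<lambda>t. t * g t) has_field_derivative g t + t * deriv g t) (at t)"
      by (auto intro!: derivative_eq_intros dg[OF that])
    then show ?thesis unfolding hg[symmetric] by (rule DERIV_imp_deriv)
  qed
  have "deriv (deriv h) 0 = deriv (\<lambda>t. g t + t * deriv g t) 0"
    by (rule deriv_cong_open[OF open_ball z dh])
  also have "\<dots> = 2 * deriv g 0"
    by (rule DERIV_imp_deriv)
      (auto intro!: derivative_eq_intros dg[OF z] holomorphic_deriv_at[OF holomorphic_deriv[OF holg open_ball] open_ball z])
  finally have g1: "deriv g 0 = 1" using h2 by simp
  have "g 0 = 0" by (simp add: g_def h1)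
  then have "((\<lambda>t. g t / t) \<longlongrightarrow> 1) (at 0)"
    using dg[OF z] g1 by (simp add: has_field_derivative_iff)
  then have lim: "((\<lambda>t. inverse (g t / t)) \<longlongrightarrow> inverse 1) (at 0)" by (rule tendsto_inverse) simp
  have "\<forall>\<^sub>F t in at 0. t \<in> ball 0 r - {0 :: complex}" using eventually_at_ball'[OF r(1), of 0 UNIV] by eventually_elim auto
  then have "\<forall>\<^sub>F t in at 0. inverse (g t / t) = t\<^sup>2 * P t"
  proof eventually_elim
    case (elim t)
    then have "P t \<noteq> 0" "t \<noteq> 0" using r(4) by auto
    moreover have "g t = inverse (P t) / t" using hg[of t] \<open>t \<noteq> 0\<close> by (simp add: h_def field_simps)
    ultimately show ?case by (simp add: power2_eq_square divide_inverse)
  qed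
  from Lim_transform_eventually[OF lim this] show ?thesis by simp
qed

lemma potential_T_limit:
  assumes l: "l \<in> L"
  shows "((\<lambda>z. (z - l)\<^sup>2 * potential_T P A z) \<longlongrightarrow> - (1 / 4)) (at l)"
proof -
  have "filterlim (\<lambda>z. - l + 1 * z) (at (- l + 1 * l)) (at l)" by (rule affine_at) simp
  then have aff: "filterlim (\<lambda>z. z - l) (at 0) (at l)" by (simp add: add.commute)
  have P: "P (z - l) = P z" for z using period[OF l, of "z - l"] by simp
  have "((\<lambda>z. (z - l)\<^sup>2 * P (z - l)) \<longlongrightarrow> 1) (at l)" by (rule filterlim_compose[OF pole_limit_zero aff])
  then have "((\<lambda>z. (z - l)\<^sup>2 * P z) \<longlongrightarrow> 1) (at l)" unfolding P .
  then have "((\<lambda>z. - (1 / 4) * ((z - l)\<^sup>2 * P z) + - (A / 4) * (z - l)\<^sup>2) \<longlongrightarrow> - (1 / 4) * 1 + - (A / 4) * (l - l)\<^sup>2) (at l)"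
    by (intro tendsto_intros)
  moreover have "- (1 / 4) * ((z - l)\<^sup>2 * P z) + - (A / 4) * (z - l)\<^sup>2 = (z - l)\<^sup>2 * potential_T P A z" for z
    by (simp add: potential_T_def field_simps)
  ultimately show ?thesis by simp
qed

end

context weierstrass
begin

section \<open>The three equations\<close>

text \<open>
  Vieta's formulas, by evaluating the factorization at \<open>0, 1, -1\<close>.
\<close>

lemma root_relations: "e'' = - e - e'" "a = - 4 * (e * e' + e * e'' + e' * e'')" "b = 4 * e * e' * e''"
proof -
  have r: "- b = 4 * (- e) * (- e') * (- e'')" "4 - a - b = 4 * (1 - e) * (1 - e') * (1 - e'')"
    "- 4 + a - b = 4 * (- 1 - e) * (- 1 - e') * (- 1 - e'')"
    using roots[of 0] roots[of 1] roots[of "-1"] by simp_all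
  have "8 * (e + e' + e'') = 0" using r by algebra
  then have "e + e' + e'' = 0" by (simp only: mult_eq_0_iff) simp
  then show "e'' = - e - e'" by algebra
  have "2 * a = 2 * (- 4 * (e * e' + e * e'' + e' * e''))" using r by algebra
  then show "a = - 4 * (e * e' + e * e'' + e' * e'')" by (simp only: mult_cancel_left) simp
  show "b = 4 * e * e' * e''" using r(1) by simp
qed

text \<open>
  With \<open>\<wp>'\<^sup>2 = 4(\<wp> - e)(\<wp> - e')(\<wp> - e'')\<close>, \<open>\<wp>'' = 6\<wp>\<^sup>2 - a/2\<close> and \<open>\<wp>''' = 12\<wp>\<wp>'\<close> the law becomes a
  polynomial identity in \<open>\<wp>, e, e', A\<close>.  The double poles of the potential of (L) at the branch points
  are exactly the Schwarzian derivative of a square root.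
\<close>

lemma pulls_back_P:
  assumes v: "v \<notin> L" "2 * v \<notin> L"
  shows "pulls_back (potential_T P A) P (potential_L e e' e'' A) v"
proof -
  define s where "s = P v"
  define d where "d = deriv P v"
  define p q r where "p = s - e" "q = s - e'" "r = s - e''"
  have d0: "d \<noteq> 0" using deriv_zero_iff v by (simp add: d_def)
  have d2: "d\<^sup>2 = 4 * p * q * r" using ode[OF v(1)] by (simp add: d_def s_def p_q_r_def cubic_roots)
  then have nz: "p \<noteq> 0" "q \<noteq> 0" "r \<noteq> 0" using d0 by auto
  have "potential_L e e' e'' A s * (p * q * r)\<^sup>2 =
      - (3 / 16) * ((q * r)\<^sup>2 + (p * r)\<^sup>2 + (p * q)\<^sup>2 - 1 / 3 * ((5 * s - A) * (p * q * r)))"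
    unfolding potential_L_def p_q_r_def[symmetric] using nz by (simp add: divide_simps power2_eq_square) algebra
  moreover have "d ^ 4 = 16 * (p * q * r)\<^sup>2"
  proof -
    have "d ^ 4 = (d\<^sup>2)\<^sup>2" by (simp flip: power_mult)
    then show ?thesis unfolding d2 by (simp add: power2_eq_square)
  qed
  ultimately have L: "2 * potential_L e e' e'' A s * d ^ 4 =
      - 6 * ((q * r)\<^sup>2 + (p * r)\<^sup>2 + (p * q)\<^sup>2) + 2 * ((5 * s - A) * (p * q * r))" by algebra
  have "- 6 * ((q * r)\<^sup>2 + (p * r)\<^sup>2 + (p * q)\<^sup>2) + 2 * ((5 * s - A) * (p * q * r))
      - (12 * s * (4 * p * q * r) - 3 / 2 * (6 * s\<^sup>2 - a / 2)\<^sup>2) = - (1 / 2) * (s + A) * (4 * p * q * r)"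
    unfolding p_q_r_def root_relations(2) root_relations(1) by (simp add: field_simps power2_eq_square)
  then have "2 * potential_L e e' e'' A s * d ^ 4 - (12 * s * d * d - 3 / 2 * (6 * s\<^sup>2 - a / 2)\<^sup>2)
      = - (1 / 2) * (s + A) * d\<^sup>2"
    unfolding L d2[symmetric] by (simp add: power2_eq_square algebra_simps)
  then show ?thesis
    using d0 unfolding pulls_back_def second_deriv[OF v(1)] third_deriv[OF v(1)] potential_T_def
    by (simp add: d_def s_def)
qed

text \<open>
  The same computation, in which the duplication formula enters through the value \<open>\<wp>(v)\<close> in the
  potential of (T).
\<close>

lemma pulls_back_P_half:
  assumes v: "v \<notin> L"
  shows "pulls_back (potential_T P A) (\<lambda>v. P (v / 2)) (potential_P e e' e'' A) v"
proof -
  have v2: "v / 2 \<notin> L" by (rule half_not_pole[OF v])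
  define x where "x = P (v / 2)"
  define d where "d = deriv P (v / 2)"
  define p q r where "p = x - e" "q = x - e'" "r = x - e''"
  have d2c: "d\<^sup>2 = cubic a b x" using ode[OF v2] by (simp add: d_def x_def)
  then have d2: "d\<^sup>2 = 4 * p * q * r" by (simp add: p_q_r_def cubic_roots)
  have d0: "d \<noteq> 0" using duplication(1)[OF v] d2c by (auto simp: x_def)
  then have nz: "p \<noteq> 0" "q \<noteq> 0" "r \<noteq> 0" using d2 by auto
  have "potential_P e e' e'' A x * (p * q * r)\<^sup>2 =
      - (1 / 4) * ((q * r)\<^sup>2 + (p * r)\<^sup>2 + (p * q)\<^sup>2 - (2 * x - A) * (p * q * r))"
    unfolding potential_P_def p_q_r_def[symmetric] using nz by (simp add: divide_simps power2_eq_square) algebra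
  moreover have d4: "d ^ 4 = 16 * (p * q * r)\<^sup>2"
  proof -
    have "d ^ 4 = (d\<^sup>2)\<^sup>2" by (simp flip: power_mult)
    then show ?thesis unfolding d2 by (simp add: power2_eq_square)
  qed
  ultimately have P: "2 * potential_P e e' e'' A x * d ^ 4 / 16 =
      - (1 / 2) * ((q * r)\<^sup>2 + (p * r)\<^sup>2 + (p * q)\<^sup>2 - (2 * x - A) * (p * q * r))" by (simp add: field_simps)
  have "- (1 / 2) * ((q * r)\<^sup>2 + (p * r)\<^sup>2 + (p * q)\<^sup>2 - (2 * x - A) * (p * q * r))
      - (3 / 4 * x * (4 * p * q * r) - 3 / 32 * (6 * x\<^sup>2 - a / 2)\<^sup>2) = - (1 / 8) * (dup_num a b x + A * (4 * p * q * r))"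
    unfolding p_q_r_def dup_num_def root_relations(2,3) root_relations(1) by (simp add: field_simps power2_eq_square)
  moreover have "dup_num a b x = P v * d\<^sup>2" using duplication_product[OF v] d2c by (simp add: x_def)
  ultimately have main: "2 * potential_P e e' e'' A x * d ^ 4 / 16 - (3 / 4 * x * d\<^sup>2 - 3 / 32 * (6 * x\<^sup>2 - a / 2)\<^sup>2)
      = - (1 / 8) * (P v + A) * d\<^sup>2"
    unfolding P d2[symmetric] by (simp add: field_simps)
  have vD: "v \<in> - L" using v by simp
  have sub: "(\<lambda>t. t / 2) ` (- L) \<subseteq> - L" using half_not_pole by auto
  have hol: "(\<lambda>t :: complex. t / 2) holomorphic_on - L" by (intro holomorphic_intros) simp
  have half: "deriv (\<lambda>t :: complex. t / 2) = (\<lambda>_. 1 / 2)"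
    by (rule ext, rule DERIV_imp_deriv) (auto intro!: derivative_eq_intros)
  note D = deriv_compose_three[OF hol openD holP openD sub vD, unfolded half]
  have ds: "deriv (\<lambda>v. P (v / 2)) v = d / 2" "deriv (deriv (\<lambda>v. P (v / 2))) v = (6 * x\<^sup>2 - a / 2) / 4"
    "deriv (deriv (deriv (\<lambda>v. P (v / 2)))) v = 12 * x * d / 8"
    using D second_deriv[OF v2] third_deriv[OF v2] by (simp_all add: d_def x_def power2_eq_square power3_eq_cube)
  define Z where "Z = 6 * x\<^sup>2 - a / 2"
  have "2 * potential_P e e' e'' A x * (d / 2) ^ 4 = 2 * potential_P e e' e'' A x * d ^ 4 / 16"
    by (simp add: power_divide)
  moreover have "12 * x * d / 8 * (d / 2) = 3 / 4 * x * d\<^sup>2" "3 / 2 * (Z / 4)\<^sup>2 = 3 / 32 * Z\<^sup>2"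
    "2 * (- (1 / 4) * (P v + A)) * (d / 2)\<^sup>2 = - (1 / 8) * (P v + A) * d\<^sup>2"
    by (simp_all add: power2_eq_square)
  ultimately show ?thesis
    using d0 main unfolding pulls_back_def ds potential_T_def x_def[symmetric] Z_def[symmetric]
    by (simp only:) simp
qed

lemma P_analytic_half: "v \<notin> L \<Longrightarrow> (\<lambda>v. P (v / 2)) analytic_on {v}"
proof -
  assume v: "v \<notin> L"
  have "(P \<circ> (\<lambda>v. v / 2)) analytic_on {v}"
    by (rule analytic_on_compose) (use analytic[OF half_not_pole[OF v]] in \<open>auto intro!: analytic_intros\<close>)
  then show ?thesis by (simp add: o_def)
qed

lemma dup_holomorphic: "dup a b holomorphic_on - {e, e', e''}"
proof -
  have "(\<lambda>x. dup_num a b x / cubic a b x) holomorphic_on - {e, e', e''}"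
    unfolding dup_num_def by (intro holomorphic_intros) (use cubic_zero in \<open>auto simp: cubic_def intro!: holomorphic_intros\<close>)
  then show ?thesis unfolding dup_eq[abs_def] .
qed

lemma eventually_not_pole_nhds: "v \<notin> L \<Longrightarrow> \<forall>\<^sub>F x in nhds v. x \<notin> L"
  using eventually_nhds_in_open[OF openD, of v] by simp

lemma duplication_germ: "v \<notin> L \<Longrightarrow> \<forall>\<^sub>F x in nhds v. P x = dup a b (P (x / 2))"
  by (rule eventually_mono[OF eventually_not_pole_nhds duplication(2)])

text \<open>
  Since \<open>dup \<circ> \<wp>(\<cdot>/2) = \<wp>\<close>, the law for \<open>dup\<close> is the quotient of the laws for \<open>\<wp>\<close> and for \<open>\<wp>(\<cdot>/2)\<close>, and
  \<open>dup'(x)\<close> vanishes for \<open>x = \<wp>(v/2)\<close> if \<open>\<wp>'(v)\<close> does.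
\<close>

lemma pulls_back_dup:
  assumes x: "x \<in> - {e, e', e''}" and d: "deriv (dup a b) x \<noteq> 0"
  shows "pulls_back (potential_P e e' e'' A) (dup a b) (potential_L e e' e'' A) x"
proof -
  obtain u where u: "u \<notin> L" "P u = x" using value_attained[OF x] by blast
  define v where "v = 2 * u"
  have v: "v \<notin> L" "P (v / 2) = x" using root_iff[OF u(1)] x u(2) by (auto simp: v_def)
  have an: "dup a b analytic_on {P (v / 2)}"
    unfolding v(2) using dup_holomorphic open_roots x analytic_at by blast
  have dvd: "deriv P v = deriv (dup a b) x * deriv (\<lambda>v. P (v / 2)) v"
  proof -
    obtain U V where UV: "open U" "v \<in> U" "(\<lambda>v. P (v / 2)) holomorphic_on U" "open V" "dup a b holomorphic_on V"
      "(\<lambda>v. P (v / 2)) ` U \<subseteq> V"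
      by (rule analytic_compose_nbhd[OF P_analytic_half[OF v(1)] an]) (rule that)
    have "deriv P v = deriv (\<lambda>v. dup a b (P (v / 2))) v" by (rule deriv_eq_germ[OF duplication_germ[OF v(1)]])
    also have "\<dots> = deriv (dup a b) x * deriv (\<lambda>v. P (v / 2)) v"
      using deriv_compose_three(1)[OF UV(3,1,5,4,6,2)] v(2) by simp
    finally show ?thesis .
  qed
  have h: "pulls_back (potential_T P A) (\<lambda>v. P (v / 2)) (potential_P e e' e'' A) v"
    by (rule pulls_back_P_half[OF v(1)])
  then have "deriv P v \<noteq> 0" using dvd d by (simp add: pulls_back_def)
  then have "2 * v \<notin> L" using deriv_zero_iff[OF v(1)] by simp
  then have "pulls_back (potential_T P A) P (potential_L e e' e'' A) v" using v(1) by (intro pulls_back_P)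
  then have "pulls_back (potential_T P A) (\<lambda>v. dup a b (P (v / 2))) (potential_L e e' e'' A) v"
    by (rule pulls_back_cong[OF _ duplication_germ[OF v(1)]])
  from pulls_back_cancel_inner[OF P_analytic_half[OF v(1)] an h this] show ?thesis unfolding v(2) .
qed

lemma transforms_T_L: "transforms_to (- L) (potential_T P A) P (potential_L e e' e'' A)"
  by (rule transforms_toI) (use deriv_zero_iff pulls_back_P in blast)

lemma transforms_T_P: "transforms_to (- L) (potential_T P A) (\<lambda>v. P (v / 2)) (potential_P e e' e'' A)"
  by (rule transforms_toI) (use pulls_back_P_half in blast)

lemma transforms_P_L:
  "transforms_to (- {e, e', e''}) (potential_P e e' e'' A) (dup a b) (potential_L e e' e'' A)"
  by (rule transforms_toI) (use pulls_back_dup in blast)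

lemma holQ_T: "potential_T P A holomorphic_on - L"
  unfolding potential_T_def[abs_def] using holP by (intro holomorphic_intros)

lemma holQ_L: "potential_L e e' e'' A holomorphic_on - {e, e', e''}"
  unfolding potential_L_def[abs_def] by (intro holomorphic_intros) auto

lemma holQ_P: "potential_P e e' e'' A holomorphic_on - {e, e', e''}"
  unfolding potential_P_def[abs_def] by (intro holomorphic_intros) auto

lemma fuchsian_singularity_limit:
  fixes c c' c'' :: complex
  assumes "c \<noteq> c'" "c \<noteq> c''"
  shows "((\<lambda>z. (z - c)\<^sup>2 * (1 / (z - c)\<^sup>2 + 1 / (z - c')\<^sup>2 + 1 / (z - c'')\<^sup>2
     - k * ((m * z - A) / ((z - c) * (z - c') * (z - c''))))) \<longlongrightarrow> 1) (at c)"
proof -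
  have "((\<lambda>z. 1 + (z - c)\<^sup>2 / (z - c')\<^sup>2 + (z - c)\<^sup>2 / (z - c'')\<^sup>2
      - k * ((z - c) * (m * z - A)) / ((z - c') * (z - c''))) \<longlongrightarrow>
      1 + (c - c)\<^sup>2 / (c - c')\<^sup>2 + (c - c)\<^sup>2 / (c - c'')\<^sup>2
      - k * ((c - c) * (m * c - A)) / ((c - c') * (c - c''))) (at c)"
    using assms by (intro tendsto_intros) auto
  then have lim: "((\<lambda>z. 1 + (z - c)\<^sup>2 / (z - c')\<^sup>2 + (z - c)\<^sup>2 / (z - c'')\<^sup>2
      - k * ((z - c) * (m * z - A)) / ((z - c') * (z - c''))) \<longlongrightarrow> 1) (at c)" by simp
  have "\<forall>\<^sub>F z in at c. z \<noteq> c" by (rule eventually_neq_at_within)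
  then show ?thesis
  proof (rule Lim_transform_eventually[OF lim eventually_mono])
    fix z assume "z \<noteq> c"
    then have z: "z - c \<noteq> 0" by simp
    have "(z - c)\<^sup>2 * (1 / (z - c)\<^sup>2) = 1" using z by simp
    moreover have "(z - c)\<^sup>2 * (k * ((m * z - A) / ((z - c) * (z - c') * (z - c'')))) =
        k * ((z - c) * (m * z - A)) / ((z - c') * (z - c''))"
      using z by (simp add: power2_eq_square)
    ultimately show "1 + (z - c)\<^sup>2 / (z - c')\<^sup>2 + (z - c)\<^sup>2 / (z - c'')\<^sup>2
      - k * ((z - c) * (m * z - A)) / ((z - c') * (z - c'')) = (z - c)\<^sup>2 * (1 / (z - c)\<^sup>2 + 1 / (z - c')\<^sup>2 + 1 / (z - c'')\<^sup>2
     - k * ((m * z - A) / ((z - c) * (z - c') * (z - c''))))"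
      by (simp only: distrib_left right_diff_distrib) simp
  qed
qed

lemma root_limit:
  assumes "c \<in> {e, e', e''}"
  shows "((\<lambda>z. (z - c)\<^sup>2 * (1 / (z - e)\<^sup>2 + 1 / (z - e')\<^sup>2 + 1 / (z - e'')\<^sup>2
     - k * ((m * z - A) / ((z - e) * (z - e') * (z - e''))))) \<longlongrightarrow> 1) (at c)"
  using fuchsian_singularity_limit[of e e' e'' k m A] fuchsian_singularity_limit[of e' e e'' k m A]
    fuchsian_singularity_limit[of e'' e e' k m A] distinct assms by (auto simp: ac_simps)

lemma potential_L_limit:
  assumes "c \<in> {e, e', e''}"
  shows "((\<lambda>z. (z - c)\<^sup>2 * potential_L e e' e'' A z) \<longlongrightarrow> - (3 / 16)) (at c)"
  using tendsto_mult[OF tendsto_const[of "- (3 / 16)"] root_limit[OF assms, of "1 / 3" 5 A]]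
  unfolding potential_L_def by (simp only: mult.left_commute[of _ "- (3 / 16)"] mult_1_right)

lemma potential_P_limit:
  assumes "c \<in> {e, e', e''}"
  shows "((\<lambda>z. (z - c)\<^sup>2 * potential_P e e' e'' A z) \<longlongrightarrow> - (1 / 4)) (at c)"
  using tendsto_mult[OF tendsto_const[of "- (1 / 4)"] root_limit[OF assms, of 1 2 A]]
  unfolding potential_P_def by (simp only: mult.left_commute[of _ "- (1 / 4)"] mult_1_right mult_1_left)

end

section \<open>Transfer of the inversion between the equations\<close>

lemma fuchsian_inversion_cong:
  assumes "fuchsian_inversion D Q \<xi>" "\<And>\<tau>. \<tau> \<in> \<H> \<Longrightarrow> \<xi> \<tau> = \<xi>' \<tau>"
  shows "fuchsian_inversion D Q \<xi>'"
proof -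
  have h: "\<xi>' holomorphic_on \<H>" if "\<xi> holomorphic_on \<H>" by (rule holomorphic_transform[OF that assms(2)])
  have *: "inverts_ratio D z0 \<psi>1 \<psi>2 \<xi>'" if "inverts_ratio D z0 \<psi>1 \<psi>2 \<xi>" for z0 \<psi>1 \<psi>2
    using that h unfolding inverts_ratio_def Let_def by (metis assms(2))
  show ?thesis using assms(1) * unfolding fuchsian_inversion_def by blast
qed

text \<open>
  Outside the given point the values of \<open>\<xi>\<close> near it lie in \<open>D\<close>; so the indicial equation applies.
\<close>

lemma pulls_back_near:
  assumes u: "uniformizes D Q \<xi>" and \<tau>: "\<tau> \<in> \<H>" and D: "\<forall>\<^sub>F z in at (\<xi> \<tau>). z \<in> D" and nc: "\<not> \<xi> constant_on \<H>"
  shows "\<forall>\<^sub>F t in at \<tau>. pulls_back (\<lambda>_. 0) \<xi> Q t"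
proof -
  have hol: "\<xi> holomorphic_on \<H>" using u by (simp add: uniformizes_def)
  have "\<forall>\<^sub>F t in at \<tau>. \<xi> t \<in> D"
    using D filterlim_at_nonconst[OF hol H_props(1,2) \<tau> nc] unfolding filterlim_iff by blast
  moreover have "\<forall>\<^sub>F t in at \<tau>. t \<in> \<H>" using H_props(1) \<tau> by (rule eventually_at_in_open')
  ultimately show ?thesis by eventually_elim (use u in \<open>auto simp: uniformizes_def\<close>)
qed

text \<open>
  \<open>Lim\<close> turns the local extensions into one function.
\<close>

lemma removable_extension:
  fixes f :: "complex \<Rightarrow> complex"
  assumes loc: "\<And>w. w \<in> S \<Longrightarrow> \<exists>r>0. \<exists>k. k holomorphic_on ball w r \<and> (\<forall>t\<in>ball w r. k t \<noteq> 0) \<and>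
      (\<forall>t\<in>ball w r - {w}. f t = k t)" and S: "open S"
  obtains F where "F holomorphic_on S" "\<And>t. t \<in> S \<Longrightarrow> F t \<noteq> 0" "\<And>t. t \<in> S \<Longrightarrow> isCont f t \<Longrightarrow> F t = f t"
proof -
  define F where "F t = Lim (at t) f" for t
  have F: "\<exists>r>0. \<exists>k. k holomorphic_on ball w r \<and> (\<forall>t\<in>ball w r. k t \<noteq> 0 \<and> F t = k t)" if w: "w \<in> S" for w
  proof -
    obtain r k where rk: "r > 0" "k holomorphic_on ball w r" "\<And>t. t \<in> ball w r \<Longrightarrow> k t \<noteq> 0"
      "\<And>t. t \<in> ball w r - {w} \<Longrightarrow> f t = k t" using loc[OF w] by blast
    have "F t = k t" if t: "t \<in> ball w r" for t
    proof -
      have "isCont k t" using rk(2) t holomorphic_on_imp_continuous_on continuous_on_eq_continuous_at open_ball by blast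
      then have lim: "(k \<longlongrightarrow> k t) (at t)" by (simp add: isCont_def)
      have "\<forall>\<^sub>F z in at t. z \<in> ball w r" using open_ball t by (rule eventually_at_in_open')
      moreover have "\<forall>\<^sub>F z in at t. z \<noteq> w" by (cases "t = w") (auto simp: eventually_neq_at_within intro: eventually_at_in_open'[of "- {w}", simplified])
      ultimately have "\<forall>\<^sub>F z in at t. k z = f z" by eventually_elim (use rk(4) in auto)
      then have "(f \<longlongrightarrow> k t) (at t)" by (rule Lim_transform_eventually[OF lim])
      then show ?thesis unfolding F_def by (rule tendsto_Lim[OF at_neq_bot])
    qed
    then show ?thesis using rk by blast
  qed
  have "F holomorphic_on S"
  proof (rule holomorphic_onI)
    fix w assume "w \<in> S"
    then obtain r k where rk: "r > 0" "k holomorphic_on ball w r" "\<And>t. t \<in> ball w r \<Longrightarrow> F t = k t" using F[of w] by blast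
    have "F holomorphic_on ball w r" by (rule holomorphic_transform[OF rk(2)]) (simp add: rk(3))
    moreover have "w \<in> ball w r" using rk(1) by simp
    ultimately have "F field_differentiable at w" using holomorphic_on_imp_differentiable_at open_ball by blast
    then show "F field_differentiable at w within S" by (rule field_differentiable_at_within)
  qed
  moreover have "F t \<noteq> 0" if t: "t \<in> S" for t
  proof -
    obtain r k where rk: "r > 0" "\<forall>t'\<in>ball t r. k t' \<noteq> 0 \<and> F t' = k t'" using F[OF t] by blast
    moreover have "t \<in> ball t r" using rk(1) by simp
    ultimately show ?thesis by simp
  qed
  moreover have "F t = f t" if "isCont f t" for t
    using that unfolding F_def isCont_def by (rule tendsto_Lim[OF at_neq_bot])
  ultimately show ?thesis using that by blast
qed

text \<open>
  The law is an equation between continuous functions.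
\<close>

lemma pulls_back_limit:
  assumes v: "v holomorphic_on S" "open S" "\<tau> \<in> S" "deriv v \<tau> \<noteq> 0" and Q: "isCont Q (v \<tau>)"
    and ev: "\<forall>\<^sub>F t in at \<tau>. pulls_back (\<lambda>_. 0) v Q t"
  shows "pulls_back (\<lambda>_. 0) v Q \<tau>"
proof -
  let ?E = "\<lambda>t. 2 * Q (v t) * deriv v t ^ 4 - (deriv (deriv (deriv v)) t * deriv v t - 3 / 2 * (deriv (deriv v) t)\<^sup>2)"
  have c: "isCont f \<tau>" if "f holomorphic_on S" for f
    using that v(2,3) holomorphic_on_imp_continuous_on continuous_on_eq_continuous_at by blast
  note h1 = holomorphic_deriv[OF v(1,2)]
  note h2 = holomorphic_deriv[OF h1 v(2)]
  note h3 = holomorphic_deriv[OF h2 v(2)]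
  have "isCont (\<lambda>t. Q (v t)) \<tau>" by (rule isCont_o2[OF c[OF v(1)] Q])
  then have "isCont ?E \<tau>" using c[OF h1] c[OF h2] c[OF h3] by (intro continuous_intros)
  then have lim: "(?E \<longlongrightarrow> ?E \<tau>) (at \<tau>)" by (simp only: isCont_def)
  have ev0: "\<forall>\<^sub>F t in at \<tau>. ?E t = 0" using ev by eventually_elim (simp add: pulls_back_def)
  have "((\<lambda>_. 0) \<longlongrightarrow> ?E \<tau>) (at \<tau>)" by (rule Lim_transform_eventually[OF lim ev0])
  then have "?E \<tau> = 0" by (simp add: tendsto_const_iff)
  then show ?thesis using v(4) by (simp add: pulls_back_def)
qed

lemma lifts_pathsI:
  assumes "\<And>\<gamma> \<tau>. path \<gamma> \<Longrightarrow> path_image \<gamma> \<subseteq> D \<Longrightarrow> \<tau> \<in> S \<Longrightarrow> \<xi> \<tau> = \<gamma> 0 \<Longrightarrow>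
     \<exists>g. path g \<and> path_image g \<subseteq> S \<and> g 0 = \<tau> \<and> (\<forall>t\<in>{0..1}. \<xi> (g t) = \<gamma> t)"
  shows "lifts_paths \<xi> S D"
  using assms unfolding lifts_paths_def by blast

context weierstrass
begin

lemma uniformization_T: "uniformizes (- L) (potential_T P A) v \<Longrightarrow> uniformization (- L) (potential_T P A) v"
  by unfold_locales (use openD countable_L holQ_T in auto)

lemma uniformization_L: "uniformizes (- {e, e', e''}) (potential_L e e' e'' A) s \<Longrightarrow>
    uniformization (- {e, e', e''}) (potential_L e e' e'' A) s"
  by unfold_locales (use open_roots countable_roots holQ_L in auto)

lemma uniformization_P: "uniformizes (- {e, e', e''}) (potential_P e e' e'' A) x \<Longrightarrow>
    uniformization (- {e, e', e''}) (potential_P e e' e'' A) x"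
  by unfold_locales (use open_roots countable_roots holQ_P in auto)

lemma not_root_eventually: "\<forall>\<^sub>F z in at c. z \<in> - {e, e', e''}"
proof -
  have "\<not> c islimpt {e, e', e''}" by (rule islimpt_finite) simp
  then show ?thesis by (simp add: islimpt_iff_eventually)
qed

text \<open>
  At a pole the potential of (T) has the leading coefficient \<open>-1/4\<close>, for which the indicial
  equation \<open>1 - k\<^sup>2 = -k\<^sup>2\<close> has no solution.
\<close>

lemma T_avoids_poles:
  assumes u: "uniformizes (- L) (potential_T P A) v" and \<tau>: "\<tau> \<in> \<H>"
  shows "v \<tau> \<notin> L"
proof
  assume l: "v \<tau> \<in> L"
  interpret U: uniformization "- L" "potential_T P A" v by (rule uniformization_T[OF u])
  have D: "\<forall>\<^sub>F z in at (v \<tau>). z \<in> - L" using not_pole_eventually by simp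
  obtain k where k: "0 < (k :: nat)" "1 - (of_nat k)\<^sup>2 = 4 * - (1 / 4) * (of_nat k :: complex)\<^sup>2"
    by (rule pulls_back_order[OF U.hol\<xi> H_props(1,2) \<tau> U.nonconst refl pulls_back_near[OF u \<tau> D U.nonconst] potential_T_limit[OF l]])
      (rule that)
  then show False by simp
qed

lemma P_avoids_roots:
  assumes u: "uniformizes (- {e, e', e''}) (potential_P e e' e'' A) x" and \<tau>: "\<tau> \<in> \<H>"
  shows "x \<tau> \<in> - {e, e', e''}"
proof (rule ccontr)
  assume "x \<tau> \<notin> - {e, e', e''}"
  then have l: "x \<tau> \<in> {e, e', e''}" by blast
  interpret U: uniformization "- {e, e', e''}" "potential_P e e' e'' A" x by (rule uniformization_P[OF u])
  obtain k where k: "0 < (k :: nat)" "1 - (of_nat k)\<^sup>2 = 4 * - (1 / 4) * (of_nat k :: complex)\<^sup>2"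
    by (rule pulls_back_order[OF U.hol\<xi> H_props(1,2) \<tau> U.nonconst refl pulls_back_near[OF u \<tau> not_root_eventually U.nonconst] potential_P_limit[OF l]])
      (rule that)
  then show False by simp
qed

text \<open>
  At a branch point the potential of (L) has the leading coefficient \<open>-3/16\<close>, and
  \<open>1 - k\<^sup>2 = -3/4 k\<^sup>2\<close> gives \<open>k = 2\<close>: the function \<open>s\<close> is ramified as \<open>\<wp>\<close> is at the half-periods.
\<close>

lemma L_ramified_order_two:
  assumes u: "uniformizes (- {e, e', e''}) (potential_L e e' e'' A) s" and \<tau>: "\<tau> \<in> \<H>" "s \<tau> \<in> {e, e', e''}"
  obtains r g where "0 < r" "ball \<tau> r \<subseteq> \<H>" "g holomorphic_on ball \<tau> r"
    "\<And>t. t \<in> ball \<tau> r \<Longrightarrow> s t - s \<tau> = (t - \<tau>)\<^sup>2 * g t" "\<And>t. t \<in> ball \<tau> r \<Longrightarrow> g t \<noteq> 0"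
proof -
  interpret U: uniformization "- {e, e', e''}" "potential_L e e' e'' A" s by (rule uniformization_L[OF u])
  obtain k r g where k: "0 < (k :: nat)" "0 < r" "ball \<tau> r \<subseteq> \<H>" "g holomorphic_on ball \<tau> r"
    "\<And>t. t \<in> ball \<tau> r \<Longrightarrow> s t - s \<tau> = (t - \<tau>) ^ k * g t" "\<And>t. t \<in> ball \<tau> r \<Longrightarrow> g t \<noteq> 0"
    "1 - (of_nat k)\<^sup>2 = 4 * - (3 / 16) * (of_nat k :: complex)\<^sup>2"
    by (rule pulls_back_order[OF U.hol\<xi> H_props(1,2) \<tau>(1) U.nonconst refl pulls_back_near[OF u \<tau>(1) not_root_eventually U.nonconst] potential_L_limit[OF \<tau>(2)]])
      (rule that)
  have "(of_nat (k\<^sup>2) :: complex) = of_nat 4" using k(7) by (simp add: field_simps)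
  then have "k\<^sup>2 = 2\<^sup>2" by (simp only: of_nat_eq_iff) simp
  then have "k = 2" by (rule power2_eq_imp_eq) simp_all
  then show ?thesis using that[OF k(2-4) _ k(6)] k(5) by simp
qed

text \<open>
  The plane without the poles is path connected, and its paths lift; so \<open>v\<close> omits only the poles.
\<close>

lemma T_path:
  assumes u: "uniformizes (- L) (potential_T P A) v" and \<tau>: "\<tau> \<in> \<H>" and w: "w \<notin> L"
  shows "\<exists>\<tau>'\<in>\<H>. v \<tau>' = w"
proof -
  have "v \<tau> \<in> - L" using T_avoids_poles[OF u \<tau>] by simp
  then obtain p where p: "path p" "path_image p \<subseteq> - L" "p 0 = v \<tau>" "p 1 = w"
    using connected_open_path_connected[OF openD connectedD'] w by (elim path_connectedE[of "- L" "v \<tau>" w]) auto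
  have l: "lifts_paths v \<H> (- L)" using u by (simp add: uniformizes_def)
  obtain g where "path g" "path_image g \<subseteq> \<H>" "g 0 = \<tau>" "\<And>t. t \<in> {0..1} \<Longrightarrow> v (g t) = p t"
    by (rule lifts_pathsE[OF l p(1,2) \<tau> p(3)[symmetric]]) (rule that)
  then have "g 1 \<in> \<H>" "v (g 1) = w" using p(4) path_image_in[of g \<H> 1] by auto
  then show ?thesis by blast
qed

lemma T_imp_uniformizes_L:
  assumes u: "uniformizes (- L) (potential_T P A) v"
  shows "uniformizes (- {e, e', e''}) (potential_L e e' e'' A) (\<lambda>\<tau>. P (v \<tau>))"
  unfolding uniformizes_def
proof (intro conjI ballI impI)
  interpret U: uniformization "- L" "potential_T P A" v by (rule uniformization_T[OF u])
  note av = T_avoids_poles[OF u]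
  have "(P \<circ> v) holomorphic_on \<H>" by (rule holomorphic_on_compose_gen[OF U.hol\<xi> holP]) (use av in auto)
  then show "(\<lambda>\<tau>. P (v \<tau>)) holomorphic_on \<H>" by (simp add: o_def)
  have "\<exists>x. x \<in> - {e, e', e''}" using ex_new_if_finite[of "{e, e', e''}"] infinite_UNIV_char_0 by auto
  then obtain w where w: "w \<notin> L" "P w \<in> - {e, e', e''}" using value_attained by blast
  show "\<exists>\<tau>\<in>\<H>. P (v \<tau>) \<in> - {e, e', e''}" using T_path[OF u H_props(5) w(1)] w(2) by auto
  show "pulls_back (\<lambda>_. 0) (\<lambda>\<tau>. P (v \<tau>)) (potential_L e e' e'' A) \<tau>"
    if \<tau>: "\<tau> \<in> \<H>" "P (v \<tau>) \<in> - {e, e', e''}" for \<tau>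
  proof -
    have an: "v analytic_on {\<tau>}" using U.hol\<xi> H_props(1) \<tau>(1) analytic_at by blast
    have "2 * v \<tau> \<notin> L" using root_iff[OF av[OF \<tau>(1)]] \<tau>(2) by simp
    then have "pulls_back (potential_T P A) P (potential_L e e' e'' A) (v \<tau>)" by (rule pulls_back_P[OF av[OF \<tau>(1)]])
    moreover have "pulls_back (\<lambda>_. 0) v (potential_T P A) \<tau>" using u \<tau>(1) av[OF \<tau>(1)] by (simp add: uniformizes_def)
    ultimately show ?thesis using pulls_back_compose_iff[OF an analytic[OF av[OF \<tau>(1)]]] by blast
  qed
  show "lifts_paths (\<lambda>\<tau>. P (v \<tau>)) \<H> (- {e, e', e''})"
  proof (rule lifts_pathsI)
    fix \<gamma> \<tau> assume \<gamma>: "path \<gamma>" "path_image \<gamma> \<subseteq> - {e, e', e''}" and \<tau>: "\<tau> \<in> \<H>" "P (v \<tau>) = \<gamma> 0"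
    have "P (v \<tau>) \<in> - {e, e', e''}" unfolding \<tau>(2) by (rule path_image_in[OF \<gamma>(2)]) simp
    then have v0: "v \<tau> \<in> {v. v \<notin> L \<and> 2 * v \<notin> L}" using root_iff[OF av[OF \<tau>(1)]] av[OF \<tau>(1)] by simp
    obtain h where h: "path h" "path_image h \<subseteq> {v. v \<notin> L \<and> 2 * v \<notin> L}" "h 0 = v \<tau>" "\<And>t. t \<in> {0..1} \<Longrightarrow> P (h t) = \<gamma> t"
      by (rule lifts_pathsE[OF lifts_paths_P \<gamma> v0 \<tau>(2)]) (rule that)
    have hL: "path_image h \<subseteq> - L" using h(2) by blast
    have l: "lifts_paths v \<H> (- L)" using u by (simp add: uniformizes_def)
    obtain g where g: "path g" "path_image g \<subseteq> \<H>" "g 0 = \<tau>" "\<And>t. t \<in> {0..1} \<Longrightarrow> v (g t) = h t"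
      by (rule lifts_pathsE[OF l h(1) hL \<tau>(1) h(3)[symmetric]]) (rule that)
    have "\<forall>t\<in>{0..1}. P (v (g t)) = \<gamma> t" using g(4) h(4) by simp
    then show "\<exists>g. path g \<and> path_image g \<subseteq> \<H> \<and> g 0 = \<tau> \<and> (\<forall>t\<in>{0..1}. P (v (g t)) = \<gamma> t)"
      using g(1-3) by blast
  qed
qed

lemma half_value_not_root: "v \<notin> L \<Longrightarrow> P (v / 2) \<in> - {e, e', e''}"
  using duplication(1) cubic_zero by blast

lemma T_imp_uniformizes_P:
  assumes u: "uniformizes (- L) (potential_T P A) v"
  shows "uniformizes (- {e, e', e''}) (potential_P e e' e'' A) (\<lambda>\<tau>. P (v \<tau> / 2))"
  unfolding uniformizes_def
proof (intro conjI ballI impI)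
  interpret U: uniformization "- L" "potential_T P A" v by (rule uniformization_T[OF u])
  note av = T_avoids_poles[OF u]
  have "(P \<circ> (\<lambda>\<tau>. v \<tau> / 2)) holomorphic_on \<H>"
    by (rule holomorphic_on_compose_gen[OF _ holP]) (use av half_not_pole U.hol\<xi> in \<open>auto intro!: holomorphic_intros\<close>)
  then show "(\<lambda>\<tau>. P (v \<tau> / 2)) holomorphic_on \<H>" by (simp add: o_def)
  show "\<exists>\<tau>\<in>\<H>. P (v \<tau> / 2) \<in> - {e, e', e''}" using half_value_not_root[OF av[OF H_props(5)]] H_props(5) by blast
  show "pulls_back (\<lambda>_. 0) (\<lambda>\<tau>. P (v \<tau> / 2)) (potential_P e e' e'' A) \<tau>" if \<tau>: "\<tau> \<in> \<H>" for \<tau>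
  proof -
    have an: "v analytic_on {\<tau>}" using U.hol\<xi> H_props(1) \<tau>(1) analytic_at by blast
    have "pulls_back (\<lambda>_. 0) v (potential_T P A) \<tau>" using u \<tau>(1) av[OF \<tau>(1)] by (simp add: uniformizes_def)
    then show ?thesis
      using pulls_back_compose_iff[OF an P_analytic_half[OF av[OF \<tau>]] pulls_back_P_half[OF av[OF \<tau>]]] by blast
  qed
  show "lifts_paths (\<lambda>\<tau>. P (v \<tau> / 2)) \<H> (- {e, e', e''})"
  proof (rule lifts_pathsI)
    fix \<gamma> \<tau> assume \<gamma>: "path \<gamma>" "path_image \<gamma> \<subseteq> - {e, e', e''}" and \<tau>: "\<tau> \<in> \<H>" "P (v \<tau> / 2) = \<gamma> 0"
    have v0: "v \<tau> / 2 \<in> {v. v \<notin> L \<and> 2 * v \<notin> L}" using half_not_pole[OF av[OF \<tau>(1)]] av[OF \<tau>(1)] by simp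
    obtain h where h: "path h" "path_image h \<subseteq> {v. v \<notin> L \<and> 2 * v \<notin> L}" "h 0 = v \<tau> / 2" "\<And>t. t \<in> {0..1} \<Longrightarrow> P (h t) = \<gamma> t"
      by (rule lifts_pathsE[OF lifts_paths_P \<gamma> v0 \<tau>(2)]) (rule that)
    have h2: "path (\<lambda>t. 2 * h t)" using h(1) unfolding path_def by (intro continuous_intros)
    have hL: "path_image (\<lambda>t. 2 * h t) \<subseteq> - L" using h(2) by (auto simp: path_image_def)
    have l: "lifts_paths v \<H> (- L)" using u by (simp add: uniformizes_def)
    have st: "v \<tau> = 2 * h 0" using h(3) by (simp add: field_simps)
    obtain g where g: "path g" "path_image g \<subseteq> \<H>" "g 0 = \<tau>" "\<And>t. t \<in> {0..1} \<Longrightarrow> v (g t) = 2 * h t"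
      by (rule lifts_pathsE[OF l h2 hL \<tau>(1) st]) (rule that)
    have "\<forall>t\<in>{0..1}. P (v (g t) / 2) = \<gamma> t" using g(4) h(4) by simp
    then show "\<exists>g. path g \<and> path_image g \<subseteq> \<H> \<and> g 0 = \<tau> \<and> (\<forall>t\<in>{0..1}. P (v (g t) / 2) = \<gamma> t)"
      using g(1-3) by blast
  qed
qed

lemma T_fuchsian:
  assumes u: "uniformizes (- L) (potential_T P A) v"
  shows "deck_transitive v" "fuchsian_inversion (- L) (potential_T P A) v"
proof -
  interpret U: uniformization "- L" "potential_T P A" v by (rule uniformization_T[OF u])
  show dt: "deck_transitive v" by (rule U.deck_transitive_if_no_exceptions) (use T_avoids_poles[OF u] in auto)
  show "fuchsian_inversion (- L) (potential_T P A) v" by (rule U.uniformizes_imp_fuchsian_inversion[OF dt])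
qed

lemma T_imp_fuchsian_P:
  assumes u: "uniformizes (- L) (potential_T P A) v"
  shows "fuchsian_inversion (- {e, e', e''}) (potential_P e e' e'' A) (\<lambda>\<tau>. P (v \<tau> / 2))"
proof -
  interpret U: uniformization "- {e, e', e''}" "potential_P e e' e'' A" "\<lambda>\<tau>. P (v \<tau> / 2)"
    by (rule uniformization_P[OF T_imp_uniformizes_P[OF u]])
  show ?thesis
    by (rule U.uniformizes_imp_fuchsian_inversion, rule U.deck_transitive_if_no_exceptions)
      (rule half_value_not_root[OF T_avoids_poles[OF u]])
qed

text \<open>
  Every translation by a period lifts to a Moebius transformation of the half-plane.  It is found as a deck
  transformation of \<open>\<wp> \<circ> v\<close> which maps a point over \<open>w\<close> to a point over \<open>w + l\<close>; the relation
  \<open>v \<circ> R = v + l\<close> holds near the first point because \<open>\<wp>\<close> is locally injective there, hence everywhere.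
\<close>

lemma period_deck:
  assumes u: "uniformizes (- L) (potential_T P A) v" and l: "l \<in> L"
  obtains R :: "real^2^2" where "det R = 1" "\<And>\<tau>. \<tau> \<in> \<H> \<Longrightarrow> v (moebius_action R \<tau>) = v \<tau> + l"
proof -
  interpret V: uniformization "- L" "potential_T P A" v by (rule uniformization_T[OF u])
  interpret U: uniformization "- {e, e', e''}" "potential_L e e' e'' A" "\<lambda>\<tau>. P (v \<tau>)"
    by (rule uniformization_L[OF T_imp_uniformizes_L[OF u]])
  note av = T_avoids_poles[OF u]
  obtain \<tau>0 where t0: "\<tau>0 \<in> U.W" using U.W_nonempty by blast
  then have \<tau>0: "\<tau>0 \<in> \<H>" "P (v \<tau>0) \<in> - {e, e', e''}" using U.WH(1) U.WD by blast+
  have "v \<tau>0 + l \<notin> L" using L_shift[OF l] av[OF \<tau>0(1)] by blast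
  then obtain \<tau>1 where \<tau>1: "\<tau>1 \<in> \<H>" "v \<tau>1 = v \<tau>0 + l" using T_path[OF u \<tau>0(1)] by blast
  have eq1: "P (v \<tau>1) = P (v \<tau>0)" unfolding \<tau>1(2) by (rule period[OF l])
  then have t1: "\<tau>1 \<in> U.W" using \<tau>1(1) \<tau>0(2) by (simp add: U.W_def)
  obtain R :: "real^2^2" where R: "det R = 1" "moebius_action R \<tau>0 = \<tau>1"
    "\<And>\<tau>. \<tau> \<in> \<H> \<Longrightarrow> P (v (moebius_action R \<tau>)) = P (v \<tau>)"
    by (rule U.deck_exists[OF t0 t1 eq1]) (rule that)
  have holR: "moebius_action R holomorphic_on \<H>" by (rule moebius_action_holomorphic[OF R(1)])
  have RH: "moebius_action R \<tau> \<in> \<H>" if "\<tau> \<in> \<H>" for \<tau> by (rule moebius_action_in_H[OF R(1) that])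
  have "(v \<circ> moebius_action R) holomorphic_on \<H>"
    by (rule holomorphic_on_compose_gen[OF holR V.hol\<xi>]) (use RH in blast)
  then have h1: "(\<lambda>\<tau>. v (moebius_action R \<tau>)) holomorphic_on \<H>" by (simp add: o_def)
  have h2: "(\<lambda>\<tau>. v \<tau> + l) holomorphic_on \<H>" using V.hol\<xi> by (intro holomorphic_intros)
  define w where "w = v \<tau>0 + l"
  have wL: "w \<in> - L" using av[OF \<tau>1(1)] \<tau>1(2) by (simp add: w_def)
  have "P w \<notin> {e, e', e''}" using \<tau>0(2) period[OF l] by (simp add: w_def)
  then obtain U where U: "open U" "w \<in> U" "inj_on P U"
    using locally_inj[OF holP openD wL not_root_deriv_nonzero] wL by blast
  have cont: "isCont f \<tau>0" if "f holomorphic_on \<H>" for f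
    using that H_props(1) \<tau>0(1) holomorphic_on_imp_continuous_on continuous_on_eq_continuous_at by blast
  have lim: "\<forall>\<^sub>F \<tau> in nhds \<tau>0. f \<tau> \<in> U" if "f holomorphic_on \<H>" "f \<tau>0 = w" for f
    using topological_tendstoD[of f w "at \<tau>0" U] cont[OF that(1)] U(1,2) that(2)
    by (simp add: isCont_def eventually_nhds_conv_at)
  have "\<forall>\<^sub>F \<tau> in nhds \<tau>0. v (moebius_action R \<tau>) \<in> U" by (rule lim[OF h1]) (simp add: R(2) \<tau>1(2) w_def)
  moreover have "\<forall>\<^sub>F \<tau> in nhds \<tau>0. v \<tau> + l \<in> U" by (rule lim[OF h2]) (simp add: w_def)
  moreover have "\<forall>\<^sub>F \<tau> in nhds \<tau>0. \<tau> \<in> \<H>" using H_props(1) \<tau>0(1) by (rule eventually_nhds_in_open)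
  ultimately have ev: "\<forall>\<^sub>F \<tau> in nhds \<tau>0. v (moebius_action R \<tau>) = v \<tau> + l"
  proof eventually_elim
    case (elim \<tau>)
    have "P (v (moebius_action R \<tau>)) = P (v \<tau> + l)" using R(3)[OF elim(3)] period[OF l] by simp
    then show ?case using inj_onD[OF U(3)] elim(1,2) by blast
  qed
  have "v (moebius_action R \<tau>) = v \<tau> + l" if "\<tau> \<in> \<H>" for \<tau>
    by (rule analytic_germ_eq_on[OF h1 h2 H_props(1,2) \<tau>0(1) that ev])
  then show ?thesis using that[OF R(1)] by blast
qed

text \<open>
  What remains is the transitivity of the deck transformations on the fibres over the branch points, which
  the general theory does not reach.  There \<open>v(\<tau>1)\<close> and \<open>v(\<tau>2)\<close> differ by a period, since \<open>2 v(\<tau>1)\<close> is a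
  period; the lift of this translation, followed by a deck transformation of \<open>v\<close>, maps \<open>\<tau>1\<close> to \<open>\<tau>2\<close>.
\<close>

lemma T_imp_fuchsian_L:
  assumes u: "uniformizes (- L) (potential_T P A) v"
  shows "fuchsian_inversion (- {e, e', e''}) (potential_L e e' e'' A) (\<lambda>\<tau>. P (v \<tau>))"
proof -
  interpret U: uniformization "- {e, e', e''}" "potential_L e e' e'' A" "\<lambda>\<tau>. P (v \<tau>)"
    by (rule uniformization_L[OF T_imp_uniformizes_L[OF u]])
  note av = T_avoids_poles[OF u]
  have "\<exists>R :: real^2^2. det R = 1 \<and> moebius_action R \<tau>1 = \<tau>2 \<and> (\<forall>\<tau>\<in>\<H>. P (v (moebius_action R \<tau>)) = P (v \<tau>))"
    if \<tau>: "\<tau>1 \<in> \<H>" "\<tau>2 \<in> \<H>" and eq: "P (v \<tau>1) = P (v \<tau>2)" for \<tau>1 \<tau>2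
  proof (cases "P (v \<tau>1) \<in> - {e, e', e''}")
    case True
    have W: "\<tau>1 \<in> U.W" "\<tau>2 \<in> U.W" using True \<tau> eq by (simp_all add: U.W_def)
    obtain R :: "real^2^2" where R: "det R = 1" "moebius_action R \<tau>1 = \<tau>2"
      "\<And>\<tau>. \<tau> \<in> \<H> \<Longrightarrow> P (v (moebius_action R \<tau>)) = P (v \<tau>)"
      by (rule U.deck_exists[OF W eq[symmetric]]) (rule that)
    then show ?thesis by blast
  next
    case False
    then have two: "2 * v \<tau>1 \<in> L" using root_iff[OF av[OF \<tau>(1)]] by simp
    have "v \<tau>2 - v \<tau>1 \<in> L"
    proof -
      consider "v \<tau>1 - v \<tau>2 \<in> L" | "v \<tau>1 + v \<tau>2 \<in> L" using fibre[OF av[OF \<tau>(1)] av[OF \<tau>(2)] eq] by blast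
      then show ?thesis
      proof cases
        case 1 then show ?thesis using L_neg[of "v \<tau>1 - v \<tau>2"] by simp
      next
        case 2
        from L_diff[OF 2 two] show ?thesis by (simp add: algebra_simps)
      qed
    qed
    then obtain R :: "real^2^2" where R: "det R = 1" "\<And>\<tau>. \<tau> \<in> \<H> \<Longrightarrow> v (moebius_action R \<tau>) = v \<tau> + (v \<tau>2 - v \<tau>1)"
      by (rule period_deck[OF u]) (rule that)
    have RH: "moebius_action R \<tau> \<in> \<H>" if "\<tau> \<in> \<H>" for \<tau> by (rule moebius_action_in_H[OF R(1) that])
    have "v (moebius_action R \<tau>1) = v \<tau>2" using R(2)[OF \<tau>(1)] by simp
    then obtain N :: "real^2^2" where N: "det N = 1" "moebius_action N (moebius_action R \<tau>1) = \<tau>2"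
      "\<And>\<tau>. \<tau> \<in> \<H> \<Longrightarrow> v (moebius_action N \<tau>) = v \<tau>"
      using T_fuchsian(1)[OF u] RH[OF \<tau>(1)] \<tau>(2) unfolding deck_transitive_def by blast
    have act: "moebius_action (N ** R) \<tau> = moebius_action N (moebius_action R \<tau>)" if "\<tau> \<in> \<H>" for \<tau>
      by (rule moebius_action_mult[OF N(1) R(1) that])
    have "P (v (moebius_action (N ** R) \<tau>)) = P (v \<tau>)" if t: "\<tau> \<in> \<H>" for \<tau>
      unfolding act[OF t] N(3)[OF RH[OF t]] R(2)[OF t] by (rule period) fact
    moreover have "det (N ** R) = 1" using N(1) R(1) by (simp add: det_mul)
    moreover have "moebius_action (N ** R) \<tau>1 = \<tau>2" using act[OF \<tau>(1)] N(2) by simp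
    ultimately show ?thesis by blast
  qed
  then have "deck_transitive (\<lambda>\<tau>. P (v \<tau>))" unfolding deck_transitive_def by blast
  then show ?thesis by (rule U.uniformizes_imp_fuchsian_inversion)
qed

end

context weierstrass
begin

section \<open>Integration of the inverse function\<close>

text \<open>
  The differential \<open>dy / \<surd>(4y\<^sup>3 - ay - b)\<close> on the half-plane.  The quotient \<open>y'\<^sup>2 / (4y\<^sup>3 - ay - b)\<close> has no
  zeros or poles: where \<open>y\<close> takes a branch value, to the order two, \<open>y'\<^sup>2\<close> and the cubic both vanish to the
  second order.  On a contractible domain it therefore has a holomorphic root.
\<close>

lemma elliptic_differential:
  assumes y: "y holomorphic_on \<H>"
    and reg: "\<And>\<tau>. \<tau> \<in> \<H> \<Longrightarrow> y \<tau> \<in> - {e, e', e''} \<Longrightarrow> deriv y \<tau> \<noteq> 0"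
    and ram: "\<And>\<tau>. \<tau> \<in> \<H> \<Longrightarrow> y \<tau> \<in> {e, e', e''} \<Longrightarrow>
      \<exists>r>0. \<exists>g. ball \<tau> r \<subseteq> \<H> \<and> g holomorphic_on ball \<tau> r \<and>
        (\<forall>t\<in>ball \<tau> r. y t - y \<tau> = (t - \<tau>)\<^sup>2 * g t \<and> g t \<noteq> 0)"
  obtains m where "m holomorphic_on \<H>" "\<And>\<tau>. \<tau> \<in> \<H> \<Longrightarrow> m \<tau> \<noteq> 0"
    "\<And>\<tau>. \<tau> \<in> \<H> \<Longrightarrow> (m \<tau>)\<^sup>2 * cubic a b (y \<tau>) = (deriv y \<tau>)\<^sup>2"
proof -
  define f where "f \<tau> = (deriv y \<tau>)\<^sup>2 / cubic a b (y \<tau>)" for \<tau>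
  define W where "W = {\<tau> \<in> \<H>. y \<tau> \<in> - {e, e', e''}}"
  have y1: "deriv y holomorphic_on \<H>" by (rule holomorphic_deriv[OF y H_props(1)])
  have cy: "(\<lambda>\<tau>. cubic a b (y \<tau>)) holomorphic_on \<H>" unfolding cubic_def using y by (intro holomorphic_intros)
  have "W = \<H> \<inter> y -` (- {e, e', e''})" by (auto simp: W_def)
  then have oW: "open W"
    using continuous_open_preimage[OF holomorphic_on_imp_continuous_on[OF y] H_props(1) open_roots] by simp
  have WH: "W \<subseteq> \<H>" by (auto simp: W_def)
  have cnz: "cubic a b (y \<tau>) \<noteq> 0" if "\<tau> \<in> W" for \<tau> using that cubic_zero[of "y \<tau>"] by (simp add: W_def)
  have holf: "f holomorphic_on W"
    unfolding f_def
    by (intro holomorphic_on_divide holomorphic_on_power holomorphic_on_subset[OF y1 WH] holomorphic_on_subset[OF cy WH] cnz)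
  have fnz: "f \<tau> \<noteq> 0" if "\<tau> \<in> W" for \<tau> using reg[of \<tau>] cnz[OF that] that by (simp add: f_def W_def)
  have loc: "\<exists>r>0. \<exists>k. k holomorphic_on ball w r \<and> (\<forall>t\<in>ball w r. k t \<noteq> 0) \<and> (\<forall>t\<in>ball w r - {w}. f t = k t)"
    if w: "w \<in> \<H>" for w
  proof (cases "y w \<in> - {e, e', e''}")
    case True
    then have "w \<in> W" using w by (simp add: W_def)
    then obtain r where r: "r > 0" "ball w r \<subseteq> W" using openE[OF oW] by blast
    have "f holomorphic_on ball w r" using holf r(2) by (rule holomorphic_on_subset)
    then show ?thesis using r fnz by blast
  next
    case False
    then have root: "y w \<in> {e, e', e''}" by blast
    obtain r g where g: "r > 0" "ball w r \<subseteq> \<H>" "g holomorphic_on ball w r"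
      "\<And>t. t \<in> ball w r \<Longrightarrow> y t - y w = (t - w)\<^sup>2 * g t" "\<And>t. t \<in> ball w r \<Longrightarrow> g t \<noteq> 0"
      using ram[OF w root] by blast
    obtain p q where pq: "\<And>t. cubic a b t = 4 * (t - y w) * (t - p) * (t - q)" "y w \<noteq> p" "y w \<noteq> q"
    proof -
      consider "y w = e" | "y w = e'" | "y w = e''" using root by blast
      then show ?thesis
      proof cases
        case 1 then show ?thesis using that[of e' e''] distinct cubic_roots by simp
      next
        case 2
        have "cubic a b t = 4 * (t - e') * (t - e) * (t - e'')" for t unfolding cubic_roots by (simp only: mult_ac)
        then show ?thesis using that[of e e''] 2 distinct by simp
      next
        case 3
        have "cubic a b t = 4 * (t - e'') * (t - e) * (t - e')" for t unfolding cubic_roots by (simp only: mult_ac)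
        then show ?thesis using that[of e e'] 3 distinct by simp
      qed
    qed
    define n where "n t = 2 * g t + (t - w) * deriv g t" for t
    have hn: "n holomorphic_on ball w r" unfolding n_def
      using g(3) holomorphic_deriv[OF g(3) open_ball] by (intro holomorphic_intros open_ball)
    have hy: "y holomorphic_on ball w r" using y g(2) by (rule holomorphic_on_subset)
    define k where "k t = (n t)\<^sup>2 / (4 * g t * (y t - p) * (y t - q))" for t
    have wb: "w \<in> ball w r" using g(1) by simp
    define N where "N t = n t * (y t - p) * (y t - q)" for t
    have "N w \<noteq> 0" using g(5)[OF wb] pq(2,3) by (simp add: n_def N_def)
    moreover have "isCont N w"
    proof -
      have "N holomorphic_on ball w r" unfolding N_def using hn hy by (intro holomorphic_intros)
      then show ?thesis using wb holomorphic_on_imp_continuous_on continuous_on_eq_continuous_at open_ball by blast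
    qed
    ultimately obtain r1 where r1: "r1 > 0" "\<And>t. t \<in> ball w r1 \<Longrightarrow> N t \<noteq> 0"
      using continuous_at_avoid[of w N 0] by (auto simp: dist_commute)
    define \<rho> where "\<rho> = min r r1"
    have \<rho>: "\<rho> > 0" "ball w \<rho> \<subseteq> ball w r" "ball w \<rho> \<subseteq> ball w r1" using g(1) r1(1) by (auto simp: \<rho>_def)
    have nz: "g t \<noteq> 0" "n t \<noteq> 0" "y t \<noteq> p" "y t \<noteq> q" if "t \<in> ball w \<rho>" for t
      using g(5)[of t] r1(2)[of t] subsetD[OF \<rho>(2) that] subsetD[OF \<rho>(3) that] by (auto simp: N_def)
    have "k holomorphic_on ball w \<rho>" unfolding k_def
      using nz holomorphic_on_subset[OF hn \<rho>(2)] holomorphic_on_subset[OF g(3) \<rho>(2)] holomorphic_on_subset[OF hy \<rho>(2)]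
      by (intro holomorphic_intros) auto
    moreover have "\<forall>t\<in>ball w \<rho>. k t \<noteq> 0" using nz by (auto simp: k_def)
    moreover have "f t = k t" if t: "t \<in> ball w \<rho> - {w}" for t
    proof -
      have tb: "t \<in> ball w r" "t - w \<noteq> 0" using t subsetD[OF \<rho>(2), of t] by auto
      have eqy: "y t = y w + (t - w)\<^sup>2 * g t" if "t \<in> ball w r" for t using g(4)[OF that] by (simp add: algebra_simps)
      have "deriv y t = deriv (\<lambda>t. y w + (t - w)\<^sup>2 * g t) t"
        by (rule deriv_cong_open[OF open_ball tb(1) eqy])
      also have "\<dots> = (t - w) * n t"
        by (rule DERIV_imp_deriv)
          (auto intro!: derivative_eq_intros holomorphic_deriv_at[OF g(3) open_ball tb(1)] simp: n_def power2_eq_square algebra_simps)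
      finally have d: "deriv y t = (t - w) * n t" .
      have cub: "cubic a b (y t) = 4 * ((t - w)\<^sup>2 * g t) * (y t - p) * (y t - q)"
        unfolding pq(1)[of "y t"] g(4)[OF tb(1)] by (rule refl)
      have "f t = ((t - w)\<^sup>2 * (n t)\<^sup>2) / ((t - w)\<^sup>2 * (4 * g t * (y t - p) * (y t - q)))"
        unfolding f_def d cub power_mult_distrib by (simp only: mult_ac)
      also have "\<dots> = k t" using tb(2) by (simp add: k_def)
      finally show ?thesis .
    qed
    ultimately show ?thesis using \<rho>(1) by blast
  qed
  obtain F where F: "F holomorphic_on \<H>" "\<And>t. t \<in> \<H> \<Longrightarrow> F t \<noteq> 0" "\<And>t. t \<in> \<H> \<Longrightarrow> isCont f t \<Longrightarrow> F t = f t"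
    by (rule removable_extension[OF loc H_props(1)]) (assumption, rule that)
  have FW: "F \<tau> * cubic a b (y \<tau>) = (deriv y \<tau>)\<^sup>2" if \<tau>: "\<tau> \<in> W" for \<tau>
  proof -
    have "isCont f \<tau>" using holf oW \<tau> holomorphic_on_imp_continuous_on continuous_on_eq_continuous_at by blast
    then have "F \<tau> = f \<tau>" using F(3) \<tau> WH by blast
    then show ?thesis using cnz[OF \<tau>] by (simp add: f_def)
  qed
  have FH: "F \<tau> * cubic a b (y \<tau>) = (deriv y \<tau>)\<^sup>2" if \<tau>: "\<tau> \<in> \<H>" for \<tau>
  proof (cases "\<tau> \<in> W")
    case False
    then have root: "y \<tau> \<in> {e, e', e''}" using \<tau> by (auto simp: W_def)
    obtain r g where g: "r > 0" "g holomorphic_on ball \<tau> r"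
      "\<And>t. t \<in> ball \<tau> r \<Longrightarrow> y t - y \<tau> = (t - \<tau>)\<^sup>2 * g t"
      using ram[OF \<tau> root] by blast
    have tb: "\<tau> \<in> ball \<tau> r" using g(1) by simp
    have eqy: "y t = y \<tau> + (t - \<tau>)\<^sup>2 * g t" if "t \<in> ball \<tau> r" for t using g(3)[OF that] by (simp add: algebra_simps)
    have "deriv y \<tau> = deriv (\<lambda>t. y \<tau> + (t - \<tau>)\<^sup>2 * g t) \<tau>" by (rule deriv_cong_open[OF open_ball tb eqy])
    also have "\<dots> = 0"
      by (rule DERIV_imp_deriv) (auto intro!: derivative_eq_intros holomorphic_deriv_at[OF g(2) open_ball tb])
    finally show ?thesis using cubic_zero[of "y \<tau>"] root by simp
  qed (rule FW)
  obtain m where m: "m holomorphic_on \<H>" "\<And>\<tau>. \<tau> \<in> \<H> \<Longrightarrow> F \<tau> = (m \<tau>)\<^sup>2"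
    using contractible_imp_holomorphic_sqrt[OF F(1) convex_imp_contractible[OF H_props(3)] F(2)] by blast
  have "m \<tau> \<noteq> 0" if "\<tau> \<in> \<H>" for \<tau> using m(2)[OF that] F(2)[OF that] by auto
  moreover have "(m \<tau>)\<^sup>2 * cubic a b (y \<tau>) = (deriv y \<tau>)\<^sup>2" if "\<tau> \<in> \<H>" for \<tau> using FH[OF that] m(2)[OF that] by simp
  ultimately show ?thesis using that[OF m(1)] by blast
qed

text \<open>
  The quadrature which computes \<open>v\<close>.  Its constant of integration is a preimage of one value under \<open>\<wp>\<close> and
  its sign is fitted to the derivative there; then \<open>\<wp> \<circ> u = y\<close> near this point, and the relation spreads.
\<close>

lemma elliptic_integral:
  assumes y: "y holomorphic_on \<H>" and t0: "\<tau>0 \<in> \<H>" "y \<tau>0 \<in> - {e, e', e''}"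
    and m: "m holomorphic_on \<H>" "\<And>\<tau>. \<tau> \<in> \<H> \<Longrightarrow> m \<tau> \<noteq> 0"
      "\<And>\<tau>. \<tau> \<in> \<H> \<Longrightarrow> (m \<tau>)\<^sup>2 * cubic a b (y \<tau>) = (deriv y \<tau>)\<^sup>2"
  obtains u where "u holomorphic_on \<H>" "\<And>\<tau>. \<tau> \<in> \<H> \<Longrightarrow> u \<tau> \<notin> L \<and> P (u \<tau>) = y \<tau>"
    "\<And>\<tau>. \<tau> \<in> \<H> \<Longrightarrow> deriv u \<tau> \<noteq> 0" "\<And>\<tau>. \<tau> \<in> \<H> \<Longrightarrow> (deriv u \<tau>)\<^sup>2 = (m \<tau>)\<^sup>2"
proof -
  obtain w where w: "w \<notin> L" "P w = y \<tau>0" using value_attained[OF t0(2)] by blast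
  obtain V where "\<And>\<tau>. \<tau> \<in> \<H> \<Longrightarrow> (V has_field_derivative m \<tau>) (at \<tau> within \<H>)"
    by (rule holomorphic_convex_primitive'[OF H_props(3,1) m(1)]) (rule that)
  then have V: "(V has_field_derivative m \<tau>) (at \<tau>)" if "\<tau> \<in> \<H>" for \<tau>
    using that by (simp add: at_within_open[OF _ H_props(1)])
  define d where "d = deriv P w"
  have d2: "d\<^sup>2 = cubic a b (y \<tau>0)" using ode[OF w(1)] w(2) by (simp add: d_def)
  then have d0: "d \<noteq> 0" using t0(2) cubic_zero[of "y \<tau>0"] by auto
  have "(deriv y \<tau>0)\<^sup>2 = (m \<tau>0 * d)\<^sup>2" using m(3)[OF t0(1)] d2 by (simp add: power_mult_distrib)
  then obtain s :: complex where s: "s\<^sup>2 = 1" "deriv y \<tau>0 = s * (m \<tau>0 * d)"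
    unfolding power2_eq_iff by (metis minus_mult_left mult_1 mult_minus1 one_power2 power2_minus)
  have snz: "s \<noteq> 0" using s(1) by auto
  define u where "u \<tau> = w + s * (V \<tau> - V \<tau>0)" for \<tau>
  have du: "(u has_field_derivative s * m \<tau>) (at \<tau>)" if "\<tau> \<in> \<H>" for \<tau>
    unfolding u_def[abs_def] by (auto intro!: derivative_eq_intros V[OF that])
  have deru: "deriv u \<tau> = s * m \<tau>" if "\<tau> \<in> \<H>" for \<tau> using du[OF that] by (rule DERIV_imp_deriv)
  have holu: "u holomorphic_on \<H>" unfolding holomorphic_on_open[OF H_props(1)] using du by blast
  have wroot: "P w \<notin> {e, e', e''}" using t0(2) w(2) by simp
  obtain r where r: "r > 0" "ball (y \<tau>0) r \<subseteq> - {e, e', e''}" by (rule roots_ball[OF t0(2)]) (rule that)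
  have c: "y \<tau>0 \<in> ball (y \<tau>0) r" using r(1) by simp
  obtain \<sigma> where \<sigma>: "\<sigma> holomorphic_on ball (y \<tau>0) r" "\<sigma> (y \<tau>0) = w"
    "\<And>x. x \<in> ball (y \<tau>0) r \<Longrightarrow> \<sigma> x \<notin> L \<and> P (\<sigma> x) = x"
    by (rule sections_on_ball[OF r(2) c w]) (rule that)
  have "\<H> \<inter> y -` ball (y \<tau>0) r = {\<tau> \<in> \<H>. y \<tau> \<in> ball (y \<tau>0) r}" by blast
  then have "open {\<tau> \<in> \<H>. y \<tau> \<in> ball (y \<tau>0) r}"
    using continuous_open_preimage[OF holomorphic_on_imp_continuous_on[OF y] H_props(1) open_ball] by metis
  then obtain \<epsilon> where \<epsilon>: "\<epsilon> > 0" "ball \<tau>0 \<epsilon> \<subseteq> {\<tau> \<in> \<H>. y \<tau> \<in> ball (y \<tau>0) r}"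
    using openE[of "{\<tau> \<in> \<H>. y \<tau> \<in> ball (y \<tau>0) r}" \<tau>0] t0(1) c by blast
  define N where "N = ball \<tau>0 \<epsilon>"
  have N: "open N" "connected N" "\<tau>0 \<in> N" "N \<subseteq> \<H>" "\<And>\<tau>. \<tau> \<in> N \<Longrightarrow> y \<tau> \<in> ball (y \<tau>0) r"
    using \<epsilon> by (auto simp: N_def)
  define z where "z \<tau> = \<sigma> (y \<tau>)" for \<tau>
  have "(\<sigma> \<circ> y) holomorphic_on N"
    by (rule holomorphic_on_compose_gen[OF holomorphic_on_subset[OF y N(4)] \<sigma>(1)]) (use N(5) in blast)
  then have holz: "z holomorphic_on N" by (simp add: o_def z_def[abs_def])
  have zP: "z \<tau> \<notin> L" "P (z \<tau>) = y \<tau>" if "\<tau> \<in> N" for \<tau> using \<sigma>(3)[OF N(5)[OF that]] by (auto simp: z_def)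
  have dz: "deriv P (z \<tau>) * deriv z \<tau> = deriv y \<tau>" if \<tau>: "\<tau> \<in> N" for \<tau>
  proof -
    have "((\<lambda>\<tau>. P (z \<tau>)) has_field_derivative deriv P (z \<tau>) * deriv z \<tau>) (at \<tau>)"
      by (rule DERIV_chain2[where f = P and g = z, OF derivP[OF zP(1)[OF \<tau>]] holomorphic_deriv_at[OF holz N(1) \<tau>]])
    then have "(y has_field_derivative deriv P (z \<tau>) * deriv z \<tau>) (at \<tau>)"
      by (rule has_field_derivative_transform_within_open[OF _ N(1) \<tau>]) (rule zP(2))
    then show ?thesis by (rule DERIV_imp_deriv[symmetric])
  qed
  have sq: "(deriv z \<tau>)\<^sup>2 = (deriv u \<tau>)\<^sup>2" if \<tau>: "\<tau> \<in> N" for \<tau>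
  proof -
    have \<tau>H: "\<tau> \<in> \<H>" using \<tau> N(4) by blast
    have c0: "cubic a b (y \<tau>) \<noteq> 0" using N(5)[OF \<tau>] r(2) cubic_zero by blast
    have "(deriv P (z \<tau>))\<^sup>2 = cubic a b (y \<tau>)" using ode[OF zP(1)[OF \<tau>]] zP(2)[OF \<tau>] by simp
    then have "cubic a b (y \<tau>) * (deriv z \<tau>)\<^sup>2 = (deriv y \<tau>)\<^sup>2" using dz[OF \<tau>] by (metis power_mult_distrib)
    also have "\<dots> = cubic a b (y \<tau>) * (m \<tau>)\<^sup>2" using m(3)[OF \<tau>H] by (simp add: mult.commute)
    finally have "(deriv z \<tau>)\<^sup>2 = (m \<tau>)\<^sup>2" using c0 by simp
    then show ?thesis unfolding deru[OF \<tau>H] using s(1) by (simp add: power_mult_distrib)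
  qed
  have unz: "deriv u \<tau> \<noteq> 0" if "\<tau> \<in> \<H>" for \<tau> unfolding deru[OF that] using snz m(2)[OF that] by simp
  have z0: "z \<tau>0 = w" by (simp add: z_def \<sigma>(2))
  have "d * deriv z \<tau>0 = d * deriv u \<tau>0" using dz[OF N(3)] s(2) deru[OF t0(1)] by (simp add: z0 d_def mult_ac)
  then have ini: "deriv z \<tau>0 = deriv u \<tau>0" using d0 by simp
  have ini0: "z \<tau>0 = u \<tau>0" by (simp add: z0 u_def)
  have holuN: "u holomorphic_on N" using holu N(4) by (rule holomorphic_on_subset)
  have unzN: "deriv u \<tau> \<noteq> 0" if "\<tau> \<in> N" for \<tau> by (rule unz) (use N(4) that in blast)
  have zu: "z \<tau> = u \<tau>" if \<tau>: "\<tau> \<in> N" for \<tau>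
    by (rule square_deriv_unique[OF holz holuN N(1,2,3) \<tau> sq unzN ini0 ini])
  have near: "u \<tau> \<notin> L \<and> P (u \<tau>) = y \<tau>" if "\<tau> \<in> N" for \<tau> using zP[OF that] zu[OF that] by simp
  have Nne: "N \<noteq> {}" using N(3) by blast
  have all: "u \<tau> \<notin> L \<and> P (u \<tau>) = y \<tau>" if "\<tau> \<in> \<H>" for \<tau>
    by (rule relation_spreads[OF H_props(1,2) holu y unz N(1) Nne N(4) near that])
  have "(deriv u \<tau>)\<^sup>2 = (m \<tau>)\<^sup>2" if "\<tau> \<in> \<H>" for \<tau> unfolding deru[OF that] using s(1) by (simp add: power_mult_distrib)
  then show ?thesis using that[OF holu all unz] by blast
qed

text \<open>
  Paths on the curve lift to the half-plane if their images under \<open>\<wp>\<close> do, since \<open>\<wp>\<close> is locally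
  injective along them.
\<close>

lemma lifts_paths_through_P:
  assumes l: "lifts_paths y \<H> (- {e, e', e''})" and u: "continuous_on \<H> u"
    and yu: "\<And>\<tau>. \<tau> \<in> \<H> \<Longrightarrow> u \<tau> \<notin> L \<and> P (u \<tau>) = y \<tau>"
  shows "lifts_paths u \<H> {v. v \<notin> L \<and> 2 * v \<notin> L}"
proof (rule lifts_pathsI)
  fix \<gamma> \<tau> assume \<gamma>: "path \<gamma>" "path_image \<gamma> \<subseteq> {v. v \<notin> L \<and> 2 * v \<notin> L}" and \<tau>: "\<tau> \<in> \<H>" "u \<tau> = \<gamma> 0"
  have \<gamma>L: "\<gamma> t \<notin> L" "2 * \<gamma> t \<notin> L" if "t \<in> {0..1}" for t using path_image_in[OF \<gamma>(2) that] by auto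
  have \<gamma>P: "P (\<gamma> t) \<in> - {e, e', e''}" if "t \<in> {0..1}" for t using root_iff[OF \<gamma>L(1)[OF that]] \<gamma>L(2)[OF that] by simp
  have c\<gamma>: "continuous_on {0..1} \<gamma>" using \<gamma>(1) by (simp add: path_def)
  have "continuous_on {0..1} (\<lambda>t. P (\<gamma> t))"
    by (rule continuous_on_compose2[OF holomorphic_on_imp_continuous_on[OF holP] c\<gamma>]) (use \<gamma>L(1) in blast)
  then have p1: "path (\<lambda>t. P (\<gamma> t))" by (simp add: path_def)
  have p2: "path_image (\<lambda>t. P (\<gamma> t)) \<subseteq> - {e, e', e''}" unfolding path_image_def using \<gamma>P by blast
  have st: "y \<tau> = P (\<gamma> 0)" using yu[OF \<tau>(1)] \<tau>(2) by simp
  obtain g where g: "path g" "path_image g \<subseteq> \<H>" "g 0 = \<tau>" "\<And>t. t \<in> {0..1} \<Longrightarrow> y (g t) = P (\<gamma> t)"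
    by (rule lifts_pathsE[OF l p1 p2 \<tau>(1) st]) (rule that)
  have gH: "g t \<in> \<H>" if "t \<in> {0..1}" for t by (rule path_image_in[OF g(2) that])
  have cg: "continuous_on {0..1} g" using g(1) by (simp add: path_def)
  have cug: "continuous_on {0..1} (\<lambda>t. u (g t))" by (rule continuous_on_compose2[OF u cg]) (use gH in blast)
  have eqP: "P (u (g t)) = P (\<gamma> t)" if t: "t \<in> {0..1}" for t using yu[OF gH[OF t]] g(4)[OF t] by simp
  have inj: "\<exists>U. open U \<and> u (g t) \<in> U \<and> inj_on P U" if t: "t \<in> {0..1}" for t
  proof -
    have uL: "u (g t) \<notin> L" using yu[OF gH[OF t]] by blast
    have "P (u (g t)) \<notin> {e, e', e''}" unfolding eqP[OF t] using \<gamma>P[OF t] by blast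
    then show ?thesis using uL by (intro locally_inj[OF holP openD] not_root_deriv_nonzero) auto
  qed
  have start: "u (g 0) = \<gamma> 0" using g(3) \<tau>(2) by simp
  have "u (g t) = \<gamma> t" if t: "t \<in> {0..1}" for t
    by (rule unique_lift[where g = "\<lambda>t. u (g t)" and p = \<gamma> and \<xi> = P, OF cug c\<gamma> connected_Icc _ t eqP start inj]) auto
  then show "\<exists>g. path g \<and> path_image g \<subseteq> \<H> \<and> g 0 = \<tau> \<and> (\<forall>t\<in>{0..1}. u (g t) = \<gamma> t)" using g(1-3) by blast
qed

text \<open>
  Here \<open>x\<close> omits the branch points, and \<open>v = 2u\<close> for the integral \<open>u\<close> with \<open>\<wp> \<circ> u = x\<close>.  The halves of the
  points that are not poles are exactly the points over which \<open>\<wp>\<close> is unramified, so all paths lift.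
\<close>

lemma P_imp_T:
  assumes u: "uniformizes (- {e, e', e''}) (potential_P e e' e'' A) x"
  obtains v where "uniformizes (- L) (potential_T P A) v" "\<And>\<tau>. \<tau> \<in> \<H> \<Longrightarrow> x \<tau> = P (v \<tau> / 2)"
    "\<And>\<tau>. \<tau> \<in> \<H> \<Longrightarrow> (deriv v \<tau>)\<^sup>2 * cubic a b (x \<tau>) = 4 * (deriv x \<tau>)\<^sup>2"
proof -
  interpret U: uniformization "- {e, e', e''}" "potential_P e e' e'' A" x by (rule uniformization_P[OF u])
  note av = P_avoids_roots[OF u]
  have pb: "pulls_back (\<lambda>_. 0) x (potential_P e e' e'' A) \<tau>" if "\<tau> \<in> \<H>" for \<tau>
    using u that av[OF that] by (simp add: uniformizes_def)
  have reg: "deriv x \<tau> \<noteq> 0" if "\<tau> \<in> \<H>" for \<tau> using pb[OF that] by (simp add: pulls_back_def)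
  have ram: "\<exists>r>0. \<exists>g. ball \<tau> r \<subseteq> \<H> \<and> g holomorphic_on ball \<tau> r \<and>
        (\<forall>t\<in>ball \<tau> r. x t - x \<tau> = (t - \<tau>)\<^sup>2 * g t \<and> g t \<noteq> 0)" if "\<tau> \<in> \<H>" "x \<tau> \<in> {e, e', e''}" for \<tau>
    using av[OF that(1)] that(2) by blast
  obtain m where m: "m holomorphic_on \<H>" "\<And>\<tau>. \<tau> \<in> \<H> \<Longrightarrow> m \<tau> \<noteq> 0"
    "\<And>\<tau>. \<tau> \<in> \<H> \<Longrightarrow> (m \<tau>)\<^sup>2 * cubic a b (x \<tau>) = (deriv x \<tau>)\<^sup>2"
    by (rule elliptic_differential[OF U.hol\<xi> reg ram]) (assumption+, rule that)
  obtain w where w: "w holomorphic_on \<H>" "\<And>\<tau>. \<tau> \<in> \<H> \<Longrightarrow> w \<tau> \<notin> L \<and> P (w \<tau>) = x \<tau>"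
    "\<And>\<tau>. \<tau> \<in> \<H> \<Longrightarrow> deriv w \<tau> \<noteq> 0" "\<And>\<tau>. \<tau> \<in> \<H> \<Longrightarrow> (deriv w \<tau>)\<^sup>2 = (m \<tau>)\<^sup>2"
    by (rule elliptic_integral[OF U.hol\<xi> H_props(5) av[OF H_props(5)] m]) (assumption+, rule that)
  define v where "v \<tau> = 2 * w \<tau>" for \<tau>
  have holv: "v holomorphic_on \<H>" unfolding v_def using w(1) by (intro holomorphic_intros)
  have vL: "v \<tau> \<notin> L" if "\<tau> \<in> \<H>" for \<tau> using root_iff[of "w \<tau>"] w(2)[OF that] av[OF that] by (simp add: v_def)
  have xv: "x \<tau> = P (v \<tau> / 2)" if "\<tau> \<in> \<H>" for \<tau> using w(2)[OF that] by (simp add: v_def)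
  have dv: "deriv v \<tau> = 2 * deriv w \<tau>" if "\<tau> \<in> \<H>" for \<tau>
    unfolding v_def[abs_def] by (rule DERIV_imp_deriv) (auto intro!: derivative_eq_intros holomorphic_deriv_at[OF w(1) H_props(1) that])
  have fml: "(deriv v \<tau>)\<^sup>2 * cubic a b (x \<tau>) = 4 * (deriv x \<tau>)\<^sup>2" if "\<tau> \<in> \<H>" for \<tau>
    using w(4)[OF that] m(3)[OF that] by (simp add: dv[OF that] power_mult_distrib)
  have pbv: "pulls_back (\<lambda>_. 0) v (potential_T P A) \<tau>" if \<tau>: "\<tau> \<in> \<H>" for \<tau>
  proof -
    have an: "v analytic_on {\<tau>}" using holv H_props(1) \<tau> analytic_at by blast
    have "\<forall>\<^sub>F t in nhds \<tau>. t \<in> \<H>" using H_props(1) \<tau> by (rule eventually_nhds_in_open)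
    then have "\<forall>\<^sub>F t in nhds \<tau>. x t = P (v t / 2)" by eventually_elim (rule xv)
    then have "pulls_back (\<lambda>_. 0) (\<lambda>\<tau>. P (v \<tau> / 2)) (potential_P e e' e'' A) \<tau>" by (rule pulls_back_cong[OF pb[OF \<tau>]])
    then show ?thesis
      using pulls_back_compose_iff[OF an P_analytic_half[OF vL[OF \<tau>]] pulls_back_P_half[OF vL[OF \<tau>]]] by blast
  qed
  have lw: "lifts_paths w \<H> {v. v \<notin> L \<and> 2 * v \<notin> L}"
    by (rule lifts_paths_through_P[OF _ holomorphic_on_imp_continuous_on[OF w(1)] w(2)]) (use u in \<open>simp_all add: uniformizes_def\<close>)
  have lv: "lifts_paths v \<H> (- L)"
  proof (rule lifts_pathsI)
    fix \<gamma> \<tau> assume \<gamma>: "path \<gamma>" "path_image \<gamma> \<subseteq> - L" and \<tau>: "\<tau> \<in> \<H>" "v \<tau> = \<gamma> 0"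
    have h: "path (\<lambda>t. \<gamma> t / 2)" using \<gamma>(1) unfolding path_def by (auto intro!: continuous_intros)
    have hL: "path_image (\<lambda>t. \<gamma> t / 2) \<subseteq> {v. v \<notin> L \<and> 2 * v \<notin> L}"
      using \<gamma>(2) half_not_pole by (fastforce simp: path_image_def)
    have st: "w \<tau> = \<gamma> 0 / 2" using \<tau>(2) by (simp add: v_def field_simps)
    obtain g where g: "path g" "path_image g \<subseteq> \<H>" "g 0 = \<tau>" "\<And>t. t \<in> {0..1} \<Longrightarrow> w (g t) = \<gamma> t / 2"
      by (rule lifts_pathsE[OF lw h hL \<tau>(1) st]) (rule that)
    have "v (g t) = \<gamma> t" if "t \<in> {0..1}" for t unfolding v_def g(4)[OF that] by simp
    then show "\<exists>g. path g \<and> path_image g \<subseteq> \<H> \<and> g 0 = \<tau> \<and> (\<forall>t\<in>{0..1}. v (g t) = \<gamma> t)" using g(1-3) by blast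
  qed
  have "uniformizes (- L) (potential_T P A) v"
    unfolding uniformizes_def using holv vL H_props(5) pbv lv by blast
  then show ?thesis using that xv fml by blast
qed

text \<open>
  Two defects of (L) at the branch points are repaired.  The Schwarzian equation for \<open>v\<close> holds at the
  ramification points of \<open>s\<close> by continuity.  Paths lift at first only if they avoid the half-periods;
  but the potential of (T) is regular at the half-periods, so that these punctures can be filled.
\<close>

lemma L_imp_T:
  assumes u: "uniformizes (- {e, e', e''}) (potential_L e e' e'' A) s"
  obtains v where "uniformizes (- L) (potential_T P A) v" "\<And>\<tau>. \<tau> \<in> \<H> \<Longrightarrow> s \<tau> = P (v \<tau>)"
    "\<And>\<tau>. \<tau> \<in> \<H> \<Longrightarrow> (deriv v \<tau>)\<^sup>2 * cubic a b (s \<tau>) = (deriv s \<tau>)\<^sup>2"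
proof -
  interpret U: uniformization "- {e, e', e''}" "potential_L e e' e'' A" s by (rule uniformization_L[OF u])
  have pb: "pulls_back (\<lambda>_. 0) s (potential_L e e' e'' A) \<tau>" if "\<tau> \<in> \<H>" "s \<tau> \<in> - {e, e', e''}" for \<tau>
    using u that by (simp add: uniformizes_def)
  have reg: "deriv s \<tau> \<noteq> 0" if "\<tau> \<in> \<H>" "s \<tau> \<in> - {e, e', e''}" for \<tau> using pb[OF that] by (simp add: pulls_back_def)
  have ram: "\<exists>r>0. \<exists>g. ball \<tau> r \<subseteq> \<H> \<and> g holomorphic_on ball \<tau> r \<and>
        (\<forall>t\<in>ball \<tau> r. s t - s \<tau> = (t - \<tau>)\<^sup>2 * g t \<and> g t \<noteq> 0)" if "\<tau> \<in> \<H>" "s \<tau> \<in> {e, e', e''}" for \<tau>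
    by (rule L_ramified_order_two[OF u that]) blast
  obtain m where m: "m holomorphic_on \<H>" "\<And>\<tau>. \<tau> \<in> \<H> \<Longrightarrow> m \<tau> \<noteq> 0"
    "\<And>\<tau>. \<tau> \<in> \<H> \<Longrightarrow> (m \<tau>)\<^sup>2 * cubic a b (s \<tau>) = (deriv s \<tau>)\<^sup>2"
    by (rule elliptic_differential[OF U.hol\<xi> reg ram]) (assumption+, rule that)
  obtain \<tau>0 where \<tau>0: "\<tau>0 \<in> \<H>" "s \<tau>0 \<in> - {e, e', e''}" using u by (auto simp: uniformizes_def)
  obtain v where v: "v holomorphic_on \<H>" "\<And>\<tau>. \<tau> \<in> \<H> \<Longrightarrow> v \<tau> \<notin> L \<and> P (v \<tau>) = s \<tau>"
    "\<And>\<tau>. \<tau> \<in> \<H> \<Longrightarrow> deriv v \<tau> \<noteq> 0" "\<And>\<tau>. \<tau> \<in> \<H> \<Longrightarrow> (deriv v \<tau>)\<^sup>2 = (m \<tau>)\<^sup>2"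
    by (rule elliptic_integral[OF U.hol\<xi> \<tau>0 m]) (assumption+, rule that)
  have vL: "v \<tau> \<notin> L" if "\<tau> \<in> \<H>" for \<tau> using v(2)[OF that] by blast
  have sv: "s \<tau> = P (v \<tau>)" if "\<tau> \<in> \<H>" for \<tau> using v(2)[OF that] by simp
  have fml: "(deriv v \<tau>)\<^sup>2 * cubic a b (s \<tau>) = (deriv s \<tau>)\<^sup>2" if "\<tau> \<in> \<H>" for \<tau>
    using v(4)[OF that] m(3)[OF that] by simp
  have pb1: "pulls_back (\<lambda>_. 0) v (potential_T P A) \<tau>" if \<tau>: "\<tau> \<in> \<H>" "s \<tau> \<in> - {e, e', e''}" for \<tau>
  proof -
    have an: "v analytic_on {\<tau>}" using v(1) H_props(1) \<tau>(1) analytic_at by blast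
    have "\<forall>\<^sub>F t in nhds \<tau>. t \<in> \<H>" using H_props(1) \<tau>(1) by (rule eventually_nhds_in_open)
    then have "\<forall>\<^sub>F t in nhds \<tau>. s t = P (v t)" by eventually_elim (rule sv)
    then have 1: "pulls_back (\<lambda>_. 0) (\<lambda>\<tau>. P (v \<tau>)) (potential_L e e' e'' A) \<tau>" by (rule pulls_back_cong[OF pb[OF \<tau>]])
    have "2 * v \<tau> \<notin> L" using root_iff[OF vL[OF \<tau>(1)]] \<tau>(2) sv[OF \<tau>(1)] by simp
    then have "pulls_back (potential_T P A) P (potential_L e e' e'' A) (v \<tau>)" by (rule pulls_back_P[OF vL[OF \<tau>(1)]])
    then show ?thesis using 1 pulls_back_compose_iff[OF an analytic[OF vL[OF \<tau>(1)]]] by blast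
  qed
  have pbv: "pulls_back (\<lambda>_. 0) v (potential_T P A) \<tau>" if \<tau>: "\<tau> \<in> \<H>" for \<tau>
  proof (rule pulls_back_limit[OF v(1) H_props(1) \<tau> v(3)[OF \<tau>]])
    have "v \<tau> \<in> - L" using vL[OF \<tau>] by blast
    then show "isCont (potential_T P A) (v \<tau>)"
      using holomorphic_on_imp_continuous_on[OF holQ_T] openD continuous_on_eq_continuous_at by blast
    have "\<forall>\<^sub>F t in at \<tau>. s t \<in> - {e, e', e''}"
      using not_root_eventually filterlim_at_nonconst[OF U.hol\<xi> H_props(1,2) \<tau> U.nonconst] unfolding filterlim_iff by blast
    moreover have "\<forall>\<^sub>F t in at \<tau>. t \<in> \<H>" using H_props(1) \<tau> by (rule eventually_at_in_open')
    ultimately show "\<forall>\<^sub>F t in at \<tau>. pulls_back (\<lambda>_. 0) v (potential_T P A) t" by eventually_elim (rule pb1)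
  qed
  define D' where "D' = {v. v \<notin> L \<and> 2 * v \<notin> L}"
  have lv: "lifts_paths v \<H> D'" unfolding D'_def
    by (rule lifts_paths_through_P[OF _ holomorphic_on_imp_continuous_on[OF v(1)] v(2)]) (use u in \<open>simp_all add: uniformizes_def\<close>)
  have "2 * v \<tau>0 \<notin> L" using root_iff[OF vL[OF \<tau>0(1)]] \<tau>0(2) sv[OF \<tau>0(1)] by simp
  then have "v \<tau>0 \<in> D'" using vL[OF \<tau>0(1)] by (simp add: D'_def)
  then have u': "uniformizes D' (potential_T P A) v"
    unfolding uniformizes_def using v(1) \<tau>0(1) pbv lv by blast
  have "D' = - L \<inter> (\<lambda>v. 2 * v) -` (- L)" by (auto simp: D'_def)
  moreover have "open ((\<lambda>v. 2 * v) -` (- L))" by (intro open_vimage openD continuous_intros)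
  ultimately have oD': "open D'" using openD by (simp add: open_Int)
  have "- D' \<subseteq> L \<union> (\<lambda>v. v / 2) ` L"
  proof
    fix z assume "z \<in> - D'"
    then have "z \<in> L \<or> 2 * z \<in> L" by (auto simp: D'_def)
    moreover have "z = (2 * z) / 2" by simp
    ultimately show "z \<in> L \<union> (\<lambda>v. v / 2) ` L" by blast
  qed
  then have cD': "countable (- D')" by (rule countable_subset) (simp add: countable_L)
  have D'L: "D' \<subseteq> - L" by (auto simp: D'_def)
  have iso: "\<exists>r>0. ball z r \<subseteq> - L \<and> ball z r - {z} \<subseteq> D'" if z: "z \<in> - L" for z
  proof -
    have two: "(2 :: complex) \<noteq> 0" by simp
    have "\<forall>\<^sub>F t in at z. 0 + 2 * t \<notin> L" using not_pole_eventually affine_at[OF two, of 0 z] unfolding filterlim_iff by blast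
    then obtain r1 where r1: "r1 > 0" "\<And>t. t \<in> ball z r1 - {z} \<Longrightarrow> 2 * t \<notin> L"
      by (auto simp: eventually_at dist_commute)
    obtain r2 where r2: "r2 > 0" "ball z r2 \<subseteq> - L" using openE[OF openD z] by blast
    have "ball z (min r1 r2) \<subseteq> - L" using r2(2) by auto
    moreover have "ball z (min r1 r2) - {z} \<subseteq> D'" using r1(2) r2(2) by (auto simp: D'_def)
    moreover have "min r1 r2 > 0" using r1(1) r2(1) by simp
    ultimately show ?thesis by blast
  qed
  have "uniformizes (- L) (potential_T P A) v"
    by (rule uniformizes_fill_punctures[OF u' oD' cD' openD D'L holQ_T iso]) (use pbv in blast)+
  then show ?thesis using that sv fml by blast
qed

end

section \<open>The covers and their curves\<close>

abbreviation Const3 :: "complex \<Rightarrow> complex poly poly poly" where "Const3 c \<equiv> [:[:[:c:]:]:]"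

abbreviation Var_s :: "complex poly poly poly" where "Var_s \<equiv> [:0, 1:]"
abbreviation Var_p :: "complex poly poly poly" where "Var_p \<equiv> [:[:0, 1:]:]"
abbreviation Var_q :: "complex poly poly poly" where "Var_q \<equiv> [:[:[:0, 1:]:]:]"

lemma eval3_simps:
  "eval3 (G + H) x = eval3 G x + eval3 H x" "eval3 (G - H) x = eval3 G x - eval3 H x"
  "eval3 (G * H) x = eval3 G x * eval3 H x" "eval3 (G ^ n) x = eval3 G x ^ n" "eval3 1 x = 1"
  by (cases x; simp add: eval3_def poly_power)+

lemma eval3_basic: "eval3 (Const3 c) (s, p, q) = c"
  "eval3 Var_s (s, p, q) = s" "eval3 Var_p (s, p, q) = p" "eval3 Var_q (s, p, q) = q"
  by (simp_all add: eval3_def)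

definition cubic_poly where
  "cubic_poly a b X = Const3 4 * X ^ 3 - Const3 a * X - Const3 b"

definition dup_num_poly where
  "dup_num_poly a b X = (X ^ 2 + Const3 (a / 4)) ^ 2 + Const3 (2 * b) * X"

text \<open>
  The Wronskian of numerator and denominator of \<open>dup\<close>, that is, the numerator of the derivative.
\<close>

definition dup_wronskian :: "complex \<Rightarrow> complex \<Rightarrow> complex \<Rightarrow> complex" where
  "dup_wronskian a b x = (4 * x * (x\<^sup>2 + a / 4) + 2 * b) * cubic a b x - dup_num a b x * (12 * x\<^sup>2 - a)"

definition dup_wronskian_poly where
  "dup_wronskian_poly a b X = (Const3 4 * X * (X ^ 2 + Const3 (a / 4)) + Const3 (2 * b)) * cubic_poly a b X
     - dup_num_poly a b X * (Const3 12 * X ^ 2 - Const3 a)"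

lemma eval3_polys:
  "eval3 (cubic_poly a b X) (s, p, q) = cubic a b (eval3 X (s, p, q))"
  "eval3 (dup_num_poly a b X) (s, p, q) = dup_num a b (eval3 X (s, p, q))"
  "eval3 (dup_wronskian_poly a b X) (s, p, q) = dup_wronskian a b (eval3 X (s, p, q))"
  by (simp_all only: cubic_poly_def dup_num_poly_def dup_wronskian_poly_def cubic_def dup_num_def dup_wronskian_def
      eval3_simps eval3_basic)

text \<open>
  For \<open>x = \<wp>(u)\<close> this is the differential equation of \<open>\<wp>\<close> at \<open>2u\<close>.
\<close>

lemma dup_wronskian_square:
  "(dup_wronskian a b x)\<^sup>2 =
     4 * (4 * dup_num a b x ^ 3 - a * dup_num a b x * (cubic a b x)\<^sup>2 - b * cubic a b x ^ 3)"
  unfolding dup_wronskian_def dup_num_def cubic_def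
  by (simp add: field_simps power2_eq_square power3_eq_cube)

lemma dup_wronskian_square_on_cover:
  assumes "dup_num a b x = p * cubic a b x"
  shows "(dup_wronskian a b x)\<^sup>2 = 4 * cubic a b x ^ 3 * cubic a b p"
  unfolding dup_wronskian_square assms
  by (simp add: cubic_def[of a b p] power2_eq_square power3_eq_cube algebra_simps)

text \<open>
  The fibre is the zero set of a monic polynomial of degree 4.
\<close>

lemma finite_dup_fibre: "finite {x. dup_num a b x = p * cubic a b x}"
proof -
  let ?f = "[:a\<^sup>2 / 16 + p * b, 2 * b + p * a, a / 2, - 4 * p, 1:]"
  have "{x. dup_num a b x = p * cubic a b x} \<subseteq> {x. poly ?f x = 0}"
  proof
    fix x assume "x \<in> {x. dup_num a b x = p * cubic a b x}"
    then have "dup_num a b x - p * cubic a b x = 0" by simp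
    moreover have "poly ?f x = dup_num a b x - p * cubic a b x"
      by (simp add: dup_num_def cubic_def field_simps power2_eq_square power3_eq_cube)
    ultimately show "x \<in> {x. poly ?f x = 0}" by simp
  qed
  moreover have "finite {x. poly ?f x = 0}" by (rule poly_roots_finite) simp
  ultimately show ?thesis by (rule finite_subset)
qed

lemma finite_square_roots: "finite {q :: complex. q\<^sup>2 = c}"
proof -
  have "{q. q\<^sup>2 = c} \<subseteq> {csqrt c, - csqrt c}"
  proof
    fix q assume "q \<in> {q. q\<^sup>2 = c}"
    then have "q\<^sup>2 = (csqrt c)\<^sup>2" by simp
    then show "q \<in> {csqrt c, - csqrt c}" unfolding power2_eq_iff by simp
  qed
  then show ?thesis by (rule finite_subset) simp
qed

text \<open>
  The duplication formula cleared of denominators, between \<open>x\<close> and \<open>\<wp>(v)\<close> and between \<open>s\<close> and \<open>\<wp>(u)\<close>.  As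
  relations over \<open>v\<close> they cannot distinguish the points \<open>(v + l)/2\<close> for the periods \<open>l\<close>.
\<close>

definition cover_poly1 where "cover_poly1 a b = dup_num_poly a b Var_s - Var_p * cubic_poly a b Var_s"

definition cover_poly2 where "cover_poly2 a b = Var_s * cubic_poly a b Var_p - dup_num_poly a b Var_p"

lemma cover_polys:
  "eval3 (cover_poly1 a b) (x, p, q) = 0 \<longleftrightarrow> dup_num a b x = p * cubic a b x"
  "eval3 (cover_poly2 a b) (s, p, q) = 0 \<longleftrightarrow> dup_num a b p = s * cubic a b p"
  unfolding cover_poly1_def cover_poly2_def eval3_simps eval3_polys eval3_basic by auto

lemma cover_curve1: "(x, p, q) \<in> cover_curve a b (cover_poly1 a b) \<longleftrightarrow> q\<^sup>2 = cubic a b p \<and> dup_num a b x = p * cubic a b x"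
  by (simp add: cover_curve_def cover_polys cubic_def)

lemma cover_curve2: "(s, p, q) \<in> cover_curve a b (cover_poly2 a b) \<longleftrightarrow> q\<^sup>2 = cubic a b p \<and> dup_num a b p = s * cubic a b p"
  by (simp add: cover_curve_def cover_polys cubic_def)

text \<open>
  The point \<open>(x, \<wp>(v), \<wp>'(v))\<close> goes to \<open>(\<wp>(v), x, \<wp>'(v/2))\<close>.  The last coordinate is rational by the
  derivative of the duplication formula, \<open>2 \<wp>'(v) W(x)\<^sup>2 = R(x) \<wp>'(v/2)\<close> with the cubic \<open>W\<close> and
  \<open>R\<close> from above.
\<close>

definition halphen_map where
  "halphen_map a b = (\<lambda>(x, p, q). (p, x, 2 * q * (cubic a b x)\<^sup>2 / dup_wronskian a b x))"

definition halphen_map_inv where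
  "halphen_map_inv a b = (\<lambda>(s, p, q). (p, s, dup_wronskian a b p * q / (2 * (cubic a b p)\<^sup>2)))"

context weierstrass
begin

lemma dup_num_nonzero_at_root: "cubic a b x = 0 \<Longrightarrow> dup_num a b x \<noteq> 0"
proof -
  assume "cubic a b x = 0"
  then consider "x = e" | "x = e'" | "x = e''" using cubic_zero by blast
  then show ?thesis
  proof cases
    case 1
    have "dup_num a b e = ((e - e') * (e - e''))\<^sup>2"
      unfolding dup_num_def root_relations(2,3) root_relations(1) by (simp add: field_simps power2_eq_square)
    then show ?thesis using 1 distinct by simp
  next
    case 2
    have "dup_num a b e' = ((e' - e) * (e' - e''))\<^sup>2"
      unfolding dup_num_def root_relations(2,3) root_relations(1) by (simp add: field_simps power2_eq_square)
    then show ?thesis using 2 distinct by simp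
  next
    case 3
    have "dup_num a b e'' = ((e'' - e) * (e'' - e'))\<^sup>2"
      unfolding dup_num_def root_relations(2,3) root_relations(1) by (simp add: field_simps power2_eq_square)
    then show ?thesis using 3 distinct by simp
  qed
qed

lemma halphen_cover1_iff: "(x, v) \<in> halphen_cover1 P \<longleftrightarrow> v \<notin> L \<and> x = P (v / 2)"
  by (simp add: halphen_cover1_def L_def)

lemma halphen_cover2_iff: "(s, u) \<in> halphen_cover2 P \<longleftrightarrow> 2 * u \<notin> L \<and> s = P (2 * u)"
  by (simp add: halphen_cover2_def L_def)

lemma halphen_inverses:
  "\<forall>c\<in>halphen_cover1 P. halphen_inv P (halphen P c) = c"
  "\<forall>c\<in>halphen_cover2 P. halphen P (halphen_inv P c) = c"
  by (auto simp: halphen_cover1_iff halphen_cover2_iff halphen_def halphen_inv_def)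

lemma halphen_bij: "bij_betw (halphen P) (halphen_cover1 P) (halphen_cover2 P)"
  by (rule bij_betw_byWitness[OF halphen_inverses])
    (auto simp: halphen_cover1_iff halphen_cover2_iff halphen_def halphen_inv_def)

text \<open>
  If the relation holds, \<open>x\<close> is no branch value, since numerator and denominator of \<open>dup\<close> have no common
  zero.  So \<open>x = \<wp>(u)\<close> with \<open>\<wp>(2u) = \<wp>(v)\<close>, and \<open>2u\<close> is \<open>v\<close> or \<open>-v\<close> up to a period.
\<close>

lemma cover1: "cover P (cover_poly1 a b) = {(x, v). \<exists>l. is_period P l \<and> (x, v + l) \<in> halphen_cover1 P}"
proof -
  have *: "v \<notin> L \<and> dup_num a b x = P v * cubic a b x \<longleftrightarrow> (\<exists>l. l \<in> L \<and> v + l \<notin> L \<and> x = P ((v + l) / 2))" for x v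
  proof
    assume v: "v \<notin> L \<and> dup_num a b x = P v * cubic a b x"
    then have c: "cubic a b x \<noteq> 0" using dup_num_nonzero_at_root[of x] by auto
    then obtain u where u: "u \<notin> L" "P u = x" using value_attained[of x] cubic_zero by auto
    have u2: "2 * u \<notin> L" using root_iff[OF u(1)] u(2) c cubic_zero by simp
    have "P (2 * u) * cubic a b x = P v * cubic a b x" using duplication_product[OF u2] u(2) v by simp
    then have "P (2 * u) = P v" using c by simp
    then consider "2 * u - v \<in> L" | "2 * u + v \<in> L" using fibre[OF u2] v by blast
    then show "\<exists>l. l \<in> L \<and> v + l \<notin> L \<and> x = P ((v + l) / 2)"
    proof cases
      case 1
      then show ?thesis using u u2 by (intro exI[of _ "2 * u - v"]) simp
    next
      case 2
      have "- (2 * u + v) \<in> L" by (rule L_neg[OF 2])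
      moreover have "v + - (2 * u + v) = - (2 * u)" by simp
      moreover have "- (2 * u) \<notin> L" using u2 L_neg_iff by blast
      moreover have "P (- (2 * u) / 2) = x" using even[of u] u(2) by simp
      ultimately show ?thesis by metis
    qed
  next
    assume "\<exists>l. l \<in> L \<and> v + l \<notin> L \<and> x = P ((v + l) / 2)"
    then obtain l where l: "l \<in> L" "v + l \<notin> L" "x = P ((v + l) / 2)" by blast
    have "v \<notin> L" using L_add[OF _ l(1)] l(2) by blast
    then show "v \<notin> L \<and> dup_num a b x = P v * cubic a b x"
      using duplication_product[OF l(2)] period[OF l(1)] l(3) by simp
  qed
  have pole: "is_pole P v \<longleftrightarrow> v \<in> L" for v by (simp add: L_def)
  show ?thesis unfolding cover_def cover_polys halphen_cover1_iff period_iff pole * ..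
qed

lemma cover2: "cover P (cover_poly2 a b) = halphen_cover2 P"
proof -
  have "u \<notin> L \<and> dup_num a b (P u) = s * cubic a b (P u) \<longleftrightarrow> 2 * u \<notin> L \<and> s = P (2 * u)" for s u
  proof
    assume u: "u \<notin> L \<and> dup_num a b (P u) = s * cubic a b (P u)"
    then have c: "cubic a b (P u) \<noteq> 0" using dup_num_nonzero_at_root[of "P u"] by auto
    then have u2: "2 * u \<notin> L" using root_iff[of u] u cubic_zero by blast
    then show "2 * u \<notin> L \<and> s = P (2 * u)" using duplication_product[OF u2] u c by simp
  next
    assume u: "2 * u \<notin> L \<and> s = P (2 * u)"
    then show "u \<notin> L \<and> dup_num a b (P u) = s * cubic a b (P u)"
      using duplication_product[of "2 * u"] L_double by auto
  qed
  moreover have "is_pole P u \<longleftrightarrow> u \<in> L" for u by (simp add: L_def)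
  ultimately show ?thesis by (auto simp: cover_def cover_polys halphen_cover2_iff)
qed

abbreviation "curve1 \<equiv> cover_curve a b (cover_poly1 a b)"
abbreviation "curve2 \<equiv> cover_curve a b (cover_poly2 a b)"

text \<open>
  The points at which \<open>\<wp>(v)\<close>, the coordinate \<open>p\<close> of the first curve and \<open>s\<close> of the second, is a branch value.
  There the denominator of \<open>halphen_map\<close> vanishes.
\<close>

definition "exceptional1 = {(x, p, q) \<in> curve1. cubic a b p = 0}"
definition "exceptional2 = {(s, p, q) \<in> curve2. cubic a b s = 0}"

lemma regular1: "(x, p, q) \<in> curve1 - exceptional1 \<longleftrightarrow>
    q\<^sup>2 = cubic a b p \<and> dup_num a b x = p * cubic a b x \<and> cubic a b p \<noteq> 0"
  by (auto simp: exceptional1_def cover_curve1)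

lemma regular2: "(s, p, q) \<in> curve2 - exceptional2 \<longleftrightarrow>
    q\<^sup>2 = cubic a b p \<and> dup_num a b p = s * cubic a b p \<and> cubic a b s \<noteq> 0"
  by (auto simp: exceptional2_def cover_curve2)

lemma on_cover_nonzero:
  assumes "dup_num a b x = p * cubic a b x" "cubic a b p \<noteq> 0"
  shows "cubic a b x \<noteq> 0" "dup_wronskian a b x \<noteq> 0"
proof -
  show c: "cubic a b x \<noteq> 0" using dup_num_nonzero_at_root[of x] assms(1) by auto
  have "(dup_wronskian a b x)\<^sup>2 \<noteq> 0" unfolding dup_wronskian_square_on_cover[OF assms(1)] using c assms(2) by simp
  then show "dup_wronskian a b x \<noteq> 0" by simp
qed

lemma halphen_map_regular: "y \<in> curve1 - exceptional1 \<Longrightarrow>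
    halphen_map a b y \<in> curve2 - exceptional2 \<and> halphen_map_inv a b (halphen_map a b y) = y"
proof (cases y)
  fix x p q assume y: "y \<in> curve1 - exceptional1" "y = (x, p, q)"
  then have r: "q\<^sup>2 = cubic a b p" "dup_num a b x = p * cubic a b x" "cubic a b p \<noteq> 0" using regular1 by auto
  note nz = on_cover_nonzero[OF r(2,3)]
  have "(2 * q * (cubic a b x)\<^sup>2 / dup_wronskian a b x)\<^sup>2 = 4 * q\<^sup>2 * cubic a b x ^ 4 / (dup_wronskian a b x)\<^sup>2"
    by (simp add: power_divide power_mult_distrib flip: power_mult)
  also have "\<dots> = cubic a b x" unfolding dup_wronskian_square_on_cover[OF r(2)] r(1)
    using nz r(3) by (simp add: field_simps power3_eq_cube power4_eq_xxxx)
  finally have "halphen_map a b y \<in> curve2 - exceptional2"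
    unfolding y(2) halphen_map_def prod.case regular2 using r by blast
  moreover have "halphen_map_inv a b (halphen_map a b y) = y"
    using nz y(2) by (simp add: halphen_map_def halphen_map_inv_def)
  ultimately show ?thesis by blast
qed

lemma halphen_map_inv_regular: "y \<in> curve2 - exceptional2 \<Longrightarrow>
    halphen_map_inv a b y \<in> curve1 - exceptional1 \<and> halphen_map a b (halphen_map_inv a b y) = y"
proof (cases y)
  fix s p q assume y: "y \<in> curve2 - exceptional2" "y = (s, p, q)"
  then have r: "q\<^sup>2 = cubic a b p" "dup_num a b p = s * cubic a b p" "cubic a b s \<noteq> 0" using regular2 by auto
  note nz = on_cover_nonzero[OF r(2,3)]
  have "(dup_wronskian a b p * q / (2 * (cubic a b p)\<^sup>2))\<^sup>2 = (dup_wronskian a b p)\<^sup>2 * q\<^sup>2 / (4 * cubic a b p ^ 4)"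
    by (simp add: power_divide power_mult_distrib flip: power_mult)
  also have "\<dots> = cubic a b s" unfolding dup_wronskian_square_on_cover[OF r(2)] r(1)
    using nz by (simp add: field_simps power3_eq_cube power4_eq_xxxx)
  finally have "halphen_map_inv a b y \<in> curve1 - exceptional1"
    unfolding y(2) halphen_map_inv_def prod.case regular1 using r by blast
  moreover have "halphen_map a b (halphen_map_inv a b y) = y"
    using nz y(2) by (simp add: halphen_map_def halphen_map_inv_def)
  ultimately show ?thesis by blast
qed

lemma finite_exceptional: "finite exceptional1" "finite exceptional2"
proof -
  let ?fib = "\<lambda>p. {x. dup_num a b x = p * cubic a b x}"
  have "exceptional1 \<subseteq> (\<Union>p\<in>{e, e', e''}. ?fib p \<times> {p} \<times> {0})"
  proof
    fix y assume "y \<in> exceptional1"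
    moreover obtain x p q where y: "y = (x, p, q)" by (cases y)
    ultimately have c: "cubic a b p = 0" "q\<^sup>2 = cubic a b p" "dup_num a b x = p * cubic a b x"
      by (auto simp: exceptional1_def cover_curve1)
    then have "y \<in> ?fib p \<times> {p} \<times> {0}" by (simp add: y)
    then show "y \<in> (\<Union>p\<in>{e, e', e''}. ?fib p \<times> {p} \<times> {0})" using c(1) cubic_zero by blast
  qed
  moreover have "finite (\<Union>p\<in>{e, e', e''}. ?fib p \<times> {p} \<times> {0 :: complex})"
    by (intro finite_UN_I finite_cartesian_product finite_dup_fibre) auto
  ultimately show "finite exceptional1" by (rule finite_subset)
  have "exceptional2 \<subseteq> (\<Union>s\<in>{e, e', e''}. \<Union>p\<in>?fib s. {s} \<times> {p} \<times> {q. q\<^sup>2 = cubic a b p})"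
  proof
    fix y assume "y \<in> exceptional2"
    moreover obtain s p q where y: "y = (s, p, q)" by (cases y)
    ultimately have c: "cubic a b s = 0" "q\<^sup>2 = cubic a b p" "dup_num a b p = s * cubic a b p"
      by (auto simp: exceptional2_def cover_curve2)
    then have "y \<in> {s} \<times> {p} \<times> {q. q\<^sup>2 = cubic a b p}" "p \<in> ?fib s" by (simp_all add: y)
    then show "y \<in> (\<Union>s\<in>{e, e', e''}. \<Union>p\<in>?fib s. {s} \<times> {p} \<times> {q. q\<^sup>2 = cubic a b p})"
      using c(1) cubic_zero by blast
  qed
  moreover have "finite (\<Union>s\<in>{e, e', e''}. \<Union>p\<in>?fib s. {s} \<times> {p} \<times> {q. q\<^sup>2 = cubic a b p})"
    by (intro finite_UN_I finite_cartesian_product finite_dup_fibre finite_square_roots) auto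
  ultimately show "finite exceptional2" by (rule finite_subset)
qed

lemma halphen_birational:
  "birational_pair curve1 exceptional1 (halphen_map a b) curve2 exceptional2 (halphen_map_inv a b)"
proof -
  have 1: "rational_on (halphen_map a b) (curve1 - exceptional1)"
    unfolding rational_on_def
  proof (intro exI ballI)
    fix y assume y: "y \<in> curve1 - exceptional1"
    obtain x p q where xpq: "y = (x, p, q)" by (cases y)
    have "dup_wronskian a b x \<noteq> 0" using y regular1 on_cover_nonzero unfolding xpq by blast
    then show "eval3 1 y \<noteq> 0 \<and> eval3 1 y \<noteq> 0 \<and> eval3 (dup_wronskian_poly a b Var_s) y \<noteq> 0 \<and>
      halphen_map a b y = (eval3 Var_p y / eval3 1 y, eval3 Var_s y / eval3 1 y,
        eval3 (Const3 2 * Var_q * (cubic_poly a b Var_s) ^ 2) y / eval3 (dup_wronskian_poly a b Var_s) y)"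
      unfolding xpq eval3_simps eval3_polys eval3_basic by (simp add: halphen_map_def)
  qed
  have 2: "rational_on (halphen_map_inv a b) (curve2 - exceptional2)"
    unfolding rational_on_def
  proof (intro exI ballI)
    fix y assume y: "y \<in> curve2 - exceptional2"
    obtain s p q where spq: "y = (s, p, q)" by (cases y)
    have "cubic a b p \<noteq> 0" using y regular2 on_cover_nonzero unfolding spq by blast
    then show "eval3 1 y \<noteq> 0 \<and> eval3 1 y \<noteq> 0 \<and> eval3 (Const3 2 * (cubic_poly a b Var_p) ^ 2) y \<noteq> 0 \<and>
      halphen_map_inv a b y = (eval3 Var_p y / eval3 1 y, eval3 Var_s y / eval3 1 y,
        eval3 (dup_wronskian_poly a b Var_p * Var_q) y / eval3 (Const3 2 * (cubic_poly a b Var_p) ^ 2) y)"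
      unfolding spq eval3_simps eval3_polys eval3_basic by (simp add: halphen_map_inv_def)
  qed
  have 3: "halphen_map a b ` (curve1 - exceptional1) = curve2 - exceptional2"
  proof
    show "halphen_map a b ` (curve1 - exceptional1) \<subseteq> curve2 - exceptional2" using halphen_map_regular by blast
    show "curve2 - exceptional2 \<subseteq> halphen_map a b ` (curve1 - exceptional1)"
    proof
      fix y assume "y \<in> curve2 - exceptional2"
      then show "y \<in> halphen_map a b ` (curve1 - exceptional1)"
        using halphen_map_inv_regular[of y] image_eqI[of y "halphen_map a b" "halphen_map_inv a b y"] by simp
    qed
  qed
  have 4: "halphen_map_inv a b ` (curve2 - exceptional2) = curve1 - exceptional1"
  proof
    show "halphen_map_inv a b ` (curve2 - exceptional2) \<subseteq> curve1 - exceptional1" using halphen_map_inv_regular by blast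
    show "curve1 - exceptional1 \<subseteq> halphen_map_inv a b ` (curve2 - exceptional2)"
    proof
      fix y assume "y \<in> curve1 - exceptional1"
      then show "y \<in> halphen_map_inv a b ` (curve2 - exceptional2)"
        using halphen_map_regular[of y] image_eqI[of y "halphen_map_inv a b" "halphen_map a b y"] by simp
    qed
  qed
  show ?thesis unfolding birational_pair_def
    using finite_exceptional 1 2 3 4 halphen_map_regular halphen_map_inv_regular by blast
qed

lemma dup_deriv: "cubic a b x \<noteq> 0 \<Longrightarrow> (dup a b has_field_derivative dup_wronskian a b x / (cubic a b x)\<^sup>2) (at x)"
proof -
  assume c: "cubic a b x \<noteq> 0"
  have n: "(dup_num a b has_field_derivative 4 * x * (x\<^sup>2 + a / 4) + 2 * b) (at x)"
    unfolding dup_num_def[abs_def] by (auto intro!: derivative_eq_intros simp: field_simps power2_eq_square)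
  have d: "(cubic a b has_field_derivative 12 * x\<^sup>2 - a) (at x)"
    unfolding cubic_def[abs_def] by (auto intro!: derivative_eq_intros simp: power2_eq_square)
  have "((\<lambda>x. dup_num a b x / cubic a b x) has_field_derivative dup_wronskian a b x / (cubic a b x)\<^sup>2) (at x)"
    using DERIV_divide[OF n d c] by (simp add: dup_wronskian_def power2_eq_square)
  then show ?thesis unfolding dup_eq[abs_def] .
qed

lemma deriv_duplication:
  assumes v: "v \<notin> L"
  shows "2 * deriv P v * (cubic a b (P (v / 2)))\<^sup>2 = dup_wronskian a b (P (v / 2)) * deriv P (v / 2)"
proof -
  define x where "x = P (v / 2)"
  have c: "cubic a b x \<noteq> 0" using duplication(1)[OF v] by (simp add: x_def)
  have half: "((\<lambda>t. P (t / 2)) has_field_derivative deriv P (v / 2) * (1 / 2)) (at v)"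
    by (rule DERIV_chain2[where f = P and g = "\<lambda>t. t / 2", OF derivP[OF half_not_pole[OF v]]])
      (auto intro!: derivative_eq_intros)
  have "((\<lambda>t. dup a b (P (t / 2))) has_field_derivative
      dup_wronskian a b x / (cubic a b x)\<^sup>2 * (deriv P (v / 2) * (1 / 2))) (at v)"
    by (rule DERIV_chain2[where f = "dup a b" and g = "\<lambda>t. P (t / 2)", OF _ half])
      (use dup_deriv[OF c] in \<open>simp add: x_def\<close>)
  then have "deriv (\<lambda>t. dup a b (P (t / 2))) v = dup_wronskian a b x / (cubic a b x)\<^sup>2 * (deriv P (v / 2) * (1 / 2))"
    by (rule DERIV_imp_deriv)
  moreover have "deriv P v = deriv (\<lambda>t. dup a b (P (t / 2))) v" by (rule deriv_eq_germ[OF duplication_germ[OF v]])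
  ultimately show ?thesis using c unfolding x_def[symmetric] by (simp add: field_simps)
qed

lemma halphen_follows_birational:
  assumes "(x, v) \<in> halphen_cover1 P" "halphen P (x, v) = (s, u)"
  shows "(x, P v, deriv P v) \<in> exceptional1 \<longleftrightarrow> (s, P u, deriv P u) \<in> exceptional2"
    "(x, P v, deriv P v) \<notin> exceptional1 \<Longrightarrow> halphen_map a b (x, P v, deriv P v) = (s, P u, deriv P u)"
    "(x, P v, deriv P v) \<notin> exceptional1 \<Longrightarrow> halphen_map_inv a b (s, P u, deriv P u) = (x, P v, deriv P v)"
proof -
  have v: "v \<notin> L" "x = P (v / 2)" "s = P v" "u = v / 2"
    using assms by (auto simp: halphen_cover1_iff halphen_def)
  have x: "P u = x" unfolding v(4) v(2) ..
  have dn: "dup_num a b x = s * cubic a b x" using duplication_product[OF v(1)] v(2,3) by simp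
  have cv: "(x, P v, deriv P v) \<in> curve1" using ode[OF v(1)] dn v(3) by (simp add: cover_curve1)
  have cu: "(s, P u, deriv P u) \<in> curve2" using ode[OF half_not_pole[OF v(1)], folded v(4)] dn x by (simp add: cover_curve2)
  show "(x, P v, deriv P v) \<in> exceptional1 \<longleftrightarrow> (s, P u, deriv P u) \<in> exceptional2"
    using cv cu v(3) by (simp add: exceptional1_def exceptional2_def)
  assume "(x, P v, deriv P v) \<notin> exceptional1"
  then have "cubic a b s \<noteq> 0" using cv v(3) by (simp add: exceptional1_def)
  note nz = on_cover_nonzero[OF dn this]
  have d: "2 * deriv P v * (cubic a b x)\<^sup>2 = dup_wronskian a b x * deriv P u"
    using deriv_duplication[OF v(1), folded v(4)] x by simp
  show "halphen_map a b (x, P v, deriv P v) = (s, P u, deriv P u)"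
    using d nz x v(3) by (simp add: halphen_map_def)
  have "dup_wronskian a b x * deriv P u / (2 * (cubic a b x)\<^sup>2) = deriv P v"
    unfolding d[symmetric] using nz by simp
  then show "halphen_map_inv a b (s, P u, deriv P u) = (x, P v, deriv P v)"
    using x v(3) by (simp add: halphen_map_inv_def)
qed

end

section \<open>Equivalence of the parameter problems\<close>

context weierstrass
begin

lemma fuchsian_T_iff: "fuchsian_inversion (- L) (potential_T P A) v \<longleftrightarrow> uniformizes (- L) (potential_T P A) v"
  using fuchsian_inversion_imp_uniformizes[OF openD _ holQ_T] T_fuchsian(2) countable_L by (simp, blast)

lemma fuchsian_L_transfer:
  assumes s: "fuchsian_inversion (- {e, e', e''}) (potential_L e e' e'' A) s"
  obtains v where "fuchsian_inversion (- L) (potential_T P A) v"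
    "fuchsian_inversion (- {e, e', e''}) (potential_P e e' e'' A) (\<lambda>\<tau>. P (v \<tau> / 2))"
    "\<And>\<tau>. \<tau> \<in> \<H> \<Longrightarrow> s \<tau> = P (v \<tau>)"
    "\<And>\<tau>. \<tau> \<in> \<H> \<Longrightarrow> (deriv v \<tau>)\<^sup>2 * (4 * s \<tau> ^ 3 - a * s \<tau> - b) = (deriv s \<tau>)\<^sup>2"
proof -
  have u: "uniformizes (- {e, e', e''}) (potential_L e e' e'' A) s"
    by (rule fuchsian_inversion_imp_uniformizes[OF open_roots countable_roots holQ_L s])
  obtain v where v: "uniformizes (- L) (potential_T P A) v" "\<And>\<tau>. \<tau> \<in> \<H> \<Longrightarrow> s \<tau> = P (v \<tau>)"
    "\<And>\<tau>. \<tau> \<in> \<H> \<Longrightarrow> (deriv v \<tau>)\<^sup>2 * cubic a b (s \<tau>) = (deriv s \<tau>)\<^sup>2"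
    by (rule L_imp_T[OF u]) (rule that)
  show ?thesis by (rule that[OF T_fuchsian(2)[OF v(1)] T_imp_fuchsian_P[OF v(1)] v(2) v(3)[unfolded cubic_def]])
qed

lemma fuchsian_P_transfer:
  assumes x: "fuchsian_inversion (- {e, e', e''}) (potential_P e e' e'' A) x"
  obtains v where "fuchsian_inversion (- L) (potential_T P A) v"
    "fuchsian_inversion (- {e, e', e''}) (potential_L e e' e'' A) (\<lambda>\<tau>. dup a b (x \<tau>))"
    "\<And>\<tau>. \<tau> \<in> \<H> \<Longrightarrow> x \<tau> = P (v \<tau> / 2)" "\<And>\<tau>. \<tau> \<in> \<H> \<Longrightarrow> dup a b (x \<tau>) = P (v \<tau>)"
    "\<And>\<tau>. \<tau> \<in> \<H> \<Longrightarrow> (deriv v \<tau>)\<^sup>2 * (4 * x \<tau> ^ 3 - a * x \<tau> - b) = 4 * (deriv x \<tau>)\<^sup>2"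
proof -
  have u: "uniformizes (- {e, e', e''}) (potential_P e e' e'' A) x"
    by (rule fuchsian_inversion_imp_uniformizes[OF open_roots countable_roots holQ_P x])
  obtain v where v: "uniformizes (- L) (potential_T P A) v" "\<And>\<tau>. \<tau> \<in> \<H> \<Longrightarrow> x \<tau> = P (v \<tau> / 2)"
    "\<And>\<tau>. \<tau> \<in> \<H> \<Longrightarrow> (deriv v \<tau>)\<^sup>2 * cubic a b (x \<tau>) = 4 * (deriv x \<tau>)\<^sup>2"
    by (rule P_imp_T[OF u]) (rule that)
  have d: "dup a b (x \<tau>) = P (v \<tau>)" if "\<tau> \<in> \<H>" for \<tau>
    unfolding v(2)[OF that] by (rule duplication(2)[OF T_avoids_poles[OF v(1) that], symmetric])
  have "fuchsian_inversion (- {e, e', e''}) (potential_L e e' e'' A) (\<lambda>\<tau>. dup a b (x \<tau>))"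
    by (rule fuchsian_inversion_cong[OF T_imp_fuchsian_L[OF v(1)]]) (rule d[symmetric])
  then show ?thesis by (rule that[OF T_fuchsian(2)[OF v(1)] _ v(2) d v(3)[unfolded cubic_def]])
qed

end

theorem theorem7:
  fixes a b e e' e'' :: complex and P :: "complex \<Rightarrow> complex"
  assumes roots: "\<forall>t. 4 * t ^ 3 - a * t - b = 4 * (t - e) * (t - e') * (t - e'')"
    and distinct: "e \<noteq> e'" "e \<noteq> e''" "e' \<noteq> e''"
    and wp: "weierstrass_p a b P"
  shows
    \<comment> \<open>Halphen's transformation between the covers is single-valued in both directions,
      and it is a transcendental version of a birational map of the curves\<close>
    "(bij_betw (halphen P) (halphen_cover1 P) (halphen_cover2 P) \<and>
      (\<forall>c\<in>halphen_cover1 P. halphen_inv P (halphen P c) = c) \<and>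
      (\<forall>c\<in>halphen_cover2 P. halphen P (halphen_inv P c) = c) \<and>
      (\<exists>G1 G2 E f F g.
         cover P G1 = {(x, v). \<exists>l. is_period P l \<and> (x, v + l) \<in> halphen_cover1 P} \<and>
         cover P G2 = halphen_cover2 P \<and>
         birational_pair (cover_curve a b G1) E f (cover_curve a b G2) F g \<and>
         (\<forall>x v s u. (x, v) \<in> halphen_cover1 P \<and> halphen P (x, v) = (s, u) \<longrightarrow>
            ((x, P v, deriv P v) \<in> E \<longleftrightarrow> (s, P u, deriv P u) \<in> F) \<and>
            ((x, P v, deriv P v) \<notin> E \<longrightarrow>
               f (x, P v, deriv P v) = (s, P u, deriv P u) \<and>
               g (s, P u, deriv P u) = (x, P v, deriv P v)))))
     \<and> \<comment> \<open>it transforms the equations into each other, with equal parameters\<close>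
     (\<forall>A.
        transforms_to {v. \<not> is_pole P v} (potential_T P A) P (potential_L e e' e'' A) \<and>
        transforms_to {v. \<not> is_pole P v} (potential_T P A) (\<lambda>v. P (v / 2))
          (potential_P e e' e'' A) \<and>
        transforms_to (- {e, e', e''}) (potential_P e e' e'' A) (dup a b)
          (potential_L e e' e'' A))
     \<and> \<comment> \<open>the problems are equivalent, and their solutions are computed one through another:
           the parameters coincide\<close>
     (\<forall>A.
        (solves_A_problem {v. \<not> is_pole P v} (potential_T P) A \<longleftrightarrow>
         solves_A_problem (- {e, e', e''}) (potential_L e e' e'') A) \<and>
        (solves_A_problem (- {e, e', e''}) (potential_L e e' e'') A \<longleftrightarrow>
         solves_A_problem (- {e, e', e''}) (potential_P e e' e'') A))
     \<and> \<comment> \<open>any one of the functions of \<open>\<tau>\<close> gives the two others, by explicit formulas or by a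
           quadrature\<close>
     (\<forall>A v. fuchsian_inversion {v. \<not> is_pole P v} (potential_T P A) v \<longrightarrow>
        fuchsian_inversion (- {e, e', e''}) (potential_L e e' e'' A) (\<lambda>\<tau>. P (v \<tau>)) \<and>
        fuchsian_inversion (- {e, e', e''}) (potential_P e e' e'' A) (\<lambda>\<tau>. P (v \<tau> / 2)))
     \<and>
     (\<forall>A s. fuchsian_inversion (- {e, e', e''}) (potential_L e e' e'' A) s \<longrightarrow>
        (\<exists>v. fuchsian_inversion {v. \<not> is_pole P v} (potential_T P A) v \<and>
           fuchsian_inversion (- {e, e', e''}) (potential_P e e' e'' A) (\<lambda>\<tau>. P (v \<tau> / 2)) \<and>
           (\<forall>\<tau>\<in>upper_half_plane. s \<tau> = P (v \<tau>) \<and>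
              (deriv v \<tau>)\<^sup>2 * (4 * s \<tau> ^ 3 - a * s \<tau> - b) = (deriv s \<tau>)\<^sup>2)))
     \<and>
     (\<forall>A x. fuchsian_inversion (- {e, e', e''}) (potential_P e e' e'' A) x \<longrightarrow>
        fuchsian_inversion (- {e, e', e''}) (potential_L e e' e'' A) (\<lambda>\<tau>. dup a b (x \<tau>)) \<and>
        (\<exists>v. fuchsian_inversion {v. \<not> is_pole P v} (potential_T P A) v \<and>
           (\<forall>\<tau>\<in>upper_half_plane. x \<tau> = P (v \<tau> / 2) \<and> dup a b (x \<tau>) = P (v \<tau>) \<and>
              (deriv v \<tau>)\<^sup>2 * (4 * x \<tau> ^ 3 - a * x \<tau> - b) = 4 * (deriv x \<tau>)\<^sup>2)))"
proof -
  interpret weierstrass a b e e' e'' P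
    by unfold_locales (use roots distinct wp in auto)
  have D: "{v. \<not> is_pole P v} = - L" by (auto simp: L_def)
  let ?R = "- {e, e', e''}"
  let ?T = "\<lambda>A v. fuchsian_inversion (- L) (potential_T P A) v"
  let ?L = "\<lambda>A s. fuchsian_inversion ?R (potential_L e e' e'' A) s"
  let ?P = "\<lambda>A x. fuchsian_inversion ?R (potential_P e e' e'' A) x"
  have T: "?L A (\<lambda>\<tau>. P (v \<tau>)) \<and> ?P A (\<lambda>\<tau>. P (v \<tau> / 2))" if "?T A v" for A v
    using that T_imp_fuchsian_L T_imp_fuchsian_P unfolding fuchsian_T_iff by blast
  have Ls: "\<exists>v. ?T A v \<and> ?P A (\<lambda>\<tau>. P (v \<tau> / 2)) \<and> (\<forall>\<tau>\<in>\<H>. s \<tau> = P (v \<tau>) \<and>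
      (deriv v \<tau>)\<^sup>2 * (4 * s \<tau> ^ 3 - a * s \<tau> - b) = (deriv s \<tau>)\<^sup>2)" if "?L A s" for A s
    by (rule fuchsian_L_transfer[OF that]) blast
  have Px: "?L A (\<lambda>\<tau>. dup a b (x \<tau>)) \<and> (\<exists>v. ?T A v \<and> (\<forall>\<tau>\<in>\<H>. x \<tau> = P (v \<tau> / 2) \<and>
      dup a b (x \<tau>) = P (v \<tau>) \<and> (deriv v \<tau>)\<^sup>2 * (4 * x \<tau> ^ 3 - a * x \<tau> - b) = 4 * (deriv x \<tau>)\<^sup>2))"
    if "?P A x" for A x
    by (rule fuchsian_P_transfer[OF that]) blast
  have covers: "\<exists>G1 G2 E f F g.
      cover P G1 = {(x, v). \<exists>l. is_period P l \<and> (x, v + l) \<in> halphen_cover1 P} \<and>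
      cover P G2 = halphen_cover2 P \<and>
      birational_pair (cover_curve a b G1) E f (cover_curve a b G2) F g \<and>
      (\<forall>x v s u. (x, v) \<in> halphen_cover1 P \<and> halphen P (x, v) = (s, u) \<longrightarrow>
         ((x, P v, deriv P v) \<in> E \<longleftrightarrow> (s, P u, deriv P u) \<in> F) \<and>
         ((x, P v, deriv P v) \<notin> E \<longrightarrow>
            f (x, P v, deriv P v) = (s, P u, deriv P u) \<and>
            g (s, P u, deriv P u) = (x, P v, deriv P v)))"
  proof (rule exI[of _ "cover_poly1 a b"], rule exI[of _ "cover_poly2 a b"], rule exI[of _ exceptional1],
      rule exI[of _ "halphen_map a b"], rule exI[of _ exceptional2], rule exI[of _ "halphen_map_inv a b"],
      intro conjI allI impI, goal_cases)
    case 1 show ?case by (rule cover1)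
  next
    case 2 show ?case by (rule cover2)
  next
    case 3 show ?case by (rule halphen_birational)
  next
    case (4 x v s u)
    then show ?case using halphen_follows_birational(1) by blast
  next
    case (5 x v s u)
    then show ?case using halphen_follows_birational(2) by blast
  next
    case (6 x v s u)
    then show ?case using halphen_follows_birational(3) by blast
  qed
  have TL: "solves_A_problem (- L) (potential_T P) A \<longleftrightarrow> solves_A_problem ?R (potential_L e e' e'') A"
    and LP: "solves_A_problem ?R (potential_L e e' e'') A \<longleftrightarrow> solves_A_problem ?R (potential_P e e' e'') A" for A
    unfolding solves_A_problem_def using T Ls Px by blast+
  show ?thesis
    unfolding D
    by (intro conjI allI impI halphen_bij halphen_inverses covers transforms_T_L transforms_T_P transforms_P_L TL LP)
      (use T Ls Px in blast)+
qed

end
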